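(* Let $\Bbbk$ be a field and let $n\ge2$ be an integer. For $i=1,\dots,n$, let $\Delta_i$ be a simplicial complex and let $A_i=\Bbbk[\Delta_i]$. Set $\Delta=\bigsqcup_{i=1}^n\Delta_i$ and $R=\Bbbk[\Delta]$, and assume that $\Delta$ is not the discrete simplicial complex on two vertices. Then the following hold: (1) $$\operatorname{tr}_{\Bbbk[\Delta]}(\omega_{\Bbbk[\Delta]})=\bigoplus_{\substack{1\le i\le n\\ \dim(\Delta_i)=\dim(\Delta)}}\operatorname{tr}^\dagger_{\Bbbk[\Delta_i]}(\omega_{\Bbbk[\Delta_i]})\,\Bbbk[\Delta];$$ (2) $\sqrt{\operatorname{tr}_R(\omega_R)}=\mathfrak m_R$ if and only if $\sqrt{\operatorname{tr}_{A_i}(\omega_{A_i})}\supseteq\mathfrak m_{A_i}$ and $\dim(\Delta_i)=\dim(\Delta)$ for all $1\le i\le n$; (3) $\operatorname{tr}_R(\omega_R)=\mathfrak m_R$ if and only if $\operatorname{tr}_{A_i}(\omega_{A_i})\supseteq\mathfrak m_{A_i}$ and $\dim(\Delta_i)=\dim(\Delta)$ for all $1\le i\le n$.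
   Context: A simplicial complex $\Delta$ has a nonempty finite vertex set (identified with $\{1,\dots,m\}$), every vertex is a face, and it is closed under taking subsets. $\Bbbk[\Delta]=\Bbbk[x_1,\dots,x_m]/I_\Delta$ is the Stanley--Reisner ring with $\deg x_i=1$, where $I_\Delta$ is generated by the squarefree monomials of non-faces. $\dim\sigma=|\sigma|-1$, $\dim\Delta=\max_{\sigma\in\Delta}\dim\sigma$. $\bigsqcup_i\Delta_i$ is the disjoint union: the vertex sets are made disjoint and the faces are the faces of the individual $\Delta_i$. Each $\Bbbk[\Delta_i]$ is regarded as the subring of $\Bbbk[\Delta]$ generated over $\Bbbk$ by the variables of $\Delta_i$, and for an ideal $I$ of $\Bbbk[\Delta_i]$, $I\,\Bbbk[\Delta]$ is the ideal it generates; $\bigoplus$ is an internal direct sum of ideals. For a Noetherian positively graded ring $S$ with $S_0$ a field, $\mathfrak m_S$ is its graded maximal ideal and the graded canonical module is $\omega_S={}^*\mathrm{Hom}_S(H^{\dim S}_{\mathfrak m_S}(S),E_S)$, where ${}^*\mathrm{Hom}$ is the graded module of graded homomorphisms of all degrees and $E_S$ is the graded injective envelope of $S/\mathfrak m_S$. $\operatorname{tr}_S(\omega_S)=\sum_{\phi\in\mathrm{Hom}_S(\omega_S,S)}\phi(\omega_S)$. For a finitely generated graded $S$-module $M$, $\operatorname{tr}_S^\dagger(M):=\operatorname{tr}_S(M)$ if $\operatorname{tr}_S(M)\subsetneq S$ and $\operatorname{tr}_S^\dagger(M):=\mathfrak m_S$ if $\operatorname{tr}_S(M)=S$. Radicals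 are taken in the ring in which the ideal lives. *)

theory Defs
  imports
    "HOL-Algebra.QuotRing"
    "HOL-Algebra.Module"
    "HOL-Library.Poly_Mapping"
    "HOL-Library.Product_Lexorder"
    "HOL-Library.Extended_Nat"
    "HOL-Library.FuncSet"
begin

section \<open>Graded rings and graded modules\<close>

text \<open>The fields \<open>rgrade\<close> and \<open>mgrade\<close> give the homogeneous component of each degree.
  As always with the record \<open>module\<close>, the fields \<open>mult\<close> and \<open>one\<close> of a module are meaningless.\<close>

record 'a gring = "'a ring" +
  rgrade :: "int \<Rightarrow> 'a set"

record ('a, 'b) gmodule = "('a, 'b) module" +
  mgrade :: "int \<Rightarrow> 'b set"

definition graded_module :: "'a gring \<Rightarrow> ('a, 'b) gmodule \<Rightarrow> bool" where
  "graded_module S M \<longleftrightarrow>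
     Module.module S M \<and>
     (\<forall>d. additive_subgroup (mgrade M d) M) \<and>
     (\<forall>i j. \<forall>a\<in>rgrade S i. \<forall>x\<in>mgrade M j. a \<odot>\<^bsub>M\<^esub> x \<in> mgrade M (i + j)) \<and>
     (\<forall>x\<in>carrier M. \<exists>!c. (\<forall>d. c d \<in> mgrade M d) \<and> finite {d. c d \<noteq> \<zero>\<^bsub>M\<^esub>} \<and>
        x = (\<Oplus>\<^bsub>M\<^esub>d\<in>{d. c d \<noteq> \<zero>\<^bsub>M\<^esub>}. c d))"

definition regular_module :: "'a gring \<Rightarrow> ('a, 'a) gmodule" where
  "regular_module S =
     \<lparr>carrier = carrier S, mult = mult S, one = one S, zero = zero S, add = add S,
      smult = mult S, mgrade = rgrade S\<rparr>"

definition quot_module :: "('a, 'b) gmodule \<Rightarrow> 'b set \<Rightarrow> ('a, 'b set) gmodule" where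
  "quot_module M N =
     \<lparr>carrier = a_rcosets\<^bsub>M\<^esub> N, mult = undefined, one = undefined, zero = N, add = set_add M,
      smult = (\<lambda>s X. \<Union>x\<in>X. N +>\<^bsub>M\<^esub> (s \<odot>\<^bsub>M\<^esub> x)),
      mgrade = (\<lambda>d. (\<lambda>x. N +>\<^bsub>M\<^esub> x) ` mgrade M d)\<rparr>"

definition sub_module :: "('a, 'b) gmodule \<Rightarrow> 'b set \<Rightarrow> ('a, 'b) gmodule" where
  "sub_module M N = M\<lparr>carrier := N, mgrade := (\<lambda>d. mgrade M d \<inter> N)\<rparr>"

definition graded_submodule :: "'a gring \<Rightarrow> ('a, 'b) gmodule \<Rightarrow> 'b set \<Rightarrow> bool" where
  "graded_submodule S M N \<longleftrightarrow> submodule N S M \<and> graded_module S (sub_module M N)"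

definition prod_module :: "'j set \<Rightarrow> ('j \<Rightarrow> ('a, 'b) gmodule) \<Rightarrow> ('a, 'j \<Rightarrow> 'b) gmodule" where
  "prod_module I M =
     \<lparr>carrier = (\<Pi>\<^sub>E j\<in>I. carrier (M j)), mult = undefined, one = undefined,
      zero = (\<lambda>j\<in>I. \<zero>\<^bsub>M j\<^esub>), add = (\<lambda>c c'. \<lambda>j\<in>I. c j \<oplus>\<^bsub>M j\<^esub> c' j),
      smult = (\<lambda>s c. \<lambda>j\<in>I. s \<odot>\<^bsub>M j\<^esub> c j),
      mgrade = (\<lambda>d. \<Pi>\<^sub>E j\<in>I. mgrade (M j) d)\<rparr>"


section \<open>Homomorphisms\<close>

definition mod_hom :: "'a gring \<Rightarrow> ('a, 'b) gmodule \<Rightarrow> ('a, 'c) gmodule \<Rightarrow> ('b \<Rightarrow> 'c) set" where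
  "mod_hom S M N =
     {f \<in> carrier M \<rightarrow>\<^sub>E carrier N.
        (\<forall>x\<in>carrier M. \<forall>y\<in>carrier M. f (x \<oplus>\<^bsub>M\<^esub> y) = f x \<oplus>\<^bsub>N\<^esub> f y) \<and>
        (\<forall>s\<in>carrier S. \<forall>x\<in>carrier M. f (s \<odot>\<^bsub>M\<^esub> x) = s \<odot>\<^bsub>N\<^esub> f x)}"

definition graded_hom ::
    "'a gring \<Rightarrow> ('a, 'b) gmodule \<Rightarrow> ('a, 'c) gmodule \<Rightarrow> int \<Rightarrow> ('b \<Rightarrow> 'c) set" where
  "graded_hom S M N d = {f \<in> mod_hom S M N. \<forall>j. f ` mgrade M j \<subseteq> mgrade N (j + d)}"

text \<open>\<open>star_Hom S M N\<close> is the graded module of all finite sums of homogeneous homomorphisms of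
  arbitrary degrees.\<close>

definition star_Hom :: "'a gring \<Rightarrow> ('a, 'b) gmodule \<Rightarrow> ('a, 'c) gmodule \<Rightarrow> ('a, 'b \<Rightarrow> 'c) gmodule" where
  "star_Hom S M N =
     \<lparr>carrier = {f \<in> mod_hom S M N. \<exists>D g. finite D \<and> (\<forall>d\<in>D. g d \<in> graded_hom S M N d) \<and>
                   (\<forall>x\<in>carrier M. f x = (\<Oplus>\<^bsub>N\<^esub>d\<in>D. g d x))},
      mult = undefined, one = undefined,
      zero = (\<lambda>x\<in>carrier M. \<zero>\<^bsub>N\<^esub>),
      add = (\<lambda>f g. \<lambda>x\<in>carrier M. f x \<oplus>\<^bsub>N\<^esub> g x),
      smult = (\<lambda>s f. \<lambda>x\<in>carrier M. s \<odot>\<^bsub>N\<^esub> f x),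
      mgrade = graded_hom S M N\<rparr>"


section \<open>Graded injective envelopes\<close>

text \<open>HOL cannot quantify over the carrier types of the test modules \<open>M\<close> and \<open>N\<close>, so these live
  in the type of ring elements.  By the graded Baer criterion this is no restriction: it suffices
  to test the inclusions of homogeneous ideals of \<open>S\<close> into \<open>S\<close>, with all shifts of the grading.\<close>

definition graded_injective :: "'a gring \<Rightarrow> ('a, 'e) gmodule \<Rightarrow> bool" where
  "graded_injective S E \<longleftrightarrow>
     graded_module S E \<and>
     (\<forall>(M :: ('a, 'a) gmodule) (N :: ('a, 'a) gmodule) u f.
        graded_module S M \<and> graded_module S N \<and>
        u \<in> graded_hom S M N 0 \<and> inj_on u (carrier M) \<and> f \<in> graded_hom S M E 0 \<longrightarrow>
        (\<exists>g\<in>graded_hom S N E 0. \<forall>x\<in>carrier M. g (u x) = f x))"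

definition graded_injective_envelope ::
    "'a gring \<Rightarrow> ('a, 'b) gmodule \<Rightarrow> ('a, 'e) gmodule \<Rightarrow> bool" where
  "graded_injective_envelope S M E \<longleftrightarrow>
     graded_injective S E \<and>
     (\<exists>u\<in>graded_hom S M E 0. inj_on u (carrier M) \<and>
        (\<forall>N. graded_submodule S E N \<and> N \<noteq> {\<zero>\<^bsub>E\<^esub>} \<longrightarrow> N \<inter> u ` carrier M \<noteq> {\<zero>\<^bsub>E\<^esub>}))"


section \<open>Localization and the Cech complex\<close>

text \<open>\<open>mfrac S M f (a, n)\<close> is the fraction \<open>a / f ^ n\<close>, i.e. the class of \<open>(a, n)\<close>.\<close>

definition frac_rel :: "'a gring \<Rightarrow> ('a, 'b) gmodule \<Rightarrow> 'a \<Rightarrow> (('b \<times> nat) \<times> ('b \<times> nat)) set" where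
  "frac_rel S M f =
     {((a, n), (b, m)). a \<in> carrier M \<and> b \<in> carrier M \<and>
        (\<exists>k::nat. f [^]\<^bsub>S\<^esub> k \<odot>\<^bsub>M\<^esub> (f [^]\<^bsub>S\<^esub> m \<odot>\<^bsub>M\<^esub> a) = f [^]\<^bsub>S\<^esub> k \<odot>\<^bsub>M\<^esub> (f [^]\<^bsub>S\<^esub> n \<odot>\<^bsub>M\<^esub> b))}"

definition mfrac :: "'a gring \<Rightarrow> ('a, 'b) gmodule \<Rightarrow> 'a \<Rightarrow> 'b \<times> nat \<Rightarrow> ('b \<times> nat) set" where
  "mfrac S M f p = frac_rel S M f `` {p}"

definition loc_module :: "'a gring \<Rightarrow> ('a, 'b) gmodule \<Rightarrow> 'a \<Rightarrow> ('a, ('b \<times> nat) set) gmodule" where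
  "loc_module S M f =
     \<lparr>carrier = (carrier M \<times> UNIV) // frac_rel S M f,
      mult = undefined, one = undefined,
      zero = mfrac S M f (\<zero>\<^bsub>M\<^esub>, 0),
      add = (\<lambda>X Y. \<Union>(a, n)\<in>X. \<Union>(b, m)\<in>Y.
               mfrac S M f (f [^]\<^bsub>S\<^esub> m \<odot>\<^bsub>M\<^esub> a \<oplus>\<^bsub>M\<^esub> f [^]\<^bsub>S\<^esub> n \<odot>\<^bsub>M\<^esub> b, n + m)),
      smult = (\<lambda>s X. \<Union>(a, n)\<in>X. mfrac S M f (s \<odot>\<^bsub>M\<^esub> a, n)),
      mgrade = (\<lambda>d. {mfrac S M f (a, n) | a n e. f \<in> rgrade S e \<and> a \<in> mgrade M (d + int n * e)})\<rparr>"

text \<open>The canonical map \<open>M\<^sub>f \<rightarrow> M\<^sub>f\<^sub>g\<close>, sending \<open>a / f ^ n\<close> to \<open>(g ^ n a) / (f g) ^ n\<close>.\<close>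

definition loc_map ::
    "'a gring \<Rightarrow> ('a, 'b) gmodule \<Rightarrow> 'a \<Rightarrow> 'a \<Rightarrow> ('b \<times> nat) set \<Rightarrow> ('b \<times> nat) set" where
  "loc_map S M f g X = (\<Union>(a, n)\<in>X. mfrac S M (f \<otimes>\<^bsub>S\<^esub> g) (g [^]\<^bsub>S\<^esub> n \<odot>\<^bsub>M\<^esub> a, n))"

text \<open>The Cech complex of \<open>M\<close> on a finite family of homogeneous elements \<open>x v\<close>, \<open>v \<in> V\<close>:
  its term in cohomological degree \<open>i\<close> is the product of the localizations of \<open>M\<close> at
  the products of \<open>i\<close> of these elements.  The linear order on \<open>V\<close> only serves to fix signs.\<close>

definition cech_index :: "'v set \<Rightarrow> nat \<Rightarrow> 'v set set" where
  "cech_index V i = {J. J \<subseteq> V \<and> card J = i}"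

definition cech_loc ::
    "'a gring \<Rightarrow> ('v \<Rightarrow> 'a) \<Rightarrow> ('a, 'b) gmodule \<Rightarrow> 'v set \<Rightarrow> ('a, ('b \<times> nat) set) gmodule" where
  "cech_loc S x M J = loc_module S M (finprod S x J)"

definition cech_module ::
    "'a gring \<Rightarrow> 'v set \<Rightarrow> ('v \<Rightarrow> 'a) \<Rightarrow> ('a, 'b) gmodule \<Rightarrow> nat
       \<Rightarrow> ('a, 'v set \<Rightarrow> ('b \<times> nat) set) gmodule" where
  "cech_module S V x M i = prod_module (cech_index V i) (cech_loc S x M)"

definition cech_diff ::
    "'a gring \<Rightarrow> 'v::linorder set \<Rightarrow> ('v \<Rightarrow> 'a) \<Rightarrow> ('a, 'b) gmodule \<Rightarrow> nat
       \<Rightarrow> ('v set \<Rightarrow> ('b \<times> nat) set) \<Rightarrow> ('v set \<Rightarrow> ('b \<times> nat) set)" where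
  "cech_diff S V x M i c =
     (\<lambda>J\<in>cech_index V (Suc i). \<Oplus>\<^bsub>cech_loc S x M J\<^esub>j\<in>J.
        (let y = loc_map S M (finprod S x (J - {j})) (x j) (c (J - {j}))
         in if even (card {k \<in> J. k < j}) then y else \<ominus>\<^bsub>cech_loc S x M J\<^esub> y))"

definition cech_cocycles ::
    "'a gring \<Rightarrow> 'v::linorder set \<Rightarrow> ('v \<Rightarrow> 'a) \<Rightarrow> ('a, 'b) gmodule \<Rightarrow> nat
       \<Rightarrow> ('v set \<Rightarrow> ('b \<times> nat) set) set" where
  "cech_cocycles S V x M i =
     {c \<in> carrier (cech_module S V x M i).
        cech_diff S V x M i c = \<zero>\<^bsub>cech_module S V x M (Suc i)\<^esub>}"

definition cech_boundaries ::
    "'a gring \<Rightarrow> 'v::linorder set \<Rightarrow> ('v \<Rightarrow> 'a) \<Rightarrow> ('a, 'b) gmodule \<Rightarrow> nat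
       \<Rightarrow> ('v set \<Rightarrow> ('b \<times> nat) set) set" where
  "cech_boundaries S V x M i =
     (case i of 0 \<Rightarrow> {\<zero>\<^bsub>cech_module S V x M 0\<^esub>}
      | Suc k \<Rightarrow> cech_diff S V x M k ` carrier (cech_module S V x M k))"

text \<open>Local cohomology with support in the ideal generated by the \<open>x v\<close>, \<open>v \<in> V\<close>, is defined as
  the cohomology of the Cech complex, with the grading induced from \<open>M\<close> (as in Stanley's
  \<open>Combinatorics and Commutative Algebra\<close>).  Over a Noetherian ring it depends, up to graded
  isomorphism, only on the radical of that ideal.\<close>

definition local_cohomology ::
    "'a gring \<Rightarrow> 'v::linorder set \<Rightarrow> ('v \<Rightarrow> 'a) \<Rightarrow> ('a, 'b) gmodule \<Rightarrow> nat
       \<Rightarrow> ('a, ('v set \<Rightarrow> ('b \<times> nat) set) set) gmodule" where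
  "local_cohomology S V x M i =
     quot_module (sub_module (cech_module S V x M i) (cech_cocycles S V x M i))
       (cech_boundaries S V x M i)"


section \<open>Ideals, dimension, traces\<close>

definition krull_dim :: "'a gring \<Rightarrow> enat" where
  "krull_dim S = Sup {enat l | l. \<exists>P. (\<forall>i\<le>l. primeideal (P i) S) \<and> (\<forall>i<l. P i \<subset> P (Suc i))}"

definition radical :: "'a gring \<Rightarrow> 'a set \<Rightarrow> 'a set" where
  "radical S I = {a \<in> carrier S. \<exists>k::nat. a [^]\<^bsub>S\<^esub> k \<in> I}"

text \<open>The graded maximal ideal of a positively graded ring whose degree 0 part is a field.\<close>

definition graded_max :: "'a gring \<Rightarrow> 'a set" where
  "graded_max S = Idl\<^bsub>S\<^esub> (\<Union>d\<in>{0<..}. rgrade S d)"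

text \<open>The sum of a family of ideals is the ideal generated by their union.\<close>

definition trace_ideal :: "'a gring \<Rightarrow> ('a, 'b) gmodule \<Rightarrow> 'a set" where
  "trace_ideal S M = Idl\<^bsub>S\<^esub> (\<Union>\<phi>\<in>mod_hom S M (regular_module S). \<phi> ` carrier M)"

definition trace_dagger :: "'a gring \<Rightarrow> ('a, 'b) gmodule \<Rightarrow> 'a set" where
  "trace_dagger S M = (if trace_ideal S M = carrier S then graded_max S else trace_ideal S M)"

definition is_internal_direct_sum :: "'a gring \<Rightarrow> 'j set \<Rightarrow> ('j \<Rightarrow> 'a set) \<Rightarrow> 'a set \<Rightarrow> bool" where
  "is_internal_direct_sum S D J I \<longleftrightarrow>
     I = {\<Oplus>\<^bsub>S\<^esub>i\<in>D. c i | c. \<forall>i\<in>D. c i \<in> J i} \<and>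
     (\<forall>c. (\<forall>i\<in>D. c i \<in> J i) \<and> (\<Oplus>\<^bsub>S\<^esub>i\<in>D. c i) = \<zero>\<^bsub>S\<^esub> \<longrightarrow> (\<forall>i\<in>D. c i = \<zero>\<^bsub>S\<^esub>))"


section \<open>Simplicial complexes\<close>

text \<open>A complex is given by its set of faces; its vertex set is the union of the faces,
  so that every vertex is a face.\<close>

definition simplicial_complex :: "'v set set \<Rightarrow> bool" where
  "simplicial_complex \<Delta> \<longleftrightarrow>
     finite (\<Union>\<Delta>) \<and> \<Union>\<Delta> \<noteq> {} \<and> (\<forall>\<sigma>\<in>\<Delta>. \<forall>\<tau>. \<tau> \<subseteq> \<sigma> \<longrightarrow> \<tau> \<in> \<Delta>)"

definition cdim :: "'v set set \<Rightarrow> int" where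
  "cdim \<Delta> = Max ((\<lambda>\<sigma>. int (card \<sigma>) - 1) ` \<Delta>)"

definition disjoint_union :: "nat \<Rightarrow> (nat \<Rightarrow> 'v set set) \<Rightarrow> (nat \<times> 'v) set set" where
  "disjoint_union n \<Delta> = {Pair i ` \<sigma> | i \<sigma>. i \<in> {1..n} \<and> \<sigma> \<in> \<Delta> i}"

definition discrete_complex :: "'v set \<Rightarrow> 'v set set" where
  "discrete_complex V = insert {} ((\<lambda>v. {v}) ` V)"


section \<open>Stanley--Reisner rings\<close>

type_synonym ('v, 'k) mpoly = "('v \<Rightarrow>\<^sub>0 nat) \<Rightarrow>\<^sub>0 'k"

definition poly_ring :: "'v set \<Rightarrow> ('v, 'k::field) mpoly ring" where
  "poly_ring V =
     \<lparr>carrier = {p. \<forall>m\<in>Poly_Mapping.keys p. Poly_Mapping.keys m \<subseteq> V},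
      mult = (*), one = 1, zero = 0, add = (+)\<rparr>"

definition pvar :: "'v \<Rightarrow> ('v, 'k::field) mpoly" where
  "pvar v = Poly_Mapping.single (Poly_Mapping.single v 1) 1"

definition mdeg :: "('v \<Rightarrow>\<^sub>0 nat) \<Rightarrow> nat" where
  "mdeg m = (\<Sum>v\<in>Poly_Mapping.keys m. Poly_Mapping.lookup m v)"

definition SR_ideal :: "'v set set \<Rightarrow> ('v, 'k::field) mpoly set" where
  "SR_ideal \<Delta> = Idl\<^bsub>poly_ring (\<Union>\<Delta>)\<^esub> {(\<Prod>v\<in>\<sigma>. pvar v) | \<sigma>. \<sigma> \<subseteq> \<Union>\<Delta> \<and> \<sigma> \<notin> \<Delta>}"

definition SR_class :: "'v set set \<Rightarrow> ('v, 'k::field) mpoly \<Rightarrow> ('v, 'k) mpoly set" where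
  "SR_class \<Delta> p = SR_ideal \<Delta> +>\<^bsub>poly_ring (\<Union>\<Delta>)\<^esub> p"

definition SR_ring :: "'v set set \<Rightarrow> ('v, 'k::field) mpoly set gring" where
  "SR_ring \<Delta> =
     ring.extend (poly_ring (\<Union>\<Delta>) Quot SR_ideal \<Delta>)
       (gring.fields (\<lambda>d. SR_class \<Delta> `
          {p \<in> carrier (poly_ring (\<Union>\<Delta>)). \<forall>m\<in>Poly_Mapping.keys p. int (mdeg m) = d}))"

definition residue_module :: "'a gring \<Rightarrow> ('a, 'a set) gmodule" where
  "residue_module S = quot_module (regular_module S) (graded_max S)"

text \<open>The graded canonical module of the Stanley--Reisner ring \<open>S\<close> of \<open>\<Delta>\<close>, where \<open>E\<close> is meant to
  be a graded injective envelope of \<open>residue_module S\<close>.  The variables generate the graded maximal ideal.\<close>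

definition SR_canonical_module ::
    "'v::linorder set set \<Rightarrow> (('v, 'k::field) mpoly set, 'e) gmodule
       \<Rightarrow> (('v, 'k) mpoly set, ('v set \<Rightarrow> (('v, 'k) mpoly set \<times> nat) set) set \<Rightarrow> 'e) gmodule" where
  "SR_canonical_module \<Delta> E =
     (let S = SR_ring \<Delta>
      in star_Hom S
           (local_cohomology S (\<Union>\<Delta>) (\<lambda>v. SR_class \<Delta> (pvar v)) (regular_module S)
             (the_enat (krull_dim S)))
           E)"

text \<open>\<open>poly_rename g p\<close> substitutes the variable \<open>g v\<close> for each variable \<open>v\<close>, and
  \<open>SR_incl n \<Delta> i\<close> is the resulting embedding of the Stanley--Reisner ring of \<open>\<Delta> i\<close>
  into that of the disjoint union.\<close>

definition poly_rename :: "('v \<Rightarrow> 'w) \<Rightarrow> ('v, 'k::field) mpoly \<Rightarrow> ('w, 'k) mpoly" where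
  "poly_rename g p =
     (\<Sum>m\<in>Poly_Mapping.keys p. Poly_Mapping.single
        (\<Sum>v\<in>Poly_Mapping.keys m. Poly_Mapping.single (g v) (Poly_Mapping.lookup m v))
        (Poly_Mapping.lookup p m))"

definition SR_incl ::
    "nat \<Rightarrow> (nat \<Rightarrow> 'v set set) \<Rightarrow> nat \<Rightarrow> ('v, 'k::field) mpoly set \<Rightarrow> (nat \<times> 'v, 'k) mpoly set" where
  "SR_incl n \<Delta> i X = (\<Union>p\<in>X. SR_class (disjoint_union n \<Delta>) (poly_rename (Pair i) p))"

text \<open>The extension \<open>I R\<close> to the Stanley--Reisner ring \<open>R\<close> of the disjoint union.\<close>

definition SR_extend ::
    "nat \<Rightarrow> (nat \<Rightarrow> 'v set set) \<Rightarrow> nat \<Rightarrow> ('v, 'k::field) mpoly set set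
       \<Rightarrow> (nat \<times> 'v, 'k) mpoly set set" where
  "SR_extend n \<Delta> i I = Idl\<^bsub>SR_ring (disjoint_union n \<Delta>)\<^esub> (SR_incl n \<Delta> i ` I)"

end

theory Submission
  imports Defs
begin

text \<open>
  Dualising into the graded injective hull turns the top local cohomology, computed by the Cech
  complex, into an explicit module \<open>W\<close>: its elements are families of polynomials \<open>w F\<close> on the
  faces \<open>F\<close> of maximal size, the coefficient of \<open>m\<close> in \<open>w F\<close> being the value of a functional
  at the fraction \<open>1 / m\<close>, and one linear condition per codimension-one face expresses that this
  functional vanishes on coboundaries.

  If the dimension is at least one, every coface of a nonempty face lies in the same component, so
  \<open>W\<close> is the direct sum of the corresponding modules of the components of maximal dimension.
  The maximal ideal of a component is annihilated by the variables of the others; hence homomorphisms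
  from the summand of \<open>\<Delta> i\<close> to \<open>R\<close> take values in the maximal ideal of \<open>A i\<close>, and every
  homomorphism to \<open>A i\<close> with values in that ideal occurs.  When the trace over \<open>A i\<close> is the
  whole ring, some homomorphism hits a unit and its multiples by the maximal ideal generate that ideal,
  which is where the dagger comes from.  For discrete complexes on at least three points the trace is
  the maximal ideal by a direct computation.
\<close>

text \<open>The envelope \<open>E\<close> is arbitrary, so nothing inside it can be computed
  directly. What survives is that its component of degree zero is a copy of the field. Projecting to
  it gives a functional \<open>eps\<close>, and an element \<open>e\<close> is determined by the
  scalars \<open>eps (s e)\<close> for \<open>s\<close> in the ring. Homomorphisms into
  \<open>E\<close> thus become scalar functionals on local cohomology, which is graded Matlis
  duality carried out by hand. The ring is handled through normal forms: multiply polynomials, then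
  delete the monomials whose support is not a face. Since the relevant Cech degree is the Krull
  dimension, that dimension must first be shown to be the largest size of a face. Dimension zero
  needs its own argument because the only face of codimension one is then empty, and its condition,
  that the constant coefficients sum to zero, ties all the components together. For two points this
  makes the canonical module free of rank one, so its trace is the whole ring; hence the exclusion
  of that complex.\<close>

abbreviation "lookup \<equiv> Poly_Mapping.lookup"
abbreviation "keys \<equiv> Poly_Mapping.keys"
abbreviation "single \<equiv> Poly_Mapping.single"

subsection \<open>Exponents and coefficients\<close>

lemma keys_add_nat: "keys (a + b) = keys a \<union> keys b"
  for a b :: "'v \<Rightarrow>\<^sub>0 nat"
  by (auto simp: in_keys_iff lookup_add)

lemma mdeg_superset:
  assumes "finite A" "keys m \<subseteq> A"
  shows "mdeg m = (\<Sum>v\<in>A. lookup m v)"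
  unfolding mdeg_def using assms by (intro sum.mono_neutral_left) (auto simp: in_keys_iff)

lemma mdeg_add: "mdeg (a + b) = mdeg a + mdeg b"
  by (subst (1 2 3) mdeg_superset[of "keys a \<union> keys b"])
    (auto simp: keys_add_nat lookup_add sum.distrib)

lemma mdeg_zero [simp]: "mdeg 0 = 0"
  by (simp add: mdeg_def)

lemma mdeg_single [simp]: "mdeg (single v c) = c"
  by (simp add: mdeg_def)

lemma mdeg_eq_0_iff [simp]: "mdeg m = 0 \<longleftrightarrow> m = 0"
  by (auto simp: mdeg_def in_keys_iff) (metis keys_eq_empty equals0I in_keys_iff poly_mapping_eqI lookup_zero)

lemma lookup_le_mdeg: "lookup m v \<le> mdeg m"
proof (cases "v \<in> keys m")
  case True
  then show ?thesis unfolding mdeg_def by (intro member_le_sum) auto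
qed (auto simp: in_keys_iff)

text \<open>Only divisors of \<open>m\<close> contribute to the coefficient of \<open>m\<close> in a
  product. So the factors may be truncated to a face, or changed modulo the Stanley--Reisner ideal,
  when a coefficient at a monomial supported on a face is read off.\<close>

lemma mpoly_times_cong:
  assumes "\<And>l q. m = l + q \<Longrightarrow> lookup p l = lookup p' l"
    and "\<And>l q. m = l + q \<Longrightarrow> lookup q1 q = lookup q2 q"
  shows "lookup (p * q1) m = lookup (p' * q2) m"
proof -
  have *: "(\<Sum>q. lookup q1 q when m = l + q) = (\<Sum>q. lookup q2 q when m = l + q)" for l
    by (rule Sum_any.cong) (auto simp: when_def assms(2))
  have "(\<Sum>l. lookup p l * (\<Sum>q. lookup q1 q when m = l + q)) =
        (\<Sum>l. lookup p' l * (\<Sum>q. lookup q2 q when m = l + q))"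
  proof (rule Sum_any.cong)
    fix l
    show "lookup p l * (\<Sum>q. lookup q1 q when m = l + q) =
          lookup p' l * (\<Sum>q. lookup q2 q when m = l + q)"
    proof (cases "\<exists>q. m = l + q")
      case True
      then show ?thesis using assms(1) * by auto
    next
      case False
      then show ?thesis by simp
    qed
  qed
  then show ?thesis by (simp add: lookup_mult)
qed

lemma lookup_single_times:
  "lookup (single t c * p) (t + m) = c * lookup p m"
  for t :: "'a::cancel_comm_monoid_add" and p :: "'a \<Rightarrow>\<^sub>0 'k::comm_semiring_1"
proof -
  have "lookup (single t c * p) (t + m) =
     (\<Sum>l. (c * (\<Sum>q. lookup p q when t + m = l + q)) when l = t)"
    unfolding lookup_mult by (rule Sum_any.cong) (auto simp: lookup_single when_def)
  also have "\<dots> = c * (\<Sum>q. lookup p q when m = q)"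
    by simp
  finally show ?thesis by simp
qed

lemma lookup_single_times_notin:
  assumes "\<nexists>q. m = t + q"
  shows "lookup (single t c * p) m = 0"
proof -
  have "lookup (single t c * p) m = lookup (0 * p) m"
    by (rule mpoly_times_cong) (use assms in \<open>auto simp: lookup_single when_def\<close>)
  then show ?thesis by simp
qed

lemma lookup_const_times:
  "lookup (single 0 c * p) m = c * lookup p m"
  for p :: "'a::cancel_comm_monoid_add \<Rightarrow>\<^sub>0 'k::comm_semiring_1"
  using lookup_single_times[of 0 c p m] by simp

lemma lookup_times_zero:
  "lookup (p * q) 0 = lookup p 0 * lookup q 0"
  for p q :: "('v \<Rightarrow>\<^sub>0 nat) \<Rightarrow>\<^sub>0 'k::comm_semiring_1"
proof -
  have "l = 0 \<and> q = 0" if "0 = l + q" for l q :: "'v \<Rightarrow>\<^sub>0 nat"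
    using that by (metis keys_add_nat keys_eq_empty keys_zero sup_eq_bot_iff)
  then have "lookup (p * q) 0 = lookup (single 0 (lookup p 0) * q) 0"
    by (intro mpoly_times_cong) (metis lookup_single_eq, blast)
  then show ?thesis by (simp add: lookup_const_times)
qed

lemma mpoly_decompose:
  fixes p :: "'a \<Rightarrow>\<^sub>0 'b::comm_monoid_add"
  assumes "finite A" "keys p \<subseteq> A"
  shows "p = (\<Sum>m\<in>A. single m (lookup p m))"
proof (rule poly_mapping_eqI)
  fix k
  have "(\<Sum>m\<in>A. lookup p m when m = k) = lookup p k"
    using assms unfolding when_def by (subst sum.delta) (auto simp: in_keys_iff)
  then show "lookup p k =
    lookup (\<Sum>m\<in>A. single m (lookup p m)) k"
    by (simp add: lookup_sum lookup_single)
qed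

text \<open>Restricting \<open>m\<close> and \<open>q\<close> to the monomials of \<open>p\<close>
  keeps the induction inside any set cut out by conditions on monomials, such as
  \<open>polys V\<close> or the kernel of \<open>res\<close>.\<close>

lemma mpoly_induct [case_names zero single_add]:
  fixes p :: "'a \<Rightarrow>\<^sub>0 'b::comm_monoid_add"
  assumes "P 0"
    and "\<And>m c q. m \<in> keys p \<Longrightarrow> keys q \<subseteq> keys p \<Longrightarrow> P q \<Longrightarrow>
           P (single m c + q)"
  shows "P p"
proof -
  have "P (\<Sum>m\<in>A. single m (lookup p m)) \<and>
        keys (\<Sum>m\<in>A. single m (lookup p m)) \<subseteq> A"
    if "finite A" "A \<subseteq> keys p" for A
    using that
  proof (induction A)
    case empty
    then show ?case using assms(1) by simp
  next
    case (insert x A)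
    let ?q = "\<Sum>m\<in>A. single m (lookup p m)"
    have q: "P ?q" "keys ?q \<subseteq> A" using insert by auto
    have "keys (single x (lookup p x) + ?q) \<subseteq> insert x A"
      using keys_add[of "single x (lookup p x)" ?q] q(2)
      by (auto split: if_splits)
    then show ?case using insert q assms(2)[of x ?q] by auto
  qed
  from this[of "keys p"] show ?thesis
    using mpoly_decompose[of "keys p" p] by simp
qed

definition mprod :: "('v \<Rightarrow> nat) \<Rightarrow> 'v set \<Rightarrow> ('v \<Rightarrow>\<^sub>0 nat)" where
  "mprod f A = (\<Sum>v\<in>A. single v (f v))"

lemma lookup_mprod: "finite A \<Longrightarrow> lookup (mprod f A) v = (if v \<in> A then f v else 0)"
  by (auto simp: mprod_def lookup_sum lookup_single when_def sum.delta)

lemma single_sum_eq_prod: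
  "finite A \<Longrightarrow> single (\<Sum>v\<in>A. f v) (1::'k::comm_semiring_1) = (\<Prod>v\<in>A. single (f v) 1)"
proof (induction A rule: finite_induct)
  case (insert x F)
  then show ?case
    using mult_single[of "f x" "1::'k" "sum f F" 1] by simp
qed simp

lemma pvar_power: "pvar v ^ n = single (single v n) 1"
  by (induction n) (simp_all add: pvar_def mult_single flip: single_add)

lemma single_eq_0_iff: "single m c = 0 \<longleftrightarrow> c = 0"
  by (metis keys_eq_empty keys_single insert_not_empty)

lemma prod_pvar: "finite F \<Longrightarrow> (\<Prod>v\<in>F. pvar v) = single (mprod (\<lambda>_. 1) F) (1::'k::field)"
  by (simp add: mprod_def single_sum_eq_prod pvar_def)

subsection \<open>Restriction to the monomials with support in a family\<close>

text \<open>For \<open>X = Pow F\<close> this sets the variables outside \<open>F\<close> to zero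
  and is multiplicative; for a complex \<open>X\<close> it is the normal form modulo the
  Stanley--Reisner ideal.\<close>

lift_definition res :: "'v set set \<Rightarrow> ('v, 'k::zero) mpoly \<Rightarrow> ('v, 'k) mpoly" is
  "\<lambda>X p m. if keys m \<in> X then p m else 0"
  by (auto elim!: finite_subset[rotated])

lemma lookup_res: "lookup (res X p) m = (if keys m \<in> X then lookup p m else 0)"
  by transfer simp

lemma res_0 [simp]: "res X 0 = 0"
  by (rule poly_mapping_eqI) (simp add: lookup_res)

lemma res_add: "res X (p + q) = res X p + res X q"
  for p :: "('v, 'k::monoid_add) mpoly"
  by (rule poly_mapping_eqI) (simp add: lookup_res lookup_add)

lemma res_uminus: "res X (- p) = - res X p"
  for p :: "('v, 'k::ab_group_add) mpoly"
  by (rule poly_mapping_eqI) (simp add: lookup_res)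

lemma res_diff: "res X (p - q) = res X p - res X q"
  for p :: "('v, 'k::ab_group_add) mpoly"
  by (rule poly_mapping_eqI) (simp add: lookup_res lookup_minus)

lemma res_sum: "res X (\<Sum>i\<in>A. f i) = (\<Sum>i\<in>A. res X (f i))"
  for f :: "_ \<Rightarrow> ('v, 'k::comm_monoid_add) mpoly"
  by (rule poly_mapping_eqI) (simp add: lookup_res lookup_sum)

lemma res_res: "res X (res Y p) = res (X \<inter> Y) p"
  by (rule poly_mapping_eqI) (simp add: lookup_res)

lemma keys_res: "keys (res X p) = {m \<in> keys p. keys m \<in> X}"
  by (auto simp: in_keys_iff lookup_res split: if_splits)

lemma res_id_iff: "res X p = p \<longleftrightarrow> (\<forall>m\<in>keys p. keys m \<in> X)"
  by (auto simp: poly_mapping_eq_iff fun_eq_iff lookup_res in_keys_iff)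

lemma res_eq_0_iff: "res X p = 0 \<longleftrightarrow> (\<forall>m\<in>keys p. keys m \<notin> X)"
  by (auto simp: poly_mapping_eq_iff fun_eq_iff lookup_res in_keys_iff)

lemma res_single: "res X (single m c) = (if keys m \<in> X then single m c else 0)"
  by (rule poly_mapping_eqI) (auto simp: lookup_res lookup_single when_def)

text \<open>A divisor of a monomial with support in \<open>X\<close> again has support in
  \<open>X\<close>; so the deleted monomials span an ideal and never come back.\<close>

lemma res_times_res:
  assumes "\<And>A B. A \<in> X \<Longrightarrow> B \<subseteq> A \<Longrightarrow> B \<in> X"
  shows "res X (res X p * res X q) = res X (p * q)"
proof (rule poly_mapping_eqI)
  fix m
  show "lookup (res X (res X p * res X q)) m = lookup (res X (p * q)) m"
  proof (cases "keys m \<in> X")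
    case True
    then have "lookup (res X p * res X q) m = lookup (p * q) m"
      using assms by (intro mpoly_times_cong) (auto simp: lookup_res keys_add_nat)
    then show ?thesis by (simp add: lookup_res)
  qed (simp add: lookup_res)
qed

lemma keys_times_mpoly:
  assumes "m \<in> keys (p * q)"
  obtains a b where "m = a + b" "a \<in> keys p" "b \<in> keys q"
  using keys_mult[of p q] assms by blast

lemma res_Pow_times: "res (Pow F) (p * q) = res (Pow F) p * res (Pow F) q"
proof -
  have "res (Pow F) (res (Pow F) p * res (Pow F) q) = res (Pow F) p * res (Pow F) q"
    unfolding res_id_iff
    by (auto elim!: keys_times_mpoly simp: keys_res keys_add_nat)
  then show ?thesis using res_times_res[of "Pow F" p q] by auto
qed

lemma res_one: "{} \<in> X \<Longrightarrow> res X 1 = 1"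
  by (simp add: res_single flip: single_one)

subsection \<open>Homogeneous parts\<close>

text \<open>Degrees are integers because they are compared with degrees in shifted modules and in
  local cohomology, where negative ones occur.\<close>

lift_definition hpart :: "int \<Rightarrow> ('v, 'k::zero) mpoly \<Rightarrow> ('v, 'k) mpoly" is
  "\<lambda>j p m. if int (mdeg m) = j then p m else 0"
  by (auto elim!: finite_subset[rotated])

lemma lookup_hpart: "lookup (hpart j p) m = (if int (mdeg m) = j then lookup p m else 0)"
  by transfer simp

lemma keys_hpart: "keys (hpart j p) = {m \<in> keys p. int (mdeg m) = j}"
  by (auto simp: in_keys_iff lookup_hpart split: if_splits)

lemma hpart_add: "hpart j (p + q) = hpart j p + hpart j q"
  for p :: "('v, 'k::monoid_add) mpoly"
  by (rule poly_mapping_eqI) (simp add: lookup_hpart lookup_add)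

lemma hpart_0 [simp]: "hpart j 0 = 0"
  by (rule poly_mapping_eqI) (simp add: lookup_hpart)

lemma hpart_uminus: "hpart j (- p) = - hpart j p"
  for p :: "('v, 'k::ab_group_add) mpoly"
  by (rule poly_mapping_eqI) (simp add: lookup_hpart)

lemma hpart_sum: "hpart j (\<Sum>i\<in>A. f i) = (\<Sum>i\<in>A. hpart j (f i))"
  for f :: "_ \<Rightarrow> ('v, 'k::comm_monoid_add) mpoly"
  by (rule poly_mapping_eqI) (simp add: lookup_hpart lookup_sum)

lemma res_hpart: "res X (hpart j p) = hpart j (res X p)"
  by (rule poly_mapping_eqI) (simp add: lookup_hpart lookup_res)

lemma hpart_id_iff: "hpart j p = p \<longleftrightarrow> (\<forall>m\<in>keys p. int (mdeg m) = j)"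
  by (auto simp: poly_mapping_eq_iff fun_eq_iff lookup_hpart in_keys_iff)

lemma hpart_zero: "hpart 0 p = single 0 (lookup p 0)"
  by (rule poly_mapping_eqI) (auto simp: lookup_hpart lookup_single)

lemma hpart_decompose:
  fixes p :: "('v, 'k::comm_monoid_add) mpoly"
  assumes "finite A" "(\<lambda>m. int (mdeg m)) ` keys p \<subseteq> A"
  shows "p = (\<Sum>j\<in>A. hpart j p)"
proof (rule poly_mapping_eqI)
  fix m
  have "(\<Sum>j\<in>A. if int (mdeg m) = j then lookup p m else 0) = lookup p m"
    using assms by (subst sum.delta') (auto simp: in_keys_iff image_subset_iff)
  then show "lookup p m = lookup (\<Sum>j\<in>A. hpart j p) m"
    by (simp add: lookup_sum lookup_hpart)
qed

lemma hpart_single_times: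
  "hpart (int (mdeg t) + j) (single t c * p) = single t c * hpart j p"
  for p :: "('v, 'k::comm_semiring_1) mpoly"
proof (rule poly_mapping_eqI)
  fix m
  show "lookup (hpart (int (mdeg t) + j) (single t c * p)) m =
    lookup (single t c * hpart j p) m"
  proof (cases "\<exists>q. m = t + q")
    case True
    then show ?thesis by (auto simp: lookup_hpart lookup_single_times mdeg_add)
  next
    case False
    then show ?thesis by (auto simp: lookup_hpart lookup_single_times_notin)
  qed
qed

subsection \<open>The Stanley--Reisner ring in terms of polynomials\<close>

definition polys :: "'v set \<Rightarrow> ('v, 'k::field) mpoly set" where
  "polys V = {p. \<forall>m\<in>keys p. keys m \<subseteq> V}"

lemma polys_iff: "p \<in> polys V \<longleftrightarrow> res (Pow V) p = p"
  by (auto simp: polys_def res_id_iff)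

lemma polys_0 [simp]: "0 \<in> polys V" and polys_1 [simp]: "1 \<in> polys V"
  by (auto simp: polys_def)

lemma polys_add: "p \<in> polys V \<Longrightarrow> q \<in> polys V \<Longrightarrow> p + q \<in> polys V"
  by (simp add: polys_iff res_add)

lemma polys_times: "p \<in> polys V \<Longrightarrow> q \<in> polys V \<Longrightarrow> p * q \<in> polys V"
  by (simp add: polys_iff res_Pow_times)

lemma polys_uminus: "p \<in> polys V \<Longrightarrow> - p \<in> polys V"
  by (simp add: polys_iff res_uminus)

lemma polys_diff: "p \<in> polys V \<Longrightarrow> q \<in> polys V \<Longrightarrow> p - q \<in> polys V"
  by (simp add: polys_iff res_diff)

lemma polys_sum: "(\<And>i. i \<in> A \<Longrightarrow> f i \<in> polys V) \<Longrightarrow> (\<Sum>i\<in>A. f i) \<in> polys V"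
  by (induction A rule: infinite_finite_induct) (auto simp: polys_add)

lemma polys_power: "p \<in> polys V \<Longrightarrow> p ^ n \<in> polys V"
  by (induction n) (auto simp: polys_times)

lemma polys_single: "keys m \<subseteq> V \<Longrightarrow> single m c \<in> polys V"
  by (auto simp: polys_def)

lemma polys_pvar: "v \<in> V \<Longrightarrow> pvar v \<in> polys V"
  by (auto simp: pvar_def intro!: polys_single)

lemma polys_res: "p \<in> polys V \<Longrightarrow> res X p \<in> polys V"
  by (auto simp: polys_def keys_res)

lemma polys_hpart: "p \<in> polys V \<Longrightarrow> hpart j p \<in> polys V"
  by (auto simp: polys_def keys_hpart)

lemmas polys_closed = polys_add polys_times polys_uminus polys_diff polys_sum polys_power
  polys_single polys_pvar polys_res polys_hpart

lemma poly_ring_simps [simp]: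
  "carrier (poly_ring V) = polys V" "mult (poly_ring V) = (*)" "one (poly_ring V) = 1"
  "zero (poly_ring V) = 0" "add (poly_ring V) = (+)"
  by (auto simp: poly_ring_def polys_def)

lemma cring_poly_ring: "cring (poly_ring V)"
proof (rule cringI)
  show "abelian_group (poly_ring V)"
    by (rule abelian_groupI) (auto simp: polys_closed intro!: bexI[of _ "- _"])
  show "Group.comm_monoid (poly_ring V)"
    by (rule comm_monoidI) (auto simp: polys_closed algebra_simps)
qed (auto simp: algebra_simps)

lemma poly_ring_minus [simp]:
  fixes p q :: "('v, 'k::field) mpoly"
  assumes "p \<in> polys V" "q \<in> polys V"
  shows "p \<ominus>\<^bsub>poly_ring V\<^esub> q = p - q"
proof -
  interpret cring "poly_ring V :: ('v, 'k::field) mpoly ring" by (rule cring_poly_ring)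
  have "\<ominus>\<^bsub>poly_ring V\<^esub> q = - q"
    by (rule minus_equality) (use assms in \<open>auto simp: polys_closed\<close>)
  then show ?thesis by (simp add: a_minus_def)
qed

lemma extend_gring_simps [simp]:
  "carrier (ring.extend Q (gring.fields g)) = carrier Q"
  "mult (ring.extend Q (gring.fields g)) = mult Q"
  "one (ring.extend Q (gring.fields g)) = one Q"
  "zero (ring.extend Q (gring.fields g)) = zero Q"
  "add (ring.extend Q (gring.fields g)) = add Q"
  "rgrade (ring.extend Q (gring.fields g)) = g"
  by (simp_all add: ring.defs gring.defs)

locale SR =
  fixes \<Delta> :: "'v::linorder set set" and S :: "('v, 'k::field) mpoly set gring"
  assumes complex: "simplicial_complex \<Delta>" and S_def: "S = SR_ring \<Delta>"
begin

abbreviation "V \<equiv> \<Union>\<Delta>"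

abbreviation "cl \<equiv> SR_class \<Delta> :: ('v, 'k) mpoly \<Rightarrow> _"

abbreviation "P \<equiv> polys V :: ('v, 'k) mpoly set"

lemma finite_V: "finite V"
  using complex by (simp add: simplicial_complex_def)

lemma finite_face: "F \<in> \<Delta> \<Longrightarrow> finite F"
  using finite_V by (meson Union_upper finite_subset)

lemma face_mono: "F \<in> \<Delta> \<Longrightarrow> G \<subseteq> F \<Longrightarrow> G \<in> \<Delta>"
  using complex by (auto simp: simplicial_complex_def)

lemma empty_face: "{} \<in> \<Delta>"
  using complex face_mono by (auto simp: simplicial_complex_def)

lemma V_nonempty: "V \<noteq> {}"
  using complex by (simp add: simplicial_complex_def)

lemma finite_complex: "finite \<Delta>"
  using finite_V by (meson Sup_upper finite_Pow_iff finite_subset Pow_iff subsetI)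

lemma vertex_face: "v \<in> V \<Longrightarrow> {v} \<in> \<Delta>"
  using face_mono by blast

lemma ideal_res: "ideal {p \<in> P. res \<Delta> p = 0} (poly_ring V)"
proof (rule idealI)
  interpret cring "poly_ring V :: ('v, 'k) mpoly ring" by (rule cring_poly_ring)
  show "ring (poly_ring V :: ('v, 'k) mpoly ring)" by (rule ring_axioms)
  show "subgroup {p \<in> P. res \<Delta> p = 0} (add_monoid (poly_ring V))"
  proof (rule add.subgroupI)
    fix a :: "('v, 'k) mpoly" assume "a \<in> {p \<in> P. res \<Delta> p = 0}"
    moreover from this have "\<ominus>\<^bsub>poly_ring V\<^esub> a = - a"
      using poly_ring_minus[of 0 V a] l_zero[of "\<ominus>\<^bsub>poly_ring V\<^esub> a"] by (simp add: a_minus_def)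
    ultimately show "\<ominus>\<^bsub>poly_ring V\<^esub> a \<in> {p \<in> P. res \<Delta> p = 0}"
      by (simp add: polys_closed res_uminus)
  qed (auto simp: polys_closed res_add intro!: exI[of _ 0])
next
  fix a x :: "('v, 'k) mpoly"
  assume a: "a \<in> {p \<in> P. res \<Delta> p = 0}" "x \<in> carrier (poly_ring V)"
  then show "x \<otimes>\<^bsub>poly_ring V\<^esub> a \<in> {p \<in> P. res \<Delta> p = 0}" "a \<otimes>\<^bsub>poly_ring V\<^esub> x \<in> {p \<in> P. res \<Delta> p = 0}"
    using res_times_res[of \<Delta> x a] face_mono by (auto simp: polys_closed mult.commute)
qed

text \<open>A monomial whose support is a non-face is a multiple of the product of the variables in
  its support, which is a generator. Conversely the polynomials without face monomials already form
  an ideal that contains the generators.\<close>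

lemma SR_ideal_eq: "SR_ideal \<Delta> = {p \<in> P. res \<Delta> p = 0}"
proof
  interpret cring "poly_ring V :: ('v, 'k) mpoly ring" by (rule cring_poly_ring)
  let ?G = "{(\<Prod>v\<in>\<sigma>. pvar v) | \<sigma>. \<sigma> \<subseteq> V \<and> \<sigma> \<notin> \<Delta>} :: ('v, 'k) mpoly set"
  have gen: "(\<Prod>v\<in>\<sigma>. pvar v) = single (mprod (\<lambda>_. Suc 0) \<sigma>) (1::'k)"
    "keys (mprod (\<lambda>_. Suc 0) \<sigma>) = \<sigma>" if "\<sigma> \<subseteq> V" for \<sigma>
    using that finite_subset[OF that finite_V] by (auto simp: prod_pvar in_keys_iff lookup_mprod split: if_splits)
  show "SR_ideal \<Delta> \<subseteq> {p \<in> P. res \<Delta> p = 0}"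
    unfolding SR_ideal_def
  proof (rule genideal_minimal[OF ideal_res])
    show "?G \<subseteq> {p \<in> P. res \<Delta> p = 0}"
      by (auto simp: gen polys_single res_single)
  qed
  have GP: "?G \<subseteq> carrier (poly_ring V)"
    by (auto simp: gen polys_single)
  interpret I: ideal "SR_ideal \<Delta>" "poly_ring V :: ('v, 'k) mpoly ring"
    unfolding SR_ideal_def by (rule genideal_ideal[OF GP])
  show "{p \<in> P. res \<Delta> p = 0} \<subseteq> SR_ideal \<Delta>"
  proof
    fix p :: "('v, 'k) mpoly" assume p: "p \<in> {p \<in> P. res \<Delta> p = 0}"
    show "p \<in> SR_ideal \<Delta>"
    proof (induction p rule: mpoly_induct)
      case zero
      then show ?case using I.zero_closed by simp
    next
      case (single_add m c q)
      have m: "keys m \<subseteq> V" "keys m \<notin> \<Delta>" using p single_add(1) by (auto simp: polys_def res_eq_0_iff)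
      define t where "t = m - mprod (\<lambda>_. Suc 0) (keys m)"
      have mt: "m = t + mprod (\<lambda>_. Suc 0) (keys m)"
        by (rule poly_mapping_eqI) (auto simp: t_def lookup_add lookup_minus lookup_mprod in_keys_iff)
      have tV: "keys t \<subseteq> V"
        using m(1) mt by (metis keys_add_nat le_sup_iff)
      have "(\<Prod>v\<in>keys m. pvar v :: ('v, 'k) mpoly) \<in> SR_ideal \<Delta>"
        unfolding SR_ideal_def by (rule subsetD[OF genideal_self[OF GP]]) (use m in blast)
      then have "single t c * (\<Prod>v\<in>keys m. pvar v) \<in> SR_ideal \<Delta>"
        using I.I_l_closed[of "\<Prod>v\<in>keys m. pvar v" "single t c"] polys_single[OF tV, of c] by simp
      also have "single t c * (\<Prod>v\<in>keys m. pvar v) = single m c"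
        using gen(1)[OF m(1)] mult_single[of t c "mprod (\<lambda>_. Suc 0) (keys m)" 1] mt by simp
      finally show ?case using I.a_closed[OF _ single_add(3)] by simp
    qed
  qed
qed

lemma ideal_SR: "ideal (SR_ideal \<Delta> :: ('v, 'k) mpoly set) (poly_ring V)"
  using ideal_res by (simp add: SR_ideal_eq)

lemma cl_eq_iff: "p \<in> P \<Longrightarrow> q \<in> P \<Longrightarrow> cl p = cl q \<longleftrightarrow> res \<Delta> p = res \<Delta> q"
proof -
  interpret I: ideal "SR_ideal \<Delta> :: ('v, 'k) mpoly set" "poly_ring V" by (rule ideal_SR)
  assume "p \<in> P" "q \<in> P"
  then have "cl p = cl q \<longleftrightarrow> p - q \<in> SR_ideal \<Delta>"
    using I.quotient_eq_iff_same_a_r_cos[OF ideal_SR, of p q]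
    by (simp add: SR_class_def)
  also have "\<dots> \<longleftrightarrow> res \<Delta> p = res \<Delta> q"
    using \<open>p \<in> P\<close> \<open>q \<in> P\<close> by (auto simp: SR_ideal_eq polys_closed res_diff)
  finally show ?thesis .
qed

lemma cl_res: "p \<in> P \<Longrightarrow> cl (res \<Delta> p) = cl p"
  by (simp add: cl_eq_iff polys_closed res_res)

lemma carrier_S: "carrier S = cl ` P"
  by (auto simp: S_def SR_ring_def FactRing_def A_RCOSETS_def' SR_class_def image_def)

lemma cl_closed [simp]: "p \<in> P \<Longrightarrow> cl p \<in> carrier S"
  by (simp add: carrier_S)

lemma cl_add: "p \<in> P \<Longrightarrow> q \<in> P \<Longrightarrow> cl p \<oplus>\<^bsub>S\<^esub> cl q = cl (p + q)"
proof -
  interpret I: ideal "SR_ideal \<Delta> :: ('v, 'k) mpoly set" "poly_ring V" by (rule ideal_SR)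
  show "p \<in> P \<Longrightarrow> q \<in> P \<Longrightarrow> cl p \<oplus>\<^bsub>S\<^esub> cl q = cl (p + q)"
    using I.a_rcos_sum[of p q] by (simp add: S_def SR_ring_def FactRing_def SR_class_def)
qed

lemma cl_mult: "p \<in> P \<Longrightarrow> q \<in> P \<Longrightarrow> cl p \<otimes>\<^bsub>S\<^esub> cl q = cl (p * q)"
proof -
  interpret I: ideal "SR_ideal \<Delta> :: ('v, 'k) mpoly set" "poly_ring V" by (rule ideal_SR)
  show "p \<in> P \<Longrightarrow> q \<in> P \<Longrightarrow> cl p \<otimes>\<^bsub>S\<^esub> cl q = cl (p * q)"
    using I.rcoset_mult_add[of p q] by (simp add: S_def SR_ring_def FactRing_def SR_class_def)
qed

lemma S_one: "\<one>\<^bsub>S\<^esub> = cl 1"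
  by (simp add: S_def SR_ring_def FactRing_def SR_class_def)

lemma S_zero: "\<zero>\<^bsub>S\<^esub> = cl 0"
proof -
  interpret I: ideal "SR_ideal \<Delta> :: ('v, 'k) mpoly set" "poly_ring V" by (rule ideal_SR)
  have "SR_ideal \<Delta> +>\<^bsub>poly_ring V\<^esub> (0::('v, 'k) mpoly) = SR_ideal \<Delta>"
    using I.a_rcos_zero[OF ideal_SR, of 0] by (simp add: SR_ideal_eq)
  then show ?thesis
    by (simp add: S_def SR_ring_def FactRing_def SR_class_def)
qed

lemma S_cases:
  assumes "X \<in> carrier S"
  obtains p where "p \<in> P" "X = cl p"
  using assms by (auto simp: carrier_S)

lemma cring_S: "cring S"
proof (rule cringI)
  show "abelian_group S"
  proof (rule abelian_groupI)
    fix x assume "x \<in> carrier S"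
    then obtain p where "p \<in> P" "x = cl p" by (rule S_cases)
    then show "\<exists>y\<in>carrier S. y \<oplus>\<^bsub>S\<^esub> x = \<zero>\<^bsub>S\<^esub>"
      by (intro bexI[of _ "cl (- p)"]) (auto simp: cl_add S_zero polys_closed)
  qed (auto elim!: S_cases simp: cl_add S_zero polys_closed add_ac)
  show "Group.comm_monoid S"
    by (rule comm_monoidI) (auto elim!: S_cases simp: cl_mult S_one polys_closed mult_ac)
qed (auto elim!: S_cases simp: cl_mult cl_add polys_closed algebra_simps)

sublocale cring S
  by (rule cring_S)

lemma cl_uminus: "p \<in> P \<Longrightarrow> \<ominus>\<^bsub>S\<^esub> cl p = cl (- p)"
  by (rule minus_equality) (auto simp: cl_add S_zero polys_closed)

lemma cl_diff: "p \<in> P \<Longrightarrow> q \<in> P \<Longrightarrow> cl p \<ominus>\<^bsub>S\<^esub> cl q = cl (p - q)"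
  by (simp add: a_minus_def cl_uminus cl_add polys_closed)

lemma cl_pow: "p \<in> P \<Longrightarrow> cl p [^]\<^bsub>S\<^esub> (n::nat) = cl (p ^ n)"
  by (induction n) (auto simp: S_one cl_mult polys_closed mult.commute)

lemma cl_finsum:
  assumes "finite A" "\<And>i. i \<in> A \<Longrightarrow> f i \<in> P"
  shows "(\<Oplus>\<^bsub>S\<^esub>i\<in>A. cl (f i)) = cl (\<Sum>i\<in>A. f i)"
  using assms by (induction A rule: finite_induct) (auto simp: S_zero cl_add polys_closed)

lemma cl_finprod:
  assumes "finite A" "\<And>i. i \<in> A \<Longrightarrow> f i \<in> P"
  shows "finprod S (\<lambda>i. cl (f i)) A = cl (\<Prod>i\<in>A. f i)"
proof -
  have "finprod S (\<lambda>i. cl (f i)) A = cl (\<Prod>i\<in>A. f i) \<and> (\<Prod>i\<in>A. f i) \<in> P"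
    using assms by (induction A rule: finite_induct) (auto simp: S_one cl_mult polys_closed)
  then show ?thesis ..
qed

text \<open>\<open>rp X\<close> is the unique representative of \<open>X\<close> whose monomials are supported on faces.\<close>

definition rp :: "('v, 'k) mpoly set \<Rightarrow> ('v, 'k) mpoly" where
  "rp X = res \<Delta> (SOME p. p \<in> P \<and> X = cl p)"

lemma rp_cl: "p \<in> P \<Longrightarrow> rp (cl p) = res \<Delta> p"
  unfolding rp_def by (rule someI2[of _ p]) (auto simp: cl_eq_iff)

lemma lookup_rp_cl_zero: "p \<in> P \<Longrightarrow> lookup (rp (cl p)) 0 = lookup p 0"
  by (simp add: rp_cl lookup_res empty_face)

lemma cl_rp: "X \<in> carrier S \<Longrightarrow> cl (rp X) = X"
  by (auto elim!: S_cases simp: rp_cl cl_res)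

lemma rp_P: "X \<in> carrier S \<Longrightarrow> rp X \<in> P"
  by (auto elim!: S_cases simp: rp_cl polys_closed)

lemma res_rp: "X \<in> carrier S \<Longrightarrow> res \<Delta> (rp X) = rp X"
  by (auto elim!: S_cases simp: rp_cl res_res)

lemma rp_inj: "X \<in> carrier S \<Longrightarrow> Y \<in> carrier S \<Longrightarrow> rp X = rp Y \<Longrightarrow> X = Y"
  by (metis cl_rp)

lemma rp_zero [simp]: "rp \<zero>\<^bsub>S\<^esub> = 0"
  by (simp add: S_zero rp_cl)

lemma rp_one [simp]: "rp \<one>\<^bsub>S\<^esub> = 1"
  by (simp add: S_one rp_cl res_one empty_face)

lemma rp_add: "X \<in> carrier S \<Longrightarrow> Y \<in> carrier S \<Longrightarrow> rp (X \<oplus>\<^bsub>S\<^esub> Y) = rp X + rp Y"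
  by (auto elim!: S_cases simp: cl_add rp_cl polys_closed res_add)

lemma rp_mult: "X \<in> carrier S \<Longrightarrow> Y \<in> carrier S \<Longrightarrow> rp (X \<otimes>\<^bsub>S\<^esub> Y) = res \<Delta> (rp X * rp Y)"
  by (auto elim!: S_cases simp: cl_mult rp_cl polys_closed res_times_res face_mono)

lemma rp_finsum:
  assumes "finite A" "f \<in> A \<rightarrow> carrier S"
  shows "rp (\<Oplus>\<^bsub>S\<^esub>i\<in>A. f i) = (\<Sum>i\<in>A. rp (f i))"
  using assms by (induction A rule: finite_induct) (auto simp: rp_add)

lemma cl_zero_iff: "p \<in> P \<Longrightarrow> cl p = \<zero>\<^bsub>S\<^esub> \<longleftrightarrow> res \<Delta> p = 0"
  by (simp add: S_zero cl_eq_iff)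

section \<open>The grading and the graded maximal ideal\<close>

lemma rgrade_S: "rgrade S j = {X \<in> carrier S. hpart j (rp X) = rp X}"
proof -
  have "rgrade S j = cl ` {p \<in> P. hpart j p = p}"
    by (simp add: S_def SR_ring_def hpart_id_iff)
  also have "\<dots> = {X \<in> carrier S. hpart j (rp X) = rp X}"
  proof safe
    fix X assume X: "X \<in> carrier S" "hpart j (rp X) = rp X"
    then show "X \<in> cl ` {p \<in> P. hpart j p = p}"
      by (intro image_eqI[of _ _ "rp X"]) (auto simp: cl_rp rp_P)
  qed (auto simp: rp_cl simp flip: res_hpart)
  finally show ?thesis .
qed

lemma cl_rgrade: "p \<in> P \<Longrightarrow> hpart j p = p \<Longrightarrow> cl p \<in> rgrade S j"
  by (auto simp: rgrade_S rp_cl simp flip: res_hpart)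

text \<open>The Stanley--Reisner ideal is generated by monomials, hence homogeneous, so homogeneous
  components can be taken on normal forms.\<close>

definition hc :: "int \<Rightarrow> ('v, 'k) mpoly set \<Rightarrow> ('v, 'k) mpoly set" where
  "hc j X = cl (hpart j (rp X))"

lemma hc_rgrade: "X \<in> carrier S \<Longrightarrow> hc j X \<in> rgrade S j"
  unfolding hc_def by (rule cl_rgrade) (auto simp: rp_P polys_closed hpart_id_iff keys_hpart)

lemma hc_closed [simp]: "X \<in> carrier S \<Longrightarrow> hc j X \<in> carrier S"
  using hc_rgrade by (simp add: rgrade_S)

lemma rp_hc: "X \<in> carrier S \<Longrightarrow> rp (hc j X) = hpart j (rp X)"
  by (simp add: hc_def rp_cl rp_P polys_closed res_hpart res_rp)

lemma hc_finsum:
  assumes "X \<in> carrier S" "finite A" "(\<lambda>m. int (mdeg m)) ` keys (rp X) \<subseteq> A"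
  shows "X = (\<Oplus>\<^bsub>S\<^esub>j\<in>A. hc j X)"
  unfolding hc_def using assms
  by (subst cl_finsum) (auto simp: rp_P polys_closed cl_rp simp flip: hpart_decompose)

lemma rgrade_mult:
  assumes "X \<in> rgrade S i" "Y \<in> rgrade S j"
  shows "X \<otimes>\<^bsub>S\<^esub> Y \<in> rgrade S (i + j)"
proof -
  have "int (mdeg m) = i + j" if "m \<in> keys (rp X * rp Y)" for m
    using that assms by (auto elim!: keys_times_mpoly simp: rgrade_S hpart_id_iff mdeg_add)
  then show ?thesis
    using assms by (auto simp: rgrade_S rp_mult hpart_id_iff keys_res)
qed

lemma rgrade_closed: "X \<in> rgrade S j \<Longrightarrow> X \<in> carrier S"
  by (simp add: rgrade_S)

lemma rgrade_subgroup: "additive_subgroup (rgrade S j) S"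
proof (rule additive_subgroupI, rule add.subgroupI)
  fix X assume "X \<in> rgrade S j"
  then obtain p where "p \<in> P" "hpart j p = p" "X = cl p"
    by (auto simp: rgrade_S) (metis cl_rp rp_P)
  then show "\<ominus>\<^bsub>S\<^esub> X \<in> rgrade S j"
    by (auto simp: cl_uminus intro!: cl_rgrade polys_closed simp: hpart_uminus)
qed (auto simp: rgrade_S rp_add hpart_add intro!: exI[of _ "\<zero>\<^bsub>S\<^esub>"])

abbreviation "mm \<equiv> {X \<in> carrier S. lookup (rp X) 0 = 0}"

lemma ideal_mm: "ideal mm S"
proof (rule idealI)
  show "subgroup mm (add_monoid S)"
  proof (rule add.subgroupI)
    fix X assume "X \<in> mm"
    then show "\<ominus>\<^bsub>S\<^esub> X \<in> mm"
      by (auto elim!: S_cases simp: cl_uminus rp_cl polys_closed res_uminus)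
  qed (auto simp: rp_add lookup_add intro!: exI[of _ "\<zero>\<^bsub>S\<^esub>"])
qed (auto simp: rp_mult lookup_res lookup_times_zero ring_axioms)

lemma graded_max_eq: "graded_max S = mm"
proof
  show "graded_max S \<subseteq> mm"
    unfolding graded_max_def
    by (rule genideal_minimal[OF ideal_mm]) (auto simp: rgrade_S, metis hpart_id_iff in_keys_iff less_irrefl mdeg_zero of_nat_0)
  have sub: "(\<Union>d\<in>{0<..}. rgrade S d) \<subseteq> carrier S" by (auto simp: rgrade_S)
  interpret M: ideal "graded_max S" S
    unfolding graded_max_def by (rule genideal_ideal[OF sub])
  show "mm \<subseteq> graded_max S"
  proof
    fix X assume X: "X \<in> mm"
    let ?A = "(\<lambda>m. int (mdeg m)) ` keys (rp X)"
    have "hc j X \<in> graded_max S" if "j \<in> ?A" for j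
    proof -
      have "j > 0" using that X by (auto simp: in_keys_iff intro!: Nat.gr0I)
      then show ?thesis using hc_rgrade[of X j] X genideal_self[OF sub] unfolding graded_max_def by blast
    qed
    then have "(\<Oplus>\<^bsub>S\<^esub>j\<in>A. hc j X) \<in> graded_max S" if "A \<subseteq> ?A" for A
    proof -
      have "finite A" using that by (rule finite_subset) auto
      then show ?thesis using that
        by (induction A) (use \<open>\<And>j. j \<in> ?A \<Longrightarrow> _\<close> X in \<open>auto intro!: M.a_closed\<close>)
    qed
    from this[of ?A] show "X \<in> graded_max S" using hc_finsum[of X ?A] X by simp
  qed
qed

text \<open>An element outside \<open>mm\<close> differs from a nonzero constant by an element of
  \<open>mm\<close>, so an ideal containing both contains a unit.\<close>

lemma mm_maximal:
  assumes "ideal I S" "mm \<subseteq> I"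
  shows "I = mm \<or> I = carrier S"
proof (cases "I \<subseteq> mm")
  case False
  interpret I: ideal I S by fact
  obtain X where X: "X \<in> I" "X \<notin> mm" using False by blast
  then have XS: "X \<in> carrier S" using I.a_subset by auto
  define c where "c = lookup (rp X) 0"
  have c: "c \<noteq> 0" using X XS by (auto simp: c_def)
  let ?Y = "cl (single 0 c - rp X)"
  have P: "single 0 c \<in> P" "rp X \<in> P" using XS by (auto simp: rp_P polys_closed)
  have "?Y \<in> mm"
    using P by (auto simp: rp_cl polys_closed res_diff lookup_minus lookup_res empty_face c_def)
  then have "?Y \<oplus>\<^bsub>S\<^esub> X \<in> I" using X assms(2) by auto
  also have "?Y \<oplus>\<^bsub>S\<^esub> X = cl (single 0 c)"
    using P cl_add[of "single 0 c - rp X" "rp X"] by (simp add: polys_closed cl_rp XS)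
  finally have "cl (single 0 (inverse c)) \<otimes>\<^bsub>S\<^esub> cl (single 0 c) \<in> I"
    by (rule I.I_l_closed) (auto simp: polys_closed)
  then have "\<one>\<^bsub>S\<^esub> \<in> I" using c by (simp add: cl_mult polys_closed mult_single S_one)
  then show ?thesis using I.one_imp_carrier by blast
qed (use assms in auto)

subsection \<open>The ring as a graded module over itself\<close>

lemma regular_simps [simp]:
  "carrier (regular_module S) = carrier S" "add (regular_module S) = add S"
  "zero (regular_module S) = zero S" "smult (regular_module S) = mult S"
  "mgrade (regular_module S) = rgrade S"
  by (auto simp: regular_module_def)

end

subsection \<open>Krull dimension\<close>

text \<open>A prime ideal of a subring \<open>C\<close>, phrased in a type class ring: chains of
  primes in the quotient are pulled back to polynomials, where relations can be computed.\<close>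

definition prime_in :: "'a::comm_ring_1 set \<Rightarrow> 'a set \<Rightarrow> bool" where
  "prime_in C Q \<longleftrightarrow> Q \<subseteq> C \<and> 1 \<notin> Q \<and> (\<forall>x\<in>Q. \<forall>y\<in>Q. x - y \<in> Q) \<and>
     (\<forall>x\<in>C. \<forall>y\<in>Q. x * y \<in> Q) \<and> (\<forall>x\<in>C. \<forall>y\<in>C. x * y \<in> Q \<longrightarrow> x \<in> Q \<or> y \<in> Q)"

text \<open>The recursion splits off \<open>a 0\<close> and shifts the remaining elements, as the
  induction does when it passes to the chain without its bottom prime.\<close>

fun power_product :: "(nat \<Rightarrow> 'a::comm_ring_1) \<Rightarrow> nat list \<Rightarrow> 'a" where
  "power_product a [] = 1"
| "power_product a (e # es) = a 0 ^ e * power_product (\<lambda>i. a (Suc i)) es"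

text \<open>An algebraic relation between the \<open>a i\<close> cannot lie in the bottom prime: its terms with the
  lexicographically smallest exponent survive in all members of the chain.\<close>

lemma prime_chain_no_relation:
  fixes C :: "'a::comm_ring_1 set"
  assumes C: "1 \<in> C" "\<And>x y. x \<in> C \<Longrightarrow> y \<in> C \<Longrightarrow> x + y \<in> C" "0 \<in> C"
      "\<And>x y. x \<in> C \<Longrightarrow> y \<in> C \<Longrightarrow> x * y \<in> C"
    and "\<And>i. i \<le> l \<Longrightarrow> prime_in C (Q i)"
    and "\<And>i. i < l \<Longrightarrow> Q i \<subseteq> Q (Suc i)"
    and "\<And>i. i < l \<Longrightarrow> a i \<in> Q (Suc i) - Q i"
    and "finite X" "X \<noteq> {}" "\<And>es. es \<in> X \<Longrightarrow> length es = l"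
    and "\<And>es i. es \<in> X \<Longrightarrow> i \<le> l \<Longrightarrow> q es \<in> C - Q i"
  shows "(\<Sum>es\<in>X. q es * power_product a es) \<notin> Q 0"
  using assms(5-)
proof (induction l arbitrary: Q a X q)
  case 0
  then have "X = {[]}" by auto
  then show ?case using 0(7) by auto
next
  case (Suc l)
  let ?a' = "\<lambda>i. a (Suc i)"
  have pr: "prime_in C (Q 0)" "prime_in C (Q 1)" using Suc(2)[of 0] Suc(2)[of 1] by auto
  have a0: "a 0 \<in> Q 1" "a 0 \<notin> Q 0" using Suc(4)[of 0] by auto
  have aC: "a i \<in> C" if "i < Suc l" for i
    using Suc(4)[OF that] Suc(2)[of "Suc i"] that by (auto simp: prime_in_def)
  have powC: "x ^ n \<in> C" if "x \<in> C" for x n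
    by (induction n) (use that C in auto)
  have ppC: "power_product b es \<in> C" if "\<And>i. i < length es \<Longrightarrow> b i \<in> C" for b es
    using that
  proof (induction es arbitrary: b)
    case (Cons e es)
    have "b 0 ^ e \<in> C" using Cons(2)[of 0] by (auto intro: powC)
    moreover have "power_product (\<lambda>i. b (Suc i)) es \<in> C"
      by (rule Cons(1)) (use Cons(2) in auto)
    ultimately show ?case using C by simp
  qed (use C in simp)
  have sumC: "(\<Sum>i\<in>A. f i) \<in> C" if "\<And>i. i \<in> A \<Longrightarrow> f i \<in> C" for A and f :: "nat list \<Rightarrow> 'a"
    using that by (induction A rule: infinite_finite_induct) (auto intro: C)
  \<comment> \<open>Split by the exponent of \<open>a 0\<close>: the terms with the smallest
    exponent give \<open>a 0 ^ \<mu> * u\<close>, and all others contain at least one more factor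
    \<open>a 0\<close>.\<close>
  define \<mu> where "\<mu> = Min (hd ` X)"
  define Y where "Y = {es. \<mu> # es \<in> X}"
  define Z where "Z = {es \<in> X. hd es \<noteq> \<mu>}"
  have shape: "es = hd es # tl es" if "es \<in> X" for es
    using Suc(7)[OF that] by (cases es) auto
  have ne: "hd ` X \<noteq> {}" "finite (hd ` X)" using Suc(5,6) by auto
  have \<mu>: "\<mu> \<le> hd es" if "es \<in> X" for es
    unfolding \<mu>_def using that ne by auto
  have X: "X = (#) \<mu> ` Y \<union> Z" "(#) \<mu> ` Y \<inter> Z = {}"
  proof -
    show "X = (#) \<mu> ` Y \<union> Z"
    proof (intro equalityI subsetI)
      fix es assume es: "es \<in> X"
      show "es \<in> (#) \<mu> ` Y \<union> Z"
      proof (cases "hd es = \<mu>")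
        case True
        then have "es = \<mu> # tl es" using shape[OF es] by simp
        then show ?thesis using es unfolding Y_def by (metis UnI1 imageI mem_Collect_eq)
      qed (use es in \<open>simp add: Z_def\<close>)
    qed (auto simp: Y_def Z_def)
  qed (auto simp: Z_def)
  have fin: "finite Y" "finite Z"
    using Suc(5) X(1) by (auto simp: finite_image_iff dest!: sym[of X])
  have Yne: "Y \<noteq> {}"
  proof -
    have "\<mu> \<in> hd ` X" unfolding \<mu>_def using ne by (intro Min_in)
    then obtain es where "es \<in> X" "hd es = \<mu>" by auto
    then show ?thesis using shape[of es] unfolding Y_def by (metis empty_iff mem_Collect_eq)
  qed
  define u where "u = (\<Sum>es\<in>Y. q (\<mu> # es) * power_product ?a' es)"
  define w where "w = (\<Sum>es\<in>Z. q es * (a 0 ^ (hd es - \<mu> - 1) * power_product ?a' (tl es)))"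
  have Zterm: "q es * power_product a es = a 0 ^ \<mu> * (a 0 * (q es * (a 0 ^ (hd es - \<mu> - 1) * power_product ?a' (tl es))))"
    if "es \<in> Z" for es
  proof -
    have es: "es \<in> X" "hd es > \<mu>" using that \<mu>[of es] by (auto simp: Z_def)
    then have "a 0 ^ hd es = a 0 ^ \<mu> * (a 0 * a 0 ^ (hd es - \<mu> - 1))"
      by (metis (no_types, lifting) Suc_diff_Suc diff_Suc_1 le_add_diff_inverse less_or_eq_imp_le power_Suc power_add diff_Suc_eq_diff_pred diff_commute)
    then show ?thesis by (subst shape[OF es(1)]) (simp add: mult_ac)
  qed
  have "(\<Sum>es\<in>X. q es * power_product a es) =
     (\<Sum>es\<in>(#) \<mu> ` Y. q es * power_product a es) + (\<Sum>es\<in>Z. q es * power_product a es)"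
    by (subst X(1), subst sum.union_disjoint) (use X fin in auto)
  also have "(\<Sum>es\<in>(#) \<mu> ` Y. q es * power_product a es) = a 0 ^ \<mu> * u"
    unfolding u_def sum_distrib_left by (subst sum.reindex) (auto simp: mult_ac)
  also have "(\<Sum>es\<in>Z. q es * power_product a es) = a 0 ^ \<mu> * (a 0 * w)"
    unfolding w_def sum_distrib_left by (rule sum.cong) (auto simp: Zterm)
  finally have eq: "(\<Sum>es\<in>X. q es * power_product a es) = a 0 ^ \<mu> * (u + a 0 * w)"
    by (simp add: algebra_simps)
  have qC: "q es \<in> C" if "es \<in> X" for es using Suc(8)[OF that, of 0] by auto
  have uC: "u \<in> C" unfolding u_def
    by (intro sumC C(4) qC ppC aC) (auto simp: Y_def dest: Suc(7))
  have wC: "w \<in> C" unfolding w_def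
    by (intro sumC C(4) qC ppC aC powC) (auto simp: Z_def dest: Suc(7))
  have u: "u \<notin> Q 1"
    unfolding u_def One_nat_def
  proof (rule Suc.IH[of "\<lambda>i. Q (Suc i)" ?a' Y "\<lambda>es. q (\<mu> # es)"])
    show "length es = l" if "es \<in> Y" for es
      using Suc(7)[of "\<mu> # es"] that by (simp add: Y_def)
    show "q (\<mu> # es) \<in> C - Q (Suc i)" if "es \<in> Y" "i \<le> l" for es i
      using Suc(8)[of "\<mu> # es" "Suc i"] that by (simp add: Y_def)
  qed (use Suc.prems fin Yne in auto)
  \<comment> \<open>Since \<open>a 0\<close> is not in \<open>Q 0\<close>, its power can be
    cancelled from a relation in \<open>Q 0\<close>; since \<open>a 0\<close> lies in
    \<open>Q 1\<close>, reducing the rest modulo \<open>Q 1\<close> leaves \<open>u\<close>, which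
    the induction hypothesis forbids.\<close>
  show ?case
  proof
    assume "(\<Sum>es\<in>X. q es * power_product a es) \<in> Q 0"
    then have *: "a 0 ^ \<mu> * (u + a 0 * w) \<in> Q 0" by (simp only: eq)
    have "a 0 ^ n \<notin> Q 0" for n
      by (induction n) (use pr(1) a0(2) aC[of 0] powC in \<open>auto simp: prime_in_def\<close>)
    moreover have "a 0 ^ \<mu> \<in> C" "u + a 0 * w \<in> C"
      using uC wC aC[of 0] powC C by auto
    ultimately have "u + a 0 * w \<in> Q 0"
      using * pr(1) unfolding prime_in_def by blast
    then have "u + a 0 * w \<in> Q 1" using Suc(3)[of 0] by auto
    moreover have "a 0 * w \<in> Q 1" using pr(2) a0(1) wC by (auto simp: prime_in_def mult.commute)
    ultimately have "u + a 0 * w - a 0 * w \<in> Q 1" using pr(2) unfolding prime_in_def by blast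
    then show False using u by simp
  qed
qed

lemma vector_space_mpoly: "vector_space (\<lambda>c p. single 0 c * p :: ('v, 'k::field) mpoly)"
  by unfold_locales (auto simp: algebra_simps single_add mult_single simp flip: mult.assoc)

lemma res_const_times: "res X (single 0 c * p) = single 0 c * res X p"
  for p :: "('v, 'k::field) mpoly"
  by (rule poly_mapping_eqI) (simp add: lookup_res lookup_const_times)

text \<open>The bound is crude, but linear in the largest exponent \<open>M\<close>, and that is all
  the counting argument requires.\<close>

lemma mdeg_power_product:
  fixes a :: "nat \<Rightarrow> ('v, 'k::field) mpoly"
  assumes "\<And>i m. i < length es \<Longrightarrow> m \<in> keys (a i) \<Longrightarrow> mdeg m \<le> b"
    and "\<And>e. e \<in> set es \<Longrightarrow> e \<le> M" and "m \<in> keys (power_product a es)"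
  shows "mdeg m \<le> b * length es * M"
  using assms
proof (induction es arbitrary: a m)
  case (Cons e es)
  have pw: "mdeg m \<le> b * n" if "m \<in> keys (a 0 ^ n)" for m n
    using that
  proof (induction n arbitrary: m)
    case (Suc n)
    then obtain x y where "m = x + y" "x \<in> keys (a 0)" "y \<in> keys (a 0 ^ n)"
      by (auto elim: keys_times_mpoly)
    then show ?case using Suc(1)[of y] Cons.prems(1)[of 0 x] by (simp add: mdeg_add)
  qed simp
  obtain x y where m: "m = x + y" "x \<in> keys (a 0 ^ e)" "y \<in> keys (power_product (\<lambda>i. a (Suc i)) es)"
    using Cons.prems(3) by (auto elim: keys_times_mpoly)
  have "mdeg y \<le> b * length es * M"
    using m(3) Cons.prems by (intro Cons.IH[of "\<lambda>i. a (Suc i)"]) auto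
  moreover have "mdeg x \<le> b * M"
    using pw[OF m(2)] Cons.prems(2)[of e] by (meson le_trans list.set_intros(1) mult_le_mono2)
  ultimately show ?case using m(1) by (simp add: mdeg_add algebra_simps)
qed simp

context SR
begin

section \<open>Faces of maximal size and the growth of face monomials\<close>

abbreviation "dd \<equiv> Max (card ` \<Delta>)"

definition "topf = {F \<in> \<Delta>. card F = dd}"

lemma card_face: "F \<in> \<Delta> \<Longrightarrow> card F \<le> dd"
  using finite_complex by auto

lemma top_nonempty: "topf \<noteq> {}"
proof -
  have "dd \<in> card ` \<Delta>" using finite_complex empty_face by (intro Max_in) auto
  then show ?thesis by (auto simp: topf_def)
qed

lemma finite_top: "finite topf"
  using finite_complex by (auto simp: topf_def)

lemma top_face: "F \<in> topf \<Longrightarrow> F \<in> \<Delta>"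
  by (simp add: topf_def)

lemma top_maximal: "F \<in> topf \<Longrightarrow> G \<in> \<Delta> \<Longrightarrow> F \<subseteq> G \<Longrightarrow> G = F"
  using card_face[of G] finite_face[of G] card_subset_eq[of G F] card_mono[of G F] by (auto simp: topf_def)

lemma dd_pos: "dd > 0"
proof -
  obtain v where "v \<in> V" using V_nonempty by blast
  then show ?thesis using card_face[OF vertex_face, of v] by simp
qed

lemma cdim_eq: "cdim \<Delta> = int dd - 1"
proof -
  have "Max ((\<lambda>n. int n - 1) ` (card ` \<Delta>)) = (\<lambda>n. int n - 1) dd"
    using finite_complex empty_face by (intro mono_Max_commute[symmetric]) (auto simp: mono_def)
  then show ?thesis by (simp add: cdim_def image_image)
qed

definition face_monomials :: "nat \<Rightarrow> ('v \<Rightarrow>\<^sub>0 nat) set" where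
  "face_monomials N = {m. keys m \<in> \<Delta> \<and> (\<forall>v. lookup m v \<le> N)}"

text \<open>A face monomial is given by its support and at most \<open>dd\<close> exponents on it,
  so the count is of order \<open>N ^ dd\<close>.\<close>

lemma face_monomials_bound:
  "finite (face_monomials N)" "card (face_monomials N) \<le> card \<Delta> * (N + 1) ^ dd"
proof -
  let ?f = "\<lambda>F g. mprod g F"
  have sub: "face_monomials N \<subseteq> (\<Union>F\<in>\<Delta>. ?f F ` (\<Pi>\<^sub>E v\<in>F. {..N}))"
  proof
    fix m assume m: "m \<in> face_monomials N"
    let ?F = "keys m"
    have "m = mprod (restrict (lookup m) ?F) ?F"
      by (rule poly_mapping_eqI) (auto simp: lookup_mprod in_keys_iff)
    moreover have "restrict (lookup m) ?F \<in> (\<Pi>\<^sub>E v\<in>?F. {..N})"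
      using m by (auto simp: face_monomials_def)
    ultimately show "m \<in> (\<Union>F\<in>\<Delta>. ?f F ` (\<Pi>\<^sub>E v\<in>F. {..N}))"
      using m unfolding face_monomials_def by blast
  qed
  have fin: "finite (\<Union>F\<in>\<Delta>. ?f F ` (\<Pi>\<^sub>E v\<in>F. {..N}))"
    using finite_complex finite_face by (auto intro!: finite_PiE)
  show "finite (face_monomials N)" using sub fin by (rule finite_subset)
  have "card (face_monomials N) \<le> card (\<Union>F\<in>\<Delta>. ?f F ` (\<Pi>\<^sub>E v\<in>F. {..N}))"
    using sub fin by (rule card_mono[rotated])
  also have "\<dots> \<le> (\<Sum>F\<in>\<Delta>. card (?f F ` (\<Pi>\<^sub>E v\<in>F. {..N})))"
    by (rule card_UN_le[OF finite_complex])
  also have "\<dots> \<le> (\<Sum>F\<in>\<Delta>. (N + 1) ^ dd)"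
  proof (rule sum_mono)
    fix F assume F: "F \<in> \<Delta>"
    have "card (?f F ` (\<Pi>\<^sub>E v\<in>F. {..N})) \<le> card (\<Pi>\<^sub>E v\<in>F. {..N})"
      using finite_face[OF F] by (intro card_image_le finite_PiE) auto
    also have "\<dots> = (N + 1) ^ card F"
      using finite_face[OF F] by (simp add: card_PiE)
    also have "\<dots> \<le> (N + 1) ^ dd"
      using card_face[OF F] by (intro power_increasing) auto
    finally show "card (?f F ` (\<Pi>\<^sub>E v\<in>F. {..N})) \<le> (N + 1) ^ dd" .
  qed
  finally show "card (face_monomials N) \<le> card \<Delta> * (N + 1) ^ dd" by simp
qed

text \<open>Monomials in \<open>l > dd\<close> elements grow faster in number than the face monomials of the same degree.\<close>

lemma algebraic_relation:
  fixes a :: "nat \<Rightarrow> ('v, 'k) mpoly"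
  assumes "l > dd"
  obtains X c where "finite X" "X \<noteq> {}" "\<And>es. es \<in> X \<Longrightarrow> length es = l \<and> c es \<noteq> 0"
    "res \<Delta> (\<Sum>es\<in>X. single 0 (c es) * power_product a es) = 0"
proof -
  interpret vector_space "\<lambda>c p. single 0 c * p :: ('v, 'k) mpoly" by (rule vector_space_mpoly)
  define b where "b = Max (insert 0 (\<Union>i<l. mdeg ` keys (a i)))"
  have b: "mdeg m \<le> b" if "i < l" "m \<in> keys (a i)" for i m
    unfolding b_def using that by (intro Max_ge) auto
  \<comment> \<open>There are \<open>M ^ l\<close> products with exponents below \<open>M\<close>,
    of degree at most \<open>N\<close>, and \<open>N + 1\<close> is at most
    \<open>(b * l + 1) * M\<close>. With this \<open>M\<close>, already \<open>M ^ (dd + 1)\<close>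
    exceeds the number of face monomials with exponents up to \<open>N\<close>.\<close>
  define M where "M = card \<Delta> * (b * l + 1) ^ dd + 1"
  define N where "N = b * l * M"
  define E where "E = {es. set es \<subseteq> {..<M} \<and> length es = l}"
  have E: "finite E" "card E = M ^ l"
    using finite_lists_length_eq[of "{..<M}" l] card_lists_length_eq[of "{..<M}" l] by (auto simp: E_def)
  define f where "f = (\<lambda>es. res \<Delta> (power_product a es))"
  define B where "B = (\<lambda>m. single m (1::'k)) ` face_monomials N"
  have "card \<Delta> * (N + 1) ^ dd \<le> card \<Delta> * ((b * l + 1) * M) ^ dd"
    by (intro mult_le_mono power_mono) (auto simp: N_def M_def)
  also have "\<dots> = (card \<Delta> * (b * l + 1) ^ dd) * M ^ dd"
    by (simp only: power_mult_distrib mult.assoc)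
  also have "\<dots> < M * M ^ dd"
    by (rule mult_strict_right_mono) (auto simp: M_def)
  also have "\<dots> = M ^ Suc dd" by simp
  also have "\<dots> \<le> M ^ l"
    using assms by (intro power_increasing) (auto simp: M_def)
  finally have small: "card B < M ^ l"
    using face_monomials_bound[of N] card_image_le[of "face_monomials N" "\<lambda>m. single m (1::'k)"]
    by (simp add: B_def)
  have fB: "finite B" using face_monomials_bound(1) by (simp add: B_def)
  have span: "f es \<in> span B" if es: "es \<in> E" for es
  proof -
    have *: "m \<in> face_monomials N" if "m \<in> keys (f es)" for m
    proof -
      have m: "m \<in> keys (power_product a es)" "keys m \<in> \<Delta>" using that by (auto simp: f_def keys_res)
      have "mdeg m \<le> b * length es * M"
        by (rule mdeg_power_product[OF _ _ m(1)]) (use es b in \<open>auto simp: E_def subset_iff less_imp_le\<close>)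
      then have "lookup m v \<le> N" for v
        using lookup_le_mdeg[of m v] es by (simp add: N_def E_def)
      then show ?thesis using m(2) by (simp add: face_monomials_def)
    qed
    have "f es = (\<Sum>m\<in>keys (f es). single 0 (lookup (f es) m) * single m 1)"
      by (simp add: mult_single flip: mpoly_decompose)
    also have "\<dots> \<in> span B"
      by (intro span_sum span_scale span_base) (auto simp: B_def *)
    finally show ?thesis .
  qed
  \<comment> \<open>Two products with the same normal form are themselves a relation. Otherwise
    there are more normal forms than elements of the spanning set \<open>B\<close>, so they are
    linearly dependent.\<close>
  show ?thesis
  proof (cases "inj_on f E")
    case False
    then obtain x y where xy: "x \<in> E" "y \<in> E" "x \<noteq> y" "f x = f y" by (auto simp: inj_on_def)
    show ?thesis
    proof (rule that[of "{x, y}" "\<lambda>es. if es = x then 1 else -1"])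
      show "res \<Delta> (\<Sum>es\<in>{x, y}. single 0 (if es = x then 1 else - 1) * power_product a es) = 0"
        using xy by (simp add: f_def res_diff res_add res_const_times single_uminus)
    qed (use xy in \<open>auto simp: E_def\<close>)
  next
    case True
    then have "card (f ` E) > card B" using E small by (simp add: card_image)
    moreover have "f ` E \<subseteq> span B" using span by auto
    ultimately have "dependent (f ` E)"
      using independent_span_bound[OF fB, of "f ` E"] by force
    then obtain t u where t: "finite t" "t \<subseteq> f ` E" "(\<Sum>v\<in>t. single 0 (u v) * v) = 0" "\<exists>v\<in>t. u v \<noteq> 0"
      unfolding dependent_explicit by blast
    define X where "X = {es \<in> E. f es \<in> t \<and> u (f es) \<noteq> 0}"
    have X: "f ` X = {v \<in> t. u v \<noteq> 0}" using t(2) by (auto simp: X_def)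
    have "finite X" using E(1) by (rule finite_subset[rotated]) (auto simp: X_def)
    show ?thesis
    proof (rule that[of X "\<lambda>es. u (f es)"])
      show "X \<noteq> {}" using X t(4) by auto
      show "\<And>es. es \<in> X \<Longrightarrow> length es = l \<and> u (f es) \<noteq> 0" by (simp add: X_def E_def)
      have "res \<Delta> (\<Sum>es\<in>X. single 0 (u (f es)) * power_product a es) = (\<Sum>es\<in>X. single 0 (u (f es)) * f es)"
        by (simp add: res_sum res_const_times f_def)
      also have "\<dots> = (\<Sum>v\<in>f ` X. single 0 (u v) * v)"
        using True by (subst sum.reindex) (auto simp: X_def inj_on_def)
      also have "\<dots> = (\<Sum>v\<in>t. single 0 (u v) * v)"
        unfolding X using t(1) by (intro sum.mono_neutral_left) auto
      finally show "res \<Delta> (\<Sum>es\<in>X. single 0 (u (f es)) * power_product a es) = 0"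
        using t(3) by simp
    qed fact
  qed
qed

text \<open>Choose one element in each step of the chain. More than \<open>dd\<close> of them
  satisfy an algebraic relation modulo the Stanley--Reisner ideal, so the relation lies in the
  bottom prime, against \<open>prime_chain_no_relation\<close>.\<close>

lemma prime_chain_length:
  assumes "\<And>i. i \<le> l \<Longrightarrow> primeideal (p i) S" "\<And>i. i < l \<Longrightarrow> p i \<subset> p (Suc i)"
  shows "l \<le> dd"
proof (rule ccontr)
  assume "\<not> l \<le> dd"
  define Q where "Q = (\<lambda>i. {x \<in> P. cl x \<in> p i})"
  have pr: "prime_in P (Q i)" if "i \<le> l" for i
  proof -
    interpret primeideal "p i" S by (rule assms(1)[OF that])
    have sub: "x - y \<in> Q i" if "x \<in> Q i" "y \<in> Q i" for x y
    proof -
      have "cl x \<oplus>\<^bsub>S\<^esub> (\<ominus>\<^bsub>S\<^esub> cl y) \<in> p i" using that by (auto simp: Q_def)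
      then show ?thesis using that by (simp add: Q_def cl_uminus cl_add polys_closed)
    qed
    have "1 \<notin> Q i" using I_notcarr one_imp_carrier by (auto simp: Q_def S_one)
    moreover have "x * y \<in> Q i" if "x \<in> P" "y \<in> Q i" for x y
      using that I_l_closed[of "cl y" "cl x"] by (auto simp: Q_def cl_mult polys_closed)
    moreover have "x \<in> Q i \<or> y \<in> Q i" if "x \<in> P" "y \<in> P" "x * y \<in> Q i" for x y
      using that I_prime[of "cl x" "cl y"] by (auto simp: Q_def cl_mult)
    ultimately show ?thesis using sub unfolding prime_in_def by (auto simp: Q_def)
  qed
  have "\<exists>a. a \<in> Q (Suc i) - Q i" if "i < l" for i
  proof -
    have "p i \<subset> p (Suc i)" using that by (rule assms(2))
    then obtain X where X: "X \<in> p (Suc i)" "X \<notin> p i" by blast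
    interpret primeideal "p (Suc i)" S using assms(1)[of "Suc i"] that by simp
    show ?thesis using X a_subset by (intro exI[of _ "rp X"]) (auto simp: Q_def rp_P cl_rp)
  qed
  then have "\<forall>i. \<exists>a. i < l \<longrightarrow> a \<in> Q (Suc i) - Q i" by blast
  from choice[OF this] obtain a where a: "\<And>i. i < l \<Longrightarrow> a i \<in> Q (Suc i) - Q i" by blast
  have "l > dd" using \<open>\<not> l \<le> dd\<close> by simp
  then obtain X c where X: "finite X" "X \<noteq> {}" "\<And>es. es \<in> X \<Longrightarrow> length es = l \<and> c es \<noteq> 0"
    "res \<Delta> (\<Sum>es\<in>X. single 0 (c es) * power_product a es) = 0" by (rule algebraic_relation[of l a]) blast
  \<comment> \<open>The coefficients of the relation are nonzero constants, hence units, and so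
    avoid every prime of the chain.\<close>
  have unit: "single 0 d \<in> P - Q i" if "i \<le> l" "d \<noteq> 0" for d i
  proof -
    have "single 0 (inverse d) * single 0 d = (1::('v, 'k) mpoly)"
      using that(2) by (simp add: mult_single)
    then have "single 0 d \<notin> Q i"
      using pr[OF that(1)] polys_single[of 0 V "inverse d"] unfolding prime_in_def by force
    then show ?thesis by (simp add: polys_single)
  qed
  have "(\<Sum>es\<in>X. single 0 (c es) * power_product a es) \<notin> Q 0"
    by (rule prime_chain_no_relation[of P l Q])
      (use pr a X unit assms(2) in \<open>auto simp: polys_closed Q_def dest: psubsetD[OF assms(2)]\<close>)
  moreover have "(\<Sum>es\<in>X. single 0 (c es) * power_product a es) \<in> Q 0"
  proof -
    have aP: "a i \<in> P" if "i < l" for i using a[OF that] by (auto simp: Q_def)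
    have pp: "power_product b es \<in> P" if "\<And>i. i < length es \<Longrightarrow> b i \<in> P" for b es
      using that
    proof (induction es arbitrary: b)
      case (Cons e es)
      have "power_product (\<lambda>i. b (Suc i)) es \<in> P" by (rule Cons.IH) (use Cons.prems in auto)
      then show ?case using Cons.prems[of 0] by (simp add: polys_closed)
    qed simp
    have P: "(\<Sum>es\<in>X. single 0 (c es) * power_product a es) \<in> P"
      using X(3) aP by (intro polys_sum polys_times pp polys_single) auto
    interpret primeideal "p 0" S by (rule assms(1)) simp
    show ?thesis using cl_zero_iff[OF P] X(4) P zero_closed unfolding Q_def by simp
  qed
  ultimately show False by simp
qed

text \<open>The kernel of the projection to the polynomial ring on \<open>G\<close>, that is, the
  prime generated by the variables outside \<open>G\<close>.\<close>

definition face_prime :: "'v set \<Rightarrow> ('v, 'k) mpoly set set" where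
  "face_prime G = {X \<in> carrier S. res (Pow G) (rp X) = 0}"

lemma res_face: "G \<in> \<Delta> \<Longrightarrow> res (Pow G) (res \<Delta> p) = res (Pow G) p"
  using face_mono by (auto simp: res_res intro: arg_cong[of _ _ "\<lambda>X. res X p"])

lemma rp_face_mult:
  "G \<in> \<Delta> \<Longrightarrow> X \<in> carrier S \<Longrightarrow> Y \<in> carrier S \<Longrightarrow>
    res (Pow G) (rp (X \<otimes>\<^bsub>S\<^esub> Y)) = res (Pow G) (rp X) * res (Pow G) (rp Y)"
  by (simp add: rp_mult res_face res_Pow_times)

lemma face_prime_prime:
  assumes "G \<in> \<Delta>"
  shows "primeideal (face_prime G) S"
proof (rule primeidealI)
  show "ideal (face_prime G) S"
  proof (rule idealI)
    show "subgroup (face_prime G) (add_monoid S)"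
    proof (rule add.subgroupI)
      fix X assume "X \<in> face_prime G"
      then show "\<ominus>\<^bsub>S\<^esub> X \<in> face_prime G"
        using assms by (auto elim!: S_cases simp: face_prime_def cl_uminus rp_cl polys_closed res_uminus res_face)
    qed (auto simp: face_prime_def rp_add res_add intro!: exI[of _ "\<zero>\<^bsub>S\<^esub>"])
  qed (use assms in \<open>auto simp: face_prime_def rp_face_mult ring_axioms\<close>)
  have "\<one>\<^bsub>S\<^esub> \<notin> face_prime G" by (simp add: face_prime_def res_one)
  then show "carrier S \<noteq> face_prime G" by auto
qed (use assms in \<open>auto simp: face_prime_def rp_face_mult is_cring\<close>)

text \<open>For the lower bound, dropping the vertices of a largest face one at a time makes the
  primes of the remaining faces grow strictly, \<open>dd\<close> times.\<close>

lemma krull_dim_S: "krull_dim S = enat dd"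
proof (rule antisym)
  show "krull_dim S \<le> enat dd"
    unfolding krull_dim_def
  proof (rule Sup_least, safe)
    fix l P assume "\<forall>i\<le>l. primeideal (P i) S" "\<forall>i<l. P i \<subset> P (Suc i)"
    then have "l \<le> dd" using prime_chain_length[of l P] by blast
    then show "enat l \<le> enat dd" by simp
  qed
  obtain F where F: "F \<in> \<Delta>" "card F = dd" using top_nonempty by (auto simp: topf_def)
  obtain xs where xs: "set xs = F" "distinct xs" using finite_distinct_list[OF finite_face[OF F(1)]] by blast
  then have len: "length xs = dd" using F distinct_card by metis
  let ?G = "\<lambda>i. set (drop i xs)"
  have G: "?G i \<in> \<Delta>" for i using face_mono[OF F(1), of "?G i"] xs(1) set_drop_subset by metis
  have "face_prime (?G i) \<subset> face_prime (?G (Suc i))" if i: "i < dd" for i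
  proof -
    have drop: "drop i xs = xs ! i # drop (Suc i) xs" using i len by (simp add: Cons_nth_drop_Suc)
    have notin: "xs ! i \<notin> ?G (Suc i)" using xs(2) drop by (metis distinct.simps(2) distinct_drop)
    have sub: "Pow (?G (Suc i)) \<inter> Pow (?G i) = Pow (?G (Suc i))" using drop by auto
    have "res (Pow (?G (Suc i))) p = 0" if "res (Pow (?G i)) p = 0" for p :: "('v, 'k) mpoly"
      using res_res[of "Pow (?G (Suc i))" "Pow (?G i)" p] sub that by simp
    then have "face_prime (?G i) \<subseteq> face_prime (?G (Suc i))"
      unfolding face_prime_def by blast
    moreover have "xs ! i \<in> V" using i len xs F by (auto intro!: bexI[of _ F])
    then have "cl (pvar (xs ! i)) \<in> face_prime (?G (Suc i))" "cl (pvar (xs ! i)) \<notin> face_prime (?G i)"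
      using notin drop G
      by (auto simp: face_prime_def rp_cl polys_closed res_face pvar_def res_single single_eq_0_iff vertex_face)
    ultimately show ?thesis by blast
  qed
  then show "enat dd \<le> krull_dim S"
    unfolding krull_dim_def
    by (intro Sup_upper CollectI exI[of _ dd] conjI exI[of _ "\<lambda>i. face_prime (?G i)"] refl)
      (auto simp: face_prime_prime G)
qed

end

subsection \<open>Submodules, quotients and homogeneous components\<close>

lemma sub_module_simps [simp]:
  "carrier (sub_module M N) = N" "add (sub_module M N) = add M" "zero (sub_module M N) = zero M"
  "smult (sub_module M N) = smult M" "mgrade (sub_module M N) d = mgrade M d \<inter> N"
  by (auto simp: sub_module_def)

lemma quot_module_simps [simp]:
  "carrier (quot_module M N) = a_rcosets\<^bsub>M\<^esub> N" "add (quot_module M N) = set_add M"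
  "zero (quot_module M N) = N" "mgrade (quot_module M N) d = (\<lambda>x. N +>\<^bsub>M\<^esub> x) ` mgrade M d"
  by (auto simp: quot_module_def)

context Module.module
begin

text \<open>The conclusion concerns any record with these operations, because the grading may be
  changed at the same time, as in \<open>shift_sub\<close>.\<close>

lemma sub_module_module:
  assumes "N \<subseteq> carrier M" "\<zero>\<^bsub>M\<^esub> \<in> N" "\<And>x y. x \<in> N \<Longrightarrow> y \<in> N \<Longrightarrow> x \<oplus>\<^bsub>M\<^esub> y \<in> N"
    and "\<And>s x. s \<in> carrier R \<Longrightarrow> x \<in> N \<Longrightarrow> s \<odot>\<^bsub>M\<^esub> x \<in> N"
    and M': "carrier M' = N" "add M' = add M" "zero M' = zero M" "smult M' = smult M"
  shows "Module.module R M'"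
proof -
  have uminus: "\<ominus>\<^bsub>M\<^esub> x \<in> N" if "x \<in> N" for x
  proof -
    have "(\<ominus> \<one>) \<odot>\<^bsub>M\<^esub> x = \<ominus>\<^bsub>M\<^esub> x"
      using smult_l_minus[of \<one> x] that assms(1) by auto
    then show ?thesis using assms(4)[of "\<ominus> \<one>" x] that by auto
  qed
  show ?thesis
  proof (rule moduleI)
    show "abelian_group M'"
    proof (rule abelian_groupI)
      fix x assume "x \<in> carrier M'"
      then show "\<exists>y\<in>carrier M'. y \<oplus>\<^bsub>M'\<^esub> x = \<zero>\<^bsub>M'\<^esub>"
        using assms uminus[of x] by (auto intro!: bexI[of _ "\<ominus>\<^bsub>M\<^esub> x"] simp: M.l_neg subset_iff)
    qed (use assms in \<open>auto simp: M.a_ac subset_iff\<close>)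
  qed (use assms in \<open>auto simp: smult_l_distr smult_r_distr smult_assoc1 subset_iff intro: is_cring\<close>)
qed

lemma additive_subgroupI_module:
  assumes "N \<subseteq> carrier M" "\<zero>\<^bsub>M\<^esub> \<in> N" "\<And>x y. x \<in> N \<Longrightarrow> y \<in> N \<Longrightarrow> x \<oplus>\<^bsub>M\<^esub> y \<in> N"
    and "\<And>s x. s \<in> carrier R \<Longrightarrow> x \<in> N \<Longrightarrow> s \<odot>\<^bsub>M\<^esub> x \<in> N"
  shows "additive_subgroup N M"
proof (rule additive_subgroupI, rule M.add.subgroupI)
  fix x assume x: "x \<in> N"
  have "(\<ominus> \<one>) \<odot>\<^bsub>M\<^esub> x = \<ominus>\<^bsub>M\<^esub> x"
    using smult_l_minus[of \<one> x] x assms(1) by auto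
  then show "\<ominus>\<^bsub>M\<^esub> x \<in> N" using assms(4)[of "\<ominus> \<one>" x] x by auto
qed (use assms in auto)

end

lemma finsum_sub_module:
  assumes "abelian_monoid M" "abelian_monoid M'" "add M' = add M" "zero M' = zero M"
    "carrier M' \<subseteq> carrier M" "f \<in> A \<rightarrow> carrier M'"
  shows "finsum M' f A = finsum M f A"
proof -
  interpret M: abelian_monoid M by fact
  interpret M': abelian_monoid M' by fact
  show ?thesis
  proof (cases "finite A")
    case True
    then show ?thesis using assms(6)
    proof (induction A)
      case (insert x A)
      have "f \<in> A \<rightarrow> carrier M" "f x \<in> carrier M" using insert assms(5) by auto
      then show ?case using insert assms(3,4) by (subst M.finsum_insert) auto
    qed (simp add: assms)
  next
    case False
    then show ?thesis by (simp add: assms M.finsum_infinite M'.finsum_infinite)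
  qed
qed

lemma quot_module_add:
  assumes "abelian_group M" "additive_subgroup N M" "x \<in> carrier M" "y \<in> carrier M"
  shows "(N +>\<^bsub>M\<^esub> x) \<oplus>\<^bsub>quot_module M N\<^esub> (N +>\<^bsub>M\<^esub> y) = N +>\<^bsub>M\<^esub> (x \<oplus>\<^bsub>M\<^esub> y)"
proof -
  interpret abelian_subgroup N M using assms by (intro abelian_subgroupI3)
  show ?thesis using assms by (simp add: a_rcos_sum)
qed

lemma quot_module_carrier: "carrier (quot_module M N) = (\<lambda>x. N +>\<^bsub>M\<^esub> x) ` carrier M"
  by (auto simp: A_RCOSETS_def')

lemma quot_module_zero_iff:
  assumes "abelian_group M" "additive_subgroup N M" "x \<in> carrier M"
  shows "N +>\<^bsub>M\<^esub> x = N \<longleftrightarrow> x \<in> N"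
proof -
  interpret abelian_subgroup N M using assms by (intro abelian_subgroupI3)
  show ?thesis
    using assms a_rcos_self[of x] a_rcos_const by metis
qed

text \<open>The action on a coset is defined as a union over its representatives; stability of
  \<open>N\<close> under \<open>s\<close> makes all the cosets in that union equal.\<close>

lemma quot_module_smult:
  assumes "Module.module R M" "additive_subgroup N M" "s \<in> carrier R" "x \<in> carrier M"
    "\<And>y. y \<in> N \<Longrightarrow> s \<odot>\<^bsub>M\<^esub> y \<in> N"
  shows "s \<odot>\<^bsub>quot_module M N\<^esub> (N +>\<^bsub>M\<^esub> x) = N +>\<^bsub>M\<^esub> (s \<odot>\<^bsub>M\<^esub> x)"
proof -
  interpret Module.module R M by fact
  interpret N: abelian_subgroup N M using assms by (intro abelian_subgroupI3) (auto intro: M.abelian_group_axioms)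
  have *: "N +>\<^bsub>M\<^esub> (s \<odot>\<^bsub>M\<^esub> y) = N +>\<^bsub>M\<^esub> (s \<odot>\<^bsub>M\<^esub> x)" if y: "y \<in> N +>\<^bsub>M\<^esub> x" for y
  proof -
    obtain h where h: "h \<in> N" "y = h \<oplus>\<^bsub>M\<^esub> x" using y by (auto simp: a_r_coset_def')
    then have "s \<odot>\<^bsub>M\<^esub> y = s \<odot>\<^bsub>M\<^esub> h \<oplus>\<^bsub>M\<^esub> s \<odot>\<^bsub>M\<^esub> x" using assms N.a_subset by (auto simp: smult_r_distr)
    then have "s \<odot>\<^bsub>M\<^esub> y \<in> N +>\<^bsub>M\<^esub> (s \<odot>\<^bsub>M\<^esub> x)"
      using assms(5)[OF h(1)] by (auto simp: a_r_coset_def')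
    then show ?thesis using M.a_repr_independence[OF _ _ N.a_subgroup] assms by (metis smult_closed)
  qed
  have "x \<in> N +>\<^bsub>M\<^esub> x" using N.a_rcos_self assms by blast
  then have "(\<Union>y\<in>N +>\<^bsub>M\<^esub> x. N +>\<^bsub>M\<^esub> (s \<odot>\<^bsub>M\<^esub> y)) = N +>\<^bsub>M\<^esub> (s \<odot>\<^bsub>M\<^esub> x)"
    by (intro SUP_eq_const *) auto
  then show ?thesis by (simp add: quot_module_def)
qed

section \<open>Homogeneous components in graded modules\<close>

definition gcomp :: "('a, 'b) gmodule \<Rightarrow> 'b \<Rightarrow> int \<Rightarrow> 'b" where
  "gcomp M x = (THE c. (\<forall>d. c d \<in> mgrade M d) \<and> finite {d. c d \<noteq> \<zero>\<^bsub>M\<^esub>} \<and>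
        x = (\<Oplus>\<^bsub>M\<^esub>d\<in>{d. c d \<noteq> \<zero>\<^bsub>M\<^esub>}. c d))"

locale gr_module =
  fixes R :: "'a gring" and M :: "('a, 'b) gmodule"
  assumes graded: "graded_module R M"
begin

sublocale Module.module R M
  using graded by (simp add: graded_module_def)

lemma mgrade_subgroup: "additive_subgroup (mgrade M d) M"
  using graded by (simp add: graded_module_def)

lemma mgrade_closed: "x \<in> mgrade M d \<Longrightarrow> x \<in> carrier M"
  using additive_subgroup.a_Hcarr[OF mgrade_subgroup] .

lemma mgrade_zero [simp]: "\<zero>\<^bsub>M\<^esub> \<in> mgrade M d"
  using additive_subgroup.zero_closed[OF mgrade_subgroup] .

lemma mgrade_add: "x \<in> mgrade M d \<Longrightarrow> y \<in> mgrade M d \<Longrightarrow> x \<oplus>\<^bsub>M\<^esub> y \<in> mgrade M d"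
  using additive_subgroup.a_closed[OF mgrade_subgroup] .

lemma mgrade_smult: "s \<in> rgrade R i \<Longrightarrow> x \<in> mgrade M j \<Longrightarrow> s \<odot>\<^bsub>M\<^esub> x \<in> mgrade M (i + j)"
  using graded by (simp add: graded_module_def)

lemma gcomp_ex1:
  assumes "x \<in> carrier M"
  shows "\<exists>!c. (\<forall>d. c d \<in> mgrade M d) \<and> finite {d. c d \<noteq> \<zero>\<^bsub>M\<^esub>} \<and>
        x = (\<Oplus>\<^bsub>M\<^esub>d\<in>{d. c d \<noteq> \<zero>\<^bsub>M\<^esub>}. c d)"
  using graded assms unfolding graded_module_def by blast

lemma gcomp:
  assumes "x \<in> carrier M"
  shows "gcomp M x d \<in> mgrade M d" "finite {d. gcomp M x d \<noteq> \<zero>\<^bsub>M\<^esub>}"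
    "x = (\<Oplus>\<^bsub>M\<^esub>d\<in>{d. gcomp M x d \<noteq> \<zero>\<^bsub>M\<^esub>}. gcomp M x d)"
  using theI'[OF gcomp_ex1[OF assms]] unfolding gcomp_def by blast+

text \<open>By uniqueness, any finite homogeneous expression computes the components, even if some
  of its terms vanish.\<close>

lemma gcomp_eqI:
  assumes "finite A" "\<And>d. d \<in> A \<Longrightarrow> f d \<in> mgrade M d" "x = (\<Oplus>\<^bsub>M\<^esub>d\<in>A. f d)"
  shows "gcomp M x d = (if d \<in> A then f d else \<zero>\<^bsub>M\<^esub>)"
proof -
  let ?c = "\<lambda>d. if d \<in> A then f d else \<zero>\<^bsub>M\<^esub>"
  have fc: "f \<in> A \<rightarrow> carrier M" using assms(2) mgrade_closed by blast
  have x: "x \<in> carrier M" using assms(3) fc by simp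
  have "(\<Oplus>\<^bsub>M\<^esub>d\<in>{d. ?c d \<noteq> \<zero>\<^bsub>M\<^esub>}. ?c d) = (\<Oplus>\<^bsub>M\<^esub>d\<in>A. f d)"
    by (rule M.add.finprod_mono_neutral_cong_left) (use assms(1) fc in \<open>auto split: if_splits\<close>)
  moreover have "finite {d. ?c d \<noteq> \<zero>\<^bsub>M\<^esub>}" using assms(1) by (rule finite_subset[rotated]) auto
  ultimately have "(\<forall>d. ?c d \<in> mgrade M d) \<and> finite {d. ?c d \<noteq> \<zero>\<^bsub>M\<^esub>} \<and>
        x = (\<Oplus>\<^bsub>M\<^esub>d\<in>{d. ?c d \<noteq> \<zero>\<^bsub>M\<^esub>}. ?c d)"
    using assms by auto
  then have "gcomp M x = ?c" unfolding gcomp_def using gcomp_ex1[OF x] by (intro the1_equality)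
  then show ?thesis by simp
qed

lemma gcomp_finsum:
  assumes "x \<in> carrier M" "finite A" "{d. gcomp M x d \<noteq> \<zero>\<^bsub>M\<^esub>} \<subseteq> A"
  shows "x = (\<Oplus>\<^bsub>M\<^esub>d\<in>A. gcomp M x d)"
proof -
  have "(\<Oplus>\<^bsub>M\<^esub>d\<in>{d. gcomp M x d \<noteq> \<zero>\<^bsub>M\<^esub>}. gcomp M x d) = (\<Oplus>\<^bsub>M\<^esub>d\<in>A. gcomp M x d)"
    by (rule M.add.finprod_mono_neutral_cong_left)
      (use assms gcomp(1)[OF assms(1)] mgrade_closed in auto)
  then show ?thesis using gcomp(3)[OF assms(1)] by simp
qed

lemma gcomp_mgrade:
  assumes "x \<in> mgrade M j"
  shows "gcomp M x d = (if d = j then x else \<zero>\<^bsub>M\<^esub>)"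
  using gcomp_eqI[of "{j}" "\<lambda>_. x" x d] assms mgrade_closed[OF assms] by simp

lemma gcomp_add:
  assumes "x \<in> carrier M" "y \<in> carrier M"
  shows "gcomp M (x \<oplus>\<^bsub>M\<^esub> y) d = gcomp M x d \<oplus>\<^bsub>M\<^esub> gcomp M y d"
proof -
  let ?A = "{d. gcomp M x d \<noteq> \<zero>\<^bsub>M\<^esub>} \<union> {d. gcomp M y d \<noteq> \<zero>\<^bsub>M\<^esub>}"
  have A: "finite ?A" using gcomp(2) assms by auto
  have c: "gcomp M x \<in> ?A \<rightarrow> carrier M" "gcomp M y \<in> ?A \<rightarrow> carrier M"
    using gcomp(1) mgrade_closed assms by blast+
  have "x \<oplus>\<^bsub>M\<^esub> y = (\<Oplus>\<^bsub>M\<^esub>d\<in>?A. gcomp M x d \<oplus>\<^bsub>M\<^esub> gcomp M y d)"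
    using gcomp_finsum[OF assms(1) A] gcomp_finsum[OF assms(2) A] c by (simp add: M.finsum_addf)
  from gcomp_eqI[OF A _ this, of d] show ?thesis
    using gcomp(1) assms by (auto simp: mgrade_add)
qed

lemma gcomp_smult:
  assumes "s \<in> rgrade R i" "s \<in> carrier R" "x \<in> carrier M"
  shows "gcomp M (s \<odot>\<^bsub>M\<^esub> x) d = s \<odot>\<^bsub>M\<^esub> gcomp M x (d - i)"
proof -
  let ?A = "{d. gcomp M x d \<noteq> \<zero>\<^bsub>M\<^esub>}"
  have A: "finite ?A" using gcomp(2) assms by auto
  have c: "gcomp M x \<in> B \<rightarrow> carrier M" for B
    using gcomp(1) mgrade_closed assms by blast
  have "s \<odot>\<^bsub>M\<^esub> x = s \<odot>\<^bsub>M\<^esub> (\<Oplus>\<^bsub>M\<^esub>d\<in>?A. gcomp M x d)"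
    using gcomp_finsum[OF assms(3) A] by simp
  also have "\<dots> = (\<Oplus>\<^bsub>M\<^esub>d\<in>?A. s \<odot>\<^bsub>M\<^esub> gcomp M x d)"
    using c A assms by (intro finsum_smult_ldistr) auto
  also have "\<dots> = (\<Oplus>\<^bsub>M\<^esub>d\<in>(\<lambda>d. d + i) ` ?A. s \<odot>\<^bsub>M\<^esub> gcomp M x (d - i))"
    using c assms by (subst M.add.finprod_reindex) (auto intro!: inj_onI)
  finally have "s \<odot>\<^bsub>M\<^esub> x = (\<Oplus>\<^bsub>M\<^esub>d\<in>(\<lambda>d. d + i) ` ?A. s \<odot>\<^bsub>M\<^esub> gcomp M x (d - i))" .
  moreover have "s \<odot>\<^bsub>M\<^esub> gcomp M x (d - i) \<in> mgrade M d" for d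
    using mgrade_smult[OF assms(1) gcomp(1)[OF assms(3)], of "d - i"] by simp
  ultimately have
    "gcomp M (s \<odot>\<^bsub>M\<^esub> x) d = (if d \<in> (\<lambda>d. d + i) ` ?A then s \<odot>\<^bsub>M\<^esub> gcomp M x (d - i) else \<zero>\<^bsub>M\<^esub>)"
    using A by (intro gcomp_eqI) auto
  moreover have "d - i \<notin> ?A" if "d \<notin> (\<lambda>d. d + i) ` ?A"
    using that by (metis diff_add_cancel imageI)
  ultimately show ?thesis using assms by auto
qed

end

subsection \<open>The graded injective envelope of the residue field\<close>

context SR
begin

text \<open>These are the test modules for graded injectivity. The shift puts the component of
  degree \<open>j\<close> of the ring into degree zero, where the socle of \<open>E\<close>
  lives.\<close>

definition shift_sub :: "int \<Rightarrow> ('v, 'k) mpoly set set \<Rightarrow> (('v, 'k) mpoly set, ('v, 'k) mpoly set) gmodule" where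
  "shift_sub j I = sub_module ((regular_module S)\<lparr>mgrade := \<lambda>d. rgrade S (d + j)\<rparr>) I"

lemma shift_sub_simps [simp]:
  "carrier (shift_sub j I) = I" "add (shift_sub j I) = add S" "zero (shift_sub j I) = zero S"
  "smult (shift_sub j I) = mult S" "mgrade (shift_sub j I) d = rgrade S (d + j) \<inter> I"
  by (auto simp: shift_sub_def sub_module_def)

lemma abelian_group_regular: "abelian_group (regular_module S)"
proof (rule abelian_groupI)
  fix x assume "x \<in> carrier (regular_module S)"
  then show "\<exists>y\<in>carrier (regular_module S). y \<oplus>\<^bsub>regular_module S\<^esub> x = \<zero>\<^bsub>regular_module S\<^esub>"
    using l_neg[of x] by (intro bexI[of _ "\<ominus>\<^bsub>S\<^esub> x"]) simp_all
qed (simp_all add: a_ac)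

lemma module_S: "Module.module S (regular_module S)"
  by (rule moduleI) (simp_all add: l_distr r_distr m_assoc is_cring abelian_group_regular)

lemma regular_coset [simp]: "a_r_coset (regular_module S) = a_r_coset S"
  by (intro ext) (simp add: a_r_coset_def')

lemma rp_finsum_grade:
  assumes "finite A" "\<And>d. d \<in> A \<Longrightarrow> c d \<in> rgrade S (d + j)"
  shows "hpart (e + j) (rp (\<Oplus>\<^bsub>S\<^esub>d\<in>A. c d)) = (if e \<in> A then rp (c e) else 0)"
proof -
  have c: "c d \<in> carrier S" "hpart (d + j) (rp (c d)) = rp (c d)" if "d \<in> A" for d
    using assms(2)[OF that] by (auto simp: rgrade_S)
  have "hpart (e + j) (rp (c d)) = (if d = e then rp (c d) else 0)" if "d \<in> A" for d
  proof (cases "d = e")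
    case False
    have "hpart (e + j) (hpart (d + j) (rp (c d))) = 0"
      using False by (intro poly_mapping_eqI) (simp add: lookup_hpart)
    then show ?thesis using c[OF that] False by simp
  qed (use c that in simp)
  then show ?thesis
    using assms(1) c by (subst rp_finsum) (auto simp: hpart_sum sum.delta)
qed

lemma shift_sub_graded:
  assumes "ideal I S" "\<And>X j. X \<in> I \<Longrightarrow> hc j X \<in> I"
  shows "graded_module S (shift_sub j I)"
proof -
  interpret I: ideal I S by fact
  interpret M: Module.module S "regular_module S" by (rule module_S)
  have m: "Module.module S (shift_sub j I)"
    by (rule M.sub_module_module[of I]) (auto simp: I.I_l_closed)
  interpret m: Module.module S "shift_sub j I" by fact
  have fs: "finsum (shift_sub j I) c A = finsum S c A" if "c \<in> A \<rightarrow> I" for c A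
    using that by (intro finsum_sub_module) (auto intro: m.abelian_monoid_axioms abelian_monoid_axioms)
  show ?thesis
    unfolding graded_module_def
  proof (intro conjI allI ballI impI m)
    fix d
    interpret G: additive_subgroup "rgrade S (d + j)" S by (rule rgrade_subgroup)
    show "additive_subgroup (mgrade (shift_sub j I) d) (shift_sub j I)"
    proof (rule additive_subgroupI, rule m.add.subgroupI)
      fix X assume X: "X \<in> mgrade (shift_sub j I) d"
      have "\<ominus>\<^bsub>shift_sub j I\<^esub> X = \<ominus>\<^bsub>S\<^esub> X"
        by (rule m.minus_equality) (use X in \<open>auto simp: l_neg\<close>)
      then show "\<ominus>\<^bsub>shift_sub j I\<^esub> X \<in> mgrade (shift_sub j I) d" using X by auto
    next
      have "\<zero>\<^bsub>S\<^esub> \<in> mgrade (shift_sub j I) d"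
        using G.zero_closed additive_subgroup.zero_closed[OF ideal.axioms(1)[OF assms(1)]] by simp
      then show "mgrade (shift_sub j I) d \<noteq> {}" by blast
    qed simp_all
  next
    fix i k a x assume "a \<in> rgrade S i" "x \<in> mgrade (shift_sub j I) k"
    then show "a \<odot>\<^bsub>shift_sub j I\<^esub> x \<in> mgrade (shift_sub j I) (i + k)"
      using rgrade_mult[of a i x "k + j"] by (auto simp: add_ac rgrade_closed intro: I.I_l_closed)
  next
    fix X assume "X \<in> carrier (shift_sub j I)"
    then have X: "X \<in> I" "X \<in> carrier S" by auto
    let ?c = "\<lambda>d. hc (d + j) X"
    show "\<exists>!c. (\<forall>d. c d \<in> mgrade (shift_sub j I) d) \<and> finite {d. c d \<noteq> \<zero>\<^bsub>shift_sub j I\<^esub>} \<and>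
      X = (\<Oplus>\<^bsub>shift_sub j I\<^esub>d\<in>{d. c d \<noteq> \<zero>\<^bsub>shift_sub j I\<^esub>}. c d)"
    proof (rule ex1I[of _ ?c], intro conjI allI)
      fix d show "?c d \<in> mgrade (shift_sub j I) d" using X assms(2) by (auto simp: hc_rgrade)
    next
      let ?B = "(\<lambda>m. int (mdeg m)) ` keys (rp X)"
      let ?A = "(\<lambda>e. e - j) ` ?B"
      have z: "?c d = \<zero>\<^bsub>S\<^esub>" if "d \<notin> ?A" for d
      proof -
        have "d + j \<notin> ?B" using that by (force)
        then have "k \<notin> keys (rp X)" if "int (mdeg k) = d + j" for k
          using that by (metis image_eqI)
        then have "hpart (d + j) (rp X) = 0"
          by (intro poly_mapping_eqI) (auto simp: lookup_hpart in_keys_iff)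
        then show ?thesis by (simp add: hc_def S_zero)
      qed
      then have sub: "{d. ?c d \<noteq> \<zero>\<^bsub>shift_sub j I\<^esub>} \<subseteq> ?A" by auto
      then show "finite {d. ?c d \<noteq> \<zero>\<^bsub>shift_sub j I\<^esub>}" by (rule finite_subset) auto
      have "X = (\<Oplus>\<^bsub>S\<^esub>e\<in>?B. hc e X)" using X by (intro hc_finsum) auto
      also have "\<dots> = (\<Oplus>\<^bsub>S\<^esub>d\<in>?A. ?c d)"
        using X by (subst add.finprod_reindex) (auto intro!: inj_onI)
      also have "\<dots> = (\<Oplus>\<^bsub>S\<^esub>d\<in>{d. ?c d \<noteq> \<zero>\<^bsub>shift_sub j I\<^esub>}. ?c d)"
        using sub z X by (intro add.finprod_mono_neutral_cong_right) auto
      also have "\<dots> = (\<Oplus>\<^bsub>shift_sub j I\<^esub>d\<in>{d. ?c d \<noteq> \<zero>\<^bsub>shift_sub j I\<^esub>}. ?c d)"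
        using X assms(2) by (intro fs[symmetric]) auto
      finally show "X = (\<Oplus>\<^bsub>shift_sub j I\<^esub>d\<in>{d. ?c d \<noteq> \<zero>\<^bsub>shift_sub j I\<^esub>}. ?c d)" .
    next
      fix c assume c: "(\<forall>d. c d \<in> mgrade (shift_sub j I) d) \<and> finite {d. c d \<noteq> \<zero>\<^bsub>shift_sub j I\<^esub>} \<and>
        X = (\<Oplus>\<^bsub>shift_sub j I\<^esub>d\<in>{d. c d \<noteq> \<zero>\<^bsub>shift_sub j I\<^esub>}. c d)"
      then have "X = (\<Oplus>\<^bsub>S\<^esub>d\<in>{d. c d \<noteq> \<zero>\<^bsub>S\<^esub>}. c d)" using fs[of c] by auto
      then have "hpart (e + j) (rp X) = rp (c e)" for e
        using rp_finsum_grade[of "{d. c d \<noteq> \<zero>\<^bsub>S\<^esub>}" c j e] c by auto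
      then show "c = ?c"
        using c cl_rp[OF rgrade_closed] unfolding hc_def by (intro ext) (metis shift_sub_simps(5) IntD1)
    qed
  qed
qed

end

section \<open>The socle of the envelope and the functional \<open>eps\<close>\<close>

locale SR_env = SR \<Delta> S
  for \<Delta> :: "'v::linorder set set" and S :: "('v, 'k::field) mpoly set gring" +
  fixes E :: "(('v, 'k) mpoly set, 'e) gmodule"
  assumes env: "graded_injective_envelope S (residue_module S) E"
begin

sublocale E: gr_module S E
  using env by (unfold_locales) (simp add: graded_injective_envelope_def graded_injective_def)

text \<open>This is the embedding of the residue field, not its image; that the image fills the
  whole component of degree zero is shown in \<open>grade_0_range\<close>.\<close>

definition socle :: "('v, 'k) mpoly set set \<Rightarrow> 'e" where
  "socle = (SOME u. u \<in> graded_hom S (residue_module S) E 0 \<and> inj_on u (carrier (residue_module S)) \<and>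
        (\<forall>N. graded_submodule S E N \<and> N \<noteq> {\<zero>\<^bsub>E\<^esub>} \<longrightarrow> N \<inter> u ` carrier (residue_module S) \<noteq> {\<zero>\<^bsub>E\<^esub>}))"

lemma socle: "socle \<in> graded_hom S (residue_module S) E 0" "inj_on socle (carrier (residue_module S))"
    "\<And>N. graded_submodule S E N \<Longrightarrow> N \<noteq> {\<zero>\<^bsub>E\<^esub>} \<Longrightarrow> N \<inter> socle ` carrier (residue_module S) \<noteq> {\<zero>\<^bsub>E\<^esub>}"
proof -
  have "\<exists>u. u \<in> graded_hom S (residue_module S) E 0 \<and> inj_on u (carrier (residue_module S)) \<and>
        (\<forall>N. graded_submodule S E N \<and> N \<noteq> {\<zero>\<^bsub>E\<^esub>} \<longrightarrow> N \<inter> u ` carrier (residue_module S) \<noteq> {\<zero>\<^bsub>E\<^esub>})"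
    using env unfolding graded_injective_envelope_def by blast
  from someI_ex[OF this] show "socle \<in> graded_hom S (residue_module S) E 0" "inj_on socle (carrier (residue_module S))"
    "\<And>N. graded_submodule S E N \<Longrightarrow> N \<noteq> {\<zero>\<^bsub>E\<^esub>} \<Longrightarrow> N \<inter> socle ` carrier (residue_module S) \<noteq> {\<zero>\<^bsub>E\<^esub>}"
    unfolding socle_def by blast+
qed

abbreviation "con c \<equiv> cl (single 0 c)"

lemma con_P [simp]: "single 0 c \<in> P"
  by (simp add: polys_single)

definition rcl :: "'k \<Rightarrow> ('v, 'k) mpoly set set" where
  "rcl c = mm +>\<^bsub>S\<^esub> con c"

lemma mm_regular: "additive_subgroup mm (regular_module S)"
  by (rule module.additive_subgroupI_module[OF module_S])
    (auto simp: rp_add rp_mult lookup_add lookup_res lookup_times_zero)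

lemma coset_rcl:
  assumes "p \<in> P"
  shows "mm +>\<^bsub>S\<^esub> cl p = rcl (lookup p 0)"
proof -
  have "cl p \<ominus>\<^bsub>S\<^esub> con (lookup p 0) \<in> mm"
    using assms by (simp add: cl_diff lookup_rp_cl_zero polys_diff lookup_minus)
  then show ?thesis
    unfolding rcl_def using quotient_eq_iff_same_a_r_cos[OF ideal_mm, of "cl p" "con (lookup p 0)"] assms by simp
qed

lemma residue_carrier: "carrier (residue_module S) = range rcl"
proof -
  have "carrier (residue_module S) = (\<lambda>x. mm +>\<^bsub>S\<^esub> x) ` carrier S"
    unfolding residue_module_def by (subst quot_module_carrier) (simp add: graded_max_eq)
  also have "\<dots> = range rcl"
  proof (safe)
    fix X assume "X \<in> carrier S"
    then show "mm +>\<^bsub>S\<^esub> X \<in> range rcl" by (auto elim!: S_cases simp: coset_rcl)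
  next
    fix c show "rcl c \<in> (\<lambda>x. mm +>\<^bsub>S\<^esub> x) ` carrier S" by (auto simp: rcl_def)
  qed
  finally show ?thesis .
qed

lemma rcl_inj: "rcl c = rcl d \<longleftrightarrow> c = d"
proof
  assume "rcl c = rcl d"
  have "con c \<ominus>\<^bsub>S\<^esub> con d \<in> mm"
    using \<open>rcl c = rcl d\<close> quotient_eq_iff_same_a_r_cos[OF ideal_mm, of "con c" "con d"] by (simp add: rcl_def)
  then show "c = d"
    by (simp add: cl_diff lookup_rp_cl_zero polys_diff lookup_minus)
qed simp

definition \<kappa> :: "'k \<Rightarrow> 'e" where
  "\<kappa> c = socle (rcl c)"

lemma socle_range: "socle ` carrier (residue_module S) = range \<kappa>"
  by (simp add: residue_carrier \<kappa>_def image_image)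

lemma \<kappa>_inj: "\<kappa> c = \<kappa> d \<longleftrightarrow> c = d"
  using socle(2) rcl_inj unfolding \<kappa>_def by (auto simp: residue_carrier inj_on_def)

lemma \<kappa>_grade: "\<kappa> c \<in> mgrade E 0"
proof -
  have "con c \<in> rgrade S 0" by (rule cl_rgrade) (auto simp: hpart_zero)
  then have "rcl c \<in> mgrade (residue_module S) 0"
    by (auto simp: residue_module_def graded_max_eq rcl_def)
  then show ?thesis using socle(1) unfolding graded_hom_def \<kappa>_def by force
qed

lemma \<kappa>_closed [simp]: "\<kappa> c \<in> carrier E"
  using \<kappa>_grade E.mgrade_closed by blast

lemma \<kappa>_add: "\<kappa> (c + d) = \<kappa> c \<oplus>\<^bsub>E\<^esub> \<kappa> d"
proof -
  have "rcl c \<oplus>\<^bsub>residue_module S\<^esub> rcl d = rcl (c + d)"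
    using quot_module_add[OF abelian_group_regular mm_regular, of "con c" "con d"]
    by (simp add: residue_module_def graded_max_eq rcl_def cl_add single_add)
  then show ?thesis using socle(1) unfolding graded_hom_def mod_hom_def \<kappa>_def
    by (simp add: residue_carrier) (metis rangeI)
qed

lemma \<kappa>_smult: "p \<in> P \<Longrightarrow> cl p \<odot>\<^bsub>E\<^esub> \<kappa> c = \<kappa> (lookup p 0 * c)"
proof -
  assume p: "p \<in> P"
  have *: "cl p \<odot>\<^bsub>regular_module S\<^esub> y \<in> mm" if "y \<in> mm" for y
    unfolding regular_simps using that p by (intro ideal.I_l_closed[OF ideal_mm] cl_closed)
  have cs: "cl p \<in> carrier S" "con c \<in> carrier (regular_module S)" using p by simp_all
  have "cl p \<odot>\<^bsub>residue_module S\<^esub> rcl c = mm +>\<^bsub>S\<^esub> (cl p \<otimes>\<^bsub>S\<^esub> con c)"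
    using quot_module_smult[OF module_S mm_regular cs *]
    by (simp only: residue_module_def graded_max_eq rcl_def regular_coset regular_simps)
  also have "\<dots> = rcl (lookup p 0 * c)"
    using p by (simp add: cl_mult coset_rcl polys_closed lookup_times_zero)
  finally show ?thesis using socle(1) p unfolding graded_hom_def mod_hom_def \<kappa>_def
    by (simp add: residue_carrier) (metis cl_closed rangeI)
qed

lemma \<kappa>_zero: "\<kappa> 0 = \<zero>\<^bsub>E\<^esub>"
  using \<kappa>_add[of 0 0] by simp

text \<open>Essentiality of the envelope is tested on graded submodules only; the one generated by a
  homogeneous element provides a test for that element.\<close>

lemma cyclic_graded:
  assumes e: "e \<in> mgrade E j"
  shows "graded_submodule S E ((\<lambda>s. s \<odot>\<^bsub>E\<^esub> e) ` carrier S)"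
proof -
  let ?N = "(\<lambda>s. s \<odot>\<^bsub>E\<^esub> e) ` carrier S"
  have ec: "e \<in> carrier E" using e by (rule E.mgrade_closed)
  have sub: "?N \<subseteq> carrier E" "\<zero>\<^bsub>E\<^esub> \<in> ?N"
    using ec by (auto intro!: image_eqI[of _ _ "\<zero>\<^bsub>S\<^esub>"])
  have add: "x \<oplus>\<^bsub>E\<^esub> y \<in> ?N" if "x \<in> ?N" "y \<in> ?N" for x y
    using that ec by (auto simp flip: E.smult_l_distr)
  have sm: "s \<odot>\<^bsub>E\<^esub> x \<in> ?N" if "s \<in> carrier S" "x \<in> ?N" for s x
    using that ec by (auto simp flip: E.smult_assoc1)
  have m: "Module.module S (sub_module E ?N)"
    by (rule E.sub_module_module[of ?N]) (use sub add sm in auto)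
  interpret m: Module.module S "sub_module E ?N" by fact
  have N: "additive_subgroup ?N E" using sub add sm by (intro E.additive_subgroupI_module) auto
  have fs: "finsum (sub_module E ?N) c A = finsum E c A" if "c \<in> A \<rightarrow> ?N" for c A
    using that sub by (intro finsum_sub_module) (auto intro: m.M.abelian_monoid_axioms E.M.abelian_monoid_axioms)
  have "submodule ?N S E"
    unfolding submodule_def using N sm by (auto simp: additive_subgroup_def submodule_axioms_def)
  moreover have "graded_module S (sub_module E ?N)"
    unfolding graded_module_def
  proof (intro conjI allI ballI impI m)
    fix d
    interpret G: additive_subgroup "mgrade E d" E by (rule E.mgrade_subgroup)
    interpret N: additive_subgroup ?N E by (rule N)
    show "additive_subgroup (mgrade (sub_module E ?N) d) (sub_module E ?N)"
    proof (rule additive_subgroupI, rule m.M.add.subgroupI)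
      fix X assume X: "X \<in> mgrade (sub_module E ?N) d"
      then have X': "X \<in> ?N" "X \<in> mgrade E d" by auto
      have XE: "X \<in> carrier E" using X' E.mgrade_closed by blast
      have "\<ominus>\<^bsub>sub_module E ?N\<^esub> X = \<ominus>\<^bsub>E\<^esub> X"
        by (rule m.M.minus_equality) (use X' XE N.a_inv_closed in \<open>auto simp: E.M.l_neg\<close>)
      then show "\<ominus>\<^bsub>sub_module E ?N\<^esub> X \<in> mgrade (sub_module E ?N) d"
        using X' N.a_inv_closed G.a_inv_closed by (metis IntI sub_module_simps(5))
    next
      have "\<zero>\<^bsub>E\<^esub> \<in> mgrade (sub_module E ?N) d" using sub(2) by (simp del: image_iff)
      then show "mgrade (sub_module E ?N) d \<noteq> {}" by blast
    qed (use add in \<open>auto simp: E.mgrade_add simp del: image_iff\<close>)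
  next
    fix i k a x assume "a \<in> rgrade S i" "x \<in> mgrade (sub_module E ?N) k"
    then show "a \<odot>\<^bsub>sub_module E ?N\<^esub> x \<in> mgrade (sub_module E ?N) (i + k)"
      using sm[of a x] rgrade_closed[of a] by (auto simp: E.mgrade_smult simp del: image_iff)
  next
    fix x assume "x \<in> carrier (sub_module E ?N)"
    then obtain s where s: "s \<in> carrier S" "x = s \<odot>\<^bsub>E\<^esub> e" by auto
    have xE: "x \<in> carrier E" using s ec by simp
    let ?B = "(\<lambda>m. int (mdeg m)) ` keys (rp s)"
    have "x = (\<Oplus>\<^bsub>S\<^esub>i\<in>?B. hc i s) \<odot>\<^bsub>E\<^esub> e" using s hc_finsum[of s ?B] by simp
    also have "\<dots> = (\<Oplus>\<^bsub>E\<^esub>i\<in>?B. hc i s \<odot>\<^bsub>E\<^esub> e)"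
    proof -
      have "(\<Oplus>\<^bsub>S\<^esub>i\<in>B. hc i s) \<odot>\<^bsub>E\<^esub> e = (\<Oplus>\<^bsub>E\<^esub>i\<in>B. hc i s \<odot>\<^bsub>E\<^esub> e)" if "finite B" for B
        using that by induction (use s ec in \<open>auto simp: E.smult_l_distr\<close>)
      then show ?thesis by simp
    qed
    also have "\<dots> = (\<Oplus>\<^bsub>E\<^esub>d\<in>(\<lambda>i. i + j) ` ?B. hc (d - j) s \<odot>\<^bsub>E\<^esub> e)"
      using s ec by (subst E.M.add.finprod_reindex) (auto intro!: inj_onI)
    finally have "x = (\<Oplus>\<^bsub>E\<^esub>d\<in>(\<lambda>i. i + j) ` ?B. hc (d - j) s \<odot>\<^bsub>E\<^esub> e)" .
    then have gc: "gcomp E x d = (if d \<in> (\<lambda>i. i + j) ` ?B then hc (d - j) s \<odot>\<^bsub>E\<^esub> e else \<zero>\<^bsub>E\<^esub>)" for d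
      using E.mgrade_smult[OF hc_rgrade[OF s(1)] e] by (intro E.gcomp_eqI) auto
    have gN: "gcomp E x d \<in> ?N" for d
      unfolding gc using s sub by auto
    show "\<exists>!c. (\<forall>d. c d \<in> mgrade (sub_module E ?N) d) \<and> finite {d. c d \<noteq> \<zero>\<^bsub>sub_module E ?N\<^esub>} \<and>
      x = (\<Oplus>\<^bsub>sub_module E ?N\<^esub>d\<in>{d. c d \<noteq> \<zero>\<^bsub>sub_module E ?N\<^esub>}. c d)"
    proof (rule ex1I[of _ "gcomp E x"])
      show "(\<forall>d. gcomp E x d \<in> mgrade (sub_module E ?N) d) \<and> finite {d. gcomp E x d \<noteq> \<zero>\<^bsub>sub_module E ?N\<^esub>} \<and>
        x = (\<Oplus>\<^bsub>sub_module E ?N\<^esub>d\<in>{d. gcomp E x d \<noteq> \<zero>\<^bsub>sub_module E ?N\<^esub>}. gcomp E x d)"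
        using E.gcomp[OF xE] gN fs[of "gcomp E x"] by (simp del: image_iff)
    next
      fix c assume c: "(\<forall>d. c d \<in> mgrade (sub_module E ?N) d) \<and> finite {d. c d \<noteq> \<zero>\<^bsub>sub_module E ?N\<^esub>} \<and>
        x = (\<Oplus>\<^bsub>sub_module E ?N\<^esub>d\<in>{d. c d \<noteq> \<zero>\<^bsub>sub_module E ?N\<^esub>}. c d)"
      then have "c \<in> A \<rightarrow> ?N" for A by auto
      then have "(\<forall>d. c d \<in> mgrade E d) \<and> finite {d. c d \<noteq> \<zero>\<^bsub>E\<^esub>} \<and> x = (\<Oplus>\<^bsub>E\<^esub>d\<in>{d. c d \<noteq> \<zero>\<^bsub>E\<^esub>}. c d)"
        using c fs[of c] by auto
      then show "c = gcomp E x" using E.gcomp_ex1[OF xE] E.gcomp[OF xE] by blast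
    qed
  qed
  ultimately show ?thesis by (simp add: graded_submodule_def)
qed

text \<open>By essentiality some multiple of \<open>e\<close> is a nonzero element of the socle. As
  the socle sits in degree zero and \<open>e\<close> is homogeneous, only the component of degree
  \<open>- j\<close> of the multiplier contributes.\<close>

lemma socle_hit:
  assumes e: "e \<in> mgrade E j" "e \<noteq> \<zero>\<^bsub>E\<^esub>"
  obtains s c where "s \<in> rgrade S (- j)" "c \<noteq> 0" "s \<odot>\<^bsub>E\<^esub> e = \<kappa> c"
proof -
  let ?N = "(\<lambda>s. s \<odot>\<^bsub>E\<^esub> e) ` carrier S"
  have ec: "e \<in> carrier E" using e(1) by (rule E.mgrade_closed)
  have "e \<in> ?N" using ec by (intro image_eqI[of _ _ "\<one>\<^bsub>S\<^esub>"]) auto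
  then have "?N \<noteq> {\<zero>\<^bsub>E\<^esub>}" using e(2) by blast
  then have "?N \<inter> range \<kappa> \<noteq> {\<zero>\<^bsub>E\<^esub>}" using socle(3)[OF cyclic_graded[OF e(1)]] by (simp add: socle_range)
  moreover have "\<zero>\<^bsub>E\<^esub> \<in> ?N"
    using ec by (intro image_eqI[of _ _ "\<zero>\<^bsub>S\<^esub>"]) simp_all
  moreover have "\<zero>\<^bsub>E\<^esub> \<in> range \<kappa>"
    by (rule range_eqI[of _ _ 0]) (rule \<kappa>_zero[symmetric])
  ultimately obtain y where y: "y \<in> ?N" "y \<in> range \<kappa>" "y \<noteq> \<zero>\<^bsub>E\<^esub>" by blast
  from y(1) obtain s where s1: "s \<in> carrier S" "y = s \<odot>\<^bsub>E\<^esub> e" by (elim imageE)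
  from y(2) obtain c where c: "y = \<kappa> c" by (elim rangeE)
  have s: "s \<in> carrier S" "s \<odot>\<^bsub>E\<^esub> e = \<kappa> c" "\<kappa> c \<noteq> \<zero>\<^bsub>E\<^esub>"
    using s1 c y(3) by simp_all
  have "gcomp E (s \<odot>\<^bsub>E\<^esub> e) 0 = hc (- j) s \<odot>\<^bsub>E\<^esub> e"
  proof -
    let ?B = "insert (- j) ((\<lambda>m. int (mdeg m)) ` keys (rp s))"
    have B: "finite ?B" by simp
    have "s \<odot>\<^bsub>E\<^esub> e = (\<Oplus>\<^bsub>S\<^esub>i\<in>?B. hc i s) \<odot>\<^bsub>E\<^esub> e"
      by (rule arg_cong[OF hc_finsum[OF s(1) B subset_insertI]])
    moreover have "gcomp E ((\<Oplus>\<^bsub>S\<^esub>i\<in>B. hc i s) \<odot>\<^bsub>E\<^esub> e) 0 = (if - j \<in> B then hc (- j) s \<odot>\<^bsub>E\<^esub> e else \<zero>\<^bsub>E\<^esub>)" if "finite B" for B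
      using that
    proof induction
      case empty
      then show ?case using ec E.gcomp_mgrade[OF E.mgrade_zero] by simp
    next
      case (insert i B)
      have "gcomp E (hc i s \<odot>\<^bsub>E\<^esub> e) 0 = (if i = - j then hc (- j) s \<odot>\<^bsub>E\<^esub> e else \<zero>\<^bsub>E\<^esub>)"
        using E.gcomp_mgrade[OF E.mgrade_smult[OF hc_rgrade[OF s(1)] e(1)], of i 0] by auto
      then show ?case using insert s ec by (auto simp: E.smult_l_distr E.gcomp_add)
    qed
    ultimately show ?thesis using B by (metis insertI1)
  qed
  moreover have "gcomp E (s \<odot>\<^bsub>E\<^esub> e) 0 = \<kappa> c" using s(2) E.gcomp_mgrade[OF \<kappa>_grade] by simp
  ultimately show ?thesis
    using that[of "hc (- j) s" c] hc_rgrade[OF s(1), of "- j"] s(3) \<kappa>_zero by (cases "c = 0") auto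
qed

text \<open>The multiplier that moves \<open>e\<close> into the socle now has degree zero, so it is
  a nonzero constant and can be inverted.\<close>

lemma grade_0_range:
  assumes "e \<in> mgrade E 0"
  shows "e \<in> range \<kappa>"
proof (cases "e = \<zero>\<^bsub>E\<^esub>")
  case False
  then obtain s c where s: "s \<in> rgrade S 0" "c \<noteq> 0" "s \<odot>\<^bsub>E\<^esub> e = \<kappa> c"
    using socle_hit[OF assms] by auto
  have ec: "e \<in> carrier E" using assms by (rule E.mgrade_closed)
  obtain a where a: "s = con a"
    using s(1) hpart_zero[of "rp s"] by (auto simp: rgrade_S) (metis cl_rp)
  have "a \<noteq> 0"
    using s a ec \<kappa>_inj[of c 0] \<kappa>_zero E.smult_l_null[OF ec] by (auto simp: S_zero)
  have "\<kappa> (inverse a * c) = con (inverse a) \<odot>\<^bsub>E\<^esub> (con a \<odot>\<^bsub>E\<^esub> e)"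
    using s(3) a by (simp add: \<kappa>_smult)
  also have "\<dots> = e"
    using \<open>a \<noteq> 0\<close> ec by (simp add: cl_mult mult_single S_one[symmetric] flip: E.smult_assoc1)
  finally show ?thesis by (metis rangeI)
qed (metis \<kappa>_zero rangeI)

text \<open>The projection of \<open>E\<close> to its component of degree zero, read as a scalar
  through \<kappa>.\<close>

definition eps :: "'e \<Rightarrow> 'k" where
  "eps e = (THE c. gcomp E e 0 = \<kappa> c)"

lemma eps: "e \<in> carrier E \<Longrightarrow> gcomp E e 0 = \<kappa> (eps e)"
proof -
  assume e: "e \<in> carrier E"
  obtain c where c: "gcomp E e 0 = \<kappa> c" using grade_0_range[OF E.gcomp(1)[OF e, of 0]] by blast
  then show ?thesis unfolding eps_def by (simp add: \<kappa>_inj)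
qed

lemma eps_eqI: "gcomp E e 0 = \<kappa> c \<Longrightarrow> eps e = c"
  unfolding eps_def using \<kappa>_inj by auto

lemma eps_add: "x \<in> carrier E \<Longrightarrow> y \<in> carrier E \<Longrightarrow> eps (x \<oplus>\<^bsub>E\<^esub> y) = eps x + eps y"
  by (rule eps_eqI) (simp add: E.gcomp_add \<kappa>_add flip: eps)

lemma eps_const: "x \<in> carrier E \<Longrightarrow> eps (con c \<odot>\<^bsub>E\<^esub> x) = c * eps x"
proof (rule eps_eqI)
  assume "x \<in> carrier E"
  moreover have "con c \<in> rgrade S 0" by (rule cl_rgrade) (auto simp: hpart_zero)
  ultimately show "gcomp E (con c \<odot>\<^bsub>E\<^esub> x) 0 = \<kappa> (c * eps x)"
    using E.gcomp_smult[of "con c" 0 x 0] by (simp add: eps \<kappa>_smult)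
qed

lemma eps_zero [simp]: "eps \<zero>\<^bsub>E\<^esub> = 0"
  by (metis add_cancel_right_right eps_add E.M.l_zero E.M.zero_closed)

lemma eps_\<kappa>: "eps (\<kappa> c) = c"
  by (rule eps_eqI) (simp add: E.gcomp_mgrade[OF \<kappa>_grade])

lemma eps_grade: "x \<in> mgrade E j \<Longrightarrow> j \<noteq> 0 \<Longrightarrow> eps x = 0"
  by (rule eps_eqI) (simp add: E.gcomp_mgrade \<kappa>_zero)

lemma eps_finsum: "finite A \<Longrightarrow> f \<in> A \<rightarrow> carrier E \<Longrightarrow> eps (\<Oplus>\<^bsub>E\<^esub>i\<in>A. f i) = (\<Sum>i\<in>A. eps (f i))"
  by (induction A rule: finite_induct) (auto simp: eps_add)

lemma eps_gcomp:
  assumes "x \<in> carrier E" "gcomp E x j \<noteq> \<zero>\<^bsub>E\<^esub>"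
  obtains s where "s \<in> rgrade S (- j)" "eps (s \<odot>\<^bsub>E\<^esub> x) \<noteq> 0"
proof -
  obtain s c where s: "s \<in> rgrade S (- j)" "c \<noteq> 0" "s \<odot>\<^bsub>E\<^esub> gcomp E x j = \<kappa> c"
    using socle_hit[OF E.gcomp(1)[OF assms(1)] assms(2)] by blast
  have "gcomp E (s \<odot>\<^bsub>E\<^esub> x) 0 = \<kappa> c"
    using E.gcomp_smult[OF s(1) rgrade_closed[OF s(1)] assms(1), of 0] s(3) by simp
  then have "eps (s \<odot>\<^bsub>E\<^esub> x) = c" by (rule eps_eqI)
  then show ?thesis using that s by blast
qed

text \<open>A nonzero homogeneous component of the difference would be moved into the socle by some
  homogeneous multiplier, and there \<open>eps\<close> sees it.\<close>

lemma eps_separates: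
  assumes "x \<in> carrier E" "y \<in> carrier E" "\<And>s. s \<in> carrier S \<Longrightarrow> eps (s \<odot>\<^bsub>E\<^esub> x) = eps (s \<odot>\<^bsub>E\<^esub> y)"
  shows "x = y"
proof -
  define z where "z = x \<oplus>\<^bsub>E\<^esub> (\<ominus>\<^bsub>E\<^esub> y)"
  have z: "z \<in> carrier E" using assms by (simp add: z_def)
  have neg: "eps (\<ominus>\<^bsub>E\<^esub> w) = - eps w" if "w \<in> carrier E" for w
    using eps_add[of w "\<ominus>\<^bsub>E\<^esub> w"] that by (simp add: E.M.r_neg add_eq_0_iff)
  have 0: "eps (s \<odot>\<^bsub>E\<^esub> z) = 0" if "s \<in> carrier S" for s
    using that assms by (simp add: z_def E.smult_r_distr E.smult_r_minus eps_add neg)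
  have "gcomp E z d = \<zero>\<^bsub>E\<^esub>" for d
    using eps_gcomp[OF z, of d] 0 rgrade_closed by blast
  then have "z = \<zero>\<^bsub>E\<^esub>" using E.gcomp(3)[OF z] by simp
  then show ?thesis using assms unfolding z_def
    by (metis E.M.minus_minus E.M.minus_equality E.M.a_inv_closed)
qed

lemma eps_detects_grade:
  assumes "x \<in> carrier E" "\<And>s i. s \<in> rgrade S i \<Longrightarrow> i \<noteq> - j \<Longrightarrow> eps (s \<odot>\<^bsub>E\<^esub> x) = 0"
  shows "x \<in> mgrade E j"
proof -
  have "gcomp E x d = \<zero>\<^bsub>E\<^esub>" if "d \<noteq> j" for d
    using eps_gcomp[OF assms(1), of d] assms(2)[of _ "- d"] that by auto
  then have "x = (\<Oplus>\<^bsub>E\<^esub>d\<in>{j}. gcomp E x d)"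
    by (intro E.gcomp_finsum) (use assms in auto)
  then show ?thesis using E.gcomp(1)[OF assms(1), of j] assms(1) E.mgrade_closed by auto
qed

text \<open>A functional on the component of degree \<open>j\<close>, extended by zero to the ideal of all elements of degree
  at least \<open>j\<close>, is a homomorphism into the socle; injectivity extends it to the whole ring.\<close>

lemma eps_represents_homogeneous:
  assumes add: "\<And>X Y. X \<in> carrier S \<Longrightarrow> Y \<in> carrier S \<Longrightarrow> l (X \<oplus>\<^bsub>S\<^esub> Y) = l X + l Y"
    and const: "\<And>c X. X \<in> carrier S \<Longrightarrow> l (con c \<otimes>\<^bsub>S\<^esub> X) = c * l X"
  shows "\<exists>e\<in>carrier E. \<forall>s\<in>carrier S. eps (s \<odot>\<^bsub>E\<^esub> e) = l (hc j s)"
proof -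
  define I where "I = {X \<in> carrier S. \<forall>m\<in>keys (rp X). j \<le> int (mdeg m)}"
  have I1: "hc i X \<in> I" if "X \<in> I" for X i
    using that by (auto simp: I_def rp_hc keys_hpart)
  have I2: "hc j X \<in> I" if "X \<in> carrier S" for X
    using that by (auto simp: I_def rp_hc keys_hpart)
  have Iid: "ideal I S"
  proof (rule idealI)
    show "subgroup I (add_monoid S)"
    proof (rule add.subgroupI)
      fix X assume "X \<in> I"
      then show "\<ominus>\<^bsub>S\<^esub> X \<in> I"
        by (auto elim!: S_cases simp: I_def cl_uminus rp_cl polys_closed res_uminus in_keys_iff)
    next
      fix X Y assume "X \<in> I" "Y \<in> I"
      then show "X \<oplus>\<^bsub>S\<^esub> Y \<in> I" using keys_add[of "rp X" "rp Y"] by (auto simp: I_def rp_add)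
    qed (auto simp: I_def intro!: exI[of _ "\<zero>\<^bsub>S\<^esub>"])
    fix a x assume "a \<in> I" "x \<in> carrier S"
    then show "x \<otimes>\<^bsub>S\<^esub> a \<in> I"
      by (auto simp: I_def rp_mult keys_res mdeg_add elim!: keys_times_mpoly)
    then show "a \<otimes>\<^bsub>S\<^esub> x \<in> I" using \<open>a \<in> I\<close> \<open>x \<in> carrier S\<close> by (simp add: m_comm I_def)
  qed (rule ring_axioms)
  have l0: "l \<zero>\<^bsub>S\<^esub> = 0" by (metis add_cancel_right_right add l_zero zero_closed)
  have hc_add: "hc j (X \<oplus>\<^bsub>S\<^esub> Y) = hc j X \<oplus>\<^bsub>S\<^esub> hc j Y" if "X \<in> carrier S" "Y \<in> carrier S" for X Y
    using that by (intro rp_inj) (auto simp: rp_hc rp_add hpart_add)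
  \<comment> \<open>Elements of \<open>I\<close> start in degree \<open>j\<close>, so in degree
    \<open>j\<close> of a product only the constant term of \<open>s\<close> is felt: the ring acts
    on the lowest component through the residue field, as it does on the socle.\<close>
  have hc_mult: "hc j (s \<otimes>\<^bsub>S\<^esub> X) = con (lookup (rp s) 0) \<otimes>\<^bsub>S\<^esub> hc j X" if s: "s \<in> carrier S" and X: "X \<in> I" for s X
  proof -
    have XS: "X \<in> carrier S" using X by (simp add: I_def)
    let ?c = "single 0 (lookup (rp s) 0) :: ('v, 'k) mpoly"
    let ?t = "rp s - ?c"
    have t0: "lookup ?t 0 = 0" by (simp add: lookup_minus)
    have "int (mdeg m) \<noteq> j" if m: "m \<in> keys (?t * rp X)" for m
    proof -
      obtain a b where ab: "m = a + b" "a \<in> keys ?t" "b \<in> keys (rp X)" using m by (elim keys_times_mpoly)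
      then have "a \<noteq> 0" using t0 by (auto simp: in_keys_iff)
      then have "mdeg a > 0" using mdeg_eq_0_iff[of a] by linarith
      then show ?thesis using X ab by (auto simp: I_def mdeg_add)
    qed
    then have "hpart j (?t * rp X) = 0"
      by (intro poly_mapping_eqI) (auto simp: lookup_hpart in_keys_iff)
    then have "hpart j (rp s * rp X) = hpart j (?c * rp X)"
      using hpart_add[of j "?t * rp X" "?c * rp X"] by (simp add: algebra_simps)
    also have "\<dots> = ?c * hpart j (rp X)" using hpart_single_times[of 0 j "lookup (rp s) 0" "rp X"] by simp
    finally show ?thesis
      using s XS by (intro rp_inj)
        (auto simp: rp_hc rp_mult rp_cl res_single empty_face res_const_times res_hpart[symmetric] res_rp)
  qed
  define f where "f = (\<lambda>X\<in>I. \<kappa> (l (hc j X)))"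
  have IS: "X \<in> carrier S" if "X \<in> I" for X using that by (simp add: I_def)
  interpret I: ideal I S by (rule Iid)
  have f: "f \<in> graded_hom S (shift_sub j I) E 0"
    unfolding graded_hom_def mod_hom_def
  proof (intro CollectI conjI ballI allI)
    show "f \<in> carrier (shift_sub j I) \<rightarrow>\<^sub>E carrier E" by (auto simp: f_def)
  next
    fix X Y assume "X \<in> carrier (shift_sub j I)" "Y \<in> carrier (shift_sub j I)"
    then show "f (X \<oplus>\<^bsub>shift_sub j I\<^esub> Y) = f X \<oplus>\<^bsub>E\<^esub> f Y"
      using IS by (auto simp: f_def hc_add add \<kappa>_add)
  next
    fix s X assume s: "s \<in> carrier S" and X: "X \<in> carrier (shift_sub j I)"
    then have "\<kappa> (l (hc j (s \<otimes>\<^bsub>S\<^esub> X))) = cl (rp s) \<odot>\<^bsub>E\<^esub> \<kappa> (l (hc j X))"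
      using IS by (simp add: hc_mult const \<kappa>_smult rp_P)
    then show "f (s \<odot>\<^bsub>shift_sub j I\<^esub> X) = s \<odot>\<^bsub>E\<^esub> f X"
      using s X by (auto simp: f_def cl_rp I.I_l_closed)
  next
    fix d
    show "f ` mgrade (shift_sub j I) d \<subseteq> mgrade E (d + 0)"
    proof safe
      fix X assume "X \<in> mgrade (shift_sub j I) d"
      then have X: "X \<in> rgrade S (d + j)" "X \<in> I" by auto
      show "f X \<in> mgrade E (d + 0)"
      proof (cases "d = 0")
        case True
        then show ?thesis using X by (simp add: f_def \<kappa>_grade)
      next
        case False
        then have "hpart j (hpart (d + j) (rp X)) = 0"
          by (intro poly_mapping_eqI) (auto simp: lookup_hpart)
        then have "hc j X = \<zero>\<^bsub>S\<^esub>" using X by (auto simp: hc_def rgrade_S S_zero)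
        then show ?thesis using X by (simp add: f_def l0 \<kappa>_zero)
      qed
    qed
  qed
  let ?N = "shift_sub j (carrier S)"
  define u where "u = (\<lambda>X\<in>I. X)"
  have u: "u \<in> graded_hom S (shift_sub j I) ?N 0"
    unfolding graded_hom_def mod_hom_def u_def by (auto simp: I.I_l_closed)
  have inj: "inj_on u (carrier (shift_sub j I))" by (auto simp: u_def inj_on_def)
  have gM: "graded_module S (shift_sub j I)" by (rule shift_sub_graded[OF Iid I1])
  have gN: "graded_module S ?N" by (rule shift_sub_graded) (auto simp: oneideal)
  have gi: "graded_injective S E" using env by (simp add: graded_injective_envelope_def)
  then obtain g where g: "g \<in> graded_hom S ?N E 0" "\<forall>X\<in>carrier (shift_sub j I). g (u X) = f X"
    using gM gN u inj f unfolding graded_injective_def by blast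
  \<comment> \<open>A homomorphism on the whole ring is determined by its value at one, which is
    therefore the representing element.\<close>
  have gmul: "s \<odot>\<^bsub>E\<^esub> g \<one>\<^bsub>S\<^esub> = g s" if "s \<in> carrier S" for s
  proof -
    have "g (s \<otimes>\<^bsub>S\<^esub> \<one>\<^bsub>S\<^esub>) = s \<odot>\<^bsub>E\<^esub> g \<one>\<^bsub>S\<^esub>"
      using g(1) that one_closed unfolding graded_hom_def mod_hom_def by (simp del: r_one)
    then show ?thesis using that by simp
  qed
  have gE: "g s \<in> carrier E" if "s \<in> carrier S" for s
    using g(1) that unfolding graded_hom_def mod_hom_def by auto
  have gadd: "g (x \<oplus>\<^bsub>S\<^esub> y) = g x \<oplus>\<^bsub>E\<^esub> g y" if "x \<in> carrier S" "y \<in> carrier S" for x y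
    using g(1) that unfolding graded_hom_def mod_hom_def by auto
  have hom: "eps (g (hc i s)) = (if i = j then l (hc j s) else 0)" if s: "s \<in> carrier S" for s i
  proof (cases "i = j")
    case True
    have "hc j s \<in> I" using s by (rule I2)
    then have "g (hc j s) = f (hc j s)" using g(2) by (auto simp: u_def)
    moreover have "hc j (hc j s) = hc j s" using s by (intro rp_inj) (auto simp: rp_hc intro!: poly_mapping_eqI simp: lookup_hpart)
    ultimately show ?thesis using \<open>hc j s \<in> I\<close> True by (simp add: f_def eps_\<kappa>)
  next
    case False
    have "hc i s \<in> mgrade ?N (i - j)" using hc_rgrade[OF s, of i] s by simp
    then have "g (hc i s) \<in> mgrade E (i - j)" using g(1) unfolding graded_hom_def by force
    then show ?thesis using False by (simp add: eps_grade)
  qed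
  have "eps (g s) = l (hc j s)" if s: "s \<in> carrier S" for s
  proof -
    let ?B = "insert j ((\<lambda>m. int (mdeg m)) ` keys (rp s))"
    have "finite B \<Longrightarrow> eps (g (\<Oplus>\<^bsub>S\<^esub>i\<in>B. hc i s)) = (\<Sum>i\<in>B. if i = j then l (hc j s) else 0)" for B
    proof (induction B rule: finite_induct)
      case empty
      have "g \<zero>\<^bsub>S\<^esub> = \<zero>\<^bsub>E\<^esub>" using gadd[of "\<zero>\<^bsub>S\<^esub>" "\<zero>\<^bsub>S\<^esub>"] gE[of "\<zero>\<^bsub>S\<^esub>"] by simp
      then show ?case by simp
    next
      case (insert i B)
      then show ?case using s by (auto simp: gadd gE eps_add hom)
    qed
    from this[of ?B] show ?thesis
      by (simp add: hc_finsum[OF s _ subset_insertI, symmetric])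
  qed
  then show ?thesis using gmul gE by (intro bexI[of _ "g \<one>\<^bsub>S\<^esub>"]) auto
qed

text \<open>Injectivity supplies a representing element for one degree at a time. A functional that
  vanishes in high degrees needs only finitely many of them, and their sum represents it.\<close>

lemma eps_represents:
  assumes add: "\<And>X Y. X \<in> carrier S \<Longrightarrow> Y \<in> carrier S \<Longrightarrow> l (X \<oplus>\<^bsub>S\<^esub> Y) = l X + l Y"
    and const: "\<And>c X. X \<in> carrier S \<Longrightarrow> l (con c \<otimes>\<^bsub>S\<^esub> X) = c * l X"
    and bound: "\<And>X i. X \<in> rgrade S i \<Longrightarrow> i > N \<Longrightarrow> l X = 0"
  shows "\<exists>e\<in>carrier E. \<forall>s\<in>carrier S. eps (s \<odot>\<^bsub>E\<^esub> e) = l s"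
proof -
  have "\<forall>j. \<exists>e. e \<in> carrier E \<and> (\<forall>s\<in>carrier S. eps (s \<odot>\<^bsub>E\<^esub> e) = l (hc j s))"
    using eps_represents_homogeneous[of l, OF add const] by blast
  from choice[OF this] obtain e where
    e: "\<And>j. e j \<in> carrier E" "\<And>j s. s \<in> carrier S \<Longrightarrow> eps (s \<odot>\<^bsub>E\<^esub> e j) = l (hc j s)" by blast
  have l0: "l \<zero>\<^bsub>S\<^esub> = 0" by (metis add_cancel_right_right add l_zero zero_closed)
  have "eps (s \<odot>\<^bsub>E\<^esub> (\<Oplus>\<^bsub>E\<^esub>j\<in>{0..N}. e j)) = l s" if s: "s \<in> carrier S" for s
  proof -
    let ?B = "{0..N} \<union> (\<lambda>m. int (mdeg m)) ` keys (rp s)"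
    have "s \<odot>\<^bsub>E\<^esub> (\<Oplus>\<^bsub>E\<^esub>j\<in>{0..N}. e j) = (\<Oplus>\<^bsub>E\<^esub>j\<in>{0..N}. s \<odot>\<^bsub>E\<^esub> e j)"
      using s e by (intro E.finsum_smult_ldistr) auto
    then have "eps (s \<odot>\<^bsub>E\<^esub> (\<Oplus>\<^bsub>E\<^esub>j\<in>{0..N}. e j)) = (\<Sum>j\<in>{0..N}. l (hc j s))"
      using s e by (simp add: eps_finsum)
    also have "\<dots> = (\<Sum>j\<in>?B. l (hc j s))"
    proof (rule sum.mono_neutral_left)
      show "\<forall>i\<in>?B - {0..N}. l (hc i s) = 0"
      proof
        fix i assume "i \<in> ?B - {0..N}"
        then have "i > N" by auto
        then show "l (hc i s) = 0" using bound[OF hc_rgrade[OF s]] by blast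
      qed
    qed auto
    also have "\<dots> = l (\<Oplus>\<^bsub>S\<^esub>j\<in>?B. hc j s)"
    proof -
      have "l (\<Oplus>\<^bsub>S\<^esub>j\<in>B. hc j s) = (\<Sum>j\<in>B. l (hc j s))" if "finite B" for B
        using that by induction (use s in \<open>auto simp: l0 add\<close>)
      then show ?thesis by simp
    qed
    also have "\<dots> = l s" by (simp add: hc_finsum[OF s _ Un_upper2, symmetric])
    finally show ?thesis .
  qed
  then show ?thesis using e by (intro bexI[of _ "\<Oplus>\<^bsub>E\<^esub>j\<in>{0..N}. e j"]) auto
qed

end

subsection \<open>Localization\<close>

locale localization = Module.module S M
  for S :: "'a gring" and M :: "('a, 'b) gmodule" +
  fixes f :: 'a
  assumes f_closed [simp]: "f \<in> carrier S"
begin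

abbreviation "pw i a \<equiv> f [^]\<^bsub>S\<^esub> (i::nat) \<odot>\<^bsub>M\<^esub> a"

abbreviation "L \<equiv> loc_module S M f"

abbreviation "fr a n \<equiv> mfrac S M f (a, n)"

lemma pw_pw: "a \<in> carrier M \<Longrightarrow> pw i (pw j a) = pw (i + j) a"
  by (simp add: smult_assoc1[symmetric] R.nat_pow_mult)

lemma pw_smult: "a \<in> carrier M \<Longrightarrow> s \<in> carrier S \<Longrightarrow> pw i (s \<odot>\<^bsub>M\<^esub> a) = s \<odot>\<^bsub>M\<^esub> pw i a"
  by (simp add: smult_assoc1[symmetric] R.m_comm)

lemma frac_rel_iff:
  "((a, n), (b, m)) \<in> frac_rel S M f \<longleftrightarrow> a \<in> carrier M \<and> b \<in> carrier M \<and> (\<exists>k. pw (k + m) a = pw (k + n) b)"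
  by (auto simp: frac_rel_def pw_pw)

lemma equiv_frac_rel: "equiv (carrier M \<times> UNIV) (frac_rel S M f)"
proof (rule equivI)
  show "frac_rel S M f \<subseteq> (carrier M \<times> UNIV) \<times> (carrier M \<times> UNIV)"
    by (auto simp: frac_rel_def)
  show "refl_on (carrier M \<times> UNIV) (frac_rel S M f)"
    by (auto simp: refl_on_def frac_rel_iff)
  show "sym (frac_rel S M f)"
    by (rule symI) (auto simp: frac_rel_iff, metis)
  show "trans (frac_rel S M f)"
  proof (rule transI, clarsimp simp: frac_rel_iff)
    fix a n b m c p k l
    assume a: "a \<in> carrier M" "b \<in> carrier M" "c \<in> carrier M"
      and k: "pw (k + m) a = pw (k + n) b" and l: "pw (l + p) b = pw (l + m) c"
    have "pw ((l + k + m) + p) a = pw (l + p) (pw (k + m) a)"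
      using a by (simp add: pw_pw add_ac)
    also have "\<dots> = pw (k + n) (pw (l + p) b)"
      unfolding k using a by (simp add: pw_pw add_ac)
    also have "\<dots> = pw ((l + k + m) + n) c"
      unfolding l using a by (simp add: pw_pw add_ac)
    finally show "\<exists>k. pw (k + p) a = pw (k + n) c" by blast
  qed
qed

lemma fr_eq_iff:
  assumes "a \<in> carrier M" "b \<in> carrier M"
  shows "fr a n = fr b m \<longleftrightarrow> (\<exists>k. pw (k + m) a = pw (k + n) b)"
  unfolding mfrac_def
  using eq_equiv_class_iff[OF equiv_frac_rel, of "(a, n)" "(b, m)"] assms by (simp add: frac_rel_iff)

lemma mem_fr:
  assumes "a \<in> carrier M"
  shows "(b, m) \<in> fr a n \<longleftrightarrow> b \<in> carrier M \<and> fr b m = fr a n"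
  using assms fr_eq_iff[of a b n m] by (auto simp: mfrac_def frac_rel_iff)

lemma fr_self: "a \<in> carrier M \<Longrightarrow> (a, n) \<in> fr a n"
  by (simp add: mem_fr)

lemma carrier_L: "carrier L = {fr a n | a n. a \<in> carrier M}"
  by (auto simp: loc_module_def quotient_def mfrac_def)

lemma fr_closed [simp]: "a \<in> carrier M \<Longrightarrow> fr a n \<in> carrier L"
  by (auto simp: carrier_L)

lemma L_cases:
  assumes "X \<in> carrier L"
  obtains a n where "a \<in> carrier M" "X = fr a n"
  using assms by (auto simp: carrier_L)

lemma fr_expand: "a \<in> carrier M \<Longrightarrow> fr (pw k a) (n + k) = fr a n"
  by (subst fr_eq_iff) (auto simp: pw_pw add_ac)

text \<open>Addition in the localization is a union over all pairs of representatives; every pair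
  yields the same class, so the union collapses.\<close>

lemma fr_add:
  assumes "a \<in> carrier M" "b \<in> carrier M"
  shows "fr a n \<oplus>\<^bsub>L\<^esub> fr b m = fr (pw m a \<oplus>\<^bsub>M\<^esub> pw n b) (n + m)"
proof -
  have *: "fr (pw m' a' \<oplus>\<^bsub>M\<^esub> pw n' b') (n' + m') = fr (pw m a \<oplus>\<^bsub>M\<^esub> pw n b) (n + m)"
    if h: "(a', n') \<in> fr a n" "(b', m') \<in> fr b m" for a' n' b' m'
  proof -
    have c: "a' \<in> carrier M" "b' \<in> carrier M" using h assms by (auto simp: mem_fr)
    obtain k where k: "pw (k + n) a' = pw (k + n') a" using h assms c by (auto simp: mem_fr fr_eq_iff)
    obtain l where l: "pw (l + m) b' = pw (l + m') b" using h assms c by (auto simp: mem_fr fr_eq_iff)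
    have "pw ((k + l) + (n + m)) (pw m' a') = pw (l + m + m') (pw (k + n) a')"
      using c by (simp add: pw_pw add_ac)
    also have "\<dots> = pw ((k + l) + (n' + m')) (pw m a)"
      unfolding k using assms by (simp add: pw_pw add_ac)
    finally have 1: "pw ((k + l) + (n + m)) (pw m' a') = pw ((k + l) + (n' + m')) (pw m a)" .
    have "pw ((k + l) + (n + m)) (pw n' b') = pw (k + n + n') (pw (l + m) b')"
      using c by (simp add: pw_pw add_ac)
    also have "\<dots> = pw ((k + l) + (n' + m')) (pw n b)"
      unfolding l using assms by (simp add: pw_pw add_ac)
    finally have 2: "pw ((k + l) + (n + m)) (pw n' b') = pw ((k + l) + (n' + m')) (pw n b)" .
    show ?thesis
      using assms c 1 2 by (subst fr_eq_iff) (auto simp: smult_r_distr intro!: exI[of _ "k + l"])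
  qed
  have "fr a n \<oplus>\<^bsub>L\<^esub> fr b m =
      (\<Union>(a', n')\<in>fr a n. \<Union>(b', m')\<in>fr b m. fr (pw m' a' \<oplus>\<^bsub>M\<^esub> pw n' b') (n' + m'))"
    by (simp add: loc_module_def)
  also have "\<dots> = (\<Union>p\<in>fr a n. \<Union>q\<in>fr b m. fr (pw m a \<oplus>\<^bsub>M\<^esub> pw n b) (n + m))"
    by (intro SUP_cong refl) (auto simp: * split: prod.splits)
  also have "\<dots> = fr (pw m a \<oplus>\<^bsub>M\<^esub> pw n b) (n + m)"
    using fr_self[OF assms(1), of n] fr_self[OF assms(2), of m] by auto
  finally show ?thesis .
qed

lemma fr_smult:
  assumes "a \<in> carrier M" "s \<in> carrier S"
  shows "s \<odot>\<^bsub>L\<^esub> fr a n = fr (s \<odot>\<^bsub>M\<^esub> a) n"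
proof -
  have *: "fr (s \<odot>\<^bsub>M\<^esub> a') n' = fr (s \<odot>\<^bsub>M\<^esub> a) n" if h: "(a', n') \<in> fr a n" for a' n'
  proof -
    have c: "a' \<in> carrier M" using h assms by (auto simp: mem_fr)
    obtain k where k: "pw (k + n) a' = pw (k + n') a" using h assms c by (auto simp: mem_fr fr_eq_iff)
    then show ?thesis using assms c by (subst fr_eq_iff) (auto simp: pw_smult intro!: exI[of _ k])
  qed
  have "s \<odot>\<^bsub>L\<^esub> fr a n = (\<Union>(a', n')\<in>fr a n. fr (s \<odot>\<^bsub>M\<^esub> a') n')"
    by (simp add: loc_module_def)
  also have "\<dots> = (\<Union>p\<in>fr a n. fr (s \<odot>\<^bsub>M\<^esub> a) n)"
    by (intro SUP_cong refl) (auto simp: * split: prod.splits)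
  also have "\<dots> = fr (s \<odot>\<^bsub>M\<^esub> a) n"
    using fr_self[OF assms(1), of n] by auto
  finally show ?thesis .
qed

lemma L_zero: "\<zero>\<^bsub>L\<^esub> = fr \<zero>\<^bsub>M\<^esub> 0"
  by (simp add: loc_module_def)

lemma fr_zero: "fr \<zero>\<^bsub>M\<^esub> n = \<zero>\<^bsub>L\<^esub>"
  unfolding L_zero by (subst fr_eq_iff) auto

lemma fr_add_same:
  assumes "a \<in> carrier M" "b \<in> carrier M"
  shows "fr a n \<oplus>\<^bsub>L\<^esub> fr b n = fr (a \<oplus>\<^bsub>M\<^esub> b) n"
  using assms fr_expand[of "a \<oplus>\<^bsub>M\<^esub> b" n n] by (simp add: fr_add smult_r_distr)

lemma common_denominator:
  assumes "X \<in> carrier L" "Y \<in> carrier L"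
  obtains a b n where "a \<in> carrier M" "b \<in> carrier M" "X = fr a n" "Y = fr b n"
proof -
  obtain a n where a: "a \<in> carrier M" "X = fr a n" using assms(1) by (rule L_cases)
  obtain b m where b: "b \<in> carrier M" "Y = fr b m" using assms(2) by (rule L_cases)
  show ?thesis
    using that[of "pw m a" "pw n b" "n + m"] a b fr_expand[of a m n] fr_expand[of b n m]
    by (simp add: add.commute)
qed

lemma abelian_group_L: "abelian_group L"
proof (rule abelian_groupI)
  fix X Y assume "X \<in> carrier L" "Y \<in> carrier L"
  then obtain a b n where ab: "a \<in> carrier M" "b \<in> carrier M" "X = fr a n" "Y = fr b n"
    by (rule common_denominator)
  then show "X \<oplus>\<^bsub>L\<^esub> Y \<in> carrier L" "X \<oplus>\<^bsub>L\<^esub> Y = Y \<oplus>\<^bsub>L\<^esub> X"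
    by (simp_all add: fr_add_same M.a_comm)
next
  fix X Y Z assume XYZ: "X \<in> carrier L" "Y \<in> carrier L" "Z \<in> carrier L"
  obtain a b n where ab: "a \<in> carrier M" "b \<in> carrier M" "X = fr a n" "Y = fr b n"
    using XYZ(1,2) by (rule common_denominator)
  obtain c m where c: "c \<in> carrier M" "Z = fr c m" using XYZ(3) by (rule L_cases)
  have e: "X = fr (pw m a) (n + m)" "Y = fr (pw m b) (n + m)" "Z = fr (pw n c) (n + m)"
    using ab c fr_expand[of _ m n] fr_expand[of c n m] by (simp_all add: add.commute)
  show "X \<oplus>\<^bsub>L\<^esub> Y \<oplus>\<^bsub>L\<^esub> Z = X \<oplus>\<^bsub>L\<^esub> (Y \<oplus>\<^bsub>L\<^esub> Z)"
    unfolding e using ab c by (simp add: fr_add_same M.a_assoc)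
next
  fix X assume "X \<in> carrier L"
  then obtain a n where a: "a \<in> carrier M" "X = fr a n" by (rule L_cases)
  show "\<zero>\<^bsub>L\<^esub> \<oplus>\<^bsub>L\<^esub> X = X"
    using a fr_add_same[of "\<zero>\<^bsub>M\<^esub>" a n] by (simp add: fr_zero)
  show "\<exists>Y\<in>carrier L. Y \<oplus>\<^bsub>L\<^esub> X = \<zero>\<^bsub>L\<^esub>"
    using a fr_add_same[of "\<ominus>\<^bsub>M\<^esub> a" a n] by (intro bexI[of _ "fr (\<ominus>\<^bsub>M\<^esub> a) n"]) (simp_all add: fr_zero M.l_neg)
qed (simp add: L_zero)

lemma module_L: "Module.module S L"
proof (rule moduleI)
  fix s X Y assume s: "s \<in> carrier S" and "X \<in> carrier L" "Y \<in> carrier L"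
  then obtain a b n where ab: "a \<in> carrier M" "b \<in> carrier M" "X = fr a n" "Y = fr b n"
    using common_denominator by blast
  then show "s \<odot>\<^bsub>L\<^esub> (X \<oplus>\<^bsub>L\<^esub> Y) = s \<odot>\<^bsub>L\<^esub> X \<oplus>\<^bsub>L\<^esub> s \<odot>\<^bsub>L\<^esub> Y"
    using s by (simp add: fr_add_same fr_smult smult_r_distr)
qed (auto elim!: L_cases simp: fr_smult fr_add_same smult_l_distr smult_assoc1 abelian_group_L R.is_cring)

lemma loc_map_fr:
  assumes "a \<in> carrier M" and g: "g \<in> carrier S"
  shows "loc_map S M f g (fr a n) = mfrac S M (f \<otimes>\<^bsub>S\<^esub> g) (g [^]\<^bsub>S\<^esub> n \<odot>\<^bsub>M\<^esub> a, n)"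
proof -
  interpret g: localization S M g by unfold_locales (rule g)
  interpret fg: localization S M "f \<otimes>\<^bsub>S\<^esub> g" by unfold_locales (simp add: g)
  have pw: "fg.pw i a = pw i (g.pw i a)" if "a \<in> carrier M" for i a
    using that g by (simp add: R.nat_pow_distrib smult_assoc1)
  have comm: "g.pw i (pw j a) = pw j (g.pw i a)" if "a \<in> carrier M" for i j a
    using that g by (simp add: pw_smult)
  have *: "fg.fr (g.pw n' a') n' = fg.fr (g.pw n a) n" if h: "(a', n') \<in> fr a n" for a' n'
  proof -
    have c: "a' \<in> carrier M" using h assms by (auto simp: mem_fr)
    obtain k where k: "pw (k + n) a' = pw (k + n') a" using h assms c by (auto simp: mem_fr fr_eq_iff)
    have "fg.pw (k + n) (g.pw n' a') = g.pw (k + n + n') (pw (k + n) a')"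
      using c g by (simp add: pw comm g.pw_pw add_ac)
    also have "\<dots> = fg.pw (k + n') (g.pw n a)"
      unfolding k using assms g by (simp add: pw comm g.pw_pw add_ac)
    finally show ?thesis using assms c by (subst fg.fr_eq_iff) auto
  qed
  have "loc_map S M f g (fr a n) = (\<Union>(a', n')\<in>fr a n. fg.fr (g.pw n' a') n')"
    by (simp add: loc_map_def)
  also have "\<dots> = (\<Union>p\<in>fr a n. fg.fr (g.pw n a) n)"
    by (intro SUP_cong refl) (auto simp: * split: prod.splits)
  also have "\<dots> = fg.fr (g.pw n a) n"
    using fr_self[OF assms(1), of n] by auto
  finally show ?thesis .
qed

lemma loc_map_hom:
  assumes g: "g \<in> carrier S" and X: "X \<in> carrier L"
  shows "loc_map S M f g X \<in> carrier (loc_module S M (f \<otimes>\<^bsub>S\<^esub> g))"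
    and "Y \<in> carrier L \<Longrightarrow> loc_map S M f g (X \<oplus>\<^bsub>L\<^esub> Y) =
      loc_map S M f g X \<oplus>\<^bsub>loc_module S M (f \<otimes>\<^bsub>S\<^esub> g)\<^esub> loc_map S M f g Y"
    and "s \<in> carrier S \<Longrightarrow> loc_map S M f g (s \<odot>\<^bsub>L\<^esub> X) =
      s \<odot>\<^bsub>loc_module S M (f \<otimes>\<^bsub>S\<^esub> g)\<^esub> loc_map S M f g X"
proof -
  interpret g: localization S M g by unfold_locales (rule g)
  interpret fg: localization S M "f \<otimes>\<^bsub>S\<^esub> g" by unfold_locales (simp add: g)
  obtain a n where a: "a \<in> carrier M" "X = fr a n" using X by (rule L_cases)
  then show "loc_map S M f g X \<in> carrier fg.L" using g by (simp add: loc_map_fr)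
  show "loc_map S M f g (s \<odot>\<^bsub>L\<^esub> X) = s \<odot>\<^bsub>fg.L\<^esub> loc_map S M f g X" if "s \<in> carrier S"
    using a that g by (simp add: loc_map_fr fr_smult fg.fr_smult g.pw_smult)
  show "loc_map S M f g (X \<oplus>\<^bsub>L\<^esub> Y) = loc_map S M f g X \<oplus>\<^bsub>fg.L\<^esub> loc_map S M f g Y" if Y: "Y \<in> carrier L"
  proof -
    obtain a b n where "a \<in> carrier M" "b \<in> carrier M" "X = fr a n" "Y = fr b n"
      using X Y by (rule common_denominator)
    then show ?thesis using g by (simp add: loc_map_fr fr_add_same fg.fr_add_same smult_r_distr)
  qed
qed

end

subsection \<open>The Cech complex\<close>

lemma prod_module_simps [simp]:
  "carrier (prod_module I M) = (\<Pi>\<^sub>E j\<in>I. carrier (M j))" "zero (prod_module I M) = (\<lambda>j\<in>I. \<zero>\<^bsub>M j\<^esub>)"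
  "c \<oplus>\<^bsub>prod_module I M\<^esub> c' = (\<lambda>j\<in>I. c j \<oplus>\<^bsub>M j\<^esub> c' j)"
  "s \<odot>\<^bsub>prod_module I M\<^esub> c = (\<lambda>j\<in>I. s \<odot>\<^bsub>M j\<^esub> c j)"
  "mgrade (prod_module I M) d = (\<Pi>\<^sub>E j\<in>I. mgrade (M j) d)"
  by (auto simp: prod_module_def)

lemma prod_module_module:
  assumes "cring S" "\<And>j. j \<in> I \<Longrightarrow> Module.module S (M j)"
  shows "Module.module S (prod_module I M)"
proof (rule moduleI)
  have ag: "abelian_group (M j)" if "j \<in> I" for j
    using assms(2)[OF that] by (simp add: Module.module_def)
  have ag': "abelian_monoid (M j)" if "j \<in> I" for j
    using ag[OF that] by (simp add: abelian_group_def)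
  note cl = abelian_monoid.a_closed[OF ag'] abelian_monoid.zero_closed[OF ag'] abelian_group.a_inv_closed[OF ag]
    module.smult_closed[OF assms(2)]
  show "abelian_group (prod_module I M)"
  proof (rule abelian_groupI)
    fix x assume x: "x \<in> carrier (prod_module I M)"
    then show "\<exists>y\<in>carrier (prod_module I M). y \<oplus>\<^bsub>prod_module I M\<^esub> x = \<zero>\<^bsub>prod_module I M\<^esub>"
      by (intro bexI[of _ "\<lambda>j\<in>I. \<ominus>\<^bsub>M j\<^esub> x j"])
        (auto intro!: restrict_ext abelian_group.l_neg[OF ag] simp: cl PiE_iff)
    show "\<zero>\<^bsub>prod_module I M\<^esub> \<oplus>\<^bsub>prod_module I M\<^esub> x = x"
      using x by (intro extensionalityI[of _ I]) (auto simp: PiE_iff abelian_monoid.l_zero[OF ag'])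
  qed (auto simp: cl PiE_iff abelian_monoid.a_assoc[OF ag'] abelian_monoid.a_comm[OF ag'] abelian_monoid.a_lcomm[OF ag'] intro!: restrict_ext)
  show "\<one>\<^bsub>S\<^esub> \<odot>\<^bsub>prod_module I M\<^esub> x = x" if "x \<in> carrier (prod_module I M)" for x
    using that by (intro extensionalityI[of _ I]) (auto simp: PiE_iff module.smult_one[OF assms(2)])
qed (auto simp: PiE_iff module.smult_closed[OF assms(2)] module.smult_l_distr[OF assms(2)] module.smult_r_distr[OF assms(2)]
      module.smult_assoc1[OF assms(2)] assms(1) intro!: restrict_ext)

lemma cech_index_minus: "finite V \<Longrightarrow> J \<in> cech_index V (Suc i) \<Longrightarrow> j \<in> J \<Longrightarrow> J - {j} \<in> cech_index V i"
  by (auto simp: cech_index_def card_Diff_singleton_if dest: finite_subset)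

locale cech = Module.module S M
  for S :: "'a gring" and M :: "('a, 'b) gmodule" +
  fixes V :: "'v::linorder set" and x :: "'v \<Rightarrow> 'a"
  assumes finite_V: "finite V" and x_closed: "v \<in> V \<Longrightarrow> x v \<in> carrier S"
begin

abbreviation "xx J \<equiv> finprod S x J"

abbreviation "L \<equiv> cech_loc S x M"

abbreviation "C i \<equiv> cech_module S V x M i"

lemma xx_closed: "J \<in> cech_index V i \<Longrightarrow> xx J \<in> carrier S"
  using x_closed by (intro R.finprod_closed) (auto simp: cech_index_def)

lemma xx_remove:
  assumes "J \<in> cech_index V i" "j \<in> J"
  shows "xx (J - {j}) \<otimes>\<^bsub>S\<^esub> x j = xx J"
proof -
  have J: "finite J" "J \<subseteq> V" using assms finite_V by (auto simp: cech_index_def dest: finite_subset)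
  have "xx (insert j (J - {j})) = x j \<otimes>\<^bsub>S\<^esub> xx (J - {j})"
    using J assms x_closed by (intro R.finprod_insert) auto
  moreover have "xx (J - {j}) \<in> carrier S" using J x_closed by (intro R.finprod_closed) auto
  ultimately show ?thesis using assms J x_closed by (simp add: insert_absorb R.m_comm subset_iff)
qed

lemma loc_J: "J \<in> cech_index V i \<Longrightarrow> localization S M (xx J)"
  by unfold_locales (rule xx_closed)

lemma module_loc: "J \<in> cech_index V i \<Longrightarrow> Module.module S (L J)"
  unfolding cech_loc_def by (rule localization.module_L[OF loc_J])

lemma module_C: "Module.module S (C i)"
  unfolding cech_module_def by (intro prod_module_module module_loc R.is_cring)

lemma C_simps [simp]:
  "carrier (C i) = (\<Pi>\<^sub>E J\<in>cech_index V i. carrier (L J))" "zero (C i) = (\<lambda>J\<in>cech_index V i. \<zero>\<^bsub>L J\<^esub>)"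
  "c \<oplus>\<^bsub>C i\<^esub> c' = (\<lambda>J\<in>cech_index V i. c J \<oplus>\<^bsub>L J\<^esub> c' J)"
  "s \<odot>\<^bsub>C i\<^esub> c = (\<lambda>J\<in>cech_index V i. s \<odot>\<^bsub>L J\<^esub> c J)"
  "mgrade (C i) d = (\<Pi>\<^sub>E J\<in>cech_index V i. mgrade (L J) d)"
  by (simp_all add: cech_module_def)

text \<open>One signed term of the differential, isolated so that linearity of the differential
  reduces to that of a single localization map.\<close>

definition face_map :: "'v set \<Rightarrow> 'v \<Rightarrow> ('b \<times> nat) set \<Rightarrow> ('b \<times> nat) set" where
  "face_map J j X = (let y = loc_map S M (xx (J - {j})) (x j) X
     in if even (card {k \<in> J. k < j}) then y else \<ominus>\<^bsub>L J\<^esub> y)"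

lemma cech_diff_eq:
  "cech_diff S V x M i c = (\<lambda>J\<in>cech_index V (Suc i). \<Oplus>\<^bsub>L J\<^esub>j\<in>J. face_map J j (c (J - {j})))"
  unfolding cech_diff_def face_map_def ..

lemma face_map:
  assumes J: "J \<in> cech_index V (Suc i)" and j: "j \<in> J" and X: "X \<in> carrier (L (J - {j}))"
  shows "face_map J j X \<in> carrier (L J)"
    and "Y \<in> carrier (L (J - {j})) \<Longrightarrow> face_map J j (X \<oplus>\<^bsub>L (J - {j})\<^esub> Y) = face_map J j X \<oplus>\<^bsub>L J\<^esub> face_map J j Y"
    and "s \<in> carrier S \<Longrightarrow> face_map J j (s \<odot>\<^bsub>L (J - {j})\<^esub> X) = s \<odot>\<^bsub>L J\<^esub> face_map J j X"
proof -
  have J': "J - {j} \<in> cech_index V i" using cech_index_minus[OF finite_V J j] .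
  interpret l: localization S M "xx (J - {j})" by (rule loc_J[OF J'])
  interpret LJ: Module.module S "L J" by (rule module_loc[OF J])
  have xj: "x j \<in> carrier S" using J j x_closed by (auto simp: cech_index_def)
  have L: "L J = loc_module S M (xx (J - {j}) \<otimes>\<^bsub>S\<^esub> x j)"
    using xx_remove[OF J j] by (simp add: cech_loc_def)
  have X': "X \<in> carrier l.L" using X by (simp add: cech_loc_def)
  note h = l.loc_map_hom[OF xj, folded L]
  show "face_map J j X \<in> carrier (L J)"
    using h(1)[OF X'] by (simp add: face_map_def Let_def)
  show "face_map J j (X \<oplus>\<^bsub>L (J - {j})\<^esub> Y) = face_map J j X \<oplus>\<^bsub>L J\<^esub> face_map J j Y" if "Y \<in> carrier (L (J - {j}))"
    using h(1,2)[OF X'] h(1)[of Y] that by (simp add: face_map_def Let_def cech_loc_def[of _ _ _ "J - {j}"] LJ.M.minus_add LJ.M.a_comm)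
  show "face_map J j (s \<odot>\<^bsub>L (J - {j})\<^esub> X) = s \<odot>\<^bsub>L J\<^esub> face_map J j X" if "s \<in> carrier S"
    using h(1,3)[OF X'] that by (simp add: face_map_def Let_def cech_loc_def[of _ _ _ "J - {j}"] LJ.smult_r_minus)
qed

lemma cech_diff_hom:
  assumes c: "c \<in> carrier (C i)"
  shows "cech_diff S V x M i c \<in> carrier (C (Suc i))"
    and "c' \<in> carrier (C i) \<Longrightarrow> cech_diff S V x M i (c \<oplus>\<^bsub>C i\<^esub> c') = cech_diff S V x M i c \<oplus>\<^bsub>C (Suc i)\<^esub> cech_diff S V x M i c'"
    and "s \<in> carrier S \<Longrightarrow> cech_diff S V x M i (s \<odot>\<^bsub>C i\<^esub> c) = s \<odot>\<^bsub>C (Suc i)\<^esub> cech_diff S V x M i c"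
proof -
  have cl: "(\<lambda>j. face_map J j (c (J - {j}))) \<in> J \<rightarrow> carrier (L J)" if "J \<in> cech_index V (Suc i)" "c \<in> carrier (C i)" for J c
    using that cech_index_minus[OF finite_V that(1)] face_map(1)[OF that(1)] by (auto simp: PiE_iff)
  show "cech_diff S V x M i c \<in> carrier (C (Suc i))"
  proof -
    have "(\<Oplus>\<^bsub>L J\<^esub>j\<in>J. face_map J j (c (J - {j}))) \<in> carrier (L J)" if J: "J \<in> cech_index V (Suc i)" for J
    proof -
      interpret LJ: Module.module S "L J" by (rule module_loc[OF J])
      show ?thesis using cl[OF J c] by (rule LJ.M.finsum_closed)
    qed
    then show ?thesis by (simp add: cech_diff_eq)
  qed
  show "cech_diff S V x M i (c \<oplus>\<^bsub>C i\<^esub> c') = cech_diff S V x M i c \<oplus>\<^bsub>C (Suc i)\<^esub> cech_diff S V x M i c'"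
    if c': "c' \<in> carrier (C i)"
  proof -
    have "(\<Oplus>\<^bsub>L J\<^esub>j\<in>J. face_map J j ((c \<oplus>\<^bsub>C i\<^esub> c') (J - {j}))) =
      (\<Oplus>\<^bsub>L J\<^esub>j\<in>J. face_map J j (c (J - {j}))) \<oplus>\<^bsub>L J\<^esub> (\<Oplus>\<^bsub>L J\<^esub>j\<in>J. face_map J j (c' (J - {j})))"
      if J: "J \<in> cech_index V (Suc i)" for J
    proof -
      interpret LJ: Module.module S "L J" by (rule module_loc[OF J])
      note mm = cech_index_minus[OF finite_V J]
      have e: "face_map J j ((c \<oplus>\<^bsub>C i\<^esub> c') (J - {j})) = face_map J j (c (J - {j})) \<oplus>\<^bsub>L J\<^esub> face_map J j (c' (J - {j}))"
        if j: "j \<in> J" for j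
        using mm[OF j] c c' face_map(2)[OF J j, of "c (J - {j})" "c' (J - {j})"] by (auto simp: PiE_iff)
      have "(\<Oplus>\<^bsub>L J\<^esub>j\<in>J. face_map J j ((c \<oplus>\<^bsub>C i\<^esub> c') (J - {j}))) =
        (\<Oplus>\<^bsub>L J\<^esub>j\<in>J. face_map J j (c (J - {j})) \<oplus>\<^bsub>L J\<^esub> face_map J j (c' (J - {j})))"
        using cl[OF J c] cl[OF J c'] by (intro LJ.M.finsum_cong') (auto simp: e simp del: C_simps)
      also have "\<dots> = (\<Oplus>\<^bsub>L J\<^esub>j\<in>J. face_map J j (c (J - {j}))) \<oplus>\<^bsub>L J\<^esub> (\<Oplus>\<^bsub>L J\<^esub>j\<in>J. face_map J j (c' (J - {j})))"
        using cl[OF J c] cl[OF J c'] by (rule LJ.M.finsum_addf)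
      finally show ?thesis .
    qed
    then show ?thesis unfolding cech_diff_eq C_simps(3)[where i = "Suc i"] by (intro restrict_ext) (simp del: C_simps)
  qed
  show "cech_diff S V x M i (s \<odot>\<^bsub>C i\<^esub> c) = s \<odot>\<^bsub>C (Suc i)\<^esub> cech_diff S V x M i c"
    if s: "s \<in> carrier S"
  proof -
    have "(\<Oplus>\<^bsub>L J\<^esub>j\<in>J. face_map J j ((s \<odot>\<^bsub>C i\<^esub> c) (J - {j}))) = s \<odot>\<^bsub>L J\<^esub> (\<Oplus>\<^bsub>L J\<^esub>j\<in>J. face_map J j (c (J - {j})))"
      if J: "J \<in> cech_index V (Suc i)" for J
    proof -
      interpret LJ: Module.module S "L J" by (rule module_loc[OF J])
      note mm = cech_index_minus[OF finite_V J]
      have e: "face_map J j ((s \<odot>\<^bsub>C i\<^esub> c) (J - {j})) = s \<odot>\<^bsub>L J\<^esub> face_map J j (c (J - {j}))"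
        if j: "j \<in> J" for j
        using mm[OF j] c s face_map(3)[OF J j, of "c (J - {j})" s] by (auto simp: PiE_iff)
      have "(\<Oplus>\<^bsub>L J\<^esub>j\<in>J. face_map J j ((s \<odot>\<^bsub>C i\<^esub> c) (J - {j}))) =
        (\<Oplus>\<^bsub>L J\<^esub>j\<in>J. s \<odot>\<^bsub>L J\<^esub> face_map J j (c (J - {j})))"
        using cl[OF J c] s by (intro LJ.M.finsum_cong') (auto simp: e simp del: C_simps)
      also have "\<dots> = s \<odot>\<^bsub>L J\<^esub> (\<Oplus>\<^bsub>L J\<^esub>j\<in>J. face_map J j (c (J - {j})))"
        using cl[OF J c] s J finite_V by (intro LJ.finsum_smult_ldistr[symmetric]) (auto simp: cech_index_def dest: finite_subset)
      finally show ?thesis .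
    qed
    then show ?thesis unfolding cech_diff_eq C_simps(4)[where i = "Suc i"] by (intro restrict_ext) (simp del: C_simps)
  qed
qed

lemma boundaries_submodule:
  "cech_boundaries S V x M i \<subseteq> carrier (C i)" "\<zero>\<^bsub>C i\<^esub> \<in> cech_boundaries S V x M i"
  "c \<in> cech_boundaries S V x M i \<Longrightarrow> c' \<in> cech_boundaries S V x M i \<Longrightarrow> c \<oplus>\<^bsub>C i\<^esub> c' \<in> cech_boundaries S V x M i"
  "s \<in> carrier S \<Longrightarrow> c \<in> cech_boundaries S V x M i \<Longrightarrow> s \<odot>\<^bsub>C i\<^esub> c \<in> cech_boundaries S V x M i"
proof -
  interpret Ci: Module.module S "C i" by (rule module_C)
  have z: "cech_diff S V x M k \<zero>\<^bsub>C k\<^esub> = \<zero>\<^bsub>C (Suc k)\<^esub>" for k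
  proof -
    interpret Ck: Module.module S "C k" by (rule module_C)
    interpret Ck': Module.module S "C (Suc k)" by (rule module_C)
    have "cech_diff S V x M k (\<zero>\<^bsub>S\<^esub> \<odot>\<^bsub>C k\<^esub> \<zero>\<^bsub>C k\<^esub>) = \<zero>\<^bsub>S\<^esub> \<odot>\<^bsub>C (Suc k)\<^esub> cech_diff S V x M k \<zero>\<^bsub>C k\<^esub>"
      by (rule cech_diff_hom(3)) (auto simp del: C_simps)
    then show ?thesis using cech_diff_hom(1)[OF Ck.M.zero_closed] by (simp del: C_simps)
  qed
  show "cech_boundaries S V x M i \<subseteq> carrier (C i)"
    by (cases i) (use cech_diff_hom(1) Ci.M.zero_closed in \<open>auto simp: cech_boundaries_def simp del: C_simps\<close>)
  show "\<zero>\<^bsub>C i\<^esub> \<in> cech_boundaries S V x M i"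
  proof (cases i)
    case (Suc k)
    interpret Ck: Module.module S "C k" by (rule module_C)
    show ?thesis using z[of k] Ck.M.zero_closed Suc by (auto simp: cech_boundaries_def simp del: C_simps intro!: image_eqI[of _ _ "\<zero>\<^bsub>C k\<^esub>"])
  qed (simp add: cech_boundaries_def del: C_simps)
  show "c \<oplus>\<^bsub>C i\<^esub> c' \<in> cech_boundaries S V x M i"
    if h: "c \<in> cech_boundaries S V x M i" "c' \<in> cech_boundaries S V x M i"
  proof (cases i)
    case 0
    then show ?thesis using h Ci.M.zero_closed Ci.M.l_zero by (simp add: cech_boundaries_def del: C_simps)
  next
    case (Suc k)
    interpret Ck: Module.module S "C k" by (rule module_C)
    obtain b b' where b: "b \<in> carrier (C k)" "c = cech_diff S V x M k b" "b' \<in> carrier (C k)" "c' = cech_diff S V x M k b'"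
      using h Suc by (auto simp: cech_boundaries_def simp del: C_simps)
    then have "c \<oplus>\<^bsub>C (Suc k)\<^esub> c' = cech_diff S V x M k (b \<oplus>\<^bsub>C k\<^esub> b')" using cech_diff_hom(2) by (simp del: C_simps)
    then show ?thesis using Suc b Ck.M.a_closed by (auto simp: cech_boundaries_def simp del: C_simps)
  qed
  show "s \<odot>\<^bsub>C i\<^esub> c \<in> cech_boundaries S V x M i" if h: "s \<in> carrier S" "c \<in> cech_boundaries S V x M i"
  proof (cases i)
    case 0
    then show ?thesis using h Ci.smult_r_null by (simp add: cech_boundaries_def del: C_simps)
  next
    case (Suc k)
    interpret Ck: Module.module S "C k" by (rule module_C)
    obtain b where b: "b \<in> carrier (C k)" "c = cech_diff S V x M k b"
      using h Suc by (auto simp: cech_boundaries_def simp del: C_simps)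
    then have "s \<odot>\<^bsub>C (Suc k)\<^esub> c = cech_diff S V x M k (s \<odot>\<^bsub>C k\<^esub> b)" using h cech_diff_hom(3) by (simp del: C_simps)
    then show ?thesis using Suc b Ck.smult_closed h by (auto simp: cech_boundaries_def simp del: C_simps)
  qed
qed

end

subsection \<open>The Cech complex of a Stanley--Reisner ring\<close>

text \<open>The Cech sign as a scalar, so that it can be absorbed into the numerator of a
  fraction.\<close>

definition bsign :: "'v::linorder set \<Rightarrow> 'v \<Rightarrow> 'k::field" where
  "bsign F v = (if even (card {k \<in> F. k < v}) then 1 else - 1)"

lemma bsign_nonzero [simp]: "bsign F v \<noteq> 0"
  by (simp add: bsign_def)

text \<open>The exponent of the denominators in the localization at \<open>J\<close>: the product of
  the variables of \<open>J\<close>, raised to the power \<open>n\<close>.\<close>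

abbreviation xm :: "'v set \<Rightarrow> nat \<Rightarrow> ('v \<Rightarrow>\<^sub>0 nat)" where
  "xm J n \<equiv> mprod (\<lambda>_. n) J"

lemma xm_add: "xm J (n + m) = xm J n + xm J m"
  by (simp add: mprod_def single_add sum.distrib)

lemma xm_0 [simp]: "xm J 0 = 0"
  by (simp add: mprod_def)

lemma keys_xm: "finite J \<Longrightarrow> keys (xm J n) \<subseteq> J"
  by (auto simp: in_keys_iff lookup_mprod split: if_splits)

lemma xm_insert: "finite J \<Longrightarrow> v \<notin> J \<Longrightarrow> xm (insert v J) n = single v n + xm J n"
  by (simp add: mprod_def)

lemma mdeg_xm: "finite J \<Longrightarrow> mdeg (xm J n) = n * card J"
  by (induction J rule: finite_induct) (simp_all add: xm_insert mdeg_add mprod_def[of _ "{}"])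

lemma divides_xm:
  assumes "finite J" "keys m \<subseteq> J" "\<And>v. lookup m v \<le> n"
  shows "xm J n = (xm J n - m) + m" "keys (xm J n - m) \<subseteq> J"
proof -
  show "xm J n = (xm J n - m) + m"
    using assms by (intro poly_mapping_eqI)
      (auto simp: lookup_add lookup_minus lookup_mprod in_keys_iff subset_iff)
  then show "keys (xm J n - m) \<subseteq> J"
    using keys_xm[OF assms(1), of n] by (metis keys_add_nat le_sup_iff)
qed

context SR
begin

sublocale K: cech S "regular_module S" V "\<lambda>v. cl (pvar v)"
  by (intro cech.intro module_S cech_axioms.intro) (auto simp: finite_V polys_closed)

lemma xx_eq:
  assumes "J \<subseteq> V"
  shows "K.xx J [^]\<^bsub>S\<^esub> (n::nat) = cl (single (xm J n) 1)"
proof -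
  have J: "finite J" using assms finite_V by (rule finite_subset)
  have "K.xx J = cl (\<Prod>v\<in>J. pvar v)" using assms J by (intro cl_finprod) (auto intro: polys_pvar)
  also have "\<dots> = cl (single (xm J 1) 1)" using J by (simp add: prod_pvar)
  finally have *: "K.xx J = cl (single (xm J 1) 1)" .
  have sP: "single (xm J 1) 1 \<in> P" using keys_xm[OF J, of 1] assms by (intro polys_single) auto
  have "single (xm J 1) (1::'k) ^ n = single (xm J n) 1"
    by (induction n) (simp_all add: mult_single flip: xm_add)
  then show ?thesis unfolding * using sP by (simp add: cl_pow)
qed

text \<open>The fraction with numerator \<open>p\<close> and denominator
  \<open>xm J n\<close>.\<close>

definition lf :: "'v set \<Rightarrow> ('v, 'k) mpoly \<Rightarrow> nat \<Rightarrow> (('v, 'k) mpoly set \<times> nat) set" where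
  "lf J p n = mfrac S (regular_module S) (K.xx J) (cl p, n)"

lemma index_subset: "J \<in> cech_index V i \<Longrightarrow> J \<subseteq> V"
  by (simp add: cech_index_def)

lemma index_card: "J \<in> cech_index V i \<Longrightarrow> card J = i"
  by (simp add: cech_index_def)

lemma index_finite: "J \<in> cech_index V i \<Longrightarrow> finite J"
  using finite_V finite_subset by (auto simp: cech_index_def)

lemma topf_index: "F \<in> topf \<Longrightarrow> F \<in> cech_index V dd"
  by (auto simp: topf_def cech_index_def)

lemma topf_finite: "F \<in> topf \<Longrightarrow> finite F"
  using finite_face top_face by blast

lemma topf_subset: "F \<in> topf \<Longrightarrow> F \<subseteq> V"
  using top_face by blast

lemma xm_P: "J \<subseteq> V \<Longrightarrow> single (xm J n) c \<in> P"
  using keys_xm[of J n] finite_subset[OF _ finite_V] by (intro polys_single) blast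

context
  fixes J i assumes J: "J \<in> cech_index V i"
begin

interpretation l: localization S "regular_module S" "K.xx J" by (rule K.loc_J[OF J])

lemma lf_closed: "p \<in> P \<Longrightarrow> lf J p n \<in> carrier (K.L J)"
  by (simp add: lf_def cech_loc_def)

lemma lf_cases:
  assumes "X \<in> carrier (K.L J)"
  obtains p n where "p \<in> P" "X = lf J p n"
proof -
  obtain a n where "a \<in> carrier S" "X = l.fr a n"
    using assms l.L_cases[of X] by (auto simp: cech_loc_def)
  then show ?thesis using that by (auto elim!: S_cases simp: lf_def)
qed

lemma lf_eq_iff:
  assumes "p \<in> P" "q \<in> P"
  shows "lf J p n = lf J q m \<longleftrightarrow>
    (\<exists>k. res \<Delta> (single (xm J (k + m)) 1 * p) = res \<Delta> (single (xm J (k + n)) 1 * q))"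
proof -
  have "lf J p n = lf J q m \<longleftrightarrow> (\<exists>k. l.pw (k + m) (cl p) = l.pw (k + n) (cl q))"
    unfolding lf_def using assms by (intro l.fr_eq_iff) auto
  then show ?thesis
    using assms J xm_P[OF index_subset[OF J]]
    by (simp add: xx_eq[OF index_subset[OF J]] cl_mult cl_eq_iff polys_closed)
qed

lemma lf_add: "p \<in> P \<Longrightarrow> q \<in> P \<Longrightarrow> lf J p n \<oplus>\<^bsub>K.L J\<^esub> lf J q n = lf J (p + q) n"
  using l.fr_add_same[of "cl p" "cl q" n] by (simp add: lf_def cech_loc_def cl_add)

lemma lf_smult: "p \<in> P \<Longrightarrow> q \<in> P \<Longrightarrow> cl q \<odot>\<^bsub>K.L J\<^esub> lf J p n = lf J (q * p) n"
  using l.fr_smult[of "cl p" "cl q" n] by (simp add: lf_def cech_loc_def cl_mult)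

lemma lf_zero: "lf J 0 n = \<zero>\<^bsub>K.L J\<^esub>"
  using l.fr_zero[of n] by (simp add: lf_def cech_loc_def S_zero)

lemma lf_common:
  assumes "X \<in> carrier (K.L J)" "Y \<in> carrier (K.L J)"
  obtains p q n where "p \<in> P" "q \<in> P" "X = lf J p n" "Y = lf J q n"
proof -
  obtain a b n where "a \<in> carrier S" "b \<in> carrier S" "X = l.fr a n" "Y = l.fr b n"
    using assms l.common_denominator[of X Y] by (auto simp: cech_loc_def)
  then show ?thesis using that by (auto elim!: S_cases simp: lf_def)
qed

lemma lf_uminus: "p \<in> P \<Longrightarrow> \<ominus>\<^bsub>K.L J\<^esub> lf J p n = lf J (- p) n"
proof -
  interpret LJ: Module.module S "K.L J" by (rule K.module_loc[OF J])
  show "p \<in> P \<Longrightarrow> \<ominus>\<^bsub>K.L J\<^esub> lf J p n = lf J (- p) n"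
    by (rule LJ.M.minus_equality) (simp_all add: lf_add lf_zero lf_closed polys_closed)
qed

text \<open>One more power of the denominator makes every monomial of the numerator involve all of
  \<open>J\<close>; these supports are then non-faces, so the numerator becomes zero in the
  ring.\<close>

lemma lf_vanish:
  assumes "p \<in> P" "\<And>m. m \<in> keys p \<Longrightarrow> keys m \<union> J \<notin> \<Delta>"
  shows "lf J p n = \<zero>\<^bsub>K.L J\<^esub>"
proof -
  have kx: "keys (xm J (Suc k)) = J" for k
    using index_finite[OF J] by (auto simp: in_keys_iff lookup_mprod split: if_splits)
  have "res \<Delta> (single (xm J (Suc 0)) 1 * p) = 0"
    using assms(2) by (auto simp: res_eq_0_iff keys_add_nat kx Un_commute elim!: keys_times_mpoly)
  then have "lf J p n = lf J 0 0"
    using assms(1) xm_add[of "Suc 0" n J] by (subst lf_eq_iff) (auto intro!: exI[of _ "Suc 0"])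
  then show ?thesis by (simp add: lf_zero)
qed

lemma nonface_loc_trivial: "J \<notin> \<Delta> \<Longrightarrow> X \<in> carrier (K.L J) \<Longrightarrow> X = \<zero>\<^bsub>K.L J\<^esub>"
  using face_mono by (elim lf_cases) (auto intro!: lf_vanish)

end

lemma index_top_or_trivial: "F \<in> cech_index V dd \<Longrightarrow> F \<notin> topf \<Longrightarrow> F \<notin> \<Delta>"
  by (auto simp: cech_index_def topf_def)

lemma index_Suc_dd: "J \<in> cech_index V (Suc dd) \<Longrightarrow> J \<notin> \<Delta>"
  using card_face[of J] by (auto simp: cech_index_def)

lemma face_map_lf:
  assumes J: "J \<in> cech_index V (Suc i)" and j: "j \<in> J" and p: "p \<in> P"
  shows "K.face_map J j (lf (J - {j}) p n) = lf J (single (single j n) (bsign J j) * p) n"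
proof -
  have J': "J - {j} \<in> cech_index V i" using cech_index_minus[OF finite_V J j] .
  interpret l: localization S "regular_module S" "K.xx (J - {j})" by (rule K.loc_J[OF J'])
  have jV: "j \<in> V" using J j index_subset by blast
  have sP: "single (single j n) c \<in> P" for c using jV by (intro polys_single) (auto split: if_splits)
  have "loc_map S (regular_module S) (K.xx (J - {j})) (cl (pvar j)) (lf (J - {j}) p n) =
      mfrac S (regular_module S) (K.xx J) (cl (pvar j) [^]\<^bsub>S\<^esub> n \<otimes>\<^bsub>S\<^esub> cl p, n)"
    using l.loc_map_fr[of "cl p" "cl (pvar j)" n] p jV K.xx_remove[OF J j] by (simp add: lf_def polys_closed)
  also have "\<dots> = lf J (single (single j n) 1 * p) n"
    using p jV sP by (simp add: lf_def cl_pow polys_closed pvar_power cl_mult)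
  finally show ?thesis
    using p sP by (simp add: K.face_map_def Let_def bsign_def lf_uminus[OF J] polys_closed single_uminus)
qed

subsection \<open>A concrete description of the canonical module\<close>

text \<open>Componentwise, an element of degree \<open>e\<close> is a functional on the top Cech term in degree \<open>- e\<close>;
  the coefficient of \<open>m\<close> at \<open>F\<close> is its value at the fraction \<open>1 / m\<close>.  The two conditions say that
  the functional vanishes on boundaries.\<close>

definition cofaces :: "'v set \<Rightarrow> 'v set" where
  "cofaces J = {v \<in> V - J. insert v J \<in> topf}"

definition W :: "(('v, 'k) mpoly set, 'v set \<Rightarrow> ('v, 'k) mpoly) gmodule" where
  "W = (let C = {w. (\<forall>F. F \<notin> topf \<longrightarrow> w F = 0) \<and> (\<forall>F. res (Pow F) (w F) = w F) \<and>
          (\<forall>J. J \<subseteq> V \<and> Suc (card J) = dd \<longrightarrow>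
            (\<Sum>v\<in>cofaces J. single 0 (bsign (insert v J) v) * res (Pow J) (w (insert v J))) = 0)}
     in \<lparr>carrier = C, mult = undefined, one = undefined, zero = (\<lambda>_. 0), add = (\<lambda>w w' F. w F + w' F),
      smult = (\<lambda>s w F. res (Pow F) (rp s) * w F), mgrade = (\<lambda>d. {w \<in> C. \<forall>F. hpart d (w F) = w F})\<rparr>)"

lemma W_simps [simp]:
  "zero W = (\<lambda>_. 0)" "w \<oplus>\<^bsub>W\<^esub> w' = (\<lambda>F. w F + w' F)" "s \<odot>\<^bsub>W\<^esub> w = (\<lambda>F. res (Pow F) (rp s) * w F)"
  by (simp_all add: W_def Let_def)

lemma W_carrier:
  "w \<in> carrier W \<longleftrightarrow> (\<forall>F. F \<notin> topf \<longrightarrow> w F = 0) \<and> (\<forall>F. res (Pow F) (w F) = w F) \<and>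
          (\<forall>J. J \<subseteq> V \<and> Suc (card J) = dd \<longrightarrow>
            (\<Sum>v\<in>cofaces J. single 0 (bsign (insert v J) v) * res (Pow J) (w (insert v J))) = 0)"
  by (simp add: W_def Let_def)

lemma finite_cofaces: "finite (cofaces J)"
  using finite_V by (rule finite_subset[rotated]) (auto simp: cofaces_def)

lemma W_zero_closed: "(\<lambda>_. 0) \<in> carrier W"
  by (simp add: W_carrier)

lemma W_add_closed: "w \<in> carrier W \<Longrightarrow> w' \<in> carrier W \<Longrightarrow> w \<oplus>\<^bsub>W\<^esub> w' \<in> carrier W"
  by (auto simp: W_carrier res_add distrib_left sum.distrib)

text \<open>Truncating first to a coface of \<open>J\<close> and then to \<open>J\<close> is the
  same as truncating to \<open>J\<close>. So the scalar becomes a common factor of all terms in the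
  condition at \<open>J\<close>.\<close>

lemma W_smult_closed:
  assumes "s \<in> carrier S" "w \<in> carrier W"
  shows "s \<odot>\<^bsub>W\<^esub> w \<in> carrier W"
proof -
  have "(\<Sum>v\<in>cofaces J. single 0 (bsign (insert v J) v) * res (Pow J) (res (Pow (insert v J)) (rp s) * w (insert v J))) = 0"
    if J: "J \<subseteq> V" "Suc (card J) = dd" for J
  proof -
    have "res (Pow J) (res (Pow (insert v J)) (rp s)) = res (Pow J) (rp s)" for v
    proof -
      have "Pow J \<inter> Pow (insert v J) = Pow J" by auto
      then show ?thesis by (simp add: res_res)
    qed
    then have "(\<Sum>v\<in>cofaces J. single 0 (bsign (insert v J) v) * res (Pow J) (res (Pow (insert v J)) (rp s) * w (insert v J))) =
      res (Pow J) (rp s) * (\<Sum>v\<in>cofaces J. single 0 (bsign (insert v J) v) * res (Pow J) (w (insert v J)))"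
      by (simp add: res_Pow_times sum_distrib_left mult_ac)
    then show ?thesis using assms(2) J by (simp add: W_carrier)
  qed
  then show ?thesis using assms(2) by (simp add: W_carrier res_Pow_times res_res)
qed

definition hw :: "int \<Rightarrow> ('v set \<Rightarrow> ('v, 'k) mpoly) \<Rightarrow> ('v set \<Rightarrow> ('v, 'k) mpoly)" where
  "hw e w = (\<lambda>F. hpart e (w F))"

lemma hpart_const_times: "hpart e (single 0 c * p) = single 0 c * hpart e p" for p :: "('v, 'k) mpoly"
  using hpart_single_times[of 0 e c p] by simp

lemma hw_closed:
  assumes "w \<in> carrier W"
  shows "hw e w \<in> carrier W"
  unfolding W_carrier hw_def
proof (intro conjI allI impI)
  fix J assume J: "J \<subseteq> V \<and> Suc (card J) = dd"
  have "(\<Sum>v\<in>cofaces J. single 0 (bsign (insert v J) v) * res (Pow J) (hpart e (w (insert v J)))) =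
    hpart e (\<Sum>v\<in>cofaces J. single 0 (bsign (insert v J) v) * res (Pow J) (w (insert v J)))"
    by (simp add: hpart_sum hpart_const_times res_hpart)
  then show "(\<Sum>v\<in>cofaces J. single 0 (bsign (insert v J) v) * res (Pow J) (hpart e (w (insert v J)))) = 0"
    using assms J by (simp add: W_carrier)
qed (use assms in \<open>auto simp: W_carrier res_hpart\<close>)

definition wdegs :: "('v set \<Rightarrow> ('v, 'k) mpoly) \<Rightarrow> int set" where
  "wdegs w = (\<Union>F\<in>topf. (\<lambda>m. int (mdeg m)) ` keys (w F))"

lemma finite_wdegs: "finite (wdegs w)"
  by (simp add: wdegs_def finite_top)

lemma hw_decompose:
  assumes "w \<in> carrier W" "finite A" "wdegs w \<subseteq> A"
  shows "w F = (\<Sum>e\<in>A. hw e w F)"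
proof (cases "F \<in> topf")
  case True
  then show ?thesis unfolding hw_def using assms by (intro hpart_decompose) (auto simp: wdegs_def)
qed (use assms in \<open>simp add: W_carrier hw_def\<close>)

subsection \<open>The pairing with the top term of the Cech complex\<close>

text \<open>Divisors of \<open>xm F n\<close> are face monomials, and their coefficients are not
  affected by the Stanley--Reisner ideal.\<close>

lemma lookup_times_face_cong:
  assumes "F \<in> \<Delta>" "res \<Delta> a = res \<Delta> b"
  shows "lookup (a * q) (xm F n) = lookup (b * q) (xm F n)"
proof (rule mpoly_times_cong)
  fix l t assume "xm F n = l + t"
  then have "keys l \<subseteq> F" using keys_xm[OF finite_face[OF assms(1)], of n] by (metis keys_add_nat le_sup_iff)
  then have "keys l \<in> \<Delta>" using assms(1) face_mono by blast
  then show "lookup a l = lookup b l" using assms(2) by (metis lookup_res)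
qed simp

text \<open>A residue pairing: the coefficient of the trivial monomial in the product of the
  fraction \<open>X\<close> with \<open>q\<close>. It is computed on a chosen representative;
  \<open>pf_lf\<close> shows that the choice is immaterial.\<close>

definition pf :: "('v, 'k) mpoly \<Rightarrow> 'v set \<Rightarrow> (('v, 'k) mpoly set \<times> nat) set \<Rightarrow> 'k" where
  "pf q F X = (let (Y, n) = (SOME z. z \<in> X) in lookup (rp Y * q) (xm F n))"

text \<open>Equal fractions have numerators that agree in the ring after multiplication by suitable
  powers of the denominator, and multiplying by a monomial only shifts the coefficient that is read
  off.\<close>

lemma pf_lf:
  assumes F: "F \<in> topf" and p: "p \<in> P"
  shows "pf q F (lf F p n) = lookup (p * q) (xm F n)"
proof -
  note Fi = topf_index[OF F]
  interpret l: localization S "regular_module S" "K.xx F" by (rule K.loc_J[OF Fi])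
  obtain Y m where Ym: "(SOME z. z \<in> lf F p n) = (Y, m)" by fastforce
  have "(cl p, n) \<in> lf F p n" using l.fr_self[of "cl p" n] p by (simp add: lf_def)
  then have "(Y, m) \<in> lf F p n" using someI[of "\<lambda>z. z \<in> lf F p n"] Ym by metis
  then have Y: "Y \<in> carrier S" "lf F (rp Y) m = lf F p n"
    using p l.mem_fr[of "cl p" Y m n] by (auto simp: lf_def cl_rp)
  then obtain k where k: "res \<Delta> (single (xm F (k + n)) 1 * rp Y) = res \<Delta> (single (xm F (k + m)) 1 * p)"
    using lf_eq_iff[OF Fi rp_P[OF Y(1)] p] by auto
  have "lookup (rp Y * q) (xm F m) = lookup (single (xm F (k + n)) 1 * (rp Y * q)) (xm F (k + n) + xm F m)"
    by (simp add: lookup_single_times)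
  also have "\<dots> = lookup (single (xm F (k + n)) 1 * rp Y * q) (xm F (k + n + m))"
    by (simp add: xm_add mult.assoc)
  also have "\<dots> = lookup (single (xm F (k + m)) 1 * p * q) (xm F (k + n + m))"
    by (rule lookup_times_face_cong[OF top_face[OF F] k])
  also have "\<dots> = lookup (single (xm F (k + m)) 1 * (p * q)) (xm F (k + m) + xm F n)"
    by (simp add: xm_add mult.assoc add_ac)
  also have "\<dots> = lookup (p * q) (xm F n)" by (simp add: lookup_single_times)
  finally show ?thesis by (simp add: pf_def Ym)
qed

lemma pf_add:
  assumes "F \<in> topf" "X \<in> carrier (K.L F)" "Y \<in> carrier (K.L F)"
  shows "pf q F (X \<oplus>\<^bsub>K.L F\<^esub> Y) = pf q F X + pf q F Y"
proof -
  obtain a b n where ab: "a \<in> P" "b \<in> P" "X = lf F a n" "Y = lf F b n"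
    using lf_common[OF topf_index[OF assms(1)] assms(2,3)] by blast
  show ?thesis
    unfolding ab(3,4) lf_add[OF topf_index[OF assms(1)] ab(1,2)]
    using assms(1) ab(1,2) by (simp add: pf_lf polys_add distrib_right lookup_add)
qed

lemma pf_zero: "F \<in> topf \<Longrightarrow> pf q F \<zero>\<^bsub>K.L F\<^esub> = 0"
  using pf_lf[of F 0 q 0] lf_zero[OF topf_index, of F 0] by simp

lemma pf_finsum:
  assumes F: "F \<in> topf" and "finite A" "f \<in> A \<rightarrow> carrier (K.L F)"
  shows "pf q F (\<Oplus>\<^bsub>K.L F\<^esub>i\<in>A. f i) = (\<Sum>i\<in>A. pf q F (f i))"
proof -
  interpret LF: Module.module S "K.L F" by (rule K.module_loc[OF topf_index[OF F]])
  show ?thesis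
    using assms(2,3) by (induction A rule: finite_induct) (auto simp: pf_zero pf_add F)
qed

text \<open>Only faces of maximal size enter, because the localization at any other set of
  \<open>dd\<close> vertices is zero.\<close>

definition pair :: "('v set \<Rightarrow> ('v, 'k) mpoly) \<Rightarrow> ('v set \<Rightarrow> (('v, 'k) mpoly set \<times> nat) set) \<Rightarrow> 'k" where
  "pair w c = (\<Sum>F\<in>topf. pf (w F) F (c F))"

lemma C_comp: "c \<in> carrier (K.C i) \<Longrightarrow> J \<in> cech_index V i \<Longrightarrow> c J \<in> carrier (K.L J)"
  by (auto simp: PiE_iff)

lemma pair_add:
  assumes "c \<in> carrier (K.C dd)" "c' \<in> carrier (K.C dd)"
  shows "pair w (c \<oplus>\<^bsub>K.C dd\<^esub> c') = pair w c + pair w c'"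
  unfolding pair_def using C_comp[OF assms(1)] C_comp[OF assms(2)] topf_index
  by (auto simp: pf_add sum.distrib intro!: sum.cong simp flip: sum.distrib)

lemma C_reps:
  assumes "c \<in> carrier (K.C dd)"
  obtains p n where "\<And>F. F \<in> topf \<Longrightarrow> p F \<in> P" "\<And>F. F \<in> topf \<Longrightarrow> c F = lf F (p F) (n F)"
proof -
  have "\<exists>p n. p \<in> P \<and> c F = lf F p n" if F: "F \<in> topf" for F
    using lf_cases[OF topf_index[OF F] C_comp[OF assms topf_index[OF F]]] by metis
  then show ?thesis using that by metis
qed

lemma pair_reps:
  assumes "\<And>F. F \<in> topf \<Longrightarrow> p F \<in> P" "\<And>F. F \<in> topf \<Longrightarrow> c F = lf F (p F) (n F)"
  shows "pair w c = (\<Sum>F\<in>topf. lookup (p F * w F) (xm F (n F)))"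
  unfolding pair_def using assms by (auto intro!: sum.cong simp: pf_lf)

lemma pair_smult_reps:
  assumes "\<And>F. F \<in> topf \<Longrightarrow> p F \<in> P" "\<And>F. F \<in> topf \<Longrightarrow> c F = lf F (p F) (n F)" "s \<in> carrier S"
  shows "pair w (s \<odot>\<^bsub>K.C dd\<^esub> c) = (\<Sum>F\<in>topf. lookup (rp s * p F * w F) (xm F (n F)))"
proof (rule pair_reps)
  fix F assume F: "F \<in> topf"
  show "rp s * p F \<in> P" using assms F by (simp add: polys_closed rp_P)
  show "(s \<odot>\<^bsub>K.C dd\<^esub> c) F = lf F (rp s * p F) (n F)"
    using assms F topf_index[OF F] lf_smult[OF topf_index[OF F], of "p F" "rp s" "n F"] by (simp add: rp_P cl_rp)
qed

lemma pair_W_smult: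
  assumes "c \<in> carrier (K.C dd)" "s \<in> carrier S"
  shows "pair (s \<odot>\<^bsub>W\<^esub> w) c = pair w (s \<odot>\<^bsub>K.C dd\<^esub> c)"
proof -
  obtain p n where pn: "\<And>F. F \<in> topf \<Longrightarrow> p F \<in> P" "\<And>F. F \<in> topf \<Longrightarrow> c F = lf F (p F) (n F)"
    using C_reps[OF assms(1)] by blast
  have "lookup (p F * (res (Pow F) (rp s) * w F)) (xm F (n F)) = lookup (rp s * p F * w F) (xm F (n F))"
    if F: "F \<in> topf" for F
  proof -
    have "lookup (res (Pow F) (rp s) * (p F * w F)) (xm F (n F)) = lookup (rp s * (p F * w F)) (xm F (n F))"
    proof (rule mpoly_times_cong)
      fix l t assume "xm F (n F) = l + t"
      then have "keys l \<subseteq> F" using keys_xm[OF topf_finite[OF F], of "n F"] by (metis keys_add_nat le_sup_iff)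
      then show "lookup (res (Pow F) (rp s)) l = lookup (rp s) l" by (simp add: lookup_res)
    qed simp
    then show ?thesis by (simp add: mult_ac)
  qed
  then show ?thesis using pair_smult_reps[of p c n, OF pn assms(2)] by (simp add: pair_reps[of p c n, OF pn])
qed

lemma pair_sum_left:
  assumes "c \<in> carrier (K.C dd)" "finite A" "\<And>F. F \<in> topf \<Longrightarrow> w F = (\<Sum>e\<in>A. u e F)"
  shows "pair w c = (\<Sum>e\<in>A. pair (u e) c)"
proof -
  obtain p n where pn: "\<And>F. F \<in> topf \<Longrightarrow> p F \<in> P" "\<And>F. F \<in> topf \<Longrightarrow> c F = lf F (p F) (n F)"
    using C_reps[OF assms(1)] by blast
  have pr: "pair u c = (\<Sum>F\<in>topf. lookup (p F * u F) (xm F (n F)))" for u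
    using pn by (rule pair_reps)
  have "pair w c = (\<Sum>F\<in>topf. \<Sum>e\<in>A. lookup (p F * u e F) (xm F (n F)))"
    unfolding pr by (intro sum.cong) (auto simp: assms(3) sum_distrib_left lookup_sum)
  also have "\<dots> = (\<Sum>e\<in>A. pair (u e) c)"
    unfolding pr by (rule sum.swap)
  finally show ?thesis .
qed

lemma pair_W_add:
  assumes "c \<in> carrier (K.C dd)"
  shows "pair (w \<oplus>\<^bsub>W\<^esub> w') c = pair w c + pair w' c"
  using pair_sum_left[OF assms, of "UNIV :: bool set" "w \<oplus>\<^bsub>W\<^esub> w'" "\<lambda>b. if b then w else w'"]
  by (simp add: UNIV_bool add.commute)

lemma dd_Suc: "dd = Suc (dd - 1)"
  using dd_pos by simp

text \<open>The pairing with a boundary is a sum over faces \<open>F\<close> and vertices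
  \<open>j\<close> in \<open>F\<close>. Regrouped by \<open>J = F - {j}\<close>, the part belonging
  to \<open>J\<close> is a coefficient of a multiple of the expression that \<open>W\<close>
  requires to vanish at \<open>J\<close>.\<close>

lemma pair_boundary:
  assumes w: "w \<in> carrier W" and b: "b \<in> cech_boundaries S V (\<lambda>v. cl (pvar v)) (regular_module S) dd"
  shows "pair w b = 0"
proof -
  let ?e = "dd - 1"
  obtain c where c: "c \<in> carrier (K.C ?e)" "b = cech_diff S V (\<lambda>v. cl (pvar v)) (regular_module S) ?e c"
    using b dd_Suc by (auto simp: cech_boundaries_def split: nat.splits)
  have "\<forall>J. \<exists>p n. J \<in> cech_index V ?e \<longrightarrow> p \<in> P \<and> c J = lf J p n"
    using lf_cases C_comp[OF c(1)] by metis
  then obtain p n where pn: "\<And>J. J \<in> cech_index V ?e \<Longrightarrow> p J \<in> P"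
    "\<And>J. J \<in> cech_index V ?e \<Longrightarrow> c J = lf J (p J) (n J)" by metis
  \<comment> \<open>The contribution of the coface \<open>insert v J\<close>: the factor that the
    face map puts into the numerator cancels the part of the denominator at
    \<open>v\<close>.\<close>
  define T where "T = (\<lambda>J v. bsign (insert v J) v * lookup (p J * res (Pow J) (w (insert v J))) (xm J (n J)))"
  have rem: "F - {j} \<in> cech_index V ?e" if "F \<in> topf" "j \<in> F" for F j
    using cech_index_minus[OF finite_V _ that(2), of ?e] topf_index[OF that(1)] dd_Suc by simp
  have pf_face: "pf (w F) F (K.face_map F j (c (F - {j}))) = T (F - {j}) j" if F: "F \<in> topf" and j: "j \<in> F" for F j
  proof -
    let ?J = "F - {j}" and ?n = "n (F - {j})"
    have FJ: "F = insert j ?J" using j by auto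
    have fJ: "finite ?J" using topf_finite[OF F] by simp
    have Fi: "F \<in> cech_index V (Suc ?e)" using topf_index[OF F] dd_Suc by simp
    have jV: "j \<in> V" using F j topf_subset by blast
    have sP: "single (single j ?n) c \<in> P" for c using jV by (intro polys_single) (auto split: if_splits)
    have "K.face_map F j (c ?J) = lf F (single (single j ?n) (bsign F j) * p ?J) ?n"
      using face_map_lf[OF Fi j pn(1)[OF rem[OF F j]]] pn(2)[OF rem[OF F j]] by simp
    then have "pf (w F) F (K.face_map F j (c ?J)) =
        lookup (single (single j ?n) (bsign F j) * p ?J * w F) (xm F ?n)"
      using pn(1)[OF rem[OF F j]] sP by (simp add: pf_lf[OF F] polys_closed)
    also have "xm F ?n = single j ?n + xm ?J ?n"
      using xm_insert[OF fJ, of j ?n] FJ by simp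
    also have "lookup (single (single j ?n) (bsign F j) * p ?J * w F) (single j ?n + xm ?J ?n) =
        bsign F j * lookup (p ?J * w F) (xm ?J ?n)"
      by (simp add: lookup_single_times mult.assoc)
    \<comment> \<open>No divisor of \<open>xm ?J ?n\<close> involves \<open>j\<close>, so
      \<open>w F\<close> may be truncated to \<open>?J\<close>; this produces the restriction that
      occurs in \<open>W\<close>.\<close>
    also have "lookup (p ?J * w F) (xm ?J ?n) = lookup (p ?J * res (Pow ?J) (w F)) (xm ?J ?n)"
    proof (rule mpoly_times_cong)
      fix l t assume "xm ?J ?n = l + t"
      then have "keys t \<subseteq> ?J" using keys_xm[OF fJ, of ?n] by (metis keys_add_nat le_sup_iff)
      then show "lookup (w F) t = lookup (res (Pow ?J) (w F)) t" by (simp add: lookup_res)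
    qed simp
    finally show ?thesis unfolding T_def using FJ by simp
  qed
  have "pair w b = (\<Sum>F\<in>topf. \<Sum>j\<in>F. T (F - {j}) j)"
    unfolding pair_def
  proof (rule sum.cong[OF refl])
    fix F assume F: "F \<in> topf"
    have Fi: "F \<in> cech_index V (Suc ?e)" using topf_index[OF F] dd_Suc by simp
    have "(\<lambda>j. K.face_map F j (c (F - {j}))) \<in> F \<rightarrow> carrier (K.L F)"
      using K.face_map(1)[OF Fi] C_comp[OF c(1)] rem[OF F] by blast
    then have "pf (w F) F (b F) = (\<Sum>j\<in>F. pf (w F) F (K.face_map F j (c (F - {j}))))"
      using Fi topf_finite[OF F] by (simp add: c(2) K.cech_diff_eq pf_finsum[OF F])
    then show "pf (w F) F (b F) = (\<Sum>j\<in>F. T (F - {j}) j)" using pf_face[OF F] by simp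
  qed
  also have "\<dots> = (\<Sum>(F, j)\<in>Sigma topf (\<lambda>F. F). T (F - {j}) j)"
    by (subst sum.Sigma) (auto simp: finite_top topf_finite)
  also have "\<dots> = (\<Sum>(J, v)\<in>Sigma (cech_index V ?e) cofaces. T J v)"
  proof (rule sum.reindex_bij_witness[where i = "\<lambda>(J, v). (insert v J, v)" and j = "\<lambda>(F, j). (F - {j}, j)"])
    fix a assume a: "a \<in> Sigma topf (\<lambda>F. F)"
    obtain F j where Fj: "a = (F, j)" "F \<in> topf" "j \<in> F" using a by auto
    then show "(case a of (F, j) \<Rightarrow> (F - {j}, j)) \<in> Sigma (cech_index V ?e) cofaces"
      using rem[of F j] topf_subset[of F] by (auto simp: cofaces_def insert_absorb)
    show "(case case a of (F, j) \<Rightarrow> (F - {j}, j) of (J, v) \<Rightarrow> (insert v J, v)) = a"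
      using Fj by auto
    show "(case case a of (F, j) \<Rightarrow> (F - {j}, j) of (J, v) \<Rightarrow> T J v) = (case a of (F, j) \<Rightarrow> T (F - {j}) j)"
      using Fj by auto
  qed (auto simp: cofaces_def)
  also have "\<dots> = (\<Sum>J\<in>cech_index V ?e. \<Sum>v\<in>cofaces J. T J v)"
    using finite_V by (subst sum.Sigma) (auto simp: finite_cofaces cech_index_def)
  also have "\<dots> = 0"
  proof (rule sum.neutral, rule ballI)
    fix J assume J: "J \<in> cech_index V ?e"
    have "(\<Sum>v\<in>cofaces J. T J v) =
      lookup (p J * (\<Sum>v\<in>cofaces J. single 0 (bsign (insert v J) v) * res (Pow J) (w (insert v J)))) (xm J (n J))"
      by (simp add: T_def sum_distrib_left lookup_sum mult.left_commute[of _ "single 0 _"] lookup_const_times)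
    also have "\<dots> = 0" using w J dd_Suc by (simp add: W_carrier cech_index_def)
    finally show "(\<Sum>v\<in>cofaces J. T J v) = 0" .
  qed
  finally show ?thesis .
qed

section \<open>Cochains concentrated at one index\<close>

definition conc :: "nat \<Rightarrow> 'v set \<Rightarrow> (('v, 'k) mpoly set \<times> nat) set \<Rightarrow> 'v set \<Rightarrow> (('v, 'k) mpoly set \<times> nat) set" where
  "conc i J X = (\<lambda>J'\<in>cech_index V i. if J' = J then X else \<zero>\<^bsub>K.L J'\<^esub>)"

lemma L_zero_closed: "J \<in> cech_index V i \<Longrightarrow> \<zero>\<^bsub>K.L J\<^esub> \<in> carrier (K.L J)"
  using lf_closed[of J i 0 0] lf_zero[of J i 0] by simp

lemma conc_closed: "X \<in> carrier (K.L J) \<Longrightarrow> conc i J X \<in> carrier (K.C i)"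
  by (auto simp: conc_def L_zero_closed)

lemma L_l_zero: "J \<in> cech_index V i \<Longrightarrow> X \<in> carrier (K.L J) \<Longrightarrow> \<zero>\<^bsub>K.L J\<^esub> \<oplus>\<^bsub>K.L J\<^esub> X = X"
  "J \<in> cech_index V i \<Longrightarrow> X \<in> carrier (K.L J) \<Longrightarrow> X \<oplus>\<^bsub>K.L J\<^esub> \<zero>\<^bsub>K.L J\<^esub> = X"
proof -
  assume J: "J \<in> cech_index V i" "X \<in> carrier (K.L J)"
  interpret LJ: Module.module S "K.L J" by (rule K.module_loc[OF J(1)])
  show "\<zero>\<^bsub>K.L J\<^esub> \<oplus>\<^bsub>K.L J\<^esub> X = X" "X \<oplus>\<^bsub>K.L J\<^esub> \<zero>\<^bsub>K.L J\<^esub> = X" using J by auto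
qed

lemma conc_add:
  "X \<in> carrier (K.L J) \<Longrightarrow> Y \<in> carrier (K.L J) \<Longrightarrow> conc i J (X \<oplus>\<^bsub>K.L J\<^esub> Y) = conc i J X \<oplus>\<^bsub>K.C i\<^esub> conc i J Y"
  unfolding conc_def K.C_simps by (intro restrict_ext) (simp add: L_l_zero L_zero_closed)

lemma conc_zero: "conc i J \<zero>\<^bsub>K.L J\<^esub> = \<zero>\<^bsub>K.C i\<^esub>"
  unfolding conc_def K.C_simps by (intro restrict_ext) simp

lemma conc_smult:
  assumes "s \<in> carrier S"
  shows "conc i J (s \<odot>\<^bsub>K.L J\<^esub> X) = s \<odot>\<^bsub>K.C i\<^esub> conc i J X"
proof -
  have "s \<odot>\<^bsub>K.L J'\<^esub> \<zero>\<^bsub>K.L J'\<^esub> = \<zero>\<^bsub>K.L J'\<^esub>" if "J' \<in> cech_index V i" for J'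
    using module.smult_r_null[OF K.module_loc[OF that] assms] .
  then show ?thesis unfolding conc_def K.C_simps by (intro restrict_ext) simp
qed

lemma additive_conc_sum:
  fixes \<psi> :: "('v set \<Rightarrow> (('v, 'k) mpoly set \<times> nat) set) \<Rightarrow> 'k"
  assumes add: "\<And>c c'. c \<in> carrier (K.C i) \<Longrightarrow> c' \<in> carrier (K.C i) \<Longrightarrow> \<psi> (c \<oplus>\<^bsub>K.C i\<^esub> c') = \<psi> c + \<psi> c'"
    and c: "c \<in> carrier (K.C i)"
  shows "\<psi> c = (\<Sum>J\<in>cech_index V i. \<psi> (conc i J (c J)))"
proof -
  interpret Ci: Module.module S "K.C i" by (rule K.module_C)
  have z: "\<psi> \<zero>\<^bsub>K.C i\<^esub> = 0"
    using add[OF Ci.M.zero_closed Ci.M.zero_closed] Ci.M.l_zero[OF Ci.M.zero_closed]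
    by (metis add_cancel_right_right)
  define cut where "cut = (\<lambda>A. \<lambda>J\<in>cech_index V i. if J \<in> A then c J else \<zero>\<^bsub>K.L J\<^esub>)"
  have fin: "finite (cech_index V i)" using finite_V by (simp add: cech_index_def)
  have cc: "cut A \<in> carrier (K.C i)" for A using c by (auto simp: cut_def L_zero_closed PiE_iff)
  have "\<psi> (cut A) = (\<Sum>J\<in>A. \<psi> (conc i J (c J)))" if "finite A" "A \<subseteq> cech_index V i" for A
    using that
  proof (induction A rule: finite_induct)
    case empty
    have "cut {} = \<zero>\<^bsub>K.C i\<^esub>" by (simp add: cut_def)
    then have "\<psi> (cut {}) = 0" using z by (simp only:)
    then show ?case by simp
  next
    case (insert J A)
    have "cut (insert J A) = conc i J (c J) \<oplus>\<^bsub>K.C i\<^esub> cut A"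
      unfolding cut_def conc_def K.C_simps
    proof (rule restrict_ext)
      fix I assume I: "I \<in> cech_index V i"
      then show "(if I \<in> insert J A then c I else \<zero>\<^bsub>K.L I\<^esub>) =
          (\<lambda>J'\<in>cech_index V i. if J' = J then c J else \<zero>\<^bsub>K.L J'\<^esub>) I \<oplus>\<^bsub>K.L I\<^esub>
          (\<lambda>J\<in>cech_index V i. if J \<in> A then c J else \<zero>\<^bsub>K.L J\<^esub>) I"
        using insert(2) C_comp[OF c I] by (cases "I = J") (simp_all add: L_l_zero L_zero_closed)
    qed
    then have "\<psi> (cut (insert J A)) = \<psi> (conc i J (c J)) + \<psi> (cut A)"
      using insert.prems by (simp only: add[OF conc_closed[OF C_comp[OF c]] cc] insert_subset)
    then show ?case using insert by simp
  qed
  from this[OF fin] have "\<psi> (cut (cech_index V i)) = (\<Sum>J\<in>cech_index V i. \<psi> (conc i J (c J)))" by simp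
  moreover have "cut (cech_index V i) = c"
    using c by (intro extensionalityI[of _ "cech_index V i"]) (auto simp: cut_def PiE_iff)
  ultimately show ?thesis by simp
qed

lemma cech_diff_conc:
  assumes J: "J \<in> cech_index V i" and X: "X \<in> carrier (K.L J)" and F: "F \<in> cech_index V (Suc i)"
  shows "cech_diff S V (\<lambda>v. cl (pvar v)) (regular_module S) i (conc i J X) F =
    (if J \<subseteq> F then K.face_map F (THE v. v \<in> F - J) X else \<zero>\<^bsub>K.L F\<^esub>)"
proof -
  interpret LF: Module.module S "K.L F" by (rule K.module_loc[OF F])
  have cF: "card F = Suc i" "finite F" using index_card[OF F] index_finite[OF F] by simp_all
  have cJ: "card J = i" "finite J" using index_card[OF J] index_finite[OF J] by simp_all
  have fz: "K.face_map F j \<zero>\<^bsub>K.L (F - {j})\<^esub> = \<zero>\<^bsub>K.L F\<^esub>" if j: "j \<in> F" for j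
    using face_map_lf[OF F j, of 0 0] lf_zero[OF cech_index_minus[OF finite_V F j], of 0] lf_zero[OF F, of 0]
    by simp
  have e: "cech_diff S V (\<lambda>v. cl (pvar v)) (regular_module S) i (conc i J X) F =
      (\<Oplus>\<^bsub>K.L F\<^esub>j\<in>F. if F - {j} = J then K.face_map F j X else \<zero>\<^bsub>K.L F\<^esub>)"
  proof -
    have "K.face_map F j (conc i J X (F - {j})) = (if F - {j} = J then K.face_map F j X else \<zero>\<^bsub>K.L F\<^esub>)"
      if "j \<in> F" for j
      using that fz[OF that] cech_index_minus[OF finite_V F that] by (simp add: conc_def)
    moreover have "K.face_map F j X \<in> carrier (K.L F)" if "j \<in> F" "F - {j} = J" for j
      using K.face_map(1)[OF F that(1)] X that(2) by simp
    ultimately have "(\<Oplus>\<^bsub>K.L F\<^esub>j\<in>F. K.face_map F j (conc i J X (F - {j}))) =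
      (\<Oplus>\<^bsub>K.L F\<^esub>j\<in>F. if F - {j} = J then K.face_map F j X else \<zero>\<^bsub>K.L F\<^esub>)"
      by (intro LF.M.finsum_cong') auto
    then show ?thesis using F by (simp add: K.cech_diff_eq)
  qed
  show ?thesis
  proof (cases "J \<subseteq> F")
    case True
    have "card (F - J) = 1" using True cF cJ by (simp add: card_Diff_subset)
    then obtain v where v: "F - J = {v}" by (auto simp: card_1_singleton_iff)
    have vF: "v \<in> F" "F - {v} = J" using v True by auto
    have iff: "F - {j} = J \<longleftrightarrow> j = v" if "j \<in> F" for j using v True that by auto
    have "(\<Oplus>\<^bsub>K.L F\<^esub>j\<in>F. if F - {j} = J then K.face_map F j X else \<zero>\<^bsub>K.L F\<^esub>) =
      (\<Oplus>\<^bsub>K.L F\<^esub>j\<in>F. if v = j then K.face_map F v X else \<zero>\<^bsub>K.L F\<^esub>)"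
      using K.face_map(1)[OF F vF(1)] X vF iff by (intro LF.M.finsum_cong') auto
    also have "\<dots> = K.face_map F v X"
      using K.face_map(1)[OF F vF(1)] X vF cF by (intro LF.M.add.finprod_singleton) auto
    finally show ?thesis using e True v by simp
  next
    case False
    then have "F - {j} \<noteq> J" for j by auto
    then show ?thesis using e False by simp
  qed
qed

text \<open>This converts vanishing on boundaries into one scalar relation for each index
  \<open>J\<close> and each fraction at \<open>J\<close>, which is how it is used below.\<close>

lemma additive_cech_diff_conc:
  fixes \<psi> :: "('v set \<Rightarrow> (('v, 'k) mpoly set \<times> nat) set) \<Rightarrow> 'k"
  assumes add: "\<And>c c'. c \<in> carrier (K.C (Suc i)) \<Longrightarrow> c' \<in> carrier (K.C (Suc i)) \<Longrightarrow> \<psi> (c \<oplus>\<^bsub>K.C (Suc i)\<^esub> c') = \<psi> c + \<psi> c'"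
    and J: "J \<in> cech_index V i" and X: "X \<in> carrier (K.L J)"
  shows "\<psi> (cech_diff S V (\<lambda>v. cl (pvar v)) (regular_module S) i (conc i J X)) =
    (\<Sum>v\<in>V - J. \<psi> (conc (Suc i) (insert v J) (K.face_map (insert v J) v X)))"
proof -
  let ?d = "cech_diff S V (\<lambda>v. cl (pvar v)) (regular_module S) i (conc i J X)"
  interpret Ci: Module.module S "K.C (Suc i)" by (rule K.module_C)
  have z: "\<psi> \<zero>\<^bsub>K.C (Suc i)\<^esub> = 0"
    using add[OF Ci.M.zero_closed Ci.M.zero_closed] Ci.M.l_zero[OF Ci.M.zero_closed]
    by (metis add_cancel_right_right)
  have cJ: "card J = i" "finite J" "J \<subseteq> V"
    using index_card[OF J] index_finite[OF J] index_subset[OF J] by simp_all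
  have "\<psi> ?d = (\<Sum>F\<in>cech_index V (Suc i). \<psi> (conc (Suc i) F (?d F)))"
    by (rule additive_conc_sum[OF add K.cech_diff_hom(1)[OF conc_closed[OF X]]])
  also have "\<dots> = (\<Sum>F\<in>(\<lambda>v. insert v J) ` (V - J). \<psi> (conc (Suc i) F (?d F)))"
  proof (rule sum.mono_neutral_right)
    show "(\<lambda>v. insert v J) ` (V - J) \<subseteq> cech_index V (Suc i)" using cJ by (auto simp: cech_index_def)
    show "\<forall>F\<in>cech_index V (Suc i) - (\<lambda>v. insert v J) ` (V - J). \<psi> (conc (Suc i) F (?d F)) = 0"
    proof
      fix F assume F: "F \<in> cech_index V (Suc i) - (\<lambda>v. insert v J) ` (V - J)"
      have "\<not> J \<subseteq> F"
      proof
        assume JF: "J \<subseteq> F"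
        have "card (F - J) = 1" using JF F cJ by (simp add: card_Diff_subset cech_index_def)
        then obtain v where v: "F - J = {v}" by (auto simp: card_1_singleton_iff)
        then have "F = insert v J" "v \<in> V - J" using JF F by (auto simp: cech_index_def)
        then show False using F by blast
      qed
      then show "\<psi> (conc (Suc i) F (?d F)) = 0" using cech_diff_conc[OF J X, of F] F z conc_zero by simp
    qed
  qed (simp add: cech_index_def finite_V)
  also have "\<dots> = (\<Sum>v\<in>V - J. \<psi> (conc (Suc i) (insert v J) (?d (insert v J))))"
    by (subst sum.reindex) (auto simp: inj_on_def)
  also have "\<dots> = (\<Sum>v\<in>V - J. \<psi> (conc (Suc i) (insert v J) (K.face_map (insert v J) v X)))"
  proof (rule sum.cong[OF refl])
    fix v assume v: "v \<in> V - J"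
    then have "insert v J \<in> cech_index V (Suc i)" using cJ by (auto simp: cech_index_def)
    moreover have "(THE u. u \<in> insert v J - J) = v" using v by auto
    ultimately show "\<psi> (conc (Suc i) (insert v J) (?d (insert v J))) = \<psi> (conc (Suc i) (insert v J) (K.face_map (insert v J) v X))"
      using cech_diff_conc[OF J X, of "insert v J"] by (simp add: subset_insertI)
  qed
  finally show ?thesis .
qed

end

lemma divides_xm_mdeg:
  assumes "finite J" "keys m \<subseteq> J"
  shows "xm J (mdeg m) = (xm J (mdeg m) - m) + m" "keys (xm J (mdeg m) - m) \<subseteq> J"
  using divides_xm[OF assms lookup_le_mdeg] by auto

section \<open>Identification of the canonical module with \<open>W\<close>\<close>

context SR_env
begin

declare K.C_simps [simp del]

abbreviation "Cd \<equiv> K.C dd"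

abbreviation "B \<equiv> cech_boundaries S V (\<lambda>v. cl (pvar v)) (regular_module S) dd"

abbreviation "H \<equiv> local_cohomology S V (\<lambda>v. cl (pvar v)) (regular_module S) dd"

lemma canonical_eq: "SR_canonical_module \<Delta> E = star_Hom S H E"
  by (simp add: SR_canonical_module_def S_def[symmetric] krull_dim_S)

interpretation C: Module.module S Cd by (rule K.module_C)

text \<open>Local cohomology is defined as a quotient of the submodule of cocycles, so this record
  is what appears even though all top cochains are cocycles.\<close>

abbreviation "C' \<equiv> sub_module Cd (carrier Cd)"

text \<open>No face has \<open>dd + 1\<close> vertices, so every localization in the next Cech
  degree is zero; top cohomology is thus a cokernel.\<close>

lemma cocycles_top: "cech_cocycles S V (\<lambda>v. cl (pvar v)) (regular_module S) dd = carrier Cd"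
proof -
  have "cech_diff S V (\<lambda>v. cl (pvar v)) (regular_module S) dd c = \<zero>\<^bsub>K.C (Suc dd)\<^esub>" if c: "c \<in> carrier Cd" for c
  proof -
    have "cech_diff S V (\<lambda>v. cl (pvar v)) (regular_module S) dd c \<in> carrier (K.C (Suc dd))"
      using c by (rule K.cech_diff_hom(1))
    then show ?thesis
      unfolding K.C_simps
    proof (intro extensionalityI[of _ "cech_index V (Suc dd)"])
      fix J assume J: "J \<in> cech_index V (Suc dd)"
      then show "cech_diff S V (\<lambda>v. cl (pvar v)) (regular_module S) dd c J =
          (\<lambda>J\<in>cech_index V (Suc dd). \<zero>\<^bsub>K.L J\<^esub>) J"
        using nonface_loc_trivial[OF J index_Suc_dd[OF J]] C_comp[OF K.cech_diff_hom(1)[OF c] J] by simp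
    qed (auto simp: PiE_iff)
  qed
  then show ?thesis by (auto simp: cech_cocycles_def)
qed

lemma module_C': "Module.module S C'"
  by (rule C.sub_module_module[of "carrier Cd"]) auto

interpretation C': Module.module S C' by (rule module_C')

lemma B_subgroup: "additive_subgroup B C'"
  using K.boundaries_submodule[where i = dd] by (intro C'.additive_subgroupI_module) auto

definition \<pi> :: "('v set \<Rightarrow> (('v, 'k) mpoly set \<times> nat) set) \<Rightarrow> _" where
  "\<pi> c = B +>\<^bsub>C'\<^esub> c"

lemma H_eq: "H = quot_module C' B"
  by (simp add: local_cohomology_def cocycles_top)

lemma H_carrier: "carrier H = \<pi> ` carrier Cd"
  unfolding H_eq quot_module_carrier by (auto simp: \<pi>_def)

lemma \<pi>_closed [simp]: "c \<in> carrier Cd \<Longrightarrow> \<pi> c \<in> carrier H"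
  by (simp add: H_carrier)

lemma H_add: "c \<in> carrier Cd \<Longrightarrow> c' \<in> carrier Cd \<Longrightarrow> \<pi> c \<oplus>\<^bsub>H\<^esub> \<pi> c' = \<pi> (c \<oplus>\<^bsub>Cd\<^esub> c')"
  using quot_module_add[OF C'.M.abelian_group_axioms B_subgroup, of c c'] unfolding H_eq \<pi>_def by simp

lemma H_smult: "s \<in> carrier S \<Longrightarrow> c \<in> carrier Cd \<Longrightarrow> s \<odot>\<^bsub>H\<^esub> \<pi> c = \<pi> (s \<odot>\<^bsub>Cd\<^esub> c)"
  using quot_module_smult[OF module_C' B_subgroup, of s c] K.boundaries_submodule(4)[of s _ dd]
  unfolding H_eq \<pi>_def by simp

lemma H_grade: "mgrade H d = \<pi> ` (mgrade Cd d \<inter> carrier Cd)"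
  unfolding H_eq by (simp add: \<pi>_def[abs_def])

lemma \<pi>_eqD:
  assumes "c \<in> carrier Cd" "c' \<in> carrier Cd" "\<pi> c = \<pi> c'"
  obtains b where "b \<in> B" "c = b \<oplus>\<^bsub>Cd\<^esub> c'"
proof -
  interpret abelian_subgroup B C' using B_subgroup C'.M.abelian_group_axioms by (intro abelian_subgroupI3)
  have "c \<in> \<pi> c'" using a_rcos_self[of c] assms by (simp add: \<pi>_def)
  then show ?thesis using that by (auto simp: \<pi>_def a_r_coset_def')
qed

lemma \<pi>_boundary: "b \<in> B \<Longrightarrow> \<pi> b = \<pi> \<zero>\<^bsub>Cd\<^esub>"
proof -
  have "\<pi> c = B" if "c \<in> B" for c
    using quot_module_zero_iff[OF C'.M.abelian_group_axioms B_subgroup, of c]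
      K.boundaries_submodule(1)[where i = dd] that unfolding \<pi>_def by auto
  then show "b \<in> B \<Longrightarrow> \<pi> b = \<pi> \<zero>\<^bsub>Cd\<^esub>"
    using K.boundaries_submodule(2)[where i = dd] by simp
qed

lemma pair_\<pi>_cong:
  assumes "w \<in> carrier W" "c \<in> carrier Cd" "c' \<in> carrier Cd" "\<pi> c = \<pi> c'"
  shows "pair w c = pair w c'"
proof -
  obtain b where b: "b \<in> B" "c = b \<oplus>\<^bsub>Cd\<^esub> c'" using assms(2-4) by (rule \<pi>_eqD)
  then show ?thesis
    using assms pair_add[of b c'] pair_boundary[OF assms(1) b(1)] K.boundaries_submodule(1)[where i = dd] by auto
qed

lemma lookup_times_nonzero:
  assumes "lookup (p * q) m \<noteq> 0"
  obtains a b where "m = a + b" "lookup p a \<noteq> 0" "lookup q b \<noteq> 0"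
  using assms keys_times_mpoly[of m p q] by (metis in_keys_iff)

text \<open>The coefficient at \<open>xm F (n F)\<close> has degree \<open>n F * dd\<close>, so
  scalars of larger degree pair to zero. This is the bound that \<open>eps_represents\<close> asks
  for.\<close>

lemma pair_represented:
  assumes "c \<in> carrier Cd"
  shows "\<exists>e\<in>carrier E. \<forall>s\<in>carrier S. eps (s \<odot>\<^bsub>E\<^esub> e) = pair w (s \<odot>\<^bsub>Cd\<^esub> c)"
proof -
  obtain p n where pn: "\<And>F. F \<in> topf \<Longrightarrow> p F \<in> P" "\<And>F. F \<in> topf \<Longrightarrow> c F = lf F (p F) (n F)"
    using C_reps[OF assms] by blast
  define l where "l s = (\<Sum>F\<in>topf. lookup (rp s * p F * w F) (xm F (n F)))" for s
  have l: "pair w (s \<odot>\<^bsub>Cd\<^esub> c) = l s" if "s \<in> carrier S" for s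
    unfolding l_def using pn that by (rule pair_smult_reps)
  define N where "N = Max (insert 0 ((\<lambda>F. n F * dd) ` topf))"
  have N: "n F * dd \<le> N" if "F \<in> topf" for F
    unfolding N_def using that finite_top by (intro Max_ge) auto
  have "\<exists>e\<in>carrier E. \<forall>s\<in>carrier S. eps (s \<odot>\<^bsub>E\<^esub> e) = l s"
  proof (rule eps_represents[where N = "int N"])
    fix X Y assume "X \<in> carrier S" "Y \<in> carrier S"
    then show "l (X \<oplus>\<^bsub>S\<^esub> Y) = l X + l Y"
      by (simp add: l_def rp_add distrib_right lookup_add sum.distrib)
  next
    fix a X assume "X \<in> carrier S"
    then show "l (con a \<otimes>\<^bsub>S\<^esub> X) = a * l X"
      by (simp add: l_def rp_mult rp_cl res_single empty_face res_const_times res_rp mult.assoc lookup_const_times sum_distrib_left)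
  next
    fix X i assume X: "X \<in> rgrade S i" "int N < i"
    have "lookup (rp X * (p F * w F)) (xm F (n F)) = 0" if F: "F \<in> topf" for F
    proof (rule ccontr)
      assume "lookup (rp X * (p F * w F)) (xm F (n F)) \<noteq> 0"
      then obtain a b where ab: "xm F (n F) = a + b" "lookup (rp X) a \<noteq> 0" by (elim lookup_times_nonzero)
      have "int (mdeg a) = i" using X(1) ab(2) by (auto simp: rgrade_S hpart_id_iff in_keys_iff)
      moreover have "mdeg a + mdeg b = n F * dd"
        using F mdeg_xm[OF topf_finite[OF F], of "n F"] ab(1) by (simp add: mdeg_add topf_def)
      ultimately show False using N[OF F] X(2) by linarith
    qed
    then show "l X = 0" by (simp add: l_def mult.assoc)
  qed
  then show ?thesis using l by simp
qed

definition Lam :: "('v set \<Rightarrow> ('v, 'k) mpoly) \<Rightarrow> _ \<Rightarrow> 'k" where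
  "Lam w h = pair w (SOME c. c \<in> carrier Cd \<and> \<pi> c = h)"

lemma Lam_\<pi>:
  assumes "w \<in> carrier W" "c \<in> carrier Cd"
  shows "Lam w (\<pi> c) = pair w c"
proof -
  have "(SOME c'. c' \<in> carrier Cd \<and> \<pi> c' = \<pi> c) \<in> carrier Cd \<and> \<pi> (SOME c'. c' \<in> carrier Cd \<and> \<pi> c' = \<pi> c) = \<pi> c"
    by (rule someI[of _ c]) (simp add: assms)
  then show ?thesis unfolding Lam_def using pair_\<pi>_cong[OF assms(1)] assms(2) by blast
qed

text \<open>The Matlis dual of \<open>Lam w\<close>: the homomorphism to \<open>E\<close> whose
  composition with \<open>eps\<close> is that functional.\<close>

definition \<Phi> :: "('v set \<Rightarrow> ('v, 'k) mpoly) \<Rightarrow> _ \<Rightarrow> 'e" where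
  "\<Phi> w = (\<lambda>h\<in>carrier H. THE e. e \<in> carrier E \<and> (\<forall>s\<in>carrier S. eps (s \<odot>\<^bsub>E\<^esub> e) = Lam w (s \<odot>\<^bsub>H\<^esub> h)))"

lemma \<Phi>_unique:
  assumes "w \<in> carrier W" "c \<in> carrier Cd" "e \<in> carrier E" "\<And>s. s \<in> carrier S \<Longrightarrow> eps (s \<odot>\<^bsub>E\<^esub> e) = pair w (s \<odot>\<^bsub>Cd\<^esub> c)"
  shows "\<Phi> w (\<pi> c) = e"
proof -
  have "(THE e. e \<in> carrier E \<and> (\<forall>s\<in>carrier S. eps (s \<odot>\<^bsub>E\<^esub> e) = Lam w (s \<odot>\<^bsub>H\<^esub> \<pi> c))) = e"
  proof (rule the_equality)
    show "e \<in> carrier E \<and> (\<forall>s\<in>carrier S. eps (s \<odot>\<^bsub>E\<^esub> e) = Lam w (s \<odot>\<^bsub>H\<^esub> \<pi> c))"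
      using assms by (simp add: H_smult Lam_\<pi>)
    fix e' assume e': "e' \<in> carrier E \<and> (\<forall>s\<in>carrier S. eps (s \<odot>\<^bsub>E\<^esub> e') = Lam w (s \<odot>\<^bsub>H\<^esub> \<pi> c))"
    show "e' = e"
      using e' assms by (intro eps_separates) (simp_all add: H_smult Lam_\<pi>)
  qed
  then show ?thesis using assms(2) by (simp add: \<Phi>_def)
qed

lemma \<Phi>:
  assumes "w \<in> carrier W" "c \<in> carrier Cd"
  shows "\<Phi> w (\<pi> c) \<in> carrier E" "s \<in> carrier S \<Longrightarrow> eps (s \<odot>\<^bsub>E\<^esub> \<Phi> w (\<pi> c)) = pair w (s \<odot>\<^bsub>Cd\<^esub> c)"
proof -
  obtain e where e: "e \<in> carrier E" "\<And>s. s \<in> carrier S \<Longrightarrow> eps (s \<odot>\<^bsub>E\<^esub> e) = pair w (s \<odot>\<^bsub>Cd\<^esub> c)"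
    using pair_represented[OF assms(2)] by blast
  then have "\<Phi> w (\<pi> c) = e" by (intro \<Phi>_unique assms) auto
  then show "\<Phi> w (\<pi> c) \<in> carrier E" "s \<in> carrier S \<Longrightarrow> eps (s \<odot>\<^bsub>E\<^esub> \<Phi> w (\<pi> c)) = pair w (s \<odot>\<^bsub>Cd\<^esub> c)"
    using e by auto
qed

lemma H_cases:
  assumes "h \<in> carrier H"
  obtains c where "c \<in> carrier Cd" "h = \<pi> c"
  using assms by (auto simp: H_carrier)

lemma \<Phi>_hom:
  assumes w: "w \<in> carrier W"
  shows "\<Phi> w \<in> mod_hom S H E"
  unfolding mod_hom_def
proof (intro CollectI conjI ballI)
  show "\<Phi> w \<in> carrier H \<rightarrow>\<^sub>E carrier E"
    using \<Phi>(1)[OF w] by (auto simp: H_carrier) (auto simp: \<Phi>_def H_carrier)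
next
  fix x y assume "x \<in> carrier H" "y \<in> carrier H"
  then obtain c c' where c: "c \<in> carrier Cd" "x = \<pi> c" "c' \<in> carrier Cd" "y = \<pi> c'" by (metis H_cases)
  have "\<Phi> w (\<pi> (c \<oplus>\<^bsub>Cd\<^esub> c')) = \<Phi> w (\<pi> c) \<oplus>\<^bsub>E\<^esub> \<Phi> w (\<pi> c')"
    using c w by (intro \<Phi>_unique) (simp_all add: \<Phi> E.smult_r_distr eps_add C.smult_r_distr pair_add)
  then show "\<Phi> w (x \<oplus>\<^bsub>H\<^esub> y) = \<Phi> w x \<oplus>\<^bsub>E\<^esub> \<Phi> w y"
    using c by (simp add: H_add)
next
  fix s x assume s: "s \<in> carrier S" and "x \<in> carrier H"
  then obtain c where c: "c \<in> carrier Cd" "x = \<pi> c" by (metis H_cases)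
  have "\<Phi> w (\<pi> (s \<odot>\<^bsub>Cd\<^esub> c)) = s \<odot>\<^bsub>E\<^esub> \<Phi> w (\<pi> c)"
    using c w s by (intro \<Phi>_unique) (simp_all add: \<Phi> flip: E.smult_assoc1 C.smult_assoc1)
  then show "\<Phi> w (s \<odot>\<^bsub>H\<^esub> x) = s \<odot>\<^bsub>E\<^esub> \<Phi> w x"
    using c s by (simp add: H_smult)
qed

lemma xx_grade:
  assumes "J \<in> cech_index V dd"
  shows "K.xx J \<in> rgrade S (int dd)" "K.xx J = cl (single (xm J 1) 1)"
proof -
  have J: "J \<subseteq> V" "finite J" "card J = dd" using index_subset[OF assms] index_finite[OF assms] index_card[OF assms] .
  show *: "K.xx J = cl (single (xm J 1) 1)"
    using xx_eq[OF J(1), of 1] K.xx_closed[OF assms] by simp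
  show "K.xx J \<in> rgrade S (int dd)"
    unfolding * using J by (intro cl_rgrade) (auto simp: xm_P hpart_id_iff mdeg_xm split: if_splits)
qed

text \<open>The grading of a localization quantifies over degrees of the denominator, and zero would
  have every degree. At a face the denominator is a nonzero monomial, which forces the
  value.\<close>

lemma xx_degree:
  assumes "F \<in> topf" "K.xx F \<in> rgrade S e"
  shows "e = int dd"
proof -
  note Fi = topf_index[OF assms(1)]
  have "keys (xm F 1) \<in> \<Delta>"
    using keys_xm[OF topf_finite[OF assms(1)]] face_mono top_face[OF assms(1)] by blast
  then have "rp (K.xx F) = single (xm F 1) 1"
    using xm_P[OF topf_subset[OF assms(1)], of 1 "1::'k"] xx_grade(2)[OF Fi] by (simp add: rp_cl res_single)
  then have "int (mdeg (xm F 1)) = e"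
    using assms(2) by (simp add: rgrade_S hpart_id_iff)
  then show ?thesis using mdeg_xm[OF topf_finite[OF assms(1)], of 1] assms(1) by (simp add: topf_def)
qed

text \<open>A nonzero term would need the degrees of the scalar, of the numerator and of the part of
  \<open>w\<close> to add up to the degree of the denominator, which leaves only scalars of degree
  \<open>- (j + e)\<close>.\<close>

lemma \<Phi>_graded:
  assumes w: "w \<in> carrier W"
  shows "\<Phi> (hw e w) \<in> graded_hom S H E e"
  unfolding graded_hom_def
proof (intro CollectI conjI allI \<Phi>_hom hw_closed w subsetI)
  fix j y assume "y \<in> \<Phi> (hw e w) ` mgrade H j"
  then obtain c where c: "c \<in> carrier Cd" "c \<in> mgrade Cd j" "y = \<Phi> (hw e w) (\<pi> c)"
    by (auto simp: H_grade)
  have reps: "\<exists>a n. a \<in> rgrade S (j + int n * int dd) \<and> c F = mfrac S (regular_module S) (K.xx F) (a, n)"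
    if F: "F \<in> topf" for F
  proof -
    have "c F \<in> mgrade (K.L F) j" using c(2) topf_index[OF F] by (auto simp: K.C_simps)
    then obtain a n e where "c F = mfrac S (regular_module S) (K.xx F) (a, n)" "K.xx F \<in> rgrade S e"
      "a \<in> rgrade S (j + int n * e)"
      by (auto simp: cech_loc_def loc_module_def)
    then show ?thesis using xx_degree[OF F] by blast
  qed
  then obtain a n where an: "\<And>F. F \<in> topf \<Longrightarrow> a F \<in> rgrade S (j + int (n F) * int dd)"
    "\<And>F. F \<in> topf \<Longrightarrow> c F = mfrac S (regular_module S) (K.xx F) (a F, n F)" by metis
  have aS: "a F \<in> carrier S" if "F \<in> topf" for F using rgrade_closed[OF an(1)[OF that]] .
  have pn: "\<And>F. F \<in> topf \<Longrightarrow> rp (a F) \<in> P" "\<And>F. F \<in> topf \<Longrightarrow> c F = lf F (rp (a F)) (n F)"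
    using an(2) by (simp_all add: aS rp_P lf_def cl_rp)
  show "y \<in> mgrade E (j + e)"
  proof (rule eps_detects_grade)
    show "y \<in> carrier E" unfolding c(3) by (intro \<Phi>(1) hw_closed w c)
    fix s i assume s: "s \<in> rgrade S i" "i \<noteq> - (j + e)"
    have "eps (s \<odot>\<^bsub>E\<^esub> y) = (\<Sum>F\<in>topf. lookup (rp s * rp (a F) * hw e w F) (xm F (n F)))"
      unfolding c(3) \<Phi>(2)[OF hw_closed[OF w] c(1) rgrade_closed[OF s(1)]]
      using pn rgrade_closed[OF s(1)] by (rule pair_smult_reps)
    also have "\<dots> = 0"
    proof (rule sum.neutral, rule ballI, rule ccontr)
      fix F assume F: "F \<in> topf" and "lookup (rp s * rp (a F) * hw e w F) (xm F (n F)) \<noteq> 0"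
      then obtain x y z where xyz: "xm F (n F) = x + y + z" "lookup (rp s) x \<noteq> 0" "lookup (rp (a F)) y \<noteq> 0" "lookup (hw e w F) z \<noteq> 0"
        by (elim lookup_times_nonzero) blast
      have "int (mdeg x) = i" "int (mdeg y) = j + int (n F) * int dd"
        using s(1) an(1)[OF F] xyz by (auto simp: rgrade_S hpart_id_iff in_keys_iff)
      moreover have "int (mdeg z) = e" using xyz(4) by (auto simp: hw_def lookup_hpart split: if_splits)
      moreover have "mdeg x + mdeg y + mdeg z = n F * dd"
        using F mdeg_xm[OF topf_finite[OF F], of "n F"] xyz(1) by (simp add: mdeg_add topf_def)
      then have "int (mdeg x) + int (mdeg y) + int (mdeg z) = int (n F) * int dd"
        by (metis of_nat_add of_nat_mult)
      ultimately show False using s(2) by linarith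
    qed
    finally show "eps (s \<odot>\<^bsub>E\<^esub> y) = 0" .
  qed
qed

lemma \<Phi>_in_canonical:
  assumes w: "w \<in> carrier W"
  shows "\<Phi> w \<in> carrier (star_Hom S H E)"
proof -
  have "\<Phi> w h = (\<Oplus>\<^bsub>E\<^esub>e\<in>wdegs w. \<Phi> (hw e w) h)" if h: "h \<in> carrier H" for h
  proof -
    obtain c where c: "c \<in> carrier Cd" "h = \<pi> c" using h by (rule H_cases)
    have cl: "(\<lambda>e. \<Phi> (hw e w) (\<pi> c)) \<in> wdegs w \<rightarrow> carrier E"
      using \<Phi>(1)[OF hw_closed[OF w] c(1)] by blast
    show ?thesis
      unfolding c(2)
    proof (rule \<Phi>_unique[OF w c(1)])
      show "(\<Oplus>\<^bsub>E\<^esub>e\<in>wdegs w. \<Phi> (hw e w) (\<pi> c)) \<in> carrier E" using cl by (rule E.M.finsum_closed)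
      fix s assume s: "s \<in> carrier S"
      have "s \<odot>\<^bsub>E\<^esub> (\<Oplus>\<^bsub>E\<^esub>e\<in>wdegs w. \<Phi> (hw e w) (\<pi> c)) = (\<Oplus>\<^bsub>E\<^esub>e\<in>wdegs w. s \<odot>\<^bsub>E\<^esub> \<Phi> (hw e w) (\<pi> c))"
        using cl s finite_wdegs by (intro E.finsum_smult_ldistr) auto
      then have "eps (s \<odot>\<^bsub>E\<^esub> (\<Oplus>\<^bsub>E\<^esub>e\<in>wdegs w. \<Phi> (hw e w) (\<pi> c))) = (\<Sum>e\<in>wdegs w. pair (hw e w) (s \<odot>\<^bsub>Cd\<^esub> c))"
        using cl s w c by (simp add: eps_finsum[OF finite_wdegs] Pi_iff \<Phi> hw_closed)
      also have "\<dots> = pair w (s \<odot>\<^bsub>Cd\<^esub> c)"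
        using s c(1) hw_decompose[OF w finite_wdegs order_refl]
        by (intro pair_sum_left[symmetric] finite_wdegs) auto
      finally show "eps (s \<odot>\<^bsub>E\<^esub> (\<Oplus>\<^bsub>E\<^esub>e\<in>wdegs w. \<Phi> (hw e w) (\<pi> c))) = pair w (s \<odot>\<^bsub>Cd\<^esub> c)" .
    qed
  qed
  then have "finite (wdegs w) \<and> (\<forall>e\<in>wdegs w. \<Phi> (hw e w) \<in> graded_hom S H E e) \<and>
      (\<forall>h\<in>carrier H. \<Phi> w h = (\<Oplus>\<^bsub>E\<^esub>e\<in>wdegs w. \<Phi> (hw e w) h))"
    using finite_wdegs \<Phi>_graded[OF w] by blast
  then have "\<exists>D g. finite D \<and> (\<forall>e\<in>D. g e \<in> graded_hom S H E e) \<and>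
      (\<forall>h\<in>carrier H. \<Phi> w h = (\<Oplus>\<^bsub>E\<^esub>e\<in>D. g e h))"
    by (intro exI[of _ "wdegs w"] exI[of _ "\<lambda>e. \<Phi> (hw e w)"])
  then show ?thesis
    using \<Phi>_hom[OF w] unfolding star_Hom_def by simp
qed

lemma \<Phi>_add:
  assumes "w \<in> carrier W" "w' \<in> carrier W"
  shows "\<Phi> (w \<oplus>\<^bsub>W\<^esub> w') = \<Phi> w \<oplus>\<^bsub>star_Hom S H E\<^esub> \<Phi> w'"
proof -
  have "\<Phi> (w \<oplus>\<^bsub>W\<^esub> w') (\<pi> c) = \<Phi> w (\<pi> c) \<oplus>\<^bsub>E\<^esub> \<Phi> w' (\<pi> c)" if c: "c \<in> carrier Cd" for c
    using c assms W_add_closed[OF assms] by (intro \<Phi>_unique) (simp_all add: \<Phi> E.smult_r_distr eps_add pair_W_add del: W_simps)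
  then show ?thesis
    by (intro extensionalityI[of _ "carrier H"]) (auto simp: star_Hom_def H_carrier \<Phi>_def[of "w \<oplus>\<^bsub>W\<^esub> w'"] simp del: W_simps)
qed

lemma \<Phi>_smult:
  assumes "s \<in> carrier S" "w \<in> carrier W"
  shows "\<Phi> (s \<odot>\<^bsub>W\<^esub> w) = s \<odot>\<^bsub>star_Hom S H E\<^esub> \<Phi> w"
proof -
  have "\<Phi> (s \<odot>\<^bsub>W\<^esub> w) (\<pi> c) = s \<odot>\<^bsub>E\<^esub> \<Phi> w (\<pi> c)" if c: "c \<in> carrier Cd" for c
  proof (rule \<Phi>_unique)
    fix t assume t: "t \<in> carrier S"
    have "t \<odot>\<^bsub>E\<^esub> (s \<odot>\<^bsub>E\<^esub> \<Phi> w (\<pi> c)) = (s \<otimes>\<^bsub>S\<^esub> t) \<odot>\<^bsub>E\<^esub> \<Phi> w (\<pi> c)"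
      using t c assms by (simp add: \<Phi> m_comm flip: E.smult_assoc1)
    then have "eps (t \<odot>\<^bsub>E\<^esub> (s \<odot>\<^bsub>E\<^esub> \<Phi> w (\<pi> c))) = pair w (s \<odot>\<^bsub>Cd\<^esub> (t \<odot>\<^bsub>Cd\<^esub> c))"
      using t c assms by (simp add: \<Phi> flip: C.smult_assoc1)
    then show "eps (t \<odot>\<^bsub>E\<^esub> (s \<odot>\<^bsub>E\<^esub> \<Phi> w (\<pi> c))) = pair (s \<odot>\<^bsub>W\<^esub> w) (t \<odot>\<^bsub>Cd\<^esub> c)"
      using t c assms by (simp add: pair_W_smult del: W_simps)
  qed (use c assms W_smult_closed \<Phi> in \<open>auto simp del: W_simps\<close>)
  then show ?thesis
    by (intro extensionalityI[of _ "carrier H"]) (auto simp: star_Hom_def H_carrier \<Phi>_def[of "s \<odot>\<^bsub>W\<^esub> w"] simp del: W_simps)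
qed

text \<open>The fraction \<open>1 / m\<close> at the face \<open>F\<close>.\<close>

definition recip :: "'v set \<Rightarrow> ('v \<Rightarrow>\<^sub>0 nat) \<Rightarrow> (('v, 'k) mpoly set \<times> nat) set" where
  "recip F m = lf F (single (xm F (mdeg m) - m) 1) (mdeg m)"

lemma recip_P: "J \<subseteq> V \<Longrightarrow> keys m \<subseteq> J \<Longrightarrow> single (xm J (mdeg m) - m) c \<in> P"
  using divides_xm_mdeg(2)[of J m] finite_subset[OF _ finite_V, of J]
  by (intro polys_single) blast

lemma recip_closed: "F \<in> topf \<Longrightarrow> keys m \<subseteq> F \<Longrightarrow> recip F m \<in> carrier (K.L F)"
  unfolding recip_def by (intro lf_closed[OF topf_index] recip_P topf_subset)

lemma conc_pair:
  assumes F: "F \<in> topf"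
  shows "pair w (conc dd F X) = pf (w F) F X"
proof -
  have "pair w (conc dd F X) = (\<Sum>F'\<in>topf. if F' = F then pf (w F) F X else 0)"
    unfolding pair_def
    by (rule sum.cong) (auto simp: conc_def topf_index pf_zero simp del: K.C_simps)
  then show ?thesis using F finite_top by simp
qed

lemma pair_recip:
  assumes F: "F \<in> topf" and m: "keys m \<subseteq> F"
  shows "pair w (conc dd F (recip F m)) = lookup (w F) m"
proof -
  have "xm F (mdeg m) = (xm F (mdeg m) - m) + m"
    by (rule divides_xm_mdeg(1)[OF topf_finite[OF F] m])
  then have "lookup (single (xm F (mdeg m) - m) 1 * w F) (xm F (mdeg m)) = lookup (w F) m"
    using lookup_single_times[of "xm F (mdeg m) - m" 1 "w F" m] by simp
  then show ?thesis
    using F m by (simp add: conc_pair recip_def pf_lf recip_P topf_subset)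
qed

lemma \<Phi>_inj: "inj_on \<Phi> (carrier W)"
proof (rule inj_onI)
  fix w w' assume w: "w \<in> carrier W" "w' \<in> carrier W" and eq: "\<Phi> w = \<Phi> w'"
  have p: "pair w c = pair w' c" if c: "c \<in> carrier Cd" for c
    using \<Phi>(2)[OF w(1) c one_closed] \<Phi>(2)[OF w(2) c one_closed] eq c by simp
  have "lookup (w F) m = lookup (w' F) m" for F m
  proof (cases "F \<in> topf \<and> keys m \<subseteq> F")
    case True
    then show ?thesis using p[OF conc_closed[OF recip_closed]] by (simp add: pair_recip)
  next
    case False
    have "lookup (u F) m = 0" if "u \<in> carrier W" for u
    proof (cases "F \<in> topf")
      case True
      then have "lookup (res (Pow F) (u F)) m = 0" using False by (simp add: lookup_res)
      then show ?thesis using that by (simp add: W_carrier)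
    qed (use that in \<open>simp add: W_carrier\<close>)
    then show ?thesis using w by simp
  qed
  then show "w = w'" by (intro ext poly_mapping_eqI)
qed

text \<open>For the surjectivity of \<open>\<Phi>\<close>: a functional on the top term that kills the boundaries is
  determined by its values on the fractions \<open>1 / m\<close>.\<close>

context
  fixes \<psi> :: "('v set \<Rightarrow> (('v, 'k) mpoly set \<times> nat) set) \<Rightarrow> 'k" and w :: "'v set \<Rightarrow> ('v, 'k) mpoly"
  assumes \<psi>_add: "\<And>c c'. c \<in> carrier Cd \<Longrightarrow> c' \<in> carrier Cd \<Longrightarrow> \<psi> (c \<oplus>\<^bsub>Cd\<^esub> c') = \<psi> c + \<psi> c'"
    and \<psi>_const: "\<And>a c. c \<in> carrier Cd \<Longrightarrow> \<psi> (con a \<odot>\<^bsub>Cd\<^esub> c) = a * \<psi> c"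
    and \<psi>_B: "\<And>b. b \<in> B \<Longrightarrow> \<psi> b = 0"
    and w_coeff: "\<And>F m. lookup (w F) m = (if F \<in> topf \<and> keys m \<subseteq> F then \<psi> (conc dd F (recip F m)) else 0)"
begin

lemma \<psi>_zero: "\<psi> \<zero>\<^bsub>Cd\<^esub> = 0"
  using \<psi>_B K.boundaries_submodule(2)[where i = dd] by blast

lemma \<psi>_conc_zero: "\<psi> (conc dd F \<zero>\<^bsub>K.L F\<^esub>) = 0"
  by (simp add: conc_zero \<psi>_zero)

lemma \<psi>_conc_const:
  assumes "F \<in> topf" "keys t \<subseteq> V"
  shows "\<psi> (conc dd F (lf F (single t a) n)) = a * \<psi> (conc dd F (lf F (single t 1) n))"
proof -
  have "lf F (single t a) n = con a \<odot>\<^bsub>K.L F\<^esub> lf F (single t 1) n"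
    using lf_smult[OF topf_index[OF assms(1)], of "single t 1" "single 0 a" n] assms by (simp add: polys_single mult_single)
  then show ?thesis
    using assms by (simp add: conc_smult \<psi>_const conc_closed lf_closed[OF topf_index] polys_single)
qed

lemma \<psi>_boundary_sum:
  assumes J: "Suc (card J) = dd" "J \<subseteq> V" and X: "X \<in> carrier (K.L J)"
  shows "(\<Sum>v\<in>V - J. \<psi> (conc dd (insert v J) (K.face_map (insert v J) v X))) = 0"
proof -
  have Ji: "J \<in> cech_index V (card J)" using J by (simp add: cech_index_def)
  have "cech_diff S V (\<lambda>v. cl (pvar v)) (regular_module S) (card J) (conc (card J) J X) \<in> B"
    unfolding J(1)[symmetric] cech_boundaries_def using conc_closed[OF X, of "card J"] by simp
  then have "\<psi> (cech_diff S V (\<lambda>v. cl (pvar v)) (regular_module S) (card J) (conc (card J) J X)) = 0"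
    by (rule \<psi>_B)
  then show ?thesis
    using additive_cech_diff_conc[of "card J" \<psi> J X, unfolded J(1), OF \<psi>_add Ji X] by simp
qed

lemma face_map_monomial:
  assumes J: "Suc (card J) = dd" "J \<subseteq> V" and v: "v \<in> V - J" and t: "keys t \<subseteq> V"
  shows "K.face_map (insert v J) v (lf J (single t 1) n) =
    lf (insert v J) (single (single v n + t) (bsign (insert v J) v)) n"
    and "insert v J \<in> cech_index V dd" and "keys (single v n + t) \<subseteq> V"
proof -
  have fJ: "finite J" using J(2) finite_V by (rule finite_subset)
  show i: "insert v J \<in> cech_index V dd" using J v fJ by (auto simp: cech_index_def)
  then have "insert v J \<in> cech_index V (Suc (card J))" by (simp only: J(1))
  then show "K.face_map (insert v J) v (lf J (single t 1) n) =
      lf (insert v J) (single (single v n + t) (bsign (insert v J) v)) n"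
    using face_map_lf[of "insert v J" "card J" v "single t 1" n] v t by (simp add: polys_single mult_single)
  show "keys (single v n + t) \<subseteq> V" using v t by (auto simp: keys_add_nat split: if_splits)
qed

lemma lf_monomial_vanish:
  assumes F: "F \<in> cech_index V dd" and t: "keys t \<subseteq> V" and "F \<in> topf \<Longrightarrow> \<not> keys t \<subseteq> F"
  shows "lf F (single t a) n = \<zero>\<^bsub>K.L F\<^esub>"
proof (cases "F \<in> topf")
  case True
  then show ?thesis
    using assms top_maximal[OF True, of "keys t \<union> F"]
    by (intro lf_vanish[OF F] polys_single) (auto split: if_splits)
next
  case False
  then show ?thesis
    using nonface_loc_trivial[OF F index_top_or_trivial[OF F False]] lf_closed[OF F polys_single[OF t]] by blast
qed

lemma \<psi>_monomial:
  assumes F: "F \<in> topf" and t: "keys t \<subseteq> V"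
  shows "\<psi> (conc dd F (lf F (single t 1) n)) = lookup (single t 1 * w F) (xm F n)"
proof -
  note fF = topf_finite[OF F] and Fi = topf_index[OF F] and FV = topf_subset[OF F]
  have cF: "card F = dd" using F by (simp add: topf_def)
  \<comment> \<open>In case \<open>a\<close> the fraction is zero because \<open>F\<close> is
    maximal; in case \<open>c\<close> it is the reciprocal of a monomial. In case \<open>b\<close>
    it is neither, and only the relations from boundaries show that \<psi> kills it.\<close>
  consider (a) "\<not> keys t \<subseteq> F" | (b) v where "keys t \<subseteq> F" "lookup t v > n" | (c) "keys t \<subseteq> F" "\<And>v. lookup t v \<le> n"
    by (metis linorder_not_le)
  then show ?thesis
  proof cases
    case a
    then have "lf F (single t 1) n = \<zero>\<^bsub>K.L F\<^esub>" by (intro lf_monomial_vanish Fi t)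
    moreover have "\<nexists>q. xm F n = t + q" using a keys_xm[OF fF, of n] by (metis keys_add_nat le_sup_iff)
    ultimately show ?thesis by (simp add: \<psi>_conc_zero lookup_single_times_notin)
  next
    case b
    \<comment> \<open>Cancelling the denominator at \<open>v\<close> gives a fraction at
      \<open>J = F - {v}\<close> whose image at \<open>F\<close> is the given one up to sign. At
      every other coface the image is zero, because \<open>v\<close> still occurs in
      \<open>t'\<close>.\<close>
    define J where "J = F - {v}"
    define t' where "t' = t - single v n"
    have vt: "v \<in> keys t" using b(2) by (auto simp: in_keys_iff)
    have tt: "t = single v n + t'"
      using b(2) by (intro poly_mapping_eqI) (auto simp: t'_def lookup_add lookup_minus lookup_single when_def)
    have vt': "v \<in> keys t'" using b(2) by (auto simp: t'_def in_keys_iff lookup_minus)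
    have t'V: "keys t' \<subseteq> V" using t tt by (metis keys_add_nat le_sup_iff)
    have vF: "v \<in> F" using vt b(1) by blast
    have J: "Suc (card J) = dd" "J \<subseteq> V" "insert v J = F" "v \<in> V - J"
      using vF fF cF FV card_Suc_Diff1[OF fF vF] by (auto simp: J_def)
    have X: "lf J (single t' 1) n \<in> carrier (K.L J)"
      using J t'V by (intro lf_closed[of J "card J"] polys_single) (simp_all add: cech_index_def)
    have z: "\<psi> (conc dd (insert u J) (K.face_map (insert u J) u (lf J (single t' 1) n))) = 0"
      if u: "u \<in> V - J" "u \<noteq> v" for u
    proof -
      have "\<not> keys (single u n + t') \<subseteq> insert u J"
        using vt' u J_def by (auto simp: keys_add_nat)
      then show ?thesis
        using face_map_monomial(1,3)[OF J(1,2) u(1) t'V, of n] face_map_monomial(2)[OF J(1,2) u(1) t'V]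
        by (simp add: lf_monomial_vanish \<psi>_conc_zero)
    qed
    have "0 = (\<Sum>u\<in>V - J. \<psi> (conc dd (insert u J) (K.face_map (insert u J) u (lf J (single t' 1) n))))"
      using \<psi>_boundary_sum[OF J(1,2) X] by simp
    also have "\<dots> = (\<Sum>u\<in>{v}. \<psi> (conc dd (insert u J) (K.face_map (insert u J) u (lf J (single t' 1) n))))"
      using J(4) z finite_V by (intro sum.mono_neutral_right) auto
    also have "\<dots> = bsign F v * \<psi> (conc dd F (lf F (single t 1) n))"
      using face_map_monomial(1)[OF J(1,2,4) t'V, of n] \<psi>_conc_const[OF F t, of "bsign F v" n] by (simp add: J(3) flip: tt)
    finally have "\<psi> (conc dd F (lf F (single t 1) n)) = 0" by simp
    moreover have "\<nexists>q. xm F n = t + q"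
    proof
      assume "\<exists>q. xm F n = t + q"
      then obtain q where "xm F n = t + q" by blast
      then have "lookup (xm F n) v = lookup t v + lookup q v" by (simp add: lookup_add)
      then show False using b(2) vF fF by (simp add: lookup_mprod)
    qed
    ultimately show ?thesis by (simp add: lookup_single_times_notin)
  next
    case c
    define m where "m = xm F n - t"
    define r where "r = xm F (mdeg m) - m"
    have m: "xm F n = m + t" "keys m \<subseteq> F" unfolding m_def using divides_xm[OF fF c] by auto
    have r: "xm F (mdeg m) = r + m" "keys r \<subseteq> F" unfolding r_def using divides_xm_mdeg[OF fF m(2)] by auto
    have "lf F (single t 1) n = recip F m"
      unfolding recip_def r_def[symmetric] using t r(2) FV
      by (subst lf_eq_iff[OF Fi]) (auto intro!: exI[of _ 0] simp: polys_single mult_single m(1) r(1) add_ac)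
    then have "\<psi> (conc dd F (lf F (single t 1) n)) = lookup (w F) m"
      using F m(2) by (simp add: w_coeff)
    then show ?thesis using lookup_single_times[of t 1 "w F" m] m(1) by (simp add: add.commute)
  qed
qed

lemma \<psi>_lf:
  assumes F: "F \<in> topf" and p: "p \<in> P"
  shows "\<psi> (conc dd F (lf F p n)) = lookup (p * w F) (xm F n)"
proof -
  note Fi = topf_index[OF F]
  have "p \<in> P \<and> \<psi> (conc dd F (lf F p n)) = lookup (p * w F) (xm F n)"
  proof (induction p rule: mpoly_induct)
    case zero
    then show ?case by (simp add: lf_zero[OF Fi] \<psi>_conc_zero)
  next
    case (single_add m c q)
    have mV: "keys m \<subseteq> V" using p single_add(1) by (auto simp: polys_def)
    have mP: "single m c \<in> P" using mV by (rule polys_single)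
    have qP: "q \<in> P" using single_add(3) by simp
    have "\<psi> (conc dd F (lf F (single m c + q) n)) = \<psi> (conc dd F (lf F (single m c) n)) + \<psi> (conc dd F (lf F q n))"
      unfolding lf_add[OF Fi mP qP, symmetric] using mP qP
      by (simp add: conc_add lf_closed[OF Fi] \<psi>_add conc_closed)
    also have "\<psi> (conc dd F (lf F (single m c) n)) = lookup (single m c * w F) (xm F n)"
    proof -
      have "single m c = single 0 c * single m 1"
        by (simp add: mult_single)
      then have "single m c * w F = single 0 c * (single m 1 * w F)"
        by (simp only: mult.assoc)
      then have "lookup (single m c * w F) (xm F n) = c * lookup (single m 1 * w F) (xm F n)"
        by (simp only: lookup_const_times)
      then show ?thesis using \<psi>_conc_const[OF F mV, of c n] \<psi>_monomial[OF F mV, of n] by (simp only:)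
    qed
    finally show ?case using single_add(3) mP qP by (simp add: polys_add distrib_right lookup_add)
  qed
  then show ?thesis ..
qed

lemma \<psi>_eq_pair:
  assumes c: "c \<in> carrier Cd"
  shows "\<psi> c = pair w c"
proof -
  have "\<psi> (conc dd F (c F)) = pair w (conc dd F (c F))" if F: "F \<in> cech_index V dd" for F
  proof (cases "F \<in> topf")
    case True
    obtain p n where "p \<in> P" "c F = lf F p n" using lf_cases[OF F C_comp[OF c F]] .
    then show ?thesis using True by (simp add: \<psi>_lf conc_pair pf_lf)
  next
    case False
    have "c F = \<zero>\<^bsub>K.L F\<^esub>"
      using nonface_loc_trivial[OF F index_top_or_trivial[OF F False] C_comp[OF c F]] .
    moreover have "pair w \<zero>\<^bsub>Cd\<^esub> = 0"
      using pair_add[OF C.M.zero_closed C.M.zero_closed, of w] C.M.l_zero[OF C.M.zero_closed]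
      by (metis add_cancel_right_right)
    ultimately show ?thesis by (simp add: conc_zero \<psi>_zero)
  qed
  then show ?thesis
    using additive_conc_sum[of dd \<psi>, OF \<psi>_add c] additive_conc_sum[of dd "pair w", OF pair_add c] by simp
qed

lemma w_closed: "w \<in> carrier W"
  unfolding W_carrier
proof (intro conjI allI impI)
  fix F assume "F \<notin> topf"
  then show "w F = 0" by (intro poly_mapping_eqI) (simp add: w_coeff)
next
  fix F show "res (Pow F) (w F) = w F" by (intro poly_mapping_eqI) (simp add: w_coeff lookup_res)
next
  fix J assume J: "J \<subseteq> V \<and> Suc (card J) = dd"
  then have J': "Suc (card J) = dd" "J \<subseteq> V" by auto
  have fJ: "finite J" using J'(2) finite_V by (rule finite_subset)
  show "(\<Sum>v\<in>cofaces J. single 0 (bsign (insert v J) v) * res (Pow J) (w (insert v J))) = 0"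
  proof (rule poly_mapping_eqI)
    fix m
    show "lookup (\<Sum>v\<in>cofaces J. single 0 (bsign (insert v J) v) * res (Pow J) (w (insert v J))) m = lookup 0 m"
    proof (cases "keys m \<subseteq> J")
      case True
      \<comment> \<open>The coefficient of \<open>m\<close> in the condition at \<open>J\<close> is
        the value of \<psi> on the boundary of the fraction \<open>1 / m\<close> at
        \<open>J\<close>. The exponent \<open>mdeg m\<close> is at least every exponent of
        \<open>m\<close>, so the common denominator is divisible by \<open>m\<close>.\<close>
      let ?n = "mdeg m"
      define r where "r = xm J ?n - m"
      have r: "xm J ?n = r + m" "keys r \<subseteq> J" unfolding r_def using divides_xm_mdeg[OF fJ True] by auto
      have rV: "keys r \<subseteq> V" using r(2) J'(2) by blast
      let ?X = "lf J (single r 1) ?n"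
      have X: "?X \<in> carrier (K.L J)"
        using J' rV by (intro lf_closed[of J "card J"] polys_single) (simp_all add: cech_index_def)
      have e: "\<psi> (conc dd (insert v J) (K.face_map (insert v J) v ?X)) =
          (if v \<in> cofaces J then bsign (insert v J) v * lookup (w (insert v J)) m else 0)"
        if v: "v \<in> V - J" for v
      proof (cases "insert v J \<in> topf")
        case top: True
        have "xm (insert v J) ?n = (single v ?n + r) + m" using xm_insert[OF fJ, of v ?n] v r(1) by (simp add: add_ac)
        then have "single v ?n + r = xm (insert v J) ?n - m" by simp
        then show ?thesis
          using face_map_monomial(1,3)[OF J' v rV, of ?n] face_map_monomial(2)[OF J' v rV] v True top
            \<psi>_conc_const[OF top face_map_monomial(3)[OF J' v rV, of ?n], of "bsign (insert v J) v" ?n]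
          by (auto simp: cofaces_def w_coeff recip_def)
      next
        case False
        have "lf (insert v J) (single (single v ?n + r) (bsign (insert v J) v)) ?n = \<zero>\<^bsub>K.L (insert v J)\<^esub>"
          using False by (intro lf_monomial_vanish face_map_monomial(2,3)[OF J' v rV]) simp
        then show ?thesis
          using face_map_monomial(1)[OF J' v rV, of ?n] False by (simp add: cofaces_def \<psi>_conc_zero)
      qed
      have "lookup (\<Sum>v\<in>cofaces J. single 0 (bsign (insert v J) v) * res (Pow J) (w (insert v J))) m =
        (\<Sum>v\<in>cofaces J. bsign (insert v J) v * lookup (w (insert v J)) m)"
        using True by (simp add: lookup_sum lookup_const_times lookup_res)
      also have "\<dots> = (\<Sum>v\<in>V - J. if v \<in> cofaces J then bsign (insert v J) v * lookup (w (insert v J)) m else 0)"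
        using finite_V by (intro sum.mono_neutral_cong_left) (auto simp: cofaces_def)
      also have "\<dots> = (\<Sum>v\<in>V - J. \<psi> (conc dd (insert v J) (K.face_map (insert v J) v ?X)))"
        using e by (intro sum.cong) auto
      also have "\<dots> = 0" by (rule \<psi>_boundary_sum[OF J' X])
      finally show ?thesis by simp
    next
      case False
      then show ?thesis by (simp add: lookup_sum lookup_const_times lookup_res)
    qed
  qed
qed

end

lemma recip_grade:
  assumes F: "F \<in> topf" and m: "keys m \<subseteq> F"
  shows "conc dd F (recip F m) \<in> mgrade Cd (- int (mdeg m))"
proof -
  let ?n = "mdeg m"
  have r: "xm F ?n = (xm F ?n - m) + m"
    by (rule divides_xm_mdeg(1)[OF topf_finite[OF F] m])
  have "mdeg ((xm F ?n - m) + m) = ?n * dd"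
    unfolding r[symmetric] using mdeg_xm[OF topf_finite[OF F], of ?n] F by (simp add: topf_def)
  then have "mdeg (xm F ?n - m) + ?n = ?n * dd" by (simp only: mdeg_add)
  then have "int (mdeg (xm F ?n - m)) + int ?n = int ?n * int dd"
    by (simp only: flip: of_nat_add of_nat_mult)
  then have "int (mdeg (xm F ?n - m)) = - int ?n + int ?n * int dd" by linarith
  then have "cl (single (xm F ?n - m) 1) \<in> rgrade S (- int ?n + int ?n * int dd)"
    using recip_P[OF topf_subset[OF F] m] by (intro cl_rgrade) (auto simp: hpart_id_iff)
  then have 1: "recip F m \<in> mgrade (K.L F) (- int ?n)"
    using xx_grade(1)[OF topf_index[OF F]] by (auto simp: recip_def lf_def cech_loc_def loc_module_def)
  have 2: "\<zero>\<^bsub>K.L J\<^esub> \<in> mgrade (K.L J) d" if J: "J \<in> cech_index V dd" for J d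
  proof -
    have "\<zero>\<^bsub>S\<^esub> \<in> rgrade S (d + int 0 * int dd)" by (simp add: rgrade_S)
    then show ?thesis
      unfolding cech_loc_def loc_module_def using xx_grade(1)[OF J]
      by simp (intro exI[of _ "\<zero>\<^bsub>S\<^esub>"] exI[of _ 0] conjI refl exI[of _ "int dd"], simp_all)
  qed
  show ?thesis using 1 2 by (auto simp: K.C_simps conc_def)
qed

lemma \<Phi>_surj:
  assumes \<phi>: "\<phi> \<in> carrier (star_Hom S H E)"
  shows "\<exists>w\<in>carrier W. \<Phi> w = \<phi>"
proof -
  have hom: "\<phi> \<in> mod_hom S H E" using \<phi> by (simp add: star_Hom_def)
  obtain D g where D: "finite D" "\<And>d. d \<in> D \<Longrightarrow> g d \<in> graded_hom S H E d"
    "\<And>h. h \<in> carrier H \<Longrightarrow> \<phi> h = (\<Oplus>\<^bsub>E\<^esub>d\<in>D. g d h)"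
    using \<phi> unfolding star_Hom_def by auto
  have \<phi>E: "\<phi> h \<in> carrier E" if "h \<in> carrier H" for h using hom that by (auto simp: mod_hom_def)
  have \<phi>_add: "\<phi> (\<pi> (c \<oplus>\<^bsub>Cd\<^esub> c')) = \<phi> (\<pi> c) \<oplus>\<^bsub>E\<^esub> \<phi> (\<pi> c')" if "c \<in> carrier Cd" "c' \<in> carrier Cd" for c c'
    using hom that by (auto simp: mod_hom_def simp flip: H_add)
  have \<phi>_smult: "\<phi> (\<pi> (s \<odot>\<^bsub>Cd\<^esub> c)) = s \<odot>\<^bsub>E\<^esub> \<phi> (\<pi> c)" if "s \<in> carrier S" "c \<in> carrier Cd" for s c
    using hom that by (auto simp: mod_hom_def simp flip: H_smult)
  define \<psi> where "\<psi> c = eps (\<phi> (\<pi> c))" for c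
  define w where "w F = Abs_poly_mapping (\<lambda>m. if F \<in> topf \<and> keys m \<subseteq> F then \<psi> (conc dd F (recip F m)) else 0)" for F
  have \<psi>_add: "\<psi> (c \<oplus>\<^bsub>Cd\<^esub> c') = \<psi> c + \<psi> c'" if "c \<in> carrier Cd" "c' \<in> carrier Cd" for c c'
    using that by (simp add: \<psi>_def \<phi>_add eps_add \<phi>E)
  have \<psi>_const: "\<psi> (con a \<odot>\<^bsub>Cd\<^esub> c) = a * \<psi> c" if "c \<in> carrier Cd" for a c
    using that by (simp add: \<psi>_def \<phi>_smult eps_const \<phi>E)
  have \<psi>_B: "\<psi> b = 0" if "b \<in> B" for b
  proof -
    have "\<psi> b = \<psi> \<zero>\<^bsub>Cd\<^esub>" using \<pi>_boundary[OF that] by (simp add: \<psi>_def)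
    also have "\<dots> = 0"
      using \<psi>_add[OF C.M.zero_closed C.M.zero_closed] C.M.l_zero[OF C.M.zero_closed]
      by (metis add_cancel_right_right)
    finally show ?thesis .
  qed
  \<comment> \<open>The reciprocal of \<open>m\<close> has degree \<open>- mdeg m\<close> and
    \<open>eps\<close> sees only degree zero, so \<open>mdeg m\<close> must be one of the degrees in
    \<open>D\<close>. Here it matters that \<open>star_Hom\<close> consists of finite sums of
    homogeneous maps: each \<open>w F\<close> is a polynomial.\<close>
  have w_coeff: "lookup (w F) m = (if F \<in> topf \<and> keys m \<subseteq> F then \<psi> (conc dd F (recip F m)) else 0)" for F m
  proof -
    define N where "N = nat (Max (insert 0 D))"
    have "m \<in> face_monomials N"
      if m: "F \<in> topf" "keys m \<subseteq> F" "\<psi> (conc dd F (recip F m)) \<noteq> 0" for m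
    proof -
      let ?h = "\<pi> (conc dd F (recip F m))"
      have c: "conc dd F (recip F m) \<in> carrier Cd" using m by (intro conc_closed recip_closed)
      have h: "?h \<in> mgrade H (- int (mdeg m))" "?h \<in> carrier H"
        using recip_grade[OF m(1,2)] c by (auto simp: H_grade)
      have "g d \<in> carrier H \<rightarrow>\<^sub>E carrier E" if "d \<in> D" for d
        using D(2)[OF that] by (simp add: graded_hom_def mod_hom_def)
      then have gE: "(\<lambda>d. g d ?h) \<in> D \<rightarrow> carrier E" using h(2) by (auto dest: PiE_mem)
      have "(\<Sum>d\<in>D. eps (g d ?h)) \<noteq> 0"
        using m(3) D(1) D(3)[OF h(2)] eps_finsum[OF D(1) gE] by (simp add: \<psi>_def)
      then obtain d where d: "d \<in> D" "eps (g d ?h) \<noteq> 0" by (meson sum.neutral)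
      have "g d ` mgrade H (- int (mdeg m)) \<subseteq> mgrade E (- int (mdeg m) + d)"
        using D(2)[OF d(1)] unfolding graded_hom_def by blast
      then have "g d ?h \<in> mgrade E (- int (mdeg m) + d)" using h(1) by blast
      then have "d = int (mdeg m)" using eps_grade d(2) by force
      then have "int (mdeg m) \<le> Max (insert 0 D)" using d(1) D(1) by (intro Max_ge) auto
      then have "mdeg m \<le> N" by (simp add: N_def)
      then have "lookup m v \<le> N" for v using lookup_le_mdeg[of m v] by linarith
      moreover have "keys m \<in> \<Delta>" using m(1,2) face_mono top_face by blast
      ultimately show ?thesis by (simp add: face_monomials_def)
    qed
    then have "finite {m. (if F \<in> topf \<and> keys m \<subseteq> F then \<psi> (conc dd F (recip F m)) else 0) \<noteq> 0}"
      by (intro finite_subset[OF _ face_monomials_bound(1)[of N]]) (auto split: if_splits)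
    then show ?thesis unfolding w_def by simp
  qed
  note facts = \<psi>_add \<psi>_const \<psi>_B w_coeff
  have w: "w \<in> carrier W" using w_closed[of \<psi> w] facts by blast
  have pw: "pair w c = \<psi> c" if "c \<in> carrier Cd" for c
    using \<psi>_eq_pair[of \<psi> w c] facts that by force
  have "\<Phi> w (\<pi> c) = \<phi> (\<pi> c)" if c: "c \<in> carrier Cd" for c
    using c by (intro \<Phi>_unique w) (auto simp: \<phi>E pw \<psi>_def simp flip: \<phi>_smult)
  then have "\<Phi> w h = \<phi> h" if "h \<in> carrier H" for h using that by (metis H_cases)
  moreover have "\<Phi> w \<in> extensional (carrier H)" "\<phi> \<in> extensional (carrier H)"
    using hom \<Phi>_hom[OF w] by (auto simp: mod_hom_def PiE_iff)
  ultimately have "\<Phi> w = \<phi>" by (intro extensionalityI)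
  then show ?thesis using w by blast
qed

lemma \<Phi>_bij: "bij_betw \<Phi> (carrier W) (carrier (SR_canonical_module \<Delta> E))"
  unfolding bij_betw_def canonical_eq using \<Phi>_inj \<Phi>_in_canonical \<Phi>_surj by blast

end

subsection \<open>Traces\<close>

lemma trace_ideal_subset_iso:
  assumes f: "bij_betw f (carrier M) (carrier N)"
    and closed: "\<And>x y. x \<in> carrier M \<Longrightarrow> y \<in> carrier M \<Longrightarrow> x \<oplus>\<^bsub>M\<^esub> y \<in> carrier M"
      "\<And>s x. s \<in> carrier S \<Longrightarrow> x \<in> carrier M \<Longrightarrow> s \<odot>\<^bsub>M\<^esub> x \<in> carrier M"
    and hom: "\<And>x y. x \<in> carrier M \<Longrightarrow> y \<in> carrier M \<Longrightarrow> f (x \<oplus>\<^bsub>M\<^esub> y) = f x \<oplus>\<^bsub>N\<^esub> f y"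
      "\<And>s x. s \<in> carrier S \<Longrightarrow> x \<in> carrier M \<Longrightarrow> f (s \<odot>\<^bsub>M\<^esub> x) = s \<odot>\<^bsub>N\<^esub> f x"
  shows "trace_ideal S M = trace_ideal S N"
proof -
  let ?T = "regular_module S"
  have fM: "f x \<in> carrier N" if "x \<in> carrier M" for x using f that by (auto simp: bij_betw_def)
  define g where "g = the_inv_into (carrier M) f"
  have inj: "inj_on f (carrier M)" and im: "f ` carrier M = carrier N" using f by (auto simp: bij_betw_def)
  have gN: "g y \<in> carrier M" if "y \<in> carrier N" for y
    using the_inv_into_into[OF inj, of y] im that by (auto simp: g_def)
  have fg: "f (g y) = y" if "y \<in> carrier N" for y
    using f_the_inv_into_f[OF inj, of y] im that by (auto simp: g_def)
  have gf: "g (f x) = x" if "x \<in> carrier M" for x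
    using the_inv_into_f_f[OF inj that] by (simp add: g_def)
  have gadd: "g (x \<oplus>\<^bsub>N\<^esub> y) = g x \<oplus>\<^bsub>M\<^esub> g y" if "x \<in> carrier N" "y \<in> carrier N" for x y
    using gf[OF closed(1)[OF gN gN], OF that] hom(1)[OF gN gN, OF that] fg that by simp
  have gsm: "g (s \<odot>\<^bsub>N\<^esub> y) = s \<odot>\<^bsub>M\<^esub> g y" if "s \<in> carrier S" "y \<in> carrier N" for s y
    using gf[OF closed(2)[OF that(1) gN[OF that(2)]]] hom(2)[OF that(1) gN[OF that(2)]] fg that by simp
  have Nadd: "x \<oplus>\<^bsub>N\<^esub> y \<in> carrier N" if "x \<in> carrier N" "y \<in> carrier N" for x y
    using fM[OF closed(1)[OF gN gN], OF that] hom(1)[OF gN gN, OF that] fg that by simp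
  have Nsm: "s \<odot>\<^bsub>N\<^esub> y \<in> carrier N" if "s \<in> carrier S" "y \<in> carrier N" for s y
    using fM[OF closed(2)[OF that(1) gN[OF that(2)]]] hom(2)[OF that(1) gN[OF that(2)]] fg that by simp
  have "(\<Union>\<phi>\<in>mod_hom S M ?T. \<phi> ` carrier M) = (\<Union>\<phi>\<in>mod_hom S N ?T. \<phi> ` carrier N)"
  proof (intro equalityI subsetI)
    fix z assume "z \<in> (\<Union>\<phi>\<in>mod_hom S M ?T. \<phi> ` carrier M)"
    then obtain \<phi> x where \<phi>: "\<phi> \<in> mod_hom S M ?T" "x \<in> carrier M" "z = \<phi> x" by blast
    have "(\<lambda>y\<in>carrier N. \<phi> (g y)) \<in> mod_hom S N ?T"
      using \<phi>(1) gN gadd gsm Nadd Nsm unfolding mod_hom_def by (auto simp: PiE_iff)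
    moreover have "z = (\<lambda>y\<in>carrier N. \<phi> (g y)) (f x)" using \<phi> fM gf by simp
    ultimately show "z \<in> (\<Union>\<phi>\<in>mod_hom S N ?T. \<phi> ` carrier N)" using fM[OF \<phi>(2)] by blast
  next
    fix z assume "z \<in> (\<Union>\<phi>\<in>mod_hom S N ?T. \<phi> ` carrier N)"
    then obtain \<phi> y where \<phi>: "\<phi> \<in> mod_hom S N ?T" "y \<in> carrier N" "z = \<phi> y" by blast
    have "(\<lambda>x\<in>carrier M. \<phi> (f x)) \<in> mod_hom S M ?T"
      using \<phi>(1) fM closed hom unfolding mod_hom_def by (auto simp: PiE_iff)
    moreover have "z = (\<lambda>x\<in>carrier M. \<phi> (f x)) (g y)" using \<phi> gN fg by simp
    ultimately show "z \<in> (\<Union>\<phi>\<in>mod_hom S M ?T. \<phi> ` carrier M)" using gN[OF \<phi>(2)] by blast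
  qed
  then show ?thesis by (simp add: trace_ideal_def)
qed

lemma (in SR_env) trace_canonical: "trace_ideal S (SR_canonical_module \<Delta> E) = trace_ideal S W"
  using \<Phi>_bij W_add_closed W_smult_closed \<Phi>_add \<Phi>_smult
  by (intro trace_ideal_subset_iso[symmetric]) (simp_all add: canonical_eq del: W_simps)

context SR
begin

abbreviation "homs \<equiv> mod_hom S W (regular_module S)"

abbreviation "T \<equiv> trace_ideal S W"

lemma homs_iff:
  "\<theta> \<in> homs \<longleftrightarrow> \<theta> \<in> carrier W \<rightarrow>\<^sub>E carrier S \<and>
     (\<forall>x\<in>carrier W. \<forall>y\<in>carrier W. \<theta> (x \<oplus>\<^bsub>W\<^esub> y) = \<theta> x \<oplus>\<^bsub>S\<^esub> \<theta> y) \<and>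
     (\<forall>s\<in>carrier S. \<forall>x\<in>carrier W. \<theta> (s \<odot>\<^bsub>W\<^esub> x) = s \<otimes>\<^bsub>S\<^esub> \<theta> x)"
  by (simp add: mod_hom_def)

lemma homsI:
  assumes "\<And>x. x \<in> carrier W \<Longrightarrow> f x \<in> carrier S"
    and "\<And>x y. x \<in> carrier W \<Longrightarrow> y \<in> carrier W \<Longrightarrow> f (x \<oplus>\<^bsub>W\<^esub> y) = f x \<oplus>\<^bsub>S\<^esub> f y"
    and "\<And>s x. s \<in> carrier S \<Longrightarrow> x \<in> carrier W \<Longrightarrow> f (s \<odot>\<^bsub>W\<^esub> x) = s \<otimes>\<^bsub>S\<^esub> f x"
  shows "restrict f (carrier W) \<in> homs"
  using assms W_add_closed W_smult_closed unfolding homs_iff by (auto simp del: W_simps)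

lemma
  assumes "\<theta> \<in> homs"
  shows homs_closed: "w \<in> carrier W \<Longrightarrow> \<theta> w \<in> carrier S"
    and homs_add: "w \<in> carrier W \<Longrightarrow> w' \<in> carrier W \<Longrightarrow> \<theta> (w \<oplus>\<^bsub>W\<^esub> w') = \<theta> w \<oplus>\<^bsub>S\<^esub> \<theta> w'"
    and homs_smult: "s \<in> carrier S \<Longrightarrow> w \<in> carrier W \<Longrightarrow> \<theta> (s \<odot>\<^bsub>W\<^esub> w) = s \<otimes>\<^bsub>S\<^esub> \<theta> w"
  using assms unfolding homs_iff by blast+

lemma homs_zero:
  assumes "\<theta> \<in> homs"
  shows "\<theta> (\<lambda>_. 0) = \<zero>\<^bsub>S\<^esub>"
  using homs_add[OF assms W_zero_closed W_zero_closed] homs_closed[OF assms W_zero_closed] by simp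

lemma T_gens: "(\<Union>\<theta>\<in>homs. \<theta> ` carrier W) \<subseteq> carrier S"
  using homs_closed by blast

lemma ideal_T: "ideal T S"
  unfolding trace_ideal_def by (rule genideal_ideal[OF T_gens])

lemma T_mem: "\<theta> \<in> homs \<Longrightarrow> w \<in> carrier W \<Longrightarrow> \<theta> w \<in> T"
  unfolding trace_ideal_def by (rule subsetD[OF genideal_self[OF T_gens]]) blast

lemma T_minimal:
  assumes "ideal I S" "\<And>\<theta> w. \<theta> \<in> homs \<Longrightarrow> w \<in> carrier W \<Longrightarrow> \<theta> w \<in> I"
  shows "T \<subseteq> I"
  unfolding trace_ideal_def by (rule genideal_minimal[OF assms(1)]) (use assms(2) in blast)

lemma ideal_full_iff:
  assumes "ideal I S"
  shows "I = carrier S \<longleftrightarrow> \<one>\<^bsub>S\<^esub> \<in> I"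
  using ideal.one_imp_carrier[OF assms] by auto

lemma ideal_con_full:
  assumes "ideal I S" "cl (single 0 c) \<in> I" "c \<noteq> 0"
  shows "I = carrier S"
proof -
  have P: "single 0 a \<in> P" for a by (simp add: polys_single)
  have "cl (single 0 (inverse c)) \<otimes>\<^bsub>S\<^esub> cl (single 0 c) \<in> I"
    by (rule ideal.I_l_closed[OF assms(1,2)]) (simp add: P)
  then have "\<one>\<^bsub>S\<^esub> \<in> I" using assms(3) P by (simp add: cl_mult mult_single S_one)
  then show ?thesis using ideal_full_iff[OF assms(1)] by blast
qed

lemma S_monomial_induct [consumes 1, case_names monomial add]:
  assumes "X \<in> carrier S"
    and "\<And>t c. keys t \<subseteq> V \<Longrightarrow> Q (cl (single t c))"
    and "\<And>X Y. X \<in> carrier S \<Longrightarrow> Y \<in> carrier S \<Longrightarrow> Q X \<Longrightarrow> Q Y \<Longrightarrow> Q (X \<oplus>\<^bsub>S\<^esub> Y)"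
  shows "Q X"
proof -
  obtain p where p: "p \<in> P" "X = cl p" using assms(1) by (rule S_cases)
  have "Q (cl p) \<and> p \<in> P"
  proof (induction p rule: mpoly_induct)
    case zero
    then show ?case using assms(2)[of 0 0] by simp
  next
    case (single_add m c q)
    then have m: "keys m \<subseteq> V" using p(1) by (auto simp: polys_def)
    have mP: "single m c \<in> P" using m by (rule polys_single)
    then show ?case
      using single_add assms(3)[of "cl (single m c)" "cl q"] assms(2)[OF m] by (simp add: cl_add polys_add)
  qed
  then show ?thesis using p by simp
qed

lemma rp_monomial_times:
  assumes "keys t \<subseteq> V" "X \<in> carrier S"
  shows "rp (cl (single t c) \<otimes>\<^bsub>S\<^esub> X) = res \<Delta> (single t c * rp X)"
proof -
  have "cl (single t c) \<otimes>\<^bsub>S\<^esub> X = cl (single t c * rp X)"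
    using assms cl_mult[OF polys_single[OF assms(1)] rp_P[OF assms(2)]] by (simp add: cl_rp)
  then show ?thesis using assms by (simp add: rp_cl polys_times polys_single rp_P)
qed

lemma hw_monomial:
  assumes "keys t \<subseteq> V"
  shows "hw (int (mdeg t) + j) (cl (single t c) \<odot>\<^bsub>W\<^esub> w) = cl (single t c) \<odot>\<^bsub>W\<^esub> hw j w"
proof
  fix F
  show "hw (int (mdeg t) + j) (cl (single t c) \<odot>\<^bsub>W\<^esub> w) F = (cl (single t c) \<odot>\<^bsub>W\<^esub> hw j w) F"
    using assms hpart_single_times[of t j c "w F"]
    by (simp add: hw_def rp_cl polys_single res_single)
qed

lemma hw_hw: "hw i (hw j w) = (if i = j then hw j w else (\<lambda>_. 0))"
  by (intro ext poly_mapping_eqI) (simp add: hw_def lookup_hpart)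

lemma homs_sum:
  assumes "\<theta> \<in> homs" "finite I" "\<And>i. i \<in> I \<Longrightarrow> u i \<in> carrier W"
  shows "(\<lambda>F. \<Sum>i\<in>I. u i F) \<in> carrier W \<and> \<theta> (\<lambda>F. \<Sum>i\<in>I. u i F) = (\<Oplus>\<^bsub>S\<^esub>i\<in>I. \<theta> (u i))"
  using assms(2,3)
proof (induction I rule: finite_induct)
  case empty
  then show ?case using homs_zero[OF assms(1)] by (simp add: W_zero_closed)
next
  case (insert i I)
  have "(\<lambda>F. \<Sum>i\<in>insert i I. u i F) = u i \<oplus>\<^bsub>W\<^esub> (\<lambda>F. \<Sum>i\<in>I. u i F)"
    using insert by simp
  moreover have "(\<Oplus>\<^bsub>S\<^esub>i\<in>insert i I. \<theta> (u i)) = \<theta> (u i) \<oplus>\<^bsub>S\<^esub> (\<Oplus>\<^bsub>S\<^esub>i\<in>I. \<theta> (u i))"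
    using insert homs_closed[OF assms(1)] by (intro finsum_insert) auto
  ultimately show ?case
    using insert W_add_closed[of "u i"] homs_add[OF assms(1), of "u i"] by (simp del: W_simps)
qed

lemma hw_outside: "w \<in> carrier W \<Longrightarrow> e \<notin> wdegs w \<Longrightarrow> hw e w = (\<lambda>_. 0)"
proof (intro ext poly_mapping_eqI)
  fix F m assume "w \<in> carrier W" "e \<notin> wdegs w"
  then have "int (mdeg m) \<noteq> e" if "F \<in> topf" "m \<in> keys (w F)"
    using that by (auto simp: wdegs_def)
  then show "lookup (hw e w F) m = lookup 0 m"
    using \<open>w \<in> carrier W\<close> by (cases "F \<in> topf") (auto simp: hw_def lookup_hpart in_keys_iff W_carrier)
qed

text \<open>The part of degree \<open>- e\<close> of \<theta>. It exists although \<theta> may have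
  infinitely many parts, because each \<open>w\<close> lives in finitely many degrees and so each
  value has finitely many coefficients.\<close>

lemma homogeneous_component_hom:
  assumes \<theta>: "\<theta> \<in> homs"
  obtains \<theta>' where "\<theta>' \<in> homs"
    "\<And>w m. w \<in> carrier W \<Longrightarrow> lookup (rp (\<theta>' w)) m = lookup (rp (\<theta> (hw (int (mdeg m) + e) w))) m"
proof -
  define q where "q w = Abs_poly_mapping (\<lambda>m. lookup (rp (\<theta> (hw (int (mdeg m) + e) w))) m)" for w
  have \<theta>c: "\<theta> (hw j w) \<in> carrier S" if "w \<in> carrier W" for j w
    using homs_closed[OF \<theta> hw_closed[OF that]] .
  have q: "lookup (q w) m = lookup (rp (\<theta> (hw (int (mdeg m) + e) w))) m" if w: "w \<in> carrier W" for w m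
  proof -
    have "{m. lookup (rp (\<theta> (hw (int (mdeg m) + e) w))) m \<noteq> 0} \<subseteq> (\<Union>j\<in>wdegs w. keys (rp (\<theta> (hw j w))))"
    proof
      fix m assume m: "m \<in> {m. lookup (rp (\<theta> (hw (int (mdeg m) + e) w))) m \<noteq> 0}"
      then have "int (mdeg m) + e \<in> wdegs w"
        using hw_outside[OF w, of "int (mdeg m) + e"] homs_zero[OF \<theta>] by (cases "int (mdeg m) + e \<in> wdegs w") auto
      then show "m \<in> (\<Union>j\<in>wdegs w. keys (rp (\<theta> (hw j w))))" using m by (auto simp: in_keys_iff)
    qed
    then have "finite {m. lookup (rp (\<theta> (hw (int (mdeg m) + e) w))) m \<noteq> 0}"
      by (rule finite_subset) (simp add: finite_wdegs)
    then show ?thesis by (simp add: q_def)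
  qed
  have res_q: "res \<Delta> (q w) = q w" if w: "w \<in> carrier W" for w
    using res_rp[OF \<theta>c[OF w]] by (intro poly_mapping_eqI) (metis lookup_res q[OF w])
  have qP: "q w \<in> P" if w: "w \<in> carrier W" for w
    unfolding polys_def using rp_P[OF \<theta>c[OF w]] by (auto simp: polys_def in_keys_iff q[OF w])
  have rpq: "rp (cl (q w)) = q w" if "w \<in> carrier W" for w
    using that by (simp add: rp_cl qP res_q)
  have hw_add: "hw j (w \<oplus>\<^bsub>W\<^esub> w') = hw j w \<oplus>\<^bsub>W\<^esub> hw j w'" for j w w'
    by (simp add: hw_def hpart_add)
  have q_add: "q (w \<oplus>\<^bsub>W\<^esub> w') = q w + q w'" if w: "w \<in> carrier W" "w' \<in> carrier W" for w w'
    using w by (intro poly_mapping_eqI)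
      (simp add: q W_add_closed hw_add homs_add[OF \<theta>] hw_closed rp_add \<theta>c lookup_add del: W_simps)
  have q_monomial: "q (cl (single t c) \<odot>\<^bsub>W\<^esub> w) = res \<Delta> (single t c * q w)"
    if t: "keys t \<subseteq> V" and w: "w \<in> carrier W" for t c w
  proof (rule poly_mapping_eqI)
    fix m :: "'v \<Rightarrow>\<^sub>0 nat"
    have s: "cl (single t c) \<in> carrier S" using t by (simp add: polys_single)
    let ?j = "int (mdeg m) + e - int (mdeg t)"
    have "hw (int (mdeg m) + e) (cl (single t c) \<odot>\<^bsub>W\<^esub> w) = cl (single t c) \<odot>\<^bsub>W\<^esub> hw ?j w"
      using hw_monomial[OF t, of ?j c w] by (simp del: W_simps)
    then have "lookup (q (cl (single t c) \<odot>\<^bsub>W\<^esub> w)) m = lookup (rp (cl (single t c) \<otimes>\<^bsub>S\<^esub> \<theta> (hw ?j w))) m"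
      using w s by (simp add: q W_smult_closed homs_smult[OF \<theta>] hw_closed del: W_simps)
    also have "\<dots> = lookup (res \<Delta> (single t c * rp (\<theta> (hw ?j w)))) m"
      by (simp add: rp_monomial_times[OF t \<theta>c[OF w]])
    also have "\<dots> = lookup (res \<Delta> (single t c * q w)) m"
    proof (cases "\<exists>l. m = t + l")
      case True
      then obtain l where l: "m = t + l" by blast
      then have j: "?j = int (mdeg l) + e" by (simp add: mdeg_add)
      show ?thesis unfolding j unfolding l by (simp add: lookup_res lookup_single_times q[OF w])
    next
      case False
      then show ?thesis by (simp add: lookup_res lookup_single_times_notin)
    qed
    finally show "lookup (q (cl (single t c) \<odot>\<^bsub>W\<^esub> w)) m = lookup (res \<Delta> (single t c * q w)) m" .
  qed
  \<comment> \<open>Linearity is checked for monomials, which shift all degrees by the same amount,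
    and extends to all scalars by additivity.\<close>
  have q_smult: "cl (q (s \<odot>\<^bsub>W\<^esub> w)) = s \<otimes>\<^bsub>S\<^esub> cl (q w)" if s: "s \<in> carrier S" and w: "w \<in> carrier W" for s w
    using s
  proof (induction s rule: S_monomial_induct)
    case (monomial t c)
    have "single t c * q w \<in> P" using monomial w by (simp add: polys_times polys_single qP)
    then show ?case
      using monomial w q_monomial[OF monomial w, of c] by (simp add: cl_mult polys_single qP cl_res del: W_simps)
  next
    case (add X Y)
    have "(X \<oplus>\<^bsub>S\<^esub> Y) \<odot>\<^bsub>W\<^esub> w = X \<odot>\<^bsub>W\<^esub> w \<oplus>\<^bsub>W\<^esub> Y \<odot>\<^bsub>W\<^esub> w"
      using add by (simp add: rp_add res_add distrib_right)
    then show ?case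
      using add w by (simp add: q_add W_smult_closed qP l_distr flip: cl_add del: W_simps)
  qed
  have "(\<lambda>w\<in>carrier W. cl (q w)) \<in> homs"
    by (rule homsI) (simp_all add: qP q_add cl_add q_smult del: W_simps)
  then show ?thesis
    by (rule that) (simp add: rpq q)
qed

text \<open>A value with nonzero constant term yields a homogeneous part of \<theta> and a
  homogeneous part of \<open>w\<close> with the same property. The new value has degree zero, hence
  is a nonzero constant, and the trace is the whole ring.\<close>

lemma trace_subset_mm:
  assumes "T \<noteq> carrier S"
  shows "T \<subseteq> mm"
proof (rule T_minimal[OF ideal_mm], rule ccontr)
  fix \<theta> w assume \<theta>: "\<theta> \<in> homs" and w: "w \<in> carrier W" and "\<theta> w \<notin> mm"
  then have "lookup (rp (\<theta> w)) 0 \<noteq> 0" using homs_closed[OF \<theta> w] by simp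
  moreover have "(\<lambda>F. \<Sum>e\<in>wdegs w. hw e w F) = w" using hw_decompose[OF w finite_wdegs order_refl] by auto
  ultimately have "(\<Sum>e\<in>wdegs w. lookup (rp (\<theta> (hw e w))) 0) \<noteq> 0"
    using homs_sum[OF \<theta> finite_wdegs[of w], of "\<lambda>e. hw e w", OF hw_closed[OF w]] homs_closed[OF \<theta> hw_closed[OF w]]
    by (simp add: lookup_sum rp_finsum[OF finite_wdegs] Pi_iff)
  then obtain e where e: "lookup (rp (\<theta> (hw e w))) 0 \<noteq> 0" by (meson sum.neutral)
  obtain \<theta>' where \<theta>': "\<theta>' \<in> homs"
    "\<And>w m. w \<in> carrier W \<Longrightarrow> lookup (rp (\<theta>' w)) m = lookup (rp (\<theta> (hw (int (mdeg m) + e) w))) m"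
    using homogeneous_component_hom[OF \<theta>, of e] by blast
  let ?c = "lookup (rp (\<theta> (hw e w))) 0"
  have u: "hw e w \<in> carrier W" using w by (rule hw_closed)
  have "rp (\<theta>' (hw e w)) = single 0 ?c"
    by (intro poly_mapping_eqI) (auto simp: \<theta>'(2)[OF u] hw_hw lookup_single when_def homs_zero[OF \<theta>])
  then have "\<theta>' (hw e w) = cl (single 0 ?c)" using cl_rp[OF homs_closed[OF \<theta>'(1) u]] by simp
  then have "T = carrier S" using ideal_con_full[OF ideal_T _ e] T_mem[OF \<theta>'(1) u] by simp
  then show False using assms by simp
qed

lemma trace_dagger_ideal: "ideal (trace_dagger S W) S"
  unfolding trace_dagger_def graded_max_eq using ideal_T ideal_mm by simp

lemma trace_dagger_subset_mm: "trace_dagger S W \<subseteq> mm"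
  using trace_subset_mm unfolding trace_dagger_def graded_max_eq by auto

lemma hom_into_mm_dagger:
  assumes "\<theta> \<in> homs" "w \<in> carrier W" "\<theta> w \<in> mm"
  shows "\<theta> w \<in> trace_dagger S W"
  unfolding trace_dagger_def graded_max_eq using T_mem[OF assms(1,2)] assms(3) by simp

text \<open>If the trace is the whole ring, multiplying homomorphisms by elements of the maximal ideal
  gives enough homomorphisms with values in the maximal ideal.\<close>

lemma trace_dagger_minimal:
  assumes I: "ideal I S" and *: "\<And>\<theta> w. \<theta> \<in> homs \<Longrightarrow> \<theta> ` carrier W \<subseteq> mm \<Longrightarrow> w \<in> carrier W \<Longrightarrow> \<theta> w \<in> I"
  shows "trace_dagger S W \<subseteq> I"
proof (cases "T = carrier S")
  case False
  then have "\<theta> w \<in> mm" if "\<theta> \<in> homs" "w \<in> carrier W" for \<theta> w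
    using trace_subset_mm T_mem[OF that] by blast
  then have "T \<subseteq> I" using * by (intro T_minimal[OF I]) blast
  then show ?thesis using False by (simp add: trace_dagger_def)
next
  case True
  have "x \<in> I" if x: "x \<in> mm" for x
  proof -
    have xS: "x \<in> carrier S" using x by simp
    interpret I: ideal I S by (rule I)
    \<comment> \<open>It suffices that this colon ideal contains the trace, since it then contains
      one.\<close>
    have "ideal {y \<in> carrier S. x \<otimes>\<^bsub>S\<^esub> y \<in> I} S"
    proof (rule idealI)
      show "subgroup {y \<in> carrier S. x \<otimes>\<^bsub>S\<^esub> y \<in> I} (add_monoid S)"
        by (rule add.subgroupI) (use xS in \<open>auto simp: r_distr r_minus I.a_inv_closed intro!: exI[of _ "\<zero>\<^bsub>S\<^esub>"]\<close>)
    next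
      fix a y assume a: "a \<in> {y \<in> carrier S. x \<otimes>\<^bsub>S\<^esub> y \<in> I}" and y: "y \<in> carrier S"
      then have aS: "a \<in> carrier S" and xa: "x \<otimes>\<^bsub>S\<^esub> a \<in> I" by auto
      have "(x \<otimes>\<^bsub>S\<^esub> a) \<otimes>\<^bsub>S\<^esub> y \<in> I" by (rule I.I_r_closed[OF xa y])
      then have "x \<otimes>\<^bsub>S\<^esub> (a \<otimes>\<^bsub>S\<^esub> y) \<in> I" by (simp only: m_assoc[OF xS aS y])
      then show "a \<otimes>\<^bsub>S\<^esub> y \<in> {y \<in> carrier S. x \<otimes>\<^bsub>S\<^esub> y \<in> I}" "y \<otimes>\<^bsub>S\<^esub> a \<in> {y \<in> carrier S. x \<otimes>\<^bsub>S\<^esub> y \<in> I}"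
        using aS y m_comm[OF y aS] by simp_all
    qed (rule ring_axioms)
    moreover have "\<theta> w \<in> {y \<in> carrier S. x \<otimes>\<^bsub>S\<^esub> y \<in> I}" if \<theta>: "\<theta> \<in> homs" and w: "w \<in> carrier W" for \<theta> w
    proof -
      have "(\<lambda>w\<in>carrier W. x \<otimes>\<^bsub>S\<^esub> \<theta> w) \<in> homs"
        using xS by (intro homsI)
          (simp_all add: homs_closed[OF \<theta>] homs_add[OF \<theta>] homs_smult[OF \<theta>] r_distr m_lcomm del: W_simps)
      moreover have "(\<lambda>w\<in>carrier W. x \<otimes>\<^bsub>S\<^esub> \<theta> w) ` carrier W \<subseteq> mm"
        using ideal.I_r_closed[OF ideal_mm x] homs_closed[OF \<theta>] by auto
      ultimately have "(\<lambda>w\<in>carrier W. x \<otimes>\<^bsub>S\<^esub> \<theta> w) w \<in> I" using w by (rule *)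
      then show ?thesis using w homs_closed[OF \<theta> w] by simp
    qed
    ultimately have "T \<subseteq> {y \<in> carrier S. x \<otimes>\<^bsub>S\<^esub> y \<in> I}" by (rule T_minimal)
    then show "x \<in> I" using True xS one_closed by auto
  qed
  then show ?thesis using True by (auto simp: trace_dagger_def graded_max_eq)
qed

lemma mm_subset_ideal:
  assumes I: "ideal I S" and *: "\<And>v. v \<in> V \<Longrightarrow> cl (pvar v) \<in> I"
  shows "mm \<subseteq> I"
proof
  fix X assume "X \<in> mm"
  then have X: "X \<in> carrier S" "lookup (rp X) 0 = 0" by auto
  interpret I: additive_subgroup I S using I by (rule ideal.axioms)
  obtain p where p: "p = rp X" by blast
  have "cl p \<in> I \<and> p \<in> P"
  proof (induction p rule: mpoly_induct)
    case zero
    then show ?case using I.zero_closed by (simp add: S_zero)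
  next
    case (single_add m c q)
    have m0: "m \<noteq> 0" using single_add(1) X(2) p by (auto simp: in_keys_iff)
    then obtain v where v: "v \<in> keys m" by (metis keys_eq_empty equals0I)
    have mV: "keys m \<subseteq> V" using rp_P[OF X(1)] single_add(1) p by (auto simp: polys_def)
    define t where "t = m - single v 1"
    have mt: "m = t + single v 1"
      using v by (intro poly_mapping_eqI) (auto simp: t_def lookup_add lookup_minus lookup_single when_def in_keys_iff)
    have tV: "keys t \<subseteq> V" using mV mt by (metis keys_add_nat le_sup_iff)
    have "cl (single t c) \<otimes>\<^bsub>S\<^esub> cl (pvar v) \<in> I"
      using ideal.I_l_closed[OF I *, of v "cl (single t c)"] v mV tV by (auto simp: polys_single)
    also have "cl (single t c) \<otimes>\<^bsub>S\<^esub> cl (pvar v) = cl (single m c)"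
    proof -
      have "single t c \<in> P" "pvar v \<in> P" using v mV tV by (auto intro: polys_single polys_pvar)
      moreover have "single t c * pvar v = single m c" by (simp add: pvar_def mult_single mt)
      ultimately show ?thesis by (simp add: cl_mult)
    qed
    finally have "cl (single m c) \<oplus>\<^bsub>S\<^esub> cl q \<in> I" using single_add(3) I.a_closed by blast
    moreover have "single m c \<in> P" "q \<in> P" using mV single_add(3) by (auto intro: polys_single)
    ultimately show ?case by (simp add: cl_add polys_add)
  qed
  then show "X \<in> I" using X(1) p by (simp add: cl_rp)
qed

subsection \<open>Discrete complexes\<close>

context
  assumes discrete: "dd = 1"
begin

lemma discrete_face: "F \<in> \<Delta> \<Longrightarrow> v \<in> F \<Longrightarrow> F = {v}"
  using card_face[of F] finite_face[of F] discrete by (metis card_le_Suc0_iff_eq One_nat_def insertI1 singleton_iff subsetI subset_antisym subset_singletonD insert_absorb insert_not_empty)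

lemma discrete_topf: "topf = (\<lambda>v. {v}) ` V"
proof
  show "topf \<subseteq> (\<lambda>v. {v}) ` V"
  proof
    fix F assume "F \<in> topf"
    then have "card F = 1" "F \<in> \<Delta>" using discrete by (auto simp: topf_def)
    then show "F \<in> (\<lambda>v. {v}) ` V" by (auto simp: card_1_singleton_iff)
  qed
qed (auto simp: topf_def discrete intro: vertex_face)

text \<open>The only face of codimension one is empty; its cofaces are the single vertices, all with
  sign one, and truncating to it leaves the constant terms.\<close>

lemma discrete_W:
  "w \<in> carrier W \<longleftrightarrow> (\<forall>F. F \<notin> topf \<longrightarrow> w F = 0) \<and> (\<forall>F. res (Pow F) (w F) = w F) \<and> (\<Sum>v\<in>V. lookup (w {v}) 0) = 0"
proof -
  have J: "J \<subseteq> V \<and> Suc (card J) = dd \<longleftrightarrow> J = {}" for J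
    using finite_subset[OF _ finite_V, of J] discrete by auto
  have co: "cofaces {} = V" by (auto simp: cofaces_def discrete_topf)
  have s: "bsign {v} v = (1::'k)" for v
  proof -
    have e: "{k \<in> {v}. k < v} = {}" by auto
    show ?thesis unfolding bsign_def e by simp
  qed
  have "res (Pow {}) p = single 0 (lookup p 0)" for p :: "('v, 'k) mpoly"
    by (intro poly_mapping_eqI) (auto simp: lookup_res lookup_single when_def)
  then have "(\<Sum>v\<in>cofaces {}. single 0 (bsign (insert v {}) v) * res (Pow {}) (w (insert v {}))) =
      single 0 (\<Sum>v\<in>V. lookup (w {v}) 0)"
    unfolding co by (intro poly_mapping_eqI) (simp add: s lookup_sum lookup_single when_def)
  then show ?thesis unfolding W_carrier J by (simp add: single_eq_0_iff)
qed

text \<open>Every monomial of \<open>q\<close> contains \<open>v\<close>, so it is annihilated by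
  any other variable; hence only the part of \<open>a\<close> in the variable \<open>v\<close>
  acts.\<close>

lemma discrete_restrict_times:
  assumes "a \<in> P" "q \<in> P" "\<And>m. m \<in> keys q \<Longrightarrow> v \<in> keys m"
  shows "cl (res (Pow {v}) a * q) = cl a \<otimes>\<^bsub>S\<^esub> cl q"
proof -
  have "res \<Delta> ((a - res (Pow {v}) a) * q) = 0"
    unfolding res_eq_0_iff
  proof
    fix m assume "m \<in> keys ((a - res (Pow {v}) a) * q)"
    then obtain x y where xy: "m = x + y" "x \<in> keys (a - res (Pow {v}) a)" "y \<in> keys q" by (elim keys_times_mpoly)
    have "\<not> keys x \<subseteq> {v}" using xy(2) by (auto simp: in_keys_iff lookup_minus lookup_res)
    moreover have "v \<in> keys m" using assms(3)[OF xy(3)] xy(1) by (simp add: keys_add_nat)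
    ultimately show "keys m \<notin> \<Delta>" using discrete_face[of "keys m" v] xy(1) by (auto simp: keys_add_nat)
  qed
  then have "res \<Delta> (a * q) = res \<Delta> (res (Pow {v}) a * q)" by (simp add: left_diff_distrib res_diff)
  then show ?thesis using assms by (simp add: cl_mult cl_eq_iff polys_closed)
qed

definition point :: "('v \<Rightarrow> ('v, 'k) mpoly) \<Rightarrow> 'v set \<Rightarrow> ('v, 'k) mpoly" where
  "point f F = (if F \<in> topf then f (the_elem F) else 0)"

lemma point_W:
  assumes "\<And>v. v \<in> V \<Longrightarrow> res (Pow {v}) (f v) = f v" "(\<Sum>v\<in>V. lookup (f v) 0) = 0"
  shows "point f \<in> carrier W"
  unfolding discrete_W
proof (intro conjI allI impI)
  show "res (Pow F) (point f F) = point f F" for F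
  proof (cases "F \<in> topf")
    case True
    then obtain v where "v \<in> V" "F = {v}" unfolding discrete_topf by blast
    then show ?thesis using True assms(1)[of v] by (simp add: point_def)
  qed (simp add: point_def)
  have "(\<Sum>v\<in>V. lookup (point f {v}) 0) = (\<Sum>v\<in>V. lookup (f v) 0)"
    by (intro sum.cong refl) (simp add: point_def discrete_topf)
  then show "(\<Sum>v\<in>V. lookup (point f {v}) 0) = 0" using assms(2) by simp
qed (simp add: point_def)

text \<open>With a second vertex \<open>u\<close>, multiplying the coordinate at \<open>v\<close> by
  its variable is a homomorphism, and the family with \<open>1\<close> at \<open>v\<close> and
  \<open>- 1\<close> at \<open>u\<close> is sent to that variable. For a single point the coordinate
  has no constant term and already works.\<close>

lemma discrete_mm_subset_trace: "mm \<subseteq> T"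
proof (rule mm_subset_ideal[OF ideal_T])
  fix v assume v: "v \<in> V"
  have wv: "w {v} \<in> P" "res (Pow {v}) (w {v}) = w {v}" if "w \<in> carrier W" for w
  proof -
    show 1: "res (Pow {v}) (w {v}) = w {v}" using that by (simp add: W_carrier)
    then show "w {v} \<in> P" using v by (auto simp: res_id_iff polys_def)
  qed
  have hom: "(\<lambda>w\<in>carrier W. cl (b * w {v})) \<in> homs"
    if b: "b \<in> P" and bk: "\<And>w m. w \<in> carrier W \<Longrightarrow> m \<in> keys (b * w {v}) \<Longrightarrow> v \<in> keys m" for b
  proof (rule homsI)
    fix s x assume s: "s \<in> carrier S" and x: "x \<in> carrier W"
    have "cl (res (Pow {v}) (rp s) * (b * x {v})) = cl (rp s) \<otimes>\<^bsub>S\<^esub> cl (b * x {v})"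
      using s x b bk wv by (intro discrete_restrict_times) (auto simp: rp_P polys_times)
    then show "cl (b * (s \<odot>\<^bsub>W\<^esub> x) {v}) = s \<otimes>\<^bsub>S\<^esub> cl (b * x {v})"
      using s by (simp add: cl_rp mult_ac)
  qed (use b wv in \<open>auto simp: polys_closed distrib_left cl_add\<close>)
  have v1: "v \<in> keys m" if "keys m \<subseteq> {v}" "m \<noteq> 0" for m :: "'v \<Rightarrow>\<^sub>0 nat"
    using that by (metis keys_eq_empty subset_singletonD insertI1)
  show "cl (pvar v) \<in> T"
  proof (cases "V = {v}")
    case True
    have "v \<in> keys m" if w: "w \<in> carrier W" and m: "m \<in> keys (1 * w {v})" for w m
    proof (rule v1)
      have "lookup (w {v}) 0 = 0" using w True by (simp add: discrete_W)
      then show "m \<noteq> 0" using m by (auto simp: in_keys_iff)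
      show "keys m \<subseteq> {v}" using wv(2)[OF w] m by (auto simp: res_id_iff)
    qed
    then have h: "(\<lambda>w\<in>carrier W. cl (1 * w {v})) \<in> homs" by (intro hom) simp_all
    have w: "point pvar \<in> carrier W"
      using v True by (intro point_W) (auto simp: pvar_def res_single lookup_single when_def single_eq_0_iff)
    have "point pvar {v} = (pvar v :: ('v, 'k) mpoly)" using v by (simp add: point_def discrete_topf)
    then show ?thesis using T_mem[OF h w] w by simp
  next
    case False
    then obtain u where u: "u \<in> V" "u \<noteq> v" using v by blast
    have "v \<in> keys m" if m: "m \<in> keys (pvar v * w {v})" for w :: "'v set \<Rightarrow> ('v, 'k) mpoly" and m
    proof -
      obtain a b where "m = a + b" "a \<in> keys (pvar v :: ('v, 'k) mpoly)" using m by (elim keys_times_mpoly)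
      then show ?thesis by (simp add: pvar_def keys_add_nat)
    qed
    then have h: "(\<lambda>w\<in>carrier W. cl (pvar v * w {v})) \<in> homs" using v by (intro hom polys_pvar)
    define f where "f x = (if x = v then 1 else if x = u then - 1 else 0 :: ('v, 'k) mpoly)" for x
    have "(\<Sum>x\<in>V. lookup (f x) 0) = (\<Sum>x\<in>{v, u}. lookup (f x) 0)"
      using u v finite_V by (intro sum.mono_neutral_right) (auto simp: f_def)
    also have "\<dots> = 0" using u by (simp add: f_def)
    finally have w: "point f \<in> carrier W" by (intro point_W) (auto simp: f_def res_one res_uminus)
    have "point f {v} = 1" using v by (simp add: point_def discrete_topf f_def)
    then show ?thesis using T_mem[OF h w] w by simp
  qed
qed

text \<open>Constant terms survive multiplication by a vertex variable as linear coefficients, so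
  they can be compared after such a multiplication.\<close>

lemma lookup_rp_pvar_times:
  assumes "v \<in> V" "X \<in> carrier S"
  shows "lookup (rp (cl (pvar v) \<otimes>\<^bsub>S\<^esub> X)) (single v 1) = lookup (rp X) 0"
proof -
  have "keys (single v (1::nat)) \<in> \<Delta>" using assms(1) vertex_face by simp
  then show ?thesis
    using rp_monomial_times[of "single v 1" X 1] assms lookup_single_times[of "single v 1" 1 "rp X" 0]
    by (simp add: pvar_def lookup_res)
qed

text \<open>A family supported on two vertices is annihilated by the variable of a third one, so its
  image has no constant term. After multiplication by the variable of \<open>v\<close>, every
  \<open>w\<close> becomes a multiple of this family, which carries the conclusion over to \<theta>
  \<open>w\<close>.\<close>

lemma discrete_trace_subset_mm:
  assumes card: "card V \<ge> 3"
  shows "T \<subseteq> mm"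
proof (rule T_minimal[OF ideal_mm])
  fix \<theta> w assume \<theta>: "\<theta> \<in> homs" and w: "w \<in> carrier W"
  obtain v where v: "v \<in> V" using V_nonempty by blast
  obtain u where u: "u \<in> V" "u \<noteq> v"
  proof -
    have "\<not> V \<subseteq> {v}" using card card_mono[of "{v}" V] by auto
    then show ?thesis using that by blast
  qed
  obtain t where t: "t \<in> V" "t \<noteq> v" "t \<noteq> u"
  proof -
    have "\<not> V \<subseteq> {v, u}" using card card_mono[of "{v, u}" V] u by auto
    then show ?thesis using that by blast
  qed
  have xv: "cl (pvar x) \<in> carrier S" if "x \<in> V" for x using that by (simp add: polys_pvar)
  have rpx: "rp (cl (pvar x)) = pvar x" if "x \<in> V" for x
    using that by (simp add: rp_cl polys_pvar) (simp add: pvar_def res_single vertex_face)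
  define e where "e = point (\<lambda>x. if x = v then pvar v else 0 :: ('v, 'k) mpoly)"
  have e: "e \<in> carrier W"
    unfolding e_def
    by (rule point_W) (auto simp: pvar_def res_single lookup_single when_def single_eq_0_iff intro!: sum.neutral)
  define f where "f x = (if x = v then 1 else if x = u then - 1 else 0 :: ('v, 'k) mpoly)" for x
  have "(\<Sum>x\<in>V. lookup (f x) 0) = (\<Sum>x\<in>{v, u}. lookup (f x) 0)"
    using u v finite_V by (intro sum.mono_neutral_right) (auto simp: f_def)
  also have "\<dots> = 0" using u by (simp add: f_def)
  finally have w': "point f \<in> carrier W" by (intro point_W) (auto simp: f_def res_one res_uminus)
  have pv: "res (Pow {y}) (pvar x :: ('v, 'k) mpoly) = (if y = x then pvar x else 0)" for x y
    by (simp add: pvar_def res_single)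
  have "cl (pvar t) \<odot>\<^bsub>W\<^esub> point f = (\<lambda>_. 0)"
    using t by (auto simp: fun_eq_iff rpx point_def discrete_topf pv f_def)
  then have "cl (pvar t) \<otimes>\<^bsub>S\<^esub> \<theta> (point f) = \<zero>\<^bsub>S\<^esub>"
    using homs_smult[OF \<theta> xv[OF t(1)] w'] homs_zero[OF \<theta>] by (simp del: W_simps)
  then have b0: "lookup (rp (\<theta> (point f))) 0 = 0"
    using lookup_rp_pvar_times[OF t(1) homs_closed[OF \<theta> w']] by simp
  have "cl (pvar v) \<odot>\<^bsub>W\<^esub> point f = e"
    using v by (auto simp: fun_eq_iff rpx point_def discrete_topf pv f_def e_def)
  then have \<theta>e: "\<theta> e = cl (pvar v) \<otimes>\<^bsub>S\<^esub> \<theta> (point f)"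
    using homs_smult[OF \<theta> xv[OF v] w'] by (simp del: W_simps)
  have wv: "res (Pow {v}) (w {v}) = w {v}" "w {v} \<in> P"
  proof -
    show 1: "res (Pow {v}) (w {v}) = w {v}" using w by (simp add: W_carrier)
    then show "w {v} \<in> P" using v by (auto simp: res_id_iff polys_def)
  qed
  have rw: "res (Pow {v}) (rp (cl (w {v}))) = w {v}"
    using wv v by (simp add: rp_cl res_face vertex_face)
  \<comment> \<open>Both sides vanish away from \<open>{v}\<close>, and there they are the product
    of \<open>w {v}\<close> with the variable of \<open>v\<close>.\<close>
  have "cl (w {v}) \<odot>\<^bsub>W\<^esub> e = cl (pvar v) \<odot>\<^bsub>W\<^esub> w"
    using v rw w by (auto simp: fun_eq_iff rpx point_def discrete_topf pv e_def W_carrier mult.commute)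
  then have "cl (pvar v) \<otimes>\<^bsub>S\<^esub> \<theta> w = cl (w {v}) \<otimes>\<^bsub>S\<^esub> \<theta> e"
    using homs_smult[OF \<theta> xv[OF v] w] homs_smult[OF \<theta> _ e, of "cl (w {v})"] wv(2) by (simp del: W_simps)
  also have "\<dots> = cl (pvar v) \<otimes>\<^bsub>S\<^esub> (cl (w {v}) \<otimes>\<^bsub>S\<^esub> \<theta> (point f))"
    using \<theta>e xv[OF v] wv(2) homs_closed[OF \<theta> w'] by (simp add: m_lcomm)
  finally have "lookup (rp (\<theta> w)) 0 = lookup (rp (cl (w {v}) \<otimes>\<^bsub>S\<^esub> \<theta> (point f))) 0"
    using lookup_rp_pvar_times[OF v] homs_closed[OF \<theta> w] homs_closed[OF \<theta> w'] wv(2)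
    by (metis cl_closed m_closed)
  also have "\<dots> = 0"
    using wv(2) homs_closed[OF \<theta> w'] b0 by (simp add: rp_mult lookup_res empty_face lookup_times_zero)
  finally show "\<theta> w \<in> mm" using homs_closed[OF \<theta> w] by simp
qed

end

end

subsection \<open>Renaming variables\<close>

definition ren :: "('v \<Rightarrow> 'w) \<Rightarrow> ('v \<Rightarrow>\<^sub>0 nat) \<Rightarrow> ('w \<Rightarrow>\<^sub>0 nat)" where
  "ren g m = (\<Sum>v\<in>keys m. single (g v) (lookup m v))"

lemma poly_rename_ren: "poly_rename g p = (\<Sum>m\<in>keys p. single (ren g m) (lookup p m))"
  by (simp add: poly_rename_def ren_def)

text \<open>For injective \<open>g\<close> this is a left inverse of renaming that sets the
  variables outside the range of \<open>g\<close> to zero.\<close>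

definition pull_poly :: "('v \<Rightarrow> 'w) \<Rightarrow> ('w, 'k::zero) mpoly \<Rightarrow> ('v, 'k) mpoly" where
  "pull_poly g = Poly_Mapping.map_key (ren g)"

context
  fixes g :: "'v \<Rightarrow> 'w"
  assumes inj: "inj g"
begin

lemma lookup_ren: "lookup (ren g m) (g v) = lookup m v"
proof -
  have "lookup (ren g m) (g v) = (\<Sum>u\<in>keys m. lookup m u when u = v)"
    using inj by (simp add: ren_def lookup_sum lookup_single inj_eq)
  also have "\<dots> = lookup m v"
    unfolding when_def by (subst sum.delta) (auto simp: in_keys_iff)
  finally show ?thesis .
qed

lemma lookup_ren_outside: "w \<notin> range g \<Longrightarrow> lookup (ren g m) w = 0"
  by (auto simp: ren_def lookup_sum lookup_single when_def intro!: sum.neutral)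

lemma keys_ren: "keys (ren g m) = g ` keys m"
proof (intro equalityI subsetI)
  fix w assume w: "w \<in> keys (ren g m)"
  then obtain v where v: "w = g v" using lookup_ren_outside[of w m] by (auto simp: in_keys_iff)
  then show "w \<in> g ` keys m" using w by (auto simp: in_keys_iff lookup_ren)
qed (auto simp: in_keys_iff lookup_ren)

lemma ren_add: "ren g (a + b) = ren g a + ren g b"
proof (rule poly_mapping_eqI)
  fix w show "lookup (ren g (a + b)) w = lookup (ren g a + ren g b) w"
    by (cases "w \<in> range g") (auto simp: lookup_add lookup_ren lookup_ren_outside)
qed

lemma inj_ren: "inj (ren g)"
  by (rule injI, rule poly_mapping_eqI) (metis lookup_ren)

lemma ren_zero: "ren g 0 = 0"
  by (simp add: ren_def)

lemma ren_surj:
  assumes "keys m \<subseteq> range g"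
  obtains l where "m = ren g l"
proof
  show "m = ren g (Poly_Mapping.map_key g m)"
  proof (rule poly_mapping_eqI)
    fix w show "lookup m w = lookup (ren g (Poly_Mapping.map_key g m)) w"
      using assms inj by (cases "w \<in> range g") (auto simp: lookup_ren lookup_ren_outside map_key.rep_eq in_keys_iff)
  qed
qed

lemma lookup_pull_poly: "lookup (pull_poly g p) m = lookup p (ren g m)"
  by (simp add: pull_poly_def map_key.rep_eq inj_ren)

lemma lookup_poly_rename: "lookup (poly_rename g p) (ren g m) = lookup p m"
proof -
  have "lookup (poly_rename g p) (ren g m) = (\<Sum>l\<in>keys p. lookup p l when l = m)"
    using inj_ren by (simp add: poly_rename_ren lookup_sum lookup_single inj_eq)
  also have "\<dots> = lookup p m"
    unfolding when_def by (subst sum.delta) (auto simp: in_keys_iff)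
  finally show ?thesis .
qed

lemma lookup_poly_rename_outside: "m \<notin> range (ren g) \<Longrightarrow> lookup (poly_rename g p) m = 0"
  by (auto simp: poly_rename_ren lookup_sum lookup_single when_def intro!: sum.neutral)

lemma range_ren: "m \<in> range (ren g) \<longleftrightarrow> keys m \<subseteq> range g"
proof
  assume "keys m \<subseteq> range g"
  then obtain l where "m = ren g l" by (rule ren_surj)
  then show "m \<in> range (ren g)" by simp
qed (auto simp: keys_ren)

lemma lookup_pull_zero: "lookup (pull_poly g p) 0 = lookup p 0"
  using lookup_pull_poly[of p 0] by (simp add: ren_zero)

lemma lookup_rename_zero: "lookup (poly_rename g p) 0 = lookup p 0"
  using lookup_poly_rename[of p 0] by (simp add: ren_zero)

lemma pull_rename: "pull_poly g (poly_rename g p) = p"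
  by (rule poly_mapping_eqI) (simp add: lookup_pull_poly lookup_poly_rename)

lemma rename_pull: "poly_rename g (pull_poly g p) = res (Pow (range g)) p"
proof (rule poly_mapping_eqI)
  fix m show "lookup (poly_rename g (pull_poly g p)) m = lookup (res (Pow (range g)) p) m"
  proof (cases "m \<in> range (ren g)")
    case True
    then show ?thesis by (auto simp: lookup_poly_rename lookup_pull_poly lookup_res keys_ren)
  next
    case False
    then have "\<not> keys m \<subseteq> range g" using range_ren by blast
    then show ?thesis using False by (simp add: lookup_poly_rename_outside lookup_res)
  qed
qed

lemma poly_rename_add: "poly_rename g (p + q) = poly_rename g p + poly_rename g q"
proof (rule poly_mapping_eqI)
  fix m show "lookup (poly_rename g (p + q)) m = lookup (poly_rename g p + poly_rename g q) m"
    by (cases "m \<in> range (ren g)") (auto simp: lookup_poly_rename lookup_poly_rename_outside lookup_add)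
qed

lemma poly_rename_0: "poly_rename g 0 = 0"
  by (simp add: poly_rename_def)

lemma poly_rename_sum: "poly_rename g (\<Sum>i\<in>I. f i) = (\<Sum>i\<in>I. poly_rename g (f i))"
  by (induction I rule: infinite_finite_induct) (simp_all add: poly_rename_0 poly_rename_add)

lemma poly_rename_single: "poly_rename g (single m c) = single (ren g m) c"
  by (simp add: poly_rename_ren)

lemma poly_rename_mult: "poly_rename g (p * q) = poly_rename g p * poly_rename g q"
proof (induction p rule: mpoly_induct)
  case zero
  then show ?case by (simp add: poly_rename_0)
next
  case (single_add m c p)
  have "poly_rename g (single m c * q) = poly_rename g (single m c) * poly_rename g q"
  proof (induction q rule: mpoly_induct)
    case zero
    then show ?case by (simp add: poly_rename_0)
  next
    case (single_add m' c' q)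
    then show ?case
      by (simp add: distrib_left poly_rename_add mult_single poly_rename_single ren_add)
  qed
  then show ?case using single_add by (simp add: distrib_right poly_rename_add)
qed

lemma pull_poly_add: "pull_poly g (p + q) = pull_poly g p + pull_poly g q"
  for p :: "('w, 'k::field) mpoly"
  by (rule poly_mapping_eqI) (simp add: lookup_pull_poly lookup_add)

lemma pull_poly_0: "pull_poly g 0 = 0"
  by (rule poly_mapping_eqI) (simp add: lookup_pull_poly)

text \<open>Renaming is injective and multiplicative, and after \<open>pull_poly\<close> it is
  truncation to the range of \<open>g\<close>, which is multiplicative too.\<close>

lemma pull_poly_mult: "pull_poly g (p * q) = pull_poly g p * pull_poly g q"
  for p :: "('w, 'k::field) mpoly"
proof -
  have "poly_rename g (pull_poly g (p * q)) = poly_rename g (pull_poly g p * pull_poly g q)"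
    by (simp add: rename_pull poly_rename_mult res_Pow_times)
  then show ?thesis by (metis pull_rename)
qed

lemma pull_poly_const: "pull_poly g (single 0 c) = single 0 c"
proof (rule poly_mapping_eqI)
  fix k
  have "ren g k = 0 \<longleftrightarrow> k = 0" using inj_ren ren_zero by (metis injD)
  then show "lookup (pull_poly g (single 0 c)) k = lookup (single 0 c) k"
    by (simp add: lookup_pull_poly lookup_single when_def eq_commute[of 0])
qed

lemma res_rename: "res X (poly_rename g p) = poly_rename g (res {\<sigma>. g ` \<sigma> \<in> X} p)"
proof (rule poly_mapping_eqI)
  fix m show "lookup (res X (poly_rename g p)) m = lookup (poly_rename g (res {\<sigma>. g ` \<sigma> \<in> X} p)) m"
    by (cases "m \<in> range (ren g)") (auto simp: lookup_poly_rename lookup_poly_rename_outside lookup_res keys_ren)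
qed

lemma pull_res: "pull_poly g (res X p) = res {\<sigma>. g ` \<sigma> \<in> X} (pull_poly g p)"
  by (rule poly_mapping_eqI) (simp add: lookup_pull_poly lookup_res keys_ren)

end

subsection \<open>A component of a disjoint union\<close>

text \<open>Monotonicity of \<open>g\<close> preserves the Cech signs; \<open>inside\<close> says
  that no face joins the component to a vertex outside it.\<close>

locale component = A: SR \<Delta> A + R: SR D R
  for \<Delta> :: "'v::linorder set set" and A :: "('v, 'k::field) mpoly set gring"
    and D :: "'w::linorder set set" and R :: "('w, 'k) mpoly set gring" +
  fixes g :: "'v \<Rightarrow> 'w"
  assumes g_mono: "u < v \<Longrightarrow> g u < g v"
    and faces: "g ` \<sigma> \<in> D \<longleftrightarrow> \<sigma> \<in> \<Delta>"
    and inside: "\<tau> \<in> D \<Longrightarrow> \<tau> \<subseteq> range g \<or> \<tau> \<inter> range g = {}"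
begin

lemma g_less_iff: "g u < g v \<longleftrightarrow> u < v"
  using g_mono by (metis less_asym neqE)

lemma inj_g: "inj g"
  by (rule injI) (metis g_mono less_irrefl neqE)

abbreviation "rn \<equiv> poly_rename g :: ('v, 'k) mpoly \<Rightarrow> ('w, 'k) mpoly"

abbreviation "pb \<equiv> pull_poly g :: ('w, 'k) mpoly \<Rightarrow> ('v, 'k) mpoly"

lemmas rename_simps = poly_rename_0[OF inj_g] poly_rename_add[OF inj_g] poly_rename_mult[OF inj_g]
  pull_poly_0[OF inj_g] pull_poly_add[OF inj_g] pull_poly_mult[OF inj_g] pull_rename[OF inj_g]

lemma pb_sum: "pb (\<Sum>i\<in>I. f i) = (\<Sum>i\<in>I. pb (f i))"
  by (rule poly_mapping_eqI) (simp add: lookup_pull_poly[OF inj_g] lookup_sum)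

lemma faces_eq: "{\<sigma>. g ` \<sigma> \<in> D} = \<Delta>"
  using faces by auto

lemma vertices: "g v \<in> R.V \<longleftrightarrow> v \<in> A.V"
proof
  assume "g v \<in> R.V"
  then have "g ` {v} \<in> D" using R.vertex_face[of "g v"] by simp
  then show "v \<in> A.V" unfolding faces by blast
next
  assume "v \<in> A.V"
  then have "g ` {v} \<in> D" unfolding faces by (rule A.vertex_face)
  then show "g v \<in> R.V" by auto
qed

lemma vimage_V: "{\<sigma>. g ` \<sigma> \<in> Pow R.V} = Pow A.V"
  unfolding Pow_iff image_subset_iff vertices by (auto simp del: Union_iff)

lemma inj_on_g: "inj_on g F"
  using inj_g by (rule inj_on_subset) simp

lemma card_g: "card (g ` F) = card F"
  by (rule card_image[OF inj_on_g])

lemma rn_P: "p \<in> A.P \<Longrightarrow> rn p \<in> R.P"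
  by (simp add: polys_iff res_rename[OF inj_g] vimage_V del: Pow_iff)

lemma pb_P: "p \<in> R.P \<Longrightarrow> pb p \<in> A.P"
  using pull_res[OF inj_g, of "Pow R.V" p] by (simp add: polys_iff vimage_V del: Pow_iff)

text \<open>With \<open>ret\<close>, which sets the variables outside the component to zero, this
  makes \<open>A\<close> a retract of \<open>R\<close>.\<close>

definition inc :: "('v, 'k) mpoly set \<Rightarrow> ('w, 'k) mpoly set" where
  "inc X = R.cl (rn (A.rp X))"

definition ret :: "('w, 'k) mpoly set \<Rightarrow> ('v, 'k) mpoly set" where
  "ret Y = A.cl (pb (R.rp Y))"

lemma inc_closed [simp]: "X \<in> carrier A \<Longrightarrow> inc X \<in> carrier R"
  by (simp add: inc_def rn_P A.rp_P)

lemma ret_closed [simp]: "Y \<in> carrier R \<Longrightarrow> ret Y \<in> carrier A"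
  by (simp add: ret_def pb_P R.rp_P)

lemma rp_inc: "X \<in> carrier A \<Longrightarrow> R.rp (inc X) = rn (A.rp X)"
  by (simp add: inc_def R.rp_cl rn_P A.rp_P res_rename[OF inj_g] faces_eq A.res_rp)

lemma rp_ret: "Y \<in> carrier R \<Longrightarrow> A.rp (ret Y) = pb (R.rp Y)"
proof -
  assume Y: "Y \<in> carrier R"
  have "res \<Delta> (pb (R.rp Y)) = pb (R.rp Y)"
    using pull_res[OF inj_g, of D "R.rp Y"] R.res_rp[OF Y] by (simp add: faces_eq)
  then show ?thesis using Y by (simp add: ret_def A.rp_cl pb_P R.rp_P)
qed

lemma ret_inc: "X \<in> carrier A \<Longrightarrow> ret (inc X) = X"
  by (rule A.rp_inj) (simp_all add: rp_ret rp_inc rename_simps)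

lemma inc_add: "X \<in> carrier A \<Longrightarrow> Y \<in> carrier A \<Longrightarrow> inc (X \<oplus>\<^bsub>A\<^esub> Y) = inc X \<oplus>\<^bsub>R\<^esub> inc Y"
  by (rule R.rp_inj) (simp_all add: rp_inc A.rp_add R.rp_add rename_simps)

lemma ret_add: "X \<in> carrier R \<Longrightarrow> Y \<in> carrier R \<Longrightarrow> ret (X \<oplus>\<^bsub>R\<^esub> Y) = ret X \<oplus>\<^bsub>A\<^esub> ret Y"
  by (rule A.rp_inj) (simp_all add: rp_ret A.rp_add R.rp_add rename_simps)

lemma inc_zero [simp]: "inc \<zero>\<^bsub>A\<^esub> = \<zero>\<^bsub>R\<^esub>"
  by (rule R.rp_inj) (simp_all add: rp_inc rename_simps)

lemma ret_zero [simp]: "ret \<zero>\<^bsub>R\<^esub> = \<zero>\<^bsub>A\<^esub>"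
  by (rule A.rp_inj) (simp_all add: rp_ret rename_simps)

lemma inc_mult: "X \<in> carrier A \<Longrightarrow> Y \<in> carrier A \<Longrightarrow> inc (X \<otimes>\<^bsub>A\<^esub> Y) = inc X \<otimes>\<^bsub>R\<^esub> inc Y"
proof (rule R.rp_inj)
  assume XY: "X \<in> carrier A" "Y \<in> carrier A"
  have "rn (res \<Delta> (A.rp X * A.rp Y)) = res D (rn (A.rp X * A.rp Y))"
    by (simp add: res_rename[OF inj_g] faces_eq)
  then show "R.rp (inc (X \<otimes>\<^bsub>A\<^esub> Y)) = R.rp (inc X \<otimes>\<^bsub>R\<^esub> inc Y)"
    using XY by (simp add: rp_inc A.rp_mult R.rp_mult rename_simps)
qed auto

lemma ret_mult: "X \<in> carrier R \<Longrightarrow> Y \<in> carrier R \<Longrightarrow> ret (X \<otimes>\<^bsub>R\<^esub> Y) = ret X \<otimes>\<^bsub>A\<^esub> ret Y"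
proof (rule A.rp_inj)
  assume XY: "X \<in> carrier R" "Y \<in> carrier R"
  have "pb (res D (R.rp X * R.rp Y)) = res \<Delta> (pb (R.rp X * R.rp Y))"
    by (simp add: pull_res[OF inj_g] faces_eq)
  then show "A.rp (ret (X \<otimes>\<^bsub>R\<^esub> Y)) = A.rp (ret X \<otimes>\<^bsub>A\<^esub> ret Y)"
    using XY by (simp add: rp_ret A.rp_mult R.rp_mult rename_simps)
qed auto

lemma ret_one: "ret \<one>\<^bsub>R\<^esub> = \<one>\<^bsub>A\<^esub>"
  using pull_poly_const[OF inj_g, of "1::'k", unfolded single_one] by (intro A.rp_inj) (simp_all add: rp_ret)

lemma ret_pow: "Y \<in> carrier R \<Longrightarrow> ret (Y [^]\<^bsub>R\<^esub> (k::nat)) = ret Y [^]\<^bsub>A\<^esub> k"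
  by (induction k) (simp_all add: ret_one ret_mult)

lemma ret_mm: "Y \<in> R.mm \<Longrightarrow> ret Y \<in> A.mm"
  by (simp add: rp_ret lookup_pull_zero[OF inj_g])

lemma inc_mm: "X \<in> A.mm \<Longrightarrow> inc X \<in> R.mm"
  by (simp add: rp_inc lookup_rename_zero[OF inj_g])

lemma mm_keys: "X \<in> A.mm \<Longrightarrow> m \<in> keys (rn (A.rp X)) \<Longrightarrow> keys m \<inter> range g \<noteq> {}"
proof -
  assume X: "X \<in> A.mm" and m: "m \<in> keys (rn (A.rp X))"
  then obtain l where l: "m = ren g l" using lookup_poly_rename_outside[OF inj_g, of m] by (auto simp: in_keys_iff)
  then have "l \<noteq> 0" using X m by (auto simp: in_keys_iff lookup_poly_rename[OF inj_g])
  then obtain v where "v \<in> keys l" by (metis keys_eq_empty equals0I)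
  then show ?thesis using l by (auto simp: keys_ren[OF inj_g])
qed

text \<open>Variables outside the component annihilate its maximal ideal.\<close>

lemma mult_inc:
  assumes r: "r \<in> carrier R" and X: "X \<in> A.mm"
  shows "r \<otimes>\<^bsub>R\<^esub> inc X = inc (ret r \<otimes>\<^bsub>A\<^esub> X)"
proof (rule R.rp_inj)
  have XA: "X \<in> carrier A" using X by simp
  let ?r = "R.rp r" and ?x = "rn (A.rp X)"
  have "res D ((?r - res (Pow (range g)) ?r) * ?x) = 0"
    unfolding res_eq_0_iff
  proof
    fix m assume "m \<in> keys ((?r - res (Pow (range g)) ?r) * ?x)"
    then obtain a b where ab: "m = a + b" "a \<in> keys (?r - res (Pow (range g)) ?r)" "b \<in> keys ?x"
      by (elim keys_times_mpoly)
    have "\<not> keys a \<subseteq> range g" using ab(2) by (auto simp: in_keys_iff lookup_minus lookup_res)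
    moreover have "keys b \<inter> range g \<noteq> {}" using mm_keys[OF X ab(3)] .
    ultimately show "keys m \<notin> D" using inside[of "keys m"] ab(1) by (auto simp: keys_add_nat)
  qed
  then have "res D (?r * ?x) = res D (rn (pb ?r * A.rp X))"
    by (simp add: left_diff_distrib res_diff rename_simps rename_pull[OF inj_g])
  also have "\<dots> = rn (res \<Delta> (pb ?r * A.rp X))" by (simp add: res_rename[OF inj_g] faces_eq)
  finally show "R.rp (r \<otimes>\<^bsub>R\<^esub> inc X) = R.rp (inc (ret r \<otimes>\<^bsub>A\<^esub> X))"
    using r XA by (simp add: R.rp_mult rp_inc A.rp_mult rp_ret)
qed (use r X in auto)

text \<open>Inside the maximal ideal \<open>R\<close> acts through \<open>ret\<close>, by
  \<open>mult_inc\<close>, so the image is an ideal without generating anything further.\<close>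

lemma ideal_inc_image:
  assumes I: "ideal I A" "I \<subseteq> A.mm"
  shows "ideal (inc ` I) R"
proof (rule idealI)
  interpret I: ideal I A by (rule I(1))
  have IA: "x \<in> carrier A" if "x \<in> I" for x using I.a_subset that by blast
  have mult: "r \<otimes>\<^bsub>R\<^esub> y \<in> inc ` I" if h: "r \<in> carrier R" "y \<in> inc ` I" for r y
  proof -
    obtain x where x: "x \<in> I" "y = inc x" using h(2) by blast
    then have "r \<otimes>\<^bsub>R\<^esub> y = inc (ret r \<otimes>\<^bsub>A\<^esub> x)" using mult_inc[OF h(1)] I(2) by blast
    then show ?thesis using I.I_l_closed[OF x(1)] h(1) by simp
  qed
  show "subgroup (inc ` I) (add_monoid R)"
  proof (rule R.add.subgroupI)
    show "inc ` I \<subseteq> carrier R" using IA by auto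
    show "inc ` I \<noteq> {}" using I.zero_closed by blast
  next
    fix a assume a: "a \<in> inc ` I"
    then have aR: "a \<in> carrier R" using IA by auto
    have "(\<ominus>\<^bsub>R\<^esub> \<one>\<^bsub>R\<^esub>) \<otimes>\<^bsub>R\<^esub> a \<in> inc ` I" using a by (intro mult) auto
    then show "\<ominus>\<^bsub>R\<^esub> a \<in> inc ` I" using aR by (simp add: R.l_minus)
  next
    fix a b assume "a \<in> inc ` I" "b \<in> inc ` I"
    then obtain x y where "x \<in> I" "a = inc x" "y \<in> I" "b = inc y" by blast
    then show "a \<oplus>\<^bsub>R\<^esub> b \<in> inc ` I" using IA I.a_closed by (auto simp flip: inc_add)
  qed
  fix a r assume a: "a \<in> inc ` I" and r: "r \<in> carrier R"
  then have "a \<in> carrier R" using IA by auto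
  then show "r \<otimes>\<^bsub>R\<^esub> a \<in> inc ` I" "a \<otimes>\<^bsub>R\<^esub> r \<in> inc ` I" using mult[OF r a] r by (simp_all add: R.m_comm)
qed (rule R.ring_axioms)

lemma ideal_inc_vimage:
  assumes "ideal I R"
  shows "ideal {y \<in> carrier A. inc y \<in> I} A"
proof (rule idealI)
  interpret I: ideal I R by (rule assms)
  have mult: "inc (a \<otimes>\<^bsub>A\<^esub> y) \<in> I" if "a \<in> carrier A" "y \<in> carrier A" "inc y \<in> I" for a y
    using I.I_l_closed[OF that(3), of "inc a"] that by (simp add: inc_mult)
  show "subgroup {y \<in> carrier A. inc y \<in> I} (add_monoid A)"
  proof (rule A.add.subgroupI)
    show "{y \<in> carrier A. inc y \<in> I} \<noteq> {}" using I.zero_closed by (auto intro!: exI[of _ "\<zero>\<^bsub>A\<^esub>"])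
    fix y assume "y \<in> {y \<in> carrier A. inc y \<in> I}"
    then have "y \<in> carrier A" "inc ((\<ominus>\<^bsub>A\<^esub> \<one>\<^bsub>A\<^esub>) \<otimes>\<^bsub>A\<^esub> y) \<in> I" using mult[of "\<ominus>\<^bsub>A\<^esub> \<one>\<^bsub>A\<^esub>" y] by auto
    then show "\<ominus>\<^bsub>A\<^esub> y \<in> {y \<in> carrier A. inc y \<in> I}" by (simp add: A.l_minus)
  next
    fix a b assume "a \<in> {y \<in> carrier A. inc y \<in> I}" "b \<in> {y \<in> carrier A. inc y \<in> I}"
    then show "a \<oplus>\<^bsub>A\<^esub> b \<in> {y \<in> carrier A. inc y \<in> I}" by (simp add: inc_add)
  qed auto
qed (use ideal.I_l_closed[OF assms] ideal.I_r_closed[OF assms] A.ring_axioms in \<open>auto simp: inc_mult\<close>)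

text \<open>A monomial that forms a face together with \<open>u\<close> survives multiplication by
  the variable of \<open>u\<close>. Taking \<open>u\<close> in the support of a monomial excludes
  the monomials that leave the component, and taking \<open>u0\<close> with the trivial monomial
  excludes the constant term.\<close>

lemma annihilated_in_component:
  assumes Z: "Z \<in> carrier R" and u0: "u0 \<in> R.V - range g"
    and ann: "\<And>u. u \<in> R.V - range g \<Longrightarrow> R.cl (pvar u) \<otimes>\<^bsub>R\<^esub> Z = \<zero>\<^bsub>R\<^esub>"
  shows "Z = inc (ret Z)" "ret Z \<in> A.mm"
proof -
  let ?z = "R.rp Z"
  have zero: "lookup ?z m = 0" if u: "u \<in> R.V - range g" "insert u (keys m) \<in> D" for u m
  proof -
    have "R.rp (R.cl (pvar u) \<otimes>\<^bsub>R\<^esub> Z) = res D (single (single u 1) 1 * ?z)"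
      using R.rp_monomial_times[of "single u 1" Z 1] u Z by (simp add: pvar_def)
    then have "res D (single (single u 1) 1 * ?z) = 0" using ann[OF u(1)] by simp
    then have "lookup (res D (single (single u 1) 1 * ?z)) (single u 1 + m) = 0" by simp
    moreover have "keys (single u 1 + m) \<in> D" using u(2) by (simp add: keys_add_nat)
    ultimately show ?thesis using lookup_single_times[of "single u 1" 1 ?z m] by (simp add: lookup_res)
  qed
  have z0: "lookup ?z 0 = 0" using zero[OF u0, of 0] u0 R.vertex_face[of u0] by simp
  have "keys m \<subseteq> range g" if m: "m \<in> keys ?z" for m
  proof
    fix u assume u: "u \<in> keys m"
    have mD: "keys m \<in> D" using m R.res_rp[OF Z] by (auto simp: res_id_iff)
    show "u \<in> range g"
    proof (rule ccontr)
      assume "u \<notin> range g"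
      then have "lookup ?z m = 0" using zero[of u m] u mD by (auto simp: insert_absorb)
      then show False using m by (simp add: in_keys_iff)
    qed
  qed
  then have "rn (pb ?z) = ?z" by (simp add: rename_pull[OF inj_g] res_id_iff)
  then show "Z = inc (ret Z)" using Z by (intro R.rp_inj) (simp_all add: rp_inc rp_ret)
  show "ret Z \<in> A.mm" using Z z0 by (simp add: rp_ret lookup_pull_poly[OF inj_g] ren_zero[OF inj_g])
qed

text \<open>Extension by zero from the faces of the component to all faces; \<open>pull\<close> is
  the restriction in the other direction.\<close>

definition push :: "('v set \<Rightarrow> ('v, 'k) mpoly) \<Rightarrow> 'w set \<Rightarrow> ('w, 'k) mpoly" where
  "push w F = (if F \<subseteq> range g then rn (w (g -` F)) else 0)"

definition pull :: "('w set \<Rightarrow> ('w, 'k) mpoly) \<Rightarrow> 'v set \<Rightarrow> ('v, 'k) mpoly" where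
  "pull w F = pb (w (g ` F))"

lemma push_add: "push (w \<oplus>\<^bsub>A.W\<^esub> w') = push w \<oplus>\<^bsub>R.W\<^esub> push w'"
  by (auto simp: push_def rename_simps)

lemma pull_add: "pull (w \<oplus>\<^bsub>R.W\<^esub> w') = pull w \<oplus>\<^bsub>A.W\<^esub> pull w'"
  by (auto simp: pull_def rename_simps)

lemma vimage_Pow: "{\<sigma>. g ` \<sigma> \<in> Pow F} = Pow (g -` F)"
  by auto

lemma vimage_image: "g -` g ` F = F"
  using inj_g by (simp add: inj_vimage_image_eq)

lemma push_smult:
  assumes "r \<in> carrier R"
  shows "push (ret r \<odot>\<^bsub>A.W\<^esub> w) = r \<odot>\<^bsub>R.W\<^esub> push w"
proof
  fix F
  have "rn (res (Pow (g -` F)) (pb (R.rp r))) = res (Pow F) (R.rp r)" if "F \<subseteq> range g"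
  proof -
    have "rn (res (Pow (g -` F)) (pb (R.rp r))) = rn (pb (res (Pow F) (R.rp r)))"
      by (simp only: pull_res[OF inj_g] vimage_Pow)
    also have "\<dots> = res (Pow F) (R.rp r)"
    proof -
      have "Pow (range g) \<inter> Pow F = Pow F" using that by auto
      then show ?thesis by (simp add: rename_pull[OF inj_g] res_res)
    qed
    finally show ?thesis .
  qed
  then show "push (ret r \<odot>\<^bsub>A.W\<^esub> w) F = (r \<odot>\<^bsub>R.W\<^esub> push w) F"
    using assms by (simp add: push_def rename_simps rp_ret)
qed

lemma pull_smult:
  assumes "r \<in> carrier R"
  shows "pull (r \<odot>\<^bsub>R.W\<^esub> w) = ret r \<odot>\<^bsub>A.W\<^esub> pull w"
proof
  fix F
  have "pb (res (Pow (g ` F)) (R.rp r)) = res (Pow F) (pb (R.rp r))"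
    by (simp only: pull_res[OF inj_g] vimage_Pow vimage_image)
  then show "pull (r \<odot>\<^bsub>R.W\<^esub> w) F = (ret r \<odot>\<^bsub>A.W\<^esub> pull w) F"
    using assms by (simp add: pull_def rename_simps rp_ret)
qed

lemma pull_push: "pull (push w) = w"
  by (intro ext) (simp add: pull_def push_def vimage_image rename_simps image_mono)

lemma push_pull:
  assumes "w \<in> carrier R.W"
  shows "push (pull w) F = (if F \<subseteq> range g then w F else 0)"
proof (cases "F \<subseteq> range g")
  case True
  have "Pow (range g) \<inter> Pow F = Pow F" using True by auto
  moreover have "res (Pow F) (w F) = w F" using assms by (simp add: R.W_carrier)
  ultimately have "res (Pow (range g)) (w F) = w F" by (metis res_res)
  then show ?thesis using True by (simp add: push_def pull_def rename_pull[OF inj_g] image_vimage_eq Int_absorb2)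
qed (simp add: push_def)

lemma bsign_g: "bsign (g ` F) (g v) = (bsign F v :: 'k)"
proof -
  have "{k \<in> g ` F. k < g v} = g ` {k \<in> F. k < v}" by (auto simp: g_less_iff)
  then show ?thesis by (simp add: bsign_def card_g)
qed

section \<open>Components of full dimension\<close>

context
  assumes same_dim: "A.dd = R.dd" and dim: "R.dd \<ge> 2"
begin

lemma topf_g: "g ` F \<in> R.topf \<longleftrightarrow> F \<in> A.topf"
  using same_dim by (simp add: R.topf_def A.topf_def faces card_g)

lemma topf_inside: "F \<in> R.topf \<Longrightarrow> F \<inter> range g \<noteq> {} \<Longrightarrow> F \<subseteq> range g"
  using inside R.top_face by blast

lemma cofaces_g:
  assumes "J \<noteq> {}"
  shows "R.cofaces (g ` J) = g ` A.cofaces J"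
proof (intro equalityI subsetI)
  fix x assume x: "x \<in> R.cofaces (g ` J)"
  then have "insert x (g ` J) \<subseteq> range g" using assms by (intro topf_inside) (auto simp: R.cofaces_def)
  then obtain v where v: "x = g v" by auto
  have "insert v J \<in> A.topf" using x v topf_g[of "insert v J"] by (simp add: R.cofaces_def)
  then show "x \<in> g ` A.cofaces J" using x v vertices by (auto simp: R.cofaces_def A.cofaces_def)
next
  fix x assume "x \<in> g ` A.cofaces J"
  then obtain v where v: "x = g v" "v \<in> A.V" "v \<notin> J" "insert v J \<in> A.topf" by (auto simp: A.cofaces_def)
  then show "x \<in> R.cofaces (g ` J)"
    using topf_g[of "insert v J"] vertices[of v] inj_g by (auto simp: R.cofaces_def inj_image_mem_iff)
qed

lemma push_closed:
  assumes w: "w \<in> carrier A.W"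
  shows "push w \<in> carrier R.W"
  unfolding R.W_carrier
proof (intro conjI allI impI)
  fix F assume F: "F \<notin> R.topf"
  show "push w F = 0"
  proof (cases "F \<subseteq> range g")
    case True
    then have "g ` (g -` F) = F" by auto
    then have "g -` F \<notin> A.topf" using F topf_g[of "g -` F"] by simp
    then show ?thesis using w by (simp add: push_def A.W_carrier rename_simps)
  qed (simp add: push_def)
next
  fix F
  have "res (Pow F) (rn (w (g -` F))) = rn (res (Pow (g -` F)) (w (g -` F)))"
    by (simp only: res_rename[OF inj_g] vimage_Pow)
  then show "res (Pow F) (push w F) = push w F" using w by (simp add: push_def A.W_carrier)
next
  fix J assume J: "J \<subseteq> R.V \<and> Suc (card J) = R.dd"
  \<comment> \<open>Here \<open>dd\<close> being at least two enters: a set with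
    \<open>dd - 1\<close> elements is nonempty, so its cofaces cannot leave its component.\<close>
  then have ne: "J \<noteq> {}" using dim by auto
  show "(\<Sum>v\<in>R.cofaces J. single 0 (bsign (insert v J) v) * res (Pow J) (push w (insert v J))) = 0"
  proof (cases "J \<subseteq> range g")
    case True
    define I where "I = g -` J"
    have JI: "J = g ` I" using True by (auto simp: I_def)
    have I: "I \<noteq> {}" "I \<subseteq> A.V" "Suc (card I) = A.dd"
    proof -
      show "I \<noteq> {}" using ne JI by blast
      have "I \<in> {\<sigma>. g ` \<sigma> \<in> Pow R.V}" using J JI by simp
      then show "I \<subseteq> A.V" unfolding vimage_V by simp
      show "Suc (card I) = A.dd" using J same_dim unfolding JI by (simp add: card_g)
    qed
    have "(\<Sum>v\<in>R.cofaces J. single 0 (bsign (insert v J) v) * res (Pow J) (push w (insert v J))) =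
      (\<Sum>v\<in>A.cofaces I. single 0 (bsign (g ` insert v I) (g v)) * res (Pow J) (push w (g ` insert v I)))"
      unfolding JI cofaces_g[OF I(1)]
      by (subst sum.reindex[OF inj_on_g]) (simp add: o_def)
    also have "\<dots> = (\<Sum>v\<in>A.cofaces I. rn (single 0 (bsign (insert v I) v) * res (Pow I) (w (insert v I))))"
    proof (rule sum.cong[OF refl])
      fix v
      have "push w (g ` insert v I) = rn (w (insert v I))"
        unfolding push_def vimage_image by (simp add: image_mono)
      moreover have "res (Pow J) (rn (w (insert v I))) = rn (res (Pow I) (w (insert v I)))"
        by (simp only: res_rename[OF inj_g] vimage_Pow I_def)
      ultimately show "single 0 (bsign (g ` insert v I) (g v)) * res (Pow J) (push w (g ` insert v I)) =
          rn (single 0 (bsign (insert v I) v) * res (Pow I) (w (insert v I)))"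
        by (simp only: bsign_g rename_simps poly_rename_single[OF inj_g] ren_zero[OF inj_g])
    qed
    also have "\<dots> = rn (\<Sum>v\<in>A.cofaces I. single 0 (bsign (insert v I) v) * res (Pow I) (w (insert v I)))"
      by (simp only: poly_rename_sum[OF inj_g])
    also have "\<dots> = 0" using w I by (simp add: A.W_carrier rename_simps)
    finally show ?thesis .
  next
    case False
    then have "push w (insert v J) = 0" for v by (auto simp: push_def)
    then show ?thesis by simp
  qed
qed

lemma pull_closed:
  assumes w: "w \<in> carrier R.W"
  shows "pull w \<in> carrier A.W"
  unfolding A.W_carrier
proof (intro conjI allI impI)
  fix F assume "F \<notin> A.topf"
  then have "g ` F \<notin> R.topf" using topf_g by simp
  then show "pull w F = 0" using w by (simp add: pull_def R.W_carrier rename_simps)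
next
  fix F
  have "pb (res (Pow (g ` F)) (w (g ` F))) = res (Pow F) (pb (w (g ` F)))"
    by (simp only: pull_res[OF inj_g] vimage_Pow vimage_image)
  moreover have "res (Pow (g ` F)) (w (g ` F)) = w (g ` F)" using w by (simp add: R.W_carrier)
  ultimately show "res (Pow F) (pull w F) = pull w F" unfolding pull_def by metis
next
  fix J assume J: "J \<subseteq> A.V \<and> Suc (card J) = A.dd"
  then have ne: "J \<noteq> {}" using dim same_dim by auto
  have J': "g ` J \<subseteq> R.V" "Suc (card (g ` J)) = R.dd"
  proof -
    have "J \<in> {\<sigma>. g ` \<sigma> \<in> Pow R.V}" unfolding vimage_V using J by simp
    then show "g ` J \<subseteq> R.V" by simp
    show "Suc (card (g ` J)) = R.dd" using J same_dim by (simp add: card_g)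
  qed
  have "(\<Sum>v\<in>A.cofaces J. single 0 (bsign (insert v J) v) * res (Pow J) (pull w (insert v J))) =
    (\<Sum>v\<in>A.cofaces J. pb (single 0 (bsign (insert (g v) (g ` J)) (g v)) * res (Pow (g ` J)) (w (insert (g v) (g ` J)))))"
  proof (rule sum.cong[OF refl])
    fix v
    have "pb (res (Pow (g ` J)) (w (g ` insert v J))) = res (Pow J) (pull w (insert v J))"
      by (simp only: pull_res[OF inj_g] vimage_Pow vimage_image pull_def)
    then show "single 0 (bsign (insert v J) v) * res (Pow J) (pull w (insert v J)) =
        pb (single 0 (bsign (insert (g v) (g ` J)) (g v)) * res (Pow (g ` J)) (w (insert (g v) (g ` J))))"
      by (simp only: rename_simps pull_poly_const[OF inj_g] bsign_g image_insert[symmetric])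
  qed
  also have "\<dots> = pb (\<Sum>v\<in>A.cofaces J. single 0 (bsign (insert (g v) (g ` J)) (g v)) * res (Pow (g ` J)) (w (insert (g v) (g ` J))))"
    by (simp only: pb_sum)
  also have "\<dots> = pb (\<Sum>v\<in>R.cofaces (g ` J). single 0 (bsign (insert v (g ` J)) v) * res (Pow (g ` J)) (w (insert v (g ` J))))"
    unfolding cofaces_g[OF ne]
    by (subst sum.reindex[OF inj_on_g]) (simp add: o_def)
  also have "\<dots> = 0" using w J' by (simp add: R.W_carrier rename_simps)
  finally show "(\<Sum>v\<in>A.cofaces J. single 0 (bsign (insert v J) v) * res (Pow J) (pull w (insert v J))) = 0" .
qed

text \<open>Outside variables annihilate \<open>push w\<close>, hence its image, which therefore
  comes from the maximal ideal of \<open>A\<close>. A value of a homomorphism that lies there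
  belongs to the dagger even if the trace of \<open>A\<close> is the whole ring.\<close>

lemma hom_push_in_dagger:
  assumes \<theta>: "\<theta> \<in> R.homs" and w: "w \<in> carrier A.W" and u0: "u0 \<in> R.V - range g"
  shows "\<theta> (push w) \<in> inc ` trace_dagger A A.W"
proof -
  have c: "\<theta> (push w) \<in> carrier R" if "w \<in> carrier A.W" for w
    using R.homs_closed[OF \<theta> push_closed[OF that]] .
  define \<theta>' where "\<theta>' = (\<lambda>w\<in>carrier A.W. ret (\<theta> (push w)))"
  have h: "\<theta>' \<in> A.homs"
    unfolding \<theta>'_def
  proof (rule A.homsI)
    fix s x assume s: "s \<in> carrier A" and x: "x \<in> carrier A.W"
    have "push (s \<odot>\<^bsub>A.W\<^esub> x) = inc s \<odot>\<^bsub>R.W\<^esub> push x"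
      using push_smult[of "inc s" x] s by (simp add: ret_inc del: A.W_simps R.W_simps)
    then show "ret (\<theta> (push (s \<odot>\<^bsub>A.W\<^esub> x))) = s \<otimes>\<^bsub>A\<^esub> ret (\<theta> (push x))"
      using s x c by (simp add: R.homs_smult[OF \<theta>] push_closed ret_mult ret_inc del: A.W_simps R.W_simps)
  qed (simp_all add: c push_add R.homs_add[OF \<theta>] push_closed ret_add del: A.W_simps R.W_simps)
  have ann: "R.cl (pvar u) \<otimes>\<^bsub>R\<^esub> \<theta> (push w) = \<zero>\<^bsub>R\<^esub>" if u: "u \<in> R.V - range g" for u
  proof -
    have uR: "R.cl (pvar u) \<in> carrier R" using u by (simp add: polys_pvar)
    have "pb (R.rp (R.cl (pvar u))) = 0"
    proof -
      have "R.rp (R.cl (pvar u)) = pvar u"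
        using u R.vertex_face[of u] by (simp add: R.rp_cl polys_pvar) (simp add: pvar_def res_single)
      moreover have "single u (Suc 0) \<noteq> ren g m" for m
      proof
        assume "single u (Suc 0) = ren g m"
        then have "u \<in> keys (ren g m)" by (metis keys_single insertI1 nat.distinct(1))
        then show False using u by (auto simp: keys_ren[OF inj_g])
      qed
      ultimately show ?thesis
        by (intro poly_mapping_eqI) (simp add: lookup_pull_poly[OF inj_g] pvar_def lookup_single)
    qed
    then have "ret (R.cl (pvar u)) \<odot>\<^bsub>A.W\<^esub> w = (\<lambda>_. 0)" using rp_ret[OF uR] by simp
    then have "push (\<lambda>_. 0) = R.cl (pvar u) \<odot>\<^bsub>R.W\<^esub> push w" using push_smult[OF uR, of w] by (simp only:)
    moreover have "push (\<lambda>_. 0) = (\<lambda>_. 0)" by (auto simp: push_def rename_simps)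
    ultimately have "R.cl (pvar u) \<odot>\<^bsub>R.W\<^esub> push w = (\<lambda>_. 0)" by (simp only:)
    then show ?thesis
      using R.homs_smult[OF \<theta> uR push_closed[OF w]] R.homs_zero[OF \<theta>] by (simp del: R.W_simps)
  qed
  note Z = annihilated_in_component[OF c[OF w] u0 ann]
  have "\<theta>' w \<in> trace_dagger A A.W"
    using Z(2) w by (intro A.hom_into_mm_dagger[OF h w]) (simp add: \<theta>'_def)
  then show ?thesis using Z(1) w by (simp add: \<theta>'_def)
qed

text \<open>Composing with \<open>pull\<close> and \<open>inc\<close> turns a homomorphism over
  \<open>A\<close> into one over \<open>R\<close>, provided its values lie in the maximal ideal:
  only then does \<open>R\<close> act on them through \<open>ret\<close>. By
  \<open>trace_dagger_minimal\<close> such homomorphisms suffice.\<close>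

lemma inc_dagger_in_trace: "inc ` trace_dagger A A.W \<subseteq> R.T"
proof -
  have "trace_dagger A A.W \<subseteq> {y \<in> carrier A. inc y \<in> R.T}"
  proof (rule A.trace_dagger_minimal[OF ideal_inc_vimage[OF R.ideal_T]])
    fix \<theta> w assume \<theta>: "\<theta> \<in> A.homs" and mm: "\<theta> ` carrier A.W \<subseteq> A.mm" and w: "w \<in> carrier A.W"
    have mm': "\<theta> x \<in> A.mm" if "x \<in> carrier A.W" for x using mm that by blast
    have c: "\<theta> x \<in> carrier A" if "x \<in> carrier A.W" for x using A.homs_closed[OF \<theta> that] .
    have "(\<lambda>x\<in>carrier R.W. inc (\<theta> (pull x))) \<in> R.homs"
    proof (rule R.homsI)
      fix s x assume s: "s \<in> carrier R" and x: "x \<in> carrier R.W"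
      have "inc (\<theta> (pull (s \<odot>\<^bsub>R.W\<^esub> x))) = inc (ret s \<otimes>\<^bsub>A\<^esub> \<theta> (pull x))"
        using s x by (simp add: pull_smult A.homs_smult[OF \<theta>] pull_closed del: A.W_simps R.W_simps)
      then show "inc (\<theta> (pull (s \<odot>\<^bsub>R.W\<^esub> x))) = s \<otimes>\<^bsub>R\<^esub> inc (\<theta> (pull x))"
        using mult_inc[OF s mm'[OF pull_closed[OF x]]] by simp
    qed (simp_all add: c pull_add A.homs_add[OF \<theta>] pull_closed inc_add del: A.W_simps R.W_simps)
    from R.T_mem[OF this push_closed[OF w]] have "inc (\<theta> w) \<in> R.T"
      using push_closed[OF w] by (simp add: pull_push)
    then show "\<theta> w \<in> {y \<in> carrier A. inc y \<in> R.T}" using c[OF w] by simp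
  qed
  then show ?thesis by blast
qed

end

end

subsection \<open>Disjoint unions\<close>

lemma (in cring) ideal_finsum_closed:
  assumes "ideal I R" "finite A" "\<And>i. i \<in> A \<Longrightarrow> f i \<in> I"
  shows "(\<Oplus>i\<in>A. f i) \<in> I"
proof -
  interpret I: ideal I R by fact
  show ?thesis
    using assms(2,3)
  proof (induction A rule: finite_induct)
    case (insert i A)
    have "f \<in> A \<rightarrow> carrier R" "f i \<in> carrier R" using insert.prems I.a_subset by auto
    then show ?case using insert by simp
  qed (simp add: I.zero_closed)
qed

lemma (in cring) ideal_sum_set:
  assumes fin: "finite A" and M: "\<And>i. i \<in> A \<Longrightarrow> ideal (M i) R"
  shows "ideal {\<Oplus>i\<in>A. c i | c. \<forall>i\<in>A. c i \<in> M i} R" (is "ideal ?Q R")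
proof (rule idealI)
  have car: "c \<in> A \<rightarrow> carrier R" if "\<forall>i\<in>A. c i \<in> M i" for c
    using that ideal.Icarr[OF M] by blast
  have mult: "r \<otimes> q \<in> ?Q" if h: "r \<in> carrier R" "q \<in> ?Q" for r q
  proof -
    obtain c where c: "q = (\<Oplus>i\<in>A. c i)" "\<forall>i\<in>A. c i \<in> M i" using h(2) by blast
    have "r \<otimes> q = (\<Oplus>i\<in>A. r \<otimes> c i)" unfolding c(1) using car[OF c(2)] h(1) fin by (intro finsum_rdistr)
    moreover have "\<forall>i\<in>A. r \<otimes> c i \<in> M i" using c(2) h(1) ideal.I_l_closed[OF M] by blast
    ultimately show ?thesis by blast
  qed
  have closed: "?Q \<subseteq> carrier R" using car by auto
  show "subgroup ?Q (add_monoid R)"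
  proof (rule add.subgroupI)
    show "?Q \<subseteq> carrier R" by (rule closed)
    have "\<forall>i\<in>A. \<zero> \<in> M i" using additive_subgroup.zero_closed[OF ideal.axioms(1)[OF M]] by blast
    then have "(\<Oplus>i\<in>A. \<zero>) \<in> ?Q" by (intro CollectI exI[of _ "\<lambda>_. \<zero>"] conjI refl)
    then show "?Q \<noteq> {}" unfolding ex_in_conv[symmetric] by (rule exI)
  next
    fix a assume a: "a \<in> ?Q"
    then have "(\<ominus> \<one>) \<otimes> a \<in> ?Q" by (intro mult) auto
    moreover have "a \<in> carrier R" using a closed by blast
    ultimately show "\<ominus> a \<in> ?Q" by (simp add: l_minus)
  next
    fix a b assume "a \<in> ?Q" "b \<in> ?Q"
    then obtain c d where cd: "a = (\<Oplus>i\<in>A. c i)" "\<forall>i\<in>A. c i \<in> M i" "b = (\<Oplus>i\<in>A. d i)" "\<forall>i\<in>A. d i \<in> M i" by blast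
    have "a \<oplus> b = (\<Oplus>i\<in>A. c i \<oplus> d i)"
      unfolding cd(1,3) using car[OF cd(2)] car[OF cd(4)] by (simp add: finsum_addf)
    moreover have "\<forall>i\<in>A. c i \<oplus> d i \<in> M i"
      using cd(2,4) additive_subgroup.a_closed[OF ideal.axioms(1)[OF M]] by blast
    ultimately show "a \<oplus> b \<in> ?Q" by blast
  qed
  fix a r assume a: "a \<in> ?Q" and r: "r \<in> carrier R"
  then have "a \<in> carrier R" using closed by blast
  then show "r \<otimes> a \<in> ?Q" "a \<otimes> r \<in> ?Q" using mult[OF r a] m_comm[OF \<open>a \<in> carrier R\<close> r] by simp_all
qed (rule ring_axioms)

locale SR_union =
  fixes n :: nat
    and \<Delta> :: "nat \<Rightarrow> 'v::linorder set set"
    and D :: "(nat \<times> 'v) set set"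
    and R :: "(nat \<times> 'v, 'k::field) mpoly set gring"
    and A :: "nat \<Rightarrow> ('v, 'k) mpoly set gring"
  assumes n: "n \<ge> 2"
    and complexes: "\<And>i. i \<in> {1..n} \<Longrightarrow> simplicial_complex (\<Delta> i)"
    and D: "D = disjoint_union n \<Delta>"
    and R: "R = SR_ring D"
    and A: "\<And>i. i \<in> {1..n} \<Longrightarrow> A i = SR_ring (\<Delta> i)"
begin

lemma component_SR: "i \<in> {1..n} \<Longrightarrow> SR (\<Delta> i) (A i)"
  by unfold_locales (simp_all add: complexes A)

lemma face_D: "\<tau> \<in> D \<longleftrightarrow> (\<exists>i\<in>{1..n}. \<exists>\<sigma>\<in>\<Delta> i. \<tau> = Pair i ` \<sigma>)"
  unfolding D disjoint_union_def by blast

lemma face_D_intro: "i \<in> {1..n} \<Longrightarrow> \<sigma> \<in> \<Delta> i \<Longrightarrow> Pair i ` \<sigma> \<in> D"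
  unfolding face_D by blast

lemma vertex_D: "(i, v) \<in> \<Union>D \<longleftrightarrow> i \<in> {1..n} \<and> v \<in> \<Union>(\<Delta> i)"
proof
  assume "(i, v) \<in> \<Union>D"
  then obtain \<tau> where \<tau>: "\<tau> \<in> D" "(i, v) \<in> \<tau>" by blast
  then obtain j \<sigma> where "j \<in> {1..n}" "\<sigma> \<in> \<Delta> j" "(i, v) \<in> Pair j ` \<sigma>" using face_D[of \<tau>] by blast
  then show "i \<in> {1..n} \<and> v \<in> \<Union>(\<Delta> i)" by auto
next
  assume "i \<in> {1..n} \<and> v \<in> \<Union>(\<Delta> i)"
  then obtain \<sigma> where "i \<in> {1..n}" "\<sigma> \<in> \<Delta> i" "v \<in> \<sigma>" by blast
  then have "Pair i ` \<sigma> \<in> D" "(i, v) \<in> Pair i ` \<sigma>" using face_D_intro by blast+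
  then show "(i, v) \<in> \<Union>D" by blast
qed

lemma complex_D: "simplicial_complex D"
  unfolding simplicial_complex_def
proof (intro conjI ballI allI impI)
  have V: "\<Union>D = (\<Union>i\<in>{1..n}. Pair i ` \<Union>(\<Delta> i))"
  proof (rule Set.set_eqI)
    fix x :: "nat \<times> 'v"
    obtain i v where "x = (i, v)" by fastforce
    then show "x \<in> \<Union>D \<longleftrightarrow> x \<in> (\<Union>i\<in>{1..n}. Pair i ` \<Union>(\<Delta> i))"
      unfolding UN_iff image_iff using vertex_D[of i v] by blast
  qed
  show "finite (\<Union>D)" unfolding V using complexes by (auto simp: simplicial_complex_def)
  have "1 \<in> {1..n}" using n by simp
  then have "\<Union>(\<Delta> 1) \<noteq> {}" using complexes unfolding simplicial_complex_def by blast
  then show "\<Union>D \<noteq> {}" using vertex_D[of 1] \<open>1 \<in> {1..n}\<close> by blast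
  fix \<sigma> \<tau> assume "\<sigma> \<in> D" "\<tau> \<subseteq> \<sigma>"
  then obtain i \<rho> where i: "i \<in> {1..n}" "\<rho> \<in> \<Delta> i" "\<tau> \<subseteq> Pair i ` \<rho>" unfolding face_D by blast
  then obtain \<rho>' where "\<rho>' \<subseteq> \<rho>" "\<tau> = Pair i ` \<rho>'" by (auto simp: subset_image_iff)
  moreover from this have "\<rho>' \<in> \<Delta> i" using i complexes[of i] unfolding simplicial_complex_def by blast
  ultimately show "\<tau> \<in> D" using i face_D_intro by simp
qed

sublocale R: SR D R
  by unfold_locales (simp_all add: complex_D R)

lemma component: "i \<in> {1..n} \<Longrightarrow> component (\<Delta> i) (A i) D R (Pair i)"
proof (intro component.intro component_SR R.SR_axioms component_axioms.intro)
  assume i: "i \<in> {1..n}"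
  interpret Ai: SR "\<Delta> i" "A i" by (rule component_SR[OF i])
  show "Pair i u < Pair i v" if "u < v" for u v :: 'v using that by simp
  show "Pair i ` \<sigma> \<in> D \<longleftrightarrow> \<sigma> \<in> \<Delta> i" for \<sigma>
  proof
    assume "Pair i ` \<sigma> \<in> D"
    then obtain j \<rho> where j: "\<rho> \<in> \<Delta> j" "Pair i ` \<sigma> = Pair j ` \<rho>" unfolding face_D by blast
    show "\<sigma> \<in> \<Delta> i"
    proof (cases "\<sigma> = {}")
      case False
      then have "i = j" "\<sigma> = \<rho>" using j(2) by auto
      then show ?thesis using j by simp
    qed (simp add: Ai.empty_face)
  qed (use i face_D in blast)
  show "\<tau> \<subseteq> range (Pair i) \<or> \<tau> \<inter> range (Pair i) = {}" if "\<tau> \<in> D" for \<tau>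
    using that unfolding face_D by auto
qed

abbreviation "inc i \<equiv> component.inc (\<Delta> i) D (Pair i) :: ('v, 'k) mpoly set \<Rightarrow> _"

abbreviation "ret i \<equiv> component.ret (\<Delta> i) D (Pair i) :: (nat \<times> 'v, 'k) mpoly set \<Rightarrow> _"

abbreviation "mx i \<equiv> {X \<in> carrier (A i). lookup (SR.rp (\<Delta> i) X) 0 = 0}"

abbreviation "tr i \<equiv> trace_ideal (A i) (SR.W (\<Delta> i))"

abbreviation "dag i \<equiv> trace_dagger (A i) (SR.W (\<Delta> i))"

abbreviation "summands \<equiv> {i \<in> {1..n}. cdim (\<Delta> i) = cdim D}"

lemma dag_mx: "i \<in> {1..n} \<Longrightarrow> dag i \<subseteq> mx i" "i \<in> {1..n} \<Longrightarrow> ideal (dag i) (A i)"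
  using SR.trace_dagger_subset_mm[OF component_SR] SR.trace_dagger_ideal[OF component_SR] by blast+

lemma dag_eq: "i \<in> {1..n} \<Longrightarrow> dag i = (if tr i = carrier (A i) then mx i else tr i)"
  using SR.graded_max_eq[OF component_SR] by (simp add: trace_dagger_def)

lemma mx_ideal: "i \<in> {1..n} \<Longrightarrow> ideal (mx i) (A i)"
  using SR.ideal_mm[OF component_SR] .

lemma ideal_inc_image: "i \<in> {1..n} \<Longrightarrow> ideal I (A i) \<Longrightarrow> I \<subseteq> mx i \<Longrightarrow> ideal (inc i ` I) R"
  using component.ideal_inc_image[OF component] .

text \<open>Every monomial of \<open>X\<close> involves a variable of component \<open>i\<close>,
  which \<open>ret j\<close> sets to zero; only constants are shared by two components.\<close>

lemma ret_inc_other: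
  assumes "i \<in> {1..n}" "j \<in> {1..n}" "i \<noteq> j" and X: "X \<in> mx i"
  shows "ret j (inc i X) = \<zero>\<^bsub>A j\<^esub>"
proof -
  interpret i: component "\<Delta> i" "A i" D R "Pair i" by (rule component[OF assms(1)])
  interpret j: component "\<Delta> j" "A j" D R "Pair j" by (rule component[OF assms(2)])
  have XA: "X \<in> carrier (A i)" using X by simp
  have "lookup (pull_poly (Pair j) (poly_rename (Pair i) (i.A.rp X))) m = 0" for m
  proof (rule ccontr)
    assume "lookup (pull_poly (Pair j) (poly_rename (Pair i) (i.A.rp X))) m \<noteq> 0"
    then have "ren (Pair j) m \<in> keys (poly_rename (Pair i) (i.A.rp X))"
      by (simp add: lookup_pull_poly[OF j.inj_g] in_keys_iff)
    then have "keys (ren (Pair j) m) \<inter> range (Pair i) \<noteq> {}" by (rule i.mm_keys[OF X])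
    then show False using assms(3) by (auto simp: keys_ren[OF j.inj_g])
  qed
  then have "pull_poly (Pair j) (poly_rename (Pair i) (i.A.rp X)) = 0" by (intro poly_mapping_eqI) simp
  then show ?thesis using XA by (intro j.A.rp_inj) (simp_all add: j.rp_ret i.rp_inc)
qed

section \<open>Sums of ideals coming from the components\<close>

definition incsum :: "nat set \<Rightarrow> (nat \<Rightarrow> ('v, 'k) mpoly set set) \<Rightarrow> (nat \<times> 'v, 'k) mpoly set set" where
  "incsum I M = {\<Oplus>\<^bsub>R\<^esub>i\<in>I. c i | c. \<forall>i\<in>I. c i \<in> inc i ` M i}"

context
  fixes I M
  assumes I: "I \<subseteq> {1..n}" and M: "\<And>i. i \<in> I \<Longrightarrow> ideal (M i) (A i)" "\<And>i. i \<in> I \<Longrightarrow> M i \<subseteq> mx i"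
begin

lemma finite_I: "finite I"
  using I finite_subset by blast

lemma ideal_incsum: "ideal (incsum I M) R"
  unfolding incsum_def by (intro R.ideal_sum_set finite_I ideal_inc_image) (use I M in auto)

lemma inc_in_incsum:
  assumes i: "i \<in> I" and x: "x \<in> M i"
  shows "inc i x \<in> incsum I M"
proof -
  interpret i: component "\<Delta> i" "A i" D R "Pair i" by (rule component) (use i I in blast)
  have xA: "x \<in> carrier (A i)" using x M(2)[OF i] by blast
  have "(\<Oplus>\<^bsub>R\<^esub>j\<in>I. if i = j then inc i x else \<zero>\<^bsub>R\<^esub>) = inc i x"
    using i xA finite_I by (intro R.add.finprod_singleton) auto
  moreover have "\<forall>j\<in>I. (if i = j then inc i x else \<zero>\<^bsub>R\<^esub>) \<in> inc j ` M j"
  proof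
    fix j assume j: "j \<in> I"
    interpret j: component "\<Delta> j" "A j" D R "Pair j" by (rule component) (use j I in blast)
    have "\<zero>\<^bsub>A j\<^esub> \<in> M j" using additive_subgroup.zero_closed[OF ideal.axioms(1)[OF M(1)[OF j]]] .
    then have "\<zero>\<^bsub>R\<^esub> \<in> inc j ` M j" using j.inc_zero by (metis imageI)
    then show "(if i = j then inc i x else \<zero>\<^bsub>R\<^esub>) \<in> inc j ` M j" using x by auto
  qed
  ultimately show ?thesis unfolding incsum_def
    by (intro CollectI exI[of _ "\<lambda>j. if i = j then inc i x else \<zero>\<^bsub>R\<^esub>"] conjI) (rule sym)
qed

lemma incsum_minimal:
  assumes J: "ideal J R" "\<And>i. i \<in> I \<Longrightarrow> inc i ` M i \<subseteq> J"
  shows "incsum I M \<subseteq> J"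
proof
  fix q assume "q \<in> incsum I M"
  then obtain c where c: "q = (\<Oplus>\<^bsub>R\<^esub>i\<in>I. c i)" "\<forall>i\<in>I. c i \<in> inc i ` M i" unfolding incsum_def by blast
  show "q \<in> J" unfolding c(1) by (rule R.ideal_finsum_closed[OF J(1) finite_I]) (use c(2) J(2) in blast)
qed

text \<open>The retraction \<open>ret j\<close> kills the other summands and inverts
  \<open>inc j\<close> on its own one, so it recovers the term at \<open>j\<close>; directness of
  the sum follows.\<close>

lemma ret_sum:
  assumes j: "j \<in> {1..n}" and c: "\<forall>i\<in>I. c i \<in> inc i ` M i"
  shows "ret j (\<Oplus>\<^bsub>R\<^esub>i\<in>I. c i) = (if j \<in> I then ret j (c j) else \<zero>\<^bsub>A j\<^esub>)"
    and "j \<in> I \<Longrightarrow> ret j (c j) \<in> M j" and "j \<in> I \<Longrightarrow> c j = inc j (ret j (c j))"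
proof -
  interpret j: component "\<Delta> j" "A j" D R "Pair j" by (rule component[OF j])
  have cR: "c i \<in> carrier R" if i: "i \<in> I" for i
  proof -
    interpret i: component "\<Delta> i" "A i" D R "Pair i" by (rule component) (use i I in blast)
    obtain x where "x \<in> M i" "c i = inc i x" using c i by blast
    then show ?thesis using M(2)[OF i] i.inc_closed[of x] by (metis (no_types, lifting) mem_Collect_eq subsetD)
  qed
  have own: "ret j (c j) \<in> M j \<and> c j = inc j (ret j (c j))" if h: "j \<in> I"
  proof -
    obtain x where x: "x \<in> M j" "c j = inc j x" using c h by blast
    then have "x \<in> carrier (A j)" using M(2)[OF h] by blast
    then show ?thesis using x j.ret_inc by simp
  qed
  then show "j \<in> I \<Longrightarrow> ret j (c j) \<in> M j" "j \<in> I \<Longrightarrow> c j = inc j (ret j (c j))" by blast+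
  have other: "ret j (c i) = \<zero>\<^bsub>A j\<^esub>" if i: "i \<in> I" "i \<noteq> j" for i
  proof -
    obtain x where x: "x \<in> M i" "c i = inc i x" using c i by blast
    have "i \<in> {1..n}" "x \<in> mx i" using i I subsetD[OF M(2)[OF i(1)] x(1)] by blast+
    then show ?thesis unfolding x(2) using ret_inc_other j i(2) by simp
  qed
  have "ret j (\<Oplus>\<^bsub>R\<^esub>i\<in>B. c i) = (if j \<in> B then ret j (c j) else \<zero>\<^bsub>A j\<^esub>)" if "finite B" "B \<subseteq> I" for B
    using that
  proof (induction B rule: finite_induct)
    case (insert i B)
    have "c \<in> B \<rightarrow> carrier R" "c i \<in> carrier R" using insert.prems cR by auto
    then have "ret j (\<Oplus>\<^bsub>R\<^esub>i\<in>insert i B. c i) = ret j (c i) \<oplus>\<^bsub>A j\<^esub> ret j (\<Oplus>\<^bsub>R\<^esub>i\<in>B. c i)"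
      using insert by (simp add: j.ret_add)
    moreover have "ret j (c i) \<in> carrier (A j)" "j \<in> B \<Longrightarrow> ret j (c j) \<in> carrier (A j)"
      using insert.prems cR j.ret_closed by blast+
    ultimately show ?case using insert other[of i] by (cases "i = j") simp_all
  qed simp
  from this[OF finite_I order_refl] show "ret j (\<Oplus>\<^bsub>R\<^esub>i\<in>I. c i) = (if j \<in> I then ret j (c j) else \<zero>\<^bsub>A j\<^esub>)" .
qed

lemma ret_incsum:
  assumes "q \<in> incsum I M" "j \<in> {1..n}"
  shows "j \<in> I \<Longrightarrow> ret j q \<in> M j" "j \<notin> I \<Longrightarrow> ret j q = \<zero>\<^bsub>A j\<^esub>"
proof -
  obtain c where c: "q = (\<Oplus>\<^bsub>R\<^esub>i\<in>I. c i)" "\<forall>i\<in>I. c i \<in> inc i ` M i" using assms(1) unfolding incsum_def by blast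
  show "j \<in> I \<Longrightarrow> ret j q \<in> M j" "j \<notin> I \<Longrightarrow> ret j q = \<zero>\<^bsub>A j\<^esub>"
    unfolding c(1) using ret_sum(1,2)[OF assms(2) c(2)] by simp_all
qed

lemma direct_sum:
  "is_internal_direct_sum R I (\<lambda>i. inc i ` M i) (incsum I M)"
  unfolding is_internal_direct_sum_def
proof (intro conjI allI impI ballI)
  show "incsum I M = {\<Oplus>\<^bsub>R\<^esub>i\<in>I. c i | c. \<forall>i\<in>I. c i \<in> inc i ` M i}" by (simp add: incsum_def)
  fix c j assume c: "(\<forall>i\<in>I. c i \<in> inc i ` M i) \<and> (\<Oplus>\<^bsub>R\<^esub>i\<in>I. c i) = \<zero>\<^bsub>R\<^esub>" and j: "j \<in> I"
  have jn: "j \<in> {1..n}" using j I by blast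
  interpret j: component "\<Delta> j" "A j" D R "Pair j" by (rule component[OF jn])
  have "ret j (c j) = \<zero>\<^bsub>A j\<^esub>" using ret_sum(1)[OF jn, of c] c j by simp
  then show "c j = \<zero>\<^bsub>R\<^esub>" using ret_sum(3)[OF jn, of c] c j by simp
qed

end

text \<open>The variables generate the maximal ideal, and each belongs to one component.\<close>

lemma mm_eq_incsum: "R.mm = incsum {1..n} mx"
proof (rule antisym)
  note fx = subset_refl[of "{1..n}"] mx_ideal subset_refl
  show "R.mm \<subseteq> incsum {1..n} mx"
  proof (rule R.mm_subset_ideal[OF ideal_incsum[OF fx]])
    fix x assume x: "x \<in> R.V"
    obtain i v where iv: "x = (i, v)" by fastforce
    have i: "i \<in> {1..n}" "v \<in> \<Union>(\<Delta> i)" using x iv vertex_D by auto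
    interpret i: component "\<Delta> i" "A i" D R "Pair i" by (rule component[OF i(1)])
    have vP: "pvar v \<in> i.A.P" using i(2) by (rule polys_pvar)
    have rpv: "i.A.rp (i.A.cl (pvar v)) = pvar v"
      using vP i(2) i.A.vertex_face[of v] by (simp add: i.A.rp_cl) (simp add: pvar_def res_single)
    have "i.A.cl (pvar v) \<in> mx i"
      using vP rpv by (simp add: pvar_def lookup_single single_eq_0_iff)
    moreover have "inc i (i.A.cl (pvar v)) = R.cl (pvar x)"
      by (simp add: i.inc_def rpv iv) (simp add: pvar_def poly_rename_single[OF i.inj_g] ren_def)
    ultimately show "R.cl (pvar x) \<in> incsum {1..n} mx" using inc_in_incsum[OF fx i(1), of "i.A.cl (pvar v)"] by simp
  qed
  show "incsum {1..n} mx \<subseteq> R.mm"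
    by (rule incsum_minimal[OF fx R.ideal_mm]) (use component.inc_mm[OF component] in blast)+
qed

text \<open>The image under \<open>inc\<close> is already an ideal. What remains is that the union
  over representatives in \<open>SR_incl\<close> is a single class, since representatives differ by
  polynomials without face monomials.\<close>

lemma SR_extend_eq:
  assumes i: "i \<in> {1..n}" and I: "ideal I (A i)" "I \<subseteq> mx i"
  shows "SR_extend n \<Delta> i I = inc i ` I"
proof -
  interpret i: component "\<Delta> i" "A i" D R "Pair i" by (rule component[OF i])
  have "SR_incl n \<Delta> i X = inc i X" if X: "X \<in> carrier (A i)" for X
  proof -
    have p: "p \<in> i.A.P \<and> res (\<Delta> i) p = i.A.rp X" if h: "p \<in> X" for p
    proof -
      obtain q where q: "q \<in> i.A.P" "X = i.A.cl q" using X by (rule i.A.S_cases)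
      then obtain h where h: "h \<in> SR_ideal (\<Delta> i)" "p = h + q"
        using h by (auto simp: SR_class_def a_r_coset_def')
      then have "h \<in> i.A.P" "res (\<Delta> i) h = 0" by (auto simp: i.A.SR_ideal_eq)
      then show ?thesis using q h by (simp add: polys_add res_add i.A.rp_cl)
    qed
    have "SR_class D (poly_rename (Pair i) p) = inc i X" if "p \<in> X" for p
    proof -
      have "res D (poly_rename (Pair i) p) = poly_rename (Pair i) (i.A.rp X)"
        using p[OF that] by (simp add: res_rename[OF i.inj_g] i.faces_eq)
      then have "R.cl (poly_rename (Pair i) p) = R.cl (poly_rename (Pair i) (i.A.rp X))"
        using R.cl_res[OF i.rn_P, of p] p[OF that] by simp
      then show ?thesis by (simp add: i.inc_def)
    qed
    moreover have "X \<noteq> {}"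
    proof -
      obtain q where q: "q \<in> i.A.P" "X = i.A.cl q" using X by (rule i.A.S_cases)
      have "0 \<in> i.A.P" "res (\<Delta> i) (0::('v, 'k) mpoly) = 0" by simp_all
      then have "(0::('v, 'k) mpoly) \<in> SR_ideal (\<Delta> i)" unfolding i.A.SR_ideal_eq by blast
      then show ?thesis unfolding q(2) SR_class_def a_r_coset_def' by auto
    qed
    ultimately show ?thesis unfolding SR_incl_def D[symmetric] by (intro SUP_eq_const) auto
  qed
  then have *: "SR_incl n \<Delta> i ` I = inc i ` I" using I(2) by (intro image_cong) auto
  have id: "ideal (inc i ` I) R" by (rule ideal_inc_image[OF i I])
  have "Idl\<^bsub>R\<^esub> (inc i ` I) = inc i ` I"
    using R.genideal_minimal[OF id subset_refl] R.genideal_self[of "inc i ` I"] ideal.Icarr[OF id] by blast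
  then show ?thesis by (simp add: SR_extend_def * R D)
qed

lemma summand_iff:
  assumes "i \<in> {1..n}"
  shows "cdim (\<Delta> i) = cdim D \<longleftrightarrow> Max (card ` \<Delta> i) = R.dd"
proof -
  interpret i: component "\<Delta> i" "A i" D R "Pair i" by (rule component[OF assms])
  show ?thesis using i.A.cdim_eq R.cdim_eq by simp
qed

lemma dim_le:
  assumes "i \<in> {1..n}"
  shows "Max (card ` \<Delta> i) \<le> R.dd"
proof -
  interpret i: component "\<Delta> i" "A i" D R "Pair i" by (rule component[OF assms])
  obtain F where F: "F \<in> i.A.topf" using i.A.top_nonempty by blast
  then have "Pair i ` F \<in> D" using i.faces i.A.top_face by blast
  then have "card (Pair i ` F) \<le> R.dd" by (rule R.card_face)
  then show ?thesis using F by (simp add: i.card_g i.A.topf_def)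
qed

text \<open>Supplies the variable outside the component that the annihilation argument needs; a
  single complex would have none.\<close>

lemma other_vertex:
  assumes "i \<in> {1..n}"
  obtains u where "u \<in> R.V - range (Pair i)"
proof -
  obtain j where j: "j \<in> {1..n}" "j \<noteq> i"
  proof (cases "i = 1")
    case True then show ?thesis using that[of 2] n by simp
  next
    case False then show ?thesis using that[of 1] n by simp
  qed
  then obtain v where "v \<in> \<Union>(\<Delta> j)" using SR.V_nonempty[OF component_SR] by blast
  then have "(j, v) \<in> R.V - range (Pair i)" using j vertex_D by auto
  then show ?thesis by (rule that)
qed

text \<open>For the upper bound, \<open>w\<close> is cut into its restrictions to the components,
  and \<theta> is applied to each piece.\<close>

lemma trace_eq_incsum_high_dim:
  assumes dim: "R.dd \<ge> 2"
  shows "R.T = incsum summands dag"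
proof (rule antisym)
  have sub: "summands \<subseteq> {1..n}" by blast
  have fx: "summands \<subseteq> {1..n}" "\<And>i. i \<in> summands \<Longrightarrow> ideal (dag i) (A i)" "\<And>i. i \<in> summands \<Longrightarrow> dag i \<subseteq> mx i"
    using dag_mx by blast+
  show "incsum summands dag \<subseteq> R.T"
  proof (rule incsum_minimal[OF fx R.ideal_T])
    fix i assume i: "i \<in> summands"
    interpret i: component "\<Delta> i" "A i" D R "Pair i" by (rule component) (use i in blast)
    show "inc i ` dag i \<subseteq> R.T" using i summand_iff[of i] dim by (intro i.inc_dagger_in_trace) auto
  qed
  show "R.T \<subseteq> incsum summands dag"
  proof (rule R.T_minimal[OF ideal_incsum[OF fx]])
    fix \<theta> w assume \<theta>: "\<theta> \<in> R.homs" and w: "w \<in> carrier R.W"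
    define u where "u i = component.push (Pair i) (component.pull (Pair i) w)" for i
    have u: "u i \<in> carrier R.W \<and> \<theta> (u i) \<in> inc i ` dag i \<and> (\<forall>F. u i F = (if F \<subseteq> range (Pair i) then w F else 0))"
      if i: "i \<in> summands" for i
    proof -
      interpret i: component "\<Delta> i" "A i" D R "Pair i" by (rule component) (use i in blast)
      have dims: "i.A.dd = R.dd" using i summand_iff[of i] by auto
      obtain x where x: "x \<in> R.V - range (Pair i)" using other_vertex[of i] i by blast
      have p: "i.pull w \<in> carrier i.A.W" by (rule i.pull_closed[OF dims dim w])
      show ?thesis
        unfolding u_def using i.push_closed[OF dims dim p] i.hom_push_in_dagger[OF dims dim \<theta> p x] i.push_pull[OF w]
        by blast
    qed
    have "w F = (\<Sum>i\<in>summands. u i F)" for F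
    proof (cases "F \<in> R.topf")
      case True
      then obtain k \<sigma> where k: "k \<in> {1..n}" "\<sigma> \<in> \<Delta> k" "F = Pair k ` \<sigma>"
        using face_D[of F] R.top_face[of F] by blast
      interpret k: component "\<Delta> k" "A k" D R "Pair k" by (rule component[OF k(1)])
      have cF: "card \<sigma> = R.dd" using True k(3) by (simp add: R.topf_def k.card_g)
      then have "R.dd \<le> k.A.dd" using k.A.card_face[OF k(2)] by simp
      \<comment> \<open>A component with a face of maximal size has full dimension, so the pieces
        over \<open>summands\<close> lose nothing of \<open>w\<close>.\<close>
      then have kI: "k \<in> summands" using dim_le[OF k(1)] summand_iff[OF k(1)] k(1) by simp
      have "\<sigma> \<noteq> {}" using cF dim by auto
      then have iff: "F \<subseteq> range (Pair i) \<longleftrightarrow> i = k" for i using k(3) by auto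
      have "(\<Sum>i\<in>summands. u i F) = (\<Sum>i\<in>summands. if i = k then w F else 0)"
        using u iff by (intro sum.cong) auto
      then show ?thesis using kI by (simp add: sum.delta)
    next
      case False
      then have "w F = 0" using w by (simp add: R.W_carrier)
      then have "u i F = 0" if "i \<in> summands" for i using u[OF that] by simp
      then show ?thesis using \<open>w F = 0\<close> by simp
    qed
    then have "w = (\<lambda>F. \<Sum>i\<in>summands. u i F)" by (intro ext)
    then have "\<theta> w = (\<Oplus>\<^bsub>R\<^esub>i\<in>summands. \<theta> (u i))"
      using R.homs_sum[OF \<theta>, of summands u] u by simp
    then show "\<theta> w \<in> incsum summands dag" unfolding incsum_def using u by blast
  qed
qed

lemma dag_eq_mx:
  assumes "i \<in> {1..n}" "mx i \<subseteq> tr i"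
  shows "dag i = mx i"
proof -
  interpret i: component "\<Delta> i" "A i" D R "Pair i" by (rule component[OF assms(1)])
  show ?thesis using i.A.mm_maximal[OF i.A.ideal_T assms(2)] dag_eq[OF assms(1)] by auto
qed

text \<open>Here both sides are the maximal ideal. All components are discrete of the same dimension
  and their daggers are maximal ideals; having two components but not exactly two points leaves at
  least three vertices.\<close>

lemma trace_eq_incsum_discrete:
  assumes dim: "R.dd = 1" and not_two_points: "\<not> (\<exists>V. card V = 2 \<and> D = discrete_complex V)"
  shows "R.T = incsum summands dag"
proof -
  have dimi: "Max (card ` \<Delta> i) = 1" if i: "i \<in> {1..n}" for i
  proof -
    interpret i: component "\<Delta> i" "A i" D R "Pair i" by (rule component[OF i])
    show ?thesis using dim_le[OF i] i.A.dd_pos dim by linarith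
  qed
  then have I: "summands = {1..n}" using summand_iff dim by auto
  have dag: "dag i = mx i" if i: "i \<in> {1..n}" for i
  proof -
    interpret i: component "\<Delta> i" "A i" D R "Pair i" by (rule component[OF i])
    show ?thesis by (rule dag_eq_mx[OF i i.A.discrete_mm_subset_trace[OF dimi[OF i]]])
  qed
  have "D = discrete_complex R.V"
  proof (intro equalityI subsetI)
    fix F assume F: "F \<in> D"
    show "F \<in> discrete_complex R.V"
    proof (cases "F = {}")
      case False
      then obtain v where "v \<in> F" by blast
      then show ?thesis using R.discrete_face[OF dim F] F by (auto simp: discrete_complex_def)
    qed (simp add: discrete_complex_def)
  next
    fix F assume "F \<in> discrete_complex R.V"
    then show "F \<in> D" using R.empty_face R.vertex_face by (auto simp: discrete_complex_def)
  qed
  then have not2: "card R.V \<noteq> 2" using not_two_points by blast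
  obtain u where u: "u \<in> R.V - range (Pair 1)" using other_vertex[of 1] n by auto
  obtain v where v: "v \<in> \<Union>(\<Delta> 1)" using SR.V_nonempty[OF component_SR[of 1]] n by auto
  then have "(1, v) \<in> R.V" using vertex_D n by auto
  then have "{u, (1, v)} \<subseteq> R.V" "u \<noteq> (1, v)" using u by auto
  then have "card R.V \<ge> 2" using card_mono[OF R.finite_V, of "{u, (1, v)}"] by simp
  then have "card R.V \<ge> 3" using not2 by linarith
  then have "R.T = R.mm"
    using R.discrete_mm_subset_trace[OF dim] R.discrete_trace_subset_mm[OF dim] by blast
  also have "\<dots> = incsum {1..n} mx" by (rule mm_eq_incsum)
  also have "\<dots> = incsum summands dag" unfolding I incsum_def using dag by auto
  finally show ?thesis .
qed

lemma trace_eq_incsum: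
  assumes "\<not> (\<exists>V. card V = 2 \<and> D = discrete_complex V)"
  shows "R.T = incsum summands dag"
  using trace_eq_incsum_high_dim trace_eq_incsum_discrete[OF _ assms] R.dd_pos by linarith

section \<open>The decomposition of the trace and its consequences\<close>

context
  assumes not_two_points: "\<not> (\<exists>V. card V = 2 \<and> D = discrete_complex V)"
begin

lemma dag_facts: "summands \<subseteq> {1..n}" "\<And>i. i \<in> summands \<Longrightarrow> ideal (dag i) (A i)" "\<And>i. i \<in> summands \<Longrightarrow> dag i \<subseteq> mx i"
  using dag_mx by blast+

lemma ret_incsum_dag:
  assumes "q \<in> incsum summands dag" "j \<in> {1..n}"
  shows "j \<in> summands \<Longrightarrow> ret j q \<in> dag j" "j \<notin> summands \<Longrightarrow> ret j q = \<zero>\<^bsub>A j\<^esub>"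
  using ret_incsum[OF dag_facts assms] by blast+

lemma trace_direct_sum:
  "is_internal_direct_sum R summands (\<lambda>i. SR_extend n \<Delta> i (dag i)) R.T"
proof -
  have "SR_extend n \<Delta> i (dag i) = inc i ` dag i" if "i \<in> summands" for i
    using that dag_mx by (intro SR_extend_eq) auto
  then show ?thesis
    using direct_sum[OF dag_facts] trace_eq_incsum[OF not_two_points]
    unfolding is_internal_direct_sum_def by simp
qed

text \<open>Rules out components of smaller dimension: there \<open>ret i\<close> kills the whole
  trace, so no power of an element that is not nilpotent can lie in it.\<close>

lemma vertex_power_nonzero:
  assumes i: "i \<in> {1..n}"
  obtains X where "X \<in> mx i" "\<And>k::nat. X [^]\<^bsub>A i\<^esub> k \<noteq> \<zero>\<^bsub>A i\<^esub>"
proof -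
  interpret i: component "\<Delta> i" "A i" D R "Pair i" by (rule component[OF i])
  obtain v where v: "v \<in> i.A.V" using i.A.V_nonempty by blast
  have vP: "pvar v \<in> i.A.P" using v by (rule polys_pvar)
  have "i.A.cl (pvar v) \<in> mx i"
    using vP by (simp add: i.A.lookup_rp_cl_zero) (simp add: pvar_def lookup_single single_eq_0_iff)
  moreover have "i.A.cl (pvar v) [^]\<^bsub>A i\<^esub> k \<noteq> \<zero>\<^bsub>A i\<^esub>" for k :: nat
  proof -
    have kf: "keys (single v k) \<in> \<Delta> i" using v i.A.vertex_face[of v] i.A.empty_face by auto
    have "single (single v k) 1 \<in> i.A.P" using v by (intro polys_single) (auto split: if_splits)
    moreover have "res (\<Delta> i) (single (single v k) (1::'k)) \<noteq> 0" using kf by (simp only: res_single if_True single_eq_0_iff) simp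
    ultimately show ?thesis using vP by (simp add: i.A.cl_pow pvar_power i.A.cl_zero_iff)
  qed
  ultimately show ?thesis by (rule that)
qed

lemma trace_eq_mm_iff:
  "R.T = R.mm \<longleftrightarrow> (\<forall>i\<in>{1..n}. mx i \<subseteq> tr i \<and> cdim (\<Delta> i) = cdim D)"
proof
  assume eq: "R.T = R.mm"
  show "\<forall>i\<in>{1..n}. mx i \<subseteq> tr i \<and> cdim (\<Delta> i) = cdim D"
  proof
    fix i assume i: "i \<in> {1..n}"
    interpret i: component "\<Delta> i" "A i" D R "Pair i" by (rule component[OF i])
    have q: "inc i X \<in> incsum summands dag" if "X \<in> mx i" for X
      using i.inc_mm[OF that] eq trace_eq_incsum[OF not_two_points] by blast
    obtain X where X: "X \<in> mx i" "\<And>k::nat. X [^]\<^bsub>A i\<^esub> k \<noteq> \<zero>\<^bsub>A i\<^esub>"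
      using vertex_power_nonzero[OF i] by blast
    have iI: "i \<in> summands"
    proof (rule ccontr)
      assume "i \<notin> summands"
      then have "ret i (inc i X) = \<zero>\<^bsub>A i\<^esub>" by (rule ret_incsum_dag(2)[OF q[OF X(1)] i])
      then show False using X(1) X(2)[of 1] i.ret_inc[of X] by simp
    qed
    have "mx i \<subseteq> dag i"
    proof
      fix Y assume Y: "Y \<in> mx i"
      have "ret i (inc i Y) \<in> dag i" by (rule ret_incsum_dag(1)[OF q[OF Y] i iI])
      then show "Y \<in> dag i" using Y i.ret_inc[of Y] by simp
    qed
    then show "mx i \<subseteq> tr i \<and> cdim (\<Delta> i) = cdim D"
      using iI dag_eq[OF i] by (auto split: if_splits)
  qed
next
  assume h: "\<forall>i\<in>{1..n}. mx i \<subseteq> tr i \<and> cdim (\<Delta> i) = cdim D"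
  then have "summands = {1..n}" by auto
  moreover have "dag i = mx i" if "i \<in> {1..n}" for i using h that by (intro dag_eq_mx) auto
  ultimately have "incsum summands dag = incsum {1..n} mx" unfolding incsum_def by auto
  then show "R.T = R.mm" using trace_eq_incsum[OF not_two_points] mm_eq_incsum by simp
qed

lemma mm_power:
  assumes "X \<in> carrier R" "X [^]\<^bsub>R\<^esub> (k::nat) \<in> R.mm"
  shows "X \<in> R.mm"
proof -
  have "lookup (R.rp (X [^]\<^bsub>R\<^esub> k)) 0 = lookup (R.rp X) 0 ^ k" for k :: nat
    using assms(1) by (induction k) (simp_all add: R.rp_mult lookup_res R.empty_face lookup_times_zero)
  then show ?thesis using assms by simp
qed

text \<open>Multiplying by \<open>X\<close> acts on each summand through \<open>ret i\<close>, so
  powers are taken componentwise. The exponent is a successor because the zeroth power is one, which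
  is not a sum from the maximal ideals.\<close>

lemma power_sum:
  assumes X: "X \<in> R.mm"
  shows "X [^]\<^bsub>R\<^esub> Suc k = (\<Oplus>\<^bsub>R\<^esub>i\<in>{1..n}. inc i (ret i X [^]\<^bsub>A i\<^esub> Suc k))"
proof (induction k)
  note fx = subset_refl[of "{1..n}"] mx_ideal subset_refl
  have XR: "X \<in> carrier R" using X by simp
  case 0
  obtain c where c: "X = (\<Oplus>\<^bsub>R\<^esub>i\<in>{1..n}. c i)" "\<forall>i\<in>{1..n}. c i \<in> inc i ` mx i"
    using X unfolding mm_eq_incsum incsum_def by blast
  have r: "c i = inc i (ret i X [^]\<^bsub>A i\<^esub> Suc 0) \<and> c i \<in> carrier R" if i: "i \<in> {1..n}" for i
  proof -
    interpret i: component "\<Delta> i" "A i" D R "Pair i" by (rule component[OF i])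
    have "ret i X = ret i (c i)" using ret_sum(1)[OF fx i c(2)] i c(1) by simp
    moreover have "c i = inc i (ret i (c i))" by (rule ret_sum(3)[OF fx i c(2) i])
    moreover have "ret i X [^]\<^bsub>A i\<^esub> Suc 0 = ret i X" using XR by simp
    moreover have "c i \<in> carrier R"
    proof -
      obtain x where "x \<in> mx i" "c i = inc i x" using c(2) i by blast
      then show ?thesis using i.inc_closed[of x] by simp
    qed
    ultimately show ?thesis by simp
  qed
  have "(\<Oplus>\<^bsub>R\<^esub>i\<in>{1..n}. c i) = (\<Oplus>\<^bsub>R\<^esub>i\<in>{1..n}. inc i (ret i X [^]\<^bsub>A i\<^esub> Suc 0))"
  proof (rule R.finsum_cong')
    show "(\<lambda>i. inc i (ret i X [^]\<^bsub>A i\<^esub> Suc 0)) \<in> {1..n} \<rightarrow> carrier R"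
      using r by (metis (no_types, lifting) Pi_I)
  qed (use r in blast)+
  moreover have "X [^]\<^bsub>R\<^esub> Suc 0 = X" using XR by simp
  ultimately show ?case using c(1) by (simp only:)
next
  have XR: "X \<in> carrier R" using X by simp
  case (Suc k)
  have p: "inc i (ret i X [^]\<^bsub>A i\<^esub> Suc k) \<in> carrier R \<and>
      X \<otimes>\<^bsub>R\<^esub> inc i (ret i X [^]\<^bsub>A i\<^esub> Suc k) = inc i (ret i X [^]\<^bsub>A i\<^esub> Suc (Suc k))" if i: "i \<in> {1..n}" for i
  proof -
    interpret i: component "\<Delta> i" "A i" D R "Pair i" by (rule component[OF i])
    have rc: "ret i X \<in> carrier (A i)" using XR by simp
    have "ret i X [^]\<^bsub>A i\<^esub> k \<otimes>\<^bsub>A i\<^esub> ret i X \<in> mx i"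
      by (rule ideal.I_l_closed[OF mx_ideal[OF i] i.ret_mm[OF X]]) (use rc in simp)
    then have "ret i X [^]\<^bsub>A i\<^esub> Suc k \<in> mx i" by simp
    from i.mult_inc[OF XR this] show ?thesis
      using rc by (simp add: i.A.m_comm)
  qed
  have "X [^]\<^bsub>R\<^esub> Suc (Suc k) = X \<otimes>\<^bsub>R\<^esub> (X [^]\<^bsub>R\<^esub> Suc k)" using XR by (simp add: R.m_comm)
  also have "\<dots> = (\<Oplus>\<^bsub>R\<^esub>i\<in>{1..n}. X \<otimes>\<^bsub>R\<^esub> inc i (ret i X [^]\<^bsub>A i\<^esub> Suc k))"
    unfolding Suc using XR p by (intro R.finsum_rdistr) auto
  also have "\<dots> = (\<Oplus>\<^bsub>R\<^esub>i\<in>{1..n}. inc i (ret i X [^]\<^bsub>A i\<^esub> Suc (Suc k)))"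
  proof (rule R.finsum_cong')
    show "(\<lambda>i. inc i (ret i X [^]\<^bsub>A i\<^esub> Suc (Suc k))) \<in> {1..n} \<rightarrow> carrier R"
      using p XR R.m_closed by (metis (no_types, lifting) Pi_I)
  qed (use p in auto)
  finally show ?case .
qed

lemma radical_trace_iff:
  "radical R R.T = R.mm \<longleftrightarrow> (\<forall>i\<in>{1..n}. mx i \<subseteq> radical (A i) (tr i) \<and> cdim (\<Delta> i) = cdim D)"
proof
  assume eq: "radical R R.T = R.mm"
  show "\<forall>i\<in>{1..n}. mx i \<subseteq> radical (A i) (tr i) \<and> cdim (\<Delta> i) = cdim D"
  proof
    fix i assume i: "i \<in> {1..n}"
    interpret i: component "\<Delta> i" "A i" D R "Pair i" by (rule component[OF i])
    have q: "\<exists>k::nat. inc i X [^]\<^bsub>R\<^esub> k \<in> incsum summands dag \<and> ret i (inc i X [^]\<^bsub>R\<^esub> k) = X [^]\<^bsub>A i\<^esub> k"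
      if X: "X \<in> mx i" for X
    proof -
      have XA: "X \<in> carrier (A i)" using X by simp
      have "inc i X \<in> radical R R.T" using i.inc_mm[OF X] eq by blast
      then obtain k :: nat where "inc i X [^]\<^bsub>R\<^esub> k \<in> R.T" by (auto simp: radical_def)
      then show ?thesis using trace_eq_incsum[OF not_two_points] i.ret_pow[of "inc i X" k] i.ret_inc[OF XA] XA by auto
    qed
    have iI: "i \<in> summands"
    proof (rule ccontr)
      assume ni: "i \<notin> summands"
      obtain X where X: "X \<in> mx i" "\<And>k::nat. X [^]\<^bsub>A i\<^esub> k \<noteq> \<zero>\<^bsub>A i\<^esub>"
        using vertex_power_nonzero[OF i] by blast
      obtain k :: nat where "inc i X [^]\<^bsub>R\<^esub> k \<in> incsum summands dag" "ret i (inc i X [^]\<^bsub>R\<^esub> k) = X [^]\<^bsub>A i\<^esub> k"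
        using q[OF X(1)] by blast
      then show False using ret_incsum_dag(2)[OF _ i ni] X(2)[of k] by simp
    qed
    have "X \<in> radical (A i) (tr i)" if X: "X \<in> mx i" for X
    proof -
      have XA: "X \<in> carrier (A i)" using X by simp
      obtain k :: nat where k: "inc i X [^]\<^bsub>R\<^esub> k \<in> incsum summands dag" "ret i (inc i X [^]\<^bsub>R\<^esub> k) = X [^]\<^bsub>A i\<^esub> k"
        using q[OF X] by blast
      have "X [^]\<^bsub>A i\<^esub> k \<in> dag i" using ret_incsum_dag(1)[OF k(1) i iI] k(2) by simp
      then have "X [^]\<^bsub>A i\<^esub> k \<in> tr i" using dag_eq[OF i] XA by (auto split: if_splits)
      then show ?thesis using XA by (auto simp: radical_def)
    qed
    then show "mx i \<subseteq> radical (A i) (tr i) \<and> cdim (\<Delta> i) = cdim D" using iI by blast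
  qed
next
  assume h: "\<forall>i\<in>{1..n}. mx i \<subseteq> radical (A i) (tr i) \<and> cdim (\<Delta> i) = cdim D"
  then have I: "summands = {1..n}" by auto
  have TI: "R.T = incsum {1..n} dag" using trace_eq_incsum[OF not_two_points] I by simp
  have fx: "{1..n} \<subseteq> {1..n}" "\<And>i. i \<in> {1..n} \<Longrightarrow> ideal (dag i) (A i)" "\<And>i. i \<in> {1..n} \<Longrightarrow> dag i \<subseteq> mx i"
    using dag_mx by blast+
  have "R.T \<subseteq> R.mm" unfolding TI
    by (rule incsum_minimal[OF fx R.ideal_mm]) (use component.inc_mm[OF component] dag_mx in blast)+
  show "radical R R.T = R.mm"
  proof (intro equalityI subsetI)
    fix X assume "X \<in> radical R R.T"
    then show "X \<in> R.mm" using mm_power[of X] \<open>R.T \<subseteq> R.mm\<close> by (auto simp: radical_def)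
  next
    fix X assume X: "X \<in> R.mm"
    have XR: "X \<in> carrier R" using X by simp
    have "\<exists>k::nat. ret i X [^]\<^bsub>A i\<^esub> k \<in> dag i" if i: "i \<in> {1..n}" for i
    proof -
      interpret i: component "\<Delta> i" "A i" D R "Pair i" by (rule component[OF i])
      have rx: "ret i X \<in> mx i" by (rule i.ret_mm[OF X])
      show ?thesis
      proof (cases "tr i = carrier (A i)")
        case True
        then have "ret i X [^]\<^bsub>A i\<^esub> (1::nat) \<in> dag i" using dag_eq[OF i] rx by simp
        then show ?thesis by blast
      next
        case False
        then show ?thesis using h i rx dag_eq[OF i] by (auto simp: radical_def)
      qed
    qed
    then obtain k :: "nat \<Rightarrow> nat" where k: "\<And>i. i \<in> {1..n} \<Longrightarrow> ret i X [^]\<^bsub>A i\<^esub> k i \<in> dag i" by metis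
    \<comment> \<open>One exponent has to serve all components at once, and \<open>power_sum\<close>
      needs it to be positive.\<close>
    define K where "K = (\<Sum>i\<in>{1..n}. k i)"
    have "inc i (ret i X [^]\<^bsub>A i\<^esub> Suc K) \<in> inc i ` dag i" if i: "i \<in> {1..n}" for i
    proof -
      interpret i: component "\<Delta> i" "A i" D R "Pair i" by (rule component[OF i])
      have rc: "ret i X \<in> carrier (A i)" using XR by simp
      have "k i \<le> K" unfolding K_def using i by (intro member_le_sum) auto
      then have "ret i X [^]\<^bsub>A i\<^esub> Suc K = ret i X [^]\<^bsub>A i\<^esub> (Suc K - k i) \<otimes>\<^bsub>A i\<^esub> ret i X [^]\<^bsub>A i\<^esub> k i"
        using rc i.A.nat_pow_mult[OF rc, of "Suc K - k i" "k i"] by simp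
      also have "\<dots> \<in> dag i" by (rule ideal.I_l_closed[OF dag_mx(2)[OF i] k[OF i]]) (use rc in simp)
      finally show ?thesis by blast
    qed
    then have "X [^]\<^bsub>R\<^esub> Suc K \<in> R.T" unfolding TI power_sum[OF X] incsum_def by blast
    then show "X \<in> radical R R.T" using XR unfolding radical_def by blast
  qed
qed

end

end

theorem theorem3p21:
  fixes n :: nat
    and \<Delta> :: "nat \<Rightarrow> 'v::linorder set set"
    and D :: "(nat \<times> 'v) set set"
    and R :: "(nat \<times> 'v, 'k::field) mpoly set gring"
    and A :: "nat \<Rightarrow> ('v, 'k) mpoly set gring"
    and E\<^sub>R :: "((nat \<times> 'v, 'k) mpoly set, 'e) gmodule"
    and E\<^sub>A :: "nat \<Rightarrow> (('v, 'k) mpoly set, 'f) gmodule"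
  assumes n: "n \<ge> 2"
    and complexes: "\<And>i. i \<in> {1..n} \<Longrightarrow> simplicial_complex (\<Delta> i)"
    and D: "D = disjoint_union n \<Delta>"
    and R: "R = SR_ring D"
    and A: "\<And>i. i \<in> {1..n} \<Longrightarrow> A i = SR_ring (\<Delta> i)"
    and not_two_points: "\<not> (\<exists>V. card V = 2 \<and> D = discrete_complex V)"
    and envelope_R: "graded_injective_envelope R (residue_module R) E\<^sub>R"
    and envelope_A: "\<And>i. i \<in> {1..n} \<Longrightarrow>
          graded_injective_envelope (A i) (residue_module (A i)) (E\<^sub>A i)"
    and omega_R: "\<omega>\<^sub>R = SR_canonical_module D E\<^sub>R"
    and omega_A: "\<And>i. i \<in> {1..n} \<Longrightarrow> \<omega>\<^sub>A i = SR_canonical_module (\<Delta> i) (E\<^sub>A i)"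
  shows "is_internal_direct_sum R {i \<in> {1..n}. cdim (\<Delta> i) = cdim D}
           (\<lambda>i. SR_extend n \<Delta> i (trace_dagger (A i) (\<omega>\<^sub>A i))) (trace_ideal R \<omega>\<^sub>R) \<and>
         (radical R (trace_ideal R \<omega>\<^sub>R) = graded_max R \<longleftrightarrow>
           (\<forall>i\<in>{1..n}. graded_max (A i) \<subseteq> radical (A i) (trace_ideal (A i) (\<omega>\<^sub>A i)) \<and>
              cdim (\<Delta> i) = cdim D)) \<and>
         (trace_ideal R \<omega>\<^sub>R = graded_max R \<longleftrightarrow>
           (\<forall>i\<in>{1..n}. graded_max (A i) \<subseteq> trace_ideal (A i) (\<omega>\<^sub>A i) \<and> cdim (\<Delta> i) = cdim D))"
proof -
  interpret U: SR_union n \<Delta> D R A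
    by unfold_locales (fact n, fact complexes, fact D, fact R, fact A)
  interpret RE: SR_env D R E\<^sub>R by unfold_locales (rule envelope_R)
  \<comment> \<open>All traces are moved to the concrete modules, so the chosen envelopes no longer
    appear in what remains to be shown.\<close>
  have tR: "trace_ideal R \<omega>\<^sub>R = U.R.T" unfolding omega_R by (rule RE.trace_canonical)
  have tA: "trace_ideal (A i) (\<omega>\<^sub>A i) = U.tr i" if i: "i \<in> {1..n}" for i
  proof -
    interpret Ai: SR "\<Delta> i" "A i" by (rule U.component_SR[OF i])
    interpret AE: SR_env "\<Delta> i" "A i" "E\<^sub>A i" by unfold_locales (rule envelope_A[OF i])
    show ?thesis unfolding omega_A[OF i] by (rule AE.trace_canonical)
  qed
  have dA: "trace_dagger (A i) (\<omega>\<^sub>A i) = U.dag i" if "i \<in> {1..n}" for i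
    unfolding trace_dagger_def tA[OF that] ..
  have gA: "graded_max (A i) = U.mx i" if "i \<in> {1..n}" for i
    using SR.graded_max_eq[OF U.component_SR[OF that]] .
  have "is_internal_direct_sum R U.summands (\<lambda>i. SR_extend n \<Delta> i (trace_dagger (A i) (\<omega>\<^sub>A i))) (trace_ideal R \<omega>\<^sub>R)"
    using U.trace_direct_sum[OF not_two_points] dA unfolding tR is_internal_direct_sum_def by simp
  then show ?thesis
    using U.radical_trace_iff[OF not_two_points] U.trace_eq_mm_iff[OF not_two_points]
    unfolding tR U.R.graded_max_eq by (simp add: tA gA)
qed

end
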